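(* Let $\mathbf{S}$ be a symmetric monoidal category and let $G$ be a group. There is an equivalence of categories $$\mathbf{Alg}\left(G\mathcal{F}(as)\otimes_{\mathbb{P}\otimes\mathbb{G}}G\mathcal{F}(as)^{op},\mathbf{S}\right)\simeq\mathbf{GBimon}(\mathbf{S}).$$
   Context: For $n\geq 1$, $\underline{n}=\{1,\dots,n\}$, and $\underline{0}=\emptyset$. A PROP is a symmetric strict monoidal category whose objects are the sets $\underline{n}$, $n\ge 0$, with tensor product of objects given by addition. For a PROP $T$ and a symmetric monoidal category $\mathbf{S}$, $\mathbf{Alg}(T,\mathbf{S})$ is the category of symmetric strict monoidal functors $T\to\mathbf{S}$ and natural transformations. $\mathbf{Bimon}(\mathbf{S})$ is the category of bimonoids in $\mathbf{S}$; regarding $G$ as a one-object category, $\mathbf{GBimon}(\mathbf{S})=\mathrm{Fun}(G,\mathbf{Bimon}(\mathbf{S}))$. An ordered $G$-labelled set is a finite, totally ordered subset of some $\underline{n}$ with a label $\alpha_j\in G$ on each element $j$; $G$ acts by multiplying all labels on the left: $g\ast\{j_1^{\alpha_{j_1}}<\dots<j_r^{\alpha_{j_r}}\}=\{j_1^{g\alpha_{j_1}}<\dots<j_r^{g\alpha_{j_r}}\}$. The PROP $G\mathcal{F}(as)$ has objects $\underline{n}$; a morphism $f:\underline{n}\to\underline{m}$ is a map of sets together with the structure of an ordered $G$-labelled set on each preimage $f^{-1}(i)$, $i\in\underline{m}$ (the total order being arbitrary). The composite $f_2\bullet f_1$ is the composite of set maps with $(f_2\bullet f_1)^{-1}(i)=\coprod_{j^{\alpha_j}\in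 f_2^{-1}(i)}\alpha_j\ast f_1^{-1}(j)$, an ordered disjoint union (blocks ordered as in $f_2^{-1}(i)$, each block ordered as in $f_1^{-1}(j)$). The tensor product is juxtaposition and the symmetries are the block permutations. The bijections of $G\mathcal{F}(as)$ correspond precisely to the elements of the groups $G^n\rtimes\Sigma_n$, which are the morphisms of the PROP $\mathbb{P}\otimes\mathbb{G}$. The double category $G\mathcal{F}(as)_2$ has objects $\underline{n}$; its horizontal and its vertical morphisms are the morphisms of $G\mathcal{F}(as)$. A bimorphism is a (not necessarily commutative) square of morphisms of $G\mathcal{F}(as)$ with horizontal morphisms $f_1:\underline{n}\to\underline{p}$ (top), $f:\underline{m}\to\underline{q}$ (bottom) and vertical morphisms $\phi_1:\underline{n}\to\underline{m}$ (left), $\phi:\underline{p}\to\underline{q}$ (right), such that: the underlying diagram of finite sets is a pullback square; for all $x\in\underline{m}$ the map $\phi_1^{-1}(x)\to\phi^{-1}(f(x))$ induced by $f_1$ is an isomorphism of ordered $G$-labelled sets; and for all $y\in\underline{p}$ the map $f_1^{-1}(y)\to f^{-1}(\phi(y))$ induced by $\phi_1$ is an isomorphism of ordered $G$-labelled sets. It satisfies the star condition: a horizontal morphism $f:\underline{m}\to\underline{q}$ and a vertical morphism $\phi:\underline{p}\to\underline{q}$ determine a unique such bimorphism (take the pullback of the underlying maps, with preimage data induced from $f$ and $\phi$). This defines a distributive law $G\mathcal{F}(as)^{op}\otimes G\mathcal{F}(as)\to G\mathcal{F}(as)\otimes G\mathcal{F}(as)^{op}$, sending the cospan $\underline{m}\xrightarrow{f}\underline{q}\xleftarrow{\phi}\underline{p}$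 to the span $\underline{m}\xleftarrow{\phi_1}\underline{n}\xrightarrow{f_1}\underline{p}$. The morphisms $\underline{n}\to\underline{m}$ of $G\mathcal{F}(as)\otimes G\mathcal{F}(as)^{op}$ are the spans $\underline{n}\xleftarrow{\phi}\underline{p}\xrightarrow{f}\underline{m}$ in $G\mathcal{F}(as)$; two spans are composed by replacing the inner cospan by a span by means of this distributive law and composing the legs. Two spans $(\phi,f)$, $(\phi_1,f_1)$ with middle object $\underline{p}$ are equivalent if there is a bijection $h:\underline{p}\to\underline{p}$ in $G\mathcal{F}(as)$ with $\phi_1\circ h=\phi$ and $f_1\circ h=f$. The composite PROP $G\mathcal{F}(as)\otimes_{\mathbb{P}\otimes\mathbb{G}}G\mathcal{F}(as)^{op}$ is the category obtained from $G\mathcal{F}(as)\otimes G\mathcal{F}(as)^{op}$ by identifying equivalent spans, with the induced PROP structure.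
   Formalization: Classes of spans are composed via representatives of the second span whose left leg has all labels 1 (otherwise ill-defined for non-abelian G); Alg uses monoidal natural transformations; for non-strict S, strict monoidal functors are taken up to canonical associators and unitors. *)

theory Defs
  imports "HOL-Algebra.Group" "HOL-Library.FuncSet"
begin

section \<open>Categories, functors, natural transformations\<close>

record ('o, 'a) category =
  Obj :: "'o set"
  Arr :: "'a set"
  Dom :: "'a \<Rightarrow> 'o"
  Cod :: "'a \<Rightarrow> 'o"
  Ident :: "'o \<Rightarrow> 'a"
  Cmp :: "'a \<Rightarrow> 'a \<Rightarrow> 'a"  (infixr "\<cdot>\<index>" 70)

definition Hom :: "('o, 'a, 'z) category_scheme \<Rightarrow> 'o \<Rightarrow> 'o \<Rightarrow> 'a set" where
  "Hom C x y = {f \<in> Arr C. Dom C f = x \<and> Cod C f = y}"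

locale category =
  fixes C :: "('o, 'a, 'z) category_scheme" (structure)
  assumes Dom_in: "f \<in> Arr C \<Longrightarrow> Dom C f \<in> Obj C"
    and Cod_in: "f \<in> Arr C \<Longrightarrow> Cod C f \<in> Obj C"
    and Ident_in: "x \<in> Obj C \<Longrightarrow> Ident C x \<in> Hom C x x"
    and Cmp_in: "\<lbrakk>f \<in> Hom C x y; g \<in> Hom C y z\<rbrakk> \<Longrightarrow> g \<cdot> f \<in> Hom C x z"
    and Ident_left: "f \<in> Hom C x y \<Longrightarrow> Ident C y \<cdot> f = f"
    and Ident_right: "f \<in> Hom C x y \<Longrightarrow> f \<cdot> Ident C x = f"
    and Cmp_assoc: "\<lbrakk>f \<in> Hom C w x; g \<in> Hom C x y; h \<in> Hom C y z\<rbrakk> \<Longrightarrow>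
          (h \<cdot> g) \<cdot> f = h \<cdot> (g \<cdot> f)"

definition inverse_arrows :: "('o, 'a, 'z) category_scheme \<Rightarrow> 'a \<Rightarrow> 'a \<Rightarrow> bool" where
  "inverse_arrows C f g \<longleftrightarrow> f \<in> Arr C \<and> g \<in> Hom C (Cod C f) (Dom C f) \<and>
     g \<cdot>\<^bsub>C\<^esub> f = Ident C (Dom C f) \<and> f \<cdot>\<^bsub>C\<^esub> g = Ident C (Cod C f)"

definition iso_arrow :: "('o, 'a, 'z) category_scheme \<Rightarrow> 'a \<Rightarrow> bool" where
  "iso_arrow C f \<longleftrightarrow> (\<exists>g. inverse_arrows C f g)"

definition Inv :: "('o, 'a, 'z) category_scheme \<Rightarrow> 'a \<Rightarrow> 'a" where
  "Inv C f = (THE g. inverse_arrows C f g)"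

record ('o, 'a, 'p, 'b) functor_data =
  FObj :: "'o \<Rightarrow> 'p"
  FArr :: "'a \<Rightarrow> 'b"

text \<open>Functors are extensional, i.e. undefined outside of their source category, so that
  functors that agree as functors are equal.\<close>

definition is_functor ::
  "('o, 'a, 'y) category_scheme \<Rightarrow> ('p, 'b, 'z) category_scheme \<Rightarrow> ('o, 'a, 'p, 'b) functor_data \<Rightarrow> bool"
where
  "is_functor C D F \<longleftrightarrow> category C \<and> category D \<and>
     FObj F \<in> Obj C \<rightarrow>\<^sub>E Obj D \<and> FArr F \<in> extensional (Arr C) \<and>
     (\<forall>x y. \<forall>f \<in> Hom C x y. FArr F f \<in> Hom D (FObj F x) (FObj F y)) \<and>
     (\<forall>x \<in> Obj C. FArr F (Ident C x) = Ident D (FObj F x)) \<and>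
     (\<forall>x y z. \<forall>f \<in> Hom C x y. \<forall>g \<in> Hom C y z. FArr F (g \<cdot>\<^bsub>C\<^esub> f) = FArr F g \<cdot>\<^bsub>D\<^esub> FArr F f)"

definition id_functor :: "('o, 'a, 'y) category_scheme \<Rightarrow> ('o, 'a, 'o, 'a) functor_data" where
  "id_functor C = \<lparr>FObj = (\<lambda>x \<in> Obj C. x), FArr = (\<lambda>f \<in> Arr C. f)\<rparr>"

definition comp_functor ::
  "('o, 'a, 'y) category_scheme \<Rightarrow> ('p, 'b, 'q, 'c) functor_data \<Rightarrow> ('o, 'a, 'p, 'b) functor_data
     \<Rightarrow> ('o, 'a, 'q, 'c) functor_data" where
  "comp_functor C K F =
     \<lparr>FObj = (\<lambda>x \<in> Obj C. FObj K (FObj F x)), FArr = (\<lambda>f \<in> Arr C. FArr K (FArr F f))\<rparr>"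

definition nat_trans ::
  "('o, 'a, 'y) category_scheme \<Rightarrow> ('p, 'b, 'z) category_scheme \<Rightarrow>
    ('o, 'a, 'p, 'b) functor_data \<Rightarrow> ('o, 'a, 'p, 'b) functor_data \<Rightarrow> ('o \<Rightarrow> 'b) \<Rightarrow> bool" where
  "nat_trans C D F K \<theta> \<longleftrightarrow> is_functor C D F \<and> is_functor C D K \<and> \<theta> \<in> extensional (Obj C) \<and>
     (\<forall>x \<in> Obj C. \<theta> x \<in> Hom D (FObj F x) (FObj K x)) \<and>
     (\<forall>x y. \<forall>f \<in> Hom C x y. \<theta> y \<cdot>\<^bsub>D\<^esub> FArr F f = FArr K f \<cdot>\<^bsub>D\<^esub> \<theta> x)"

definition nat_iso ::
  "('o, 'a, 'y) category_scheme \<Rightarrow> ('p, 'b, 'z) category_scheme \<Rightarrow>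
    ('o, 'a, 'p, 'b) functor_data \<Rightarrow> ('o, 'a, 'p, 'b) functor_data \<Rightarrow> ('o \<Rightarrow> 'b) \<Rightarrow> bool" where
  "nat_iso C D F K \<theta> \<longleftrightarrow> nat_trans C D F K \<theta> \<and> (\<forall>x \<in> Obj C. iso_arrow D (\<theta> x))"

definition equivalent_categories ::
  "('o, 'a, 'y) category_scheme \<Rightarrow> ('p, 'b, 'z) category_scheme \<Rightarrow> bool" where
  "equivalent_categories C D \<longleftrightarrow>
     (\<exists>F K \<eta> \<epsilon>. is_functor C D F \<and> is_functor D C K \<and>
        nat_iso C C (id_functor C) (comp_functor C K F) \<eta> \<and>
        nat_iso D D (comp_functor D F K) (id_functor D) \<epsilon>)"

definition functor_category ::
  "('o, 'a, 'y) category_scheme \<Rightarrow> ('p, 'b, 'z) category_scheme \<Rightarrow>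
    (('o, 'a, 'p, 'b) functor_data,
     ('o, 'a, 'p, 'b) functor_data \<times> ('o, 'a, 'p, 'b) functor_data \<times> ('o \<Rightarrow> 'b)) category" where
  "functor_category C D =
     \<lparr>Obj = {F. is_functor C D F},
      Arr = {(F, K, \<theta>). nat_trans C D F K \<theta>},
      Dom = (\<lambda>(F, K, \<theta>). F),
      Cod = (\<lambda>(F, K, \<theta>). K),
      Ident = (\<lambda>F. (F, F, \<lambda>x \<in> Obj C. Ident D (FObj F x))),
      Cmp = (\<lambda>(_, L, \<theta>') (F, _, \<theta>). (F, L, \<lambda>x \<in> Obj C. \<theta>' x \<cdot>\<^bsub>D\<^esub> \<theta> x))\<rparr>"

definition one_object_category :: "('g, 'z) monoid_scheme \<Rightarrow> (unit, 'g) category" where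
  "one_object_category G =
     \<lparr>Obj = UNIV, Arr = carrier G, Dom = (\<lambda>_. ()), Cod = (\<lambda>_. ()),
      Ident = (\<lambda>_. \<one>\<^bsub>G\<^esub>), Cmp = (\<lambda>g h. g \<otimes>\<^bsub>G\<^esub> h)\<rparr>"


section \<open>Symmetric monoidal categories and PROPs\<close>

record ('o, 'a) sym_mon_cat = "('o, 'a) category" +
  TObj :: "'o \<Rightarrow> 'o \<Rightarrow> 'o"  (infixr "\<odot>\<index>" 75)
  TArr :: "'a \<Rightarrow> 'a \<Rightarrow> 'a"  (infixr "\<star>\<index>" 75)
  Unit :: "'o"
  Assoc :: "'o \<Rightarrow> 'o \<Rightarrow> 'o \<Rightarrow> 'a"
  LUnit :: "'o \<Rightarrow> 'a"
  RUnit :: "'o \<Rightarrow> 'a"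
  Sym :: "'o \<Rightarrow> 'o \<Rightarrow> 'a"

locale symmetric_monoidal_category = category S
  for S :: "('o, 'a, 'z) sym_mon_cat_scheme" (structure) +
  assumes TObj_in: "\<lbrakk>x \<in> Obj S; y \<in> Obj S\<rbrakk> \<Longrightarrow> x \<odot> y \<in> Obj S"
    and TArr_in: "\<lbrakk>f \<in> Hom S x y; g \<in> Hom S x' y'\<rbrakk> \<Longrightarrow> f \<star> g \<in> Hom S (x \<odot> x') (y \<odot> y')"
    and TArr_Ident: "\<lbrakk>x \<in> Obj S; y \<in> Obj S\<rbrakk> \<Longrightarrow> Ident S x \<star> Ident S y = Ident S (x \<odot> y)"
    and interchange: "\<lbrakk>f \<in> Hom S x y; g \<in> Hom S y z; f' \<in> Hom S x' y'; g' \<in> Hom S y' z'\<rbrakk> \<Longrightarrow>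
          (g \<cdot> f) \<star> (g' \<cdot> f') = (g \<star> g') \<cdot> (f \<star> f')"
    and Unit_in: "Unit S \<in> Obj S"
    and Assoc_in: "\<lbrakk>x \<in> Obj S; y \<in> Obj S; z \<in> Obj S\<rbrakk> \<Longrightarrow>
          Assoc S x y z \<in> Hom S ((x \<odot> y) \<odot> z) (x \<odot> (y \<odot> z))"
    and Assoc_iso: "\<lbrakk>x \<in> Obj S; y \<in> Obj S; z \<in> Obj S\<rbrakk> \<Longrightarrow> iso_arrow S (Assoc S x y z)"
    and Assoc_natural: "\<lbrakk>f \<in> Hom S x x'; g \<in> Hom S y y'; h \<in> Hom S z z'\<rbrakk> \<Longrightarrow>
          Assoc S x' y' z' \<cdot> ((f \<star> g) \<star> h) = (f \<star> (g \<star> h)) \<cdot> Assoc S x y z"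
    and LUnit_in: "x \<in> Obj S \<Longrightarrow> LUnit S x \<in> Hom S (Unit S \<odot> x) x"
    and LUnit_iso: "x \<in> Obj S \<Longrightarrow> iso_arrow S (LUnit S x)"
    and LUnit_natural: "f \<in> Hom S x y \<Longrightarrow> LUnit S y \<cdot> (Ident S (Unit S) \<star> f) = f \<cdot> LUnit S x"
    and RUnit_in: "x \<in> Obj S \<Longrightarrow> RUnit S x \<in> Hom S (x \<odot> Unit S) x"
    and RUnit_iso: "x \<in> Obj S \<Longrightarrow> iso_arrow S (RUnit S x)"
    and RUnit_natural: "f \<in> Hom S x y \<Longrightarrow> RUnit S y \<cdot> (f \<star> Ident S (Unit S)) = f \<cdot> RUnit S x"
    and pentagon: "\<lbrakk>w \<in> Obj S; x \<in> Obj S; y \<in> Obj S; z \<in> Obj S\<rbrakk> \<Longrightarrow>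
          Assoc S w x (y \<odot> z) \<cdot> Assoc S (w \<odot> x) y z =
          (Ident S w \<star> Assoc S x y z) \<cdot> Assoc S w (x \<odot> y) z \<cdot> (Assoc S w x y \<star> Ident S z)"
    and triangle: "\<lbrakk>x \<in> Obj S; y \<in> Obj S\<rbrakk> \<Longrightarrow>
          (Ident S x \<star> LUnit S y) \<cdot> Assoc S x (Unit S) y = RUnit S x \<star> Ident S y"
    and Sym_in: "\<lbrakk>x \<in> Obj S; y \<in> Obj S\<rbrakk> \<Longrightarrow> Sym S x y \<in> Hom S (x \<odot> y) (y \<odot> x)"
    and Sym_natural: "\<lbrakk>f \<in> Hom S x x'; g \<in> Hom S y y'\<rbrakk> \<Longrightarrow>
          Sym S x' y' \<cdot> (f \<star> g) = (g \<star> f) \<cdot> Sym S x y"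
    and Sym_Sym: "\<lbrakk>x \<in> Obj S; y \<in> Obj S\<rbrakk> \<Longrightarrow> Sym S y x \<cdot> Sym S x y = Ident S (x \<odot> y)"
    and hexagon: "\<lbrakk>x \<in> Obj S; y \<in> Obj S; z \<in> Obj S\<rbrakk> \<Longrightarrow>
          Assoc S y z x \<cdot> Sym S x (y \<odot> z) \<cdot> Assoc S x y z =
          (Ident S y \<star> Sym S x z) \<cdot> Assoc S y x z \<cdot> (Sym S x y \<star> Ident S z)"

locale symmetric_strict_monoidal_category = symmetric_monoidal_category S
  for S :: "('o, 'a, 'z) sym_mon_cat_scheme" (structure) +
  assumes strict_assoc: "\<lbrakk>x \<in> Obj S; y \<in> Obj S; z \<in> Obj S\<rbrakk> \<Longrightarrow> (x \<odot> y) \<odot> z = x \<odot> (y \<odot> z)"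
    and strict_left: "x \<in> Obj S \<Longrightarrow> Unit S \<odot> x = x"
    and strict_right: "x \<in> Obj S \<Longrightarrow> x \<odot> Unit S = x"
    and Assoc_strict: "\<lbrakk>x \<in> Obj S; y \<in> Obj S; z \<in> Obj S\<rbrakk> \<Longrightarrow>
          Assoc S x y z = Ident S (x \<odot> (y \<odot> z))"
    and LUnit_strict: "x \<in> Obj S \<Longrightarrow> LUnit S x = Ident S x"
    and RUnit_strict: "x \<in> Obj S \<Longrightarrow> RUnit S x = Ident S x"

text \<open>The object \<open>n\<close> of a PROP stands for the set with \<open>n\<close> elements.\<close>

locale prop_category = symmetric_strict_monoidal_category T
  for T :: "(nat, 'a, 'z) sym_mon_cat_scheme" (structure) +
  assumes Obj_PROP: "Obj T = UNIV"
    and TObj_PROP: "m \<odot> n = m + n"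
    and Unit_PROP: "Unit T = 0"


section \<open>Algebras of a PROP\<close>

text \<open>A symmetric monoidal category \<open>S\<close> need not be strict, so that an equation such as
  \<open>F (m + n) = F m \<odot> F n\<close> only makes sense up to rebracketing.  We fix the left bracketed tensor
  powers \<open>tpow S X n = ((X \<odot> X) \<odot> \<dots>) \<odot> X\<close> and the coherence isomorphisms \<open>tcan S X m n\<close> from
  \<open>tpow S X m \<odot> tpow S X n\<close> to \<open>tpow S X (m + n)\<close> which are made of associators and unitors only.
  If \<open>S\<close> is strict then these are identities and the notions below reduce to equations; see
  \<open>tcan_strict\<close>, \<open>symmetric_strict_monoidal_functor_strict\<close> and \<open>monoidal_nat_trans_strict\<close>.\<close>

fun tpow :: "('o, 'a, 'z) sym_mon_cat_scheme \<Rightarrow> 'o \<Rightarrow> nat \<Rightarrow> 'o" where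
  "tpow S X 0 = Unit S"
| "tpow S X (Suc 0) = X"
| "tpow S X (Suc (Suc n)) = tpow S X (Suc n) \<odot>\<^bsub>S\<^esub> X"

fun tcan :: "('o, 'a, 'z) sym_mon_cat_scheme \<Rightarrow> 'o \<Rightarrow> nat \<Rightarrow> nat \<Rightarrow> 'a" where
  "tcan S X m 0 = RUnit S (tpow S X m)"
| "tcan S X 0 (Suc n) = LUnit S (tpow S X (Suc n))"
| "tcan S X (Suc m) (Suc 0) = Ident S (tpow S X (Suc (Suc m)))"
| "tcan S X (Suc m) (Suc (Suc n)) =
     (tcan S X (Suc m) (Suc n) \<star>\<^bsub>S\<^esub> Ident S X)
       \<cdot>\<^bsub>S\<^esub> Inv S (Assoc S (tpow S X (Suc m)) (tpow S X (Suc n)) X)"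

definition symmetric_strict_monoidal_functor ::
  "(nat, 'b, 'y) sym_mon_cat_scheme \<Rightarrow> ('o, 'a, 'z) sym_mon_cat_scheme \<Rightarrow>
    (nat, 'b, 'o, 'a) functor_data \<Rightarrow> bool" where
  "symmetric_strict_monoidal_functor T S F \<longleftrightarrow>
     prop_category T \<and> symmetric_monoidal_category S \<and> is_functor T S F \<and>
     (let c = tcan S (FObj F 1) in
        (\<forall>n. FObj F n = tpow S (FObj F 1) n) \<and>
        (\<forall>m n m' n'. \<forall>f \<in> Hom T m m'. \<forall>g \<in> Hom T n n'.
            FArr F (f \<star>\<^bsub>T\<^esub> g) \<cdot>\<^bsub>S\<^esub> c m n = c m' n' \<cdot>\<^bsub>S\<^esub> (FArr F f \<star>\<^bsub>S\<^esub> FArr F g)) \<and>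
        (\<forall>m n. FArr F (Sym T m n) \<cdot>\<^bsub>S\<^esub> c m n = c n m \<cdot>\<^bsub>S\<^esub> Sym S (FObj F m) (FObj F n)))"

text \<open>The natural transformations between monoidal functors are the monoidal ones.\<close>

definition monoidal_nat_trans ::
  "(nat, 'b, 'y) sym_mon_cat_scheme \<Rightarrow> ('o, 'a, 'z) sym_mon_cat_scheme \<Rightarrow>
    (nat, 'b, 'o, 'a) functor_data \<Rightarrow> (nat, 'b, 'o, 'a) functor_data \<Rightarrow> (nat \<Rightarrow> 'a) \<Rightarrow> bool" where
  "monoidal_nat_trans T S F K \<theta> \<longleftrightarrow> nat_trans T S F K \<theta> \<and>
     \<theta> 0 = Ident S (Unit S) \<and>
     (\<forall>m n. \<theta> (m + n) \<cdot>\<^bsub>S\<^esub> tcan S (FObj F 1) m n = tcan S (FObj K 1) m n \<cdot>\<^bsub>S\<^esub> (\<theta> m \<star>\<^bsub>S\<^esub> \<theta> n))"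

definition Alg ::
  "(nat, 'b, 'y) sym_mon_cat_scheme \<Rightarrow> ('o, 'a, 'z) sym_mon_cat_scheme \<Rightarrow>
    ((nat, 'b, 'o, 'a) functor_data,
     (nat, 'b, 'o, 'a) functor_data \<times> (nat, 'b, 'o, 'a) functor_data \<times> (nat \<Rightarrow> 'a)) category" where
  "Alg T S = (functor_category T S)
     \<lparr>Obj := {F. symmetric_strict_monoidal_functor T S F},
      Arr := {(F, K, \<theta>). symmetric_strict_monoidal_functor T S F \<and>
                symmetric_strict_monoidal_functor T S K \<and> monoidal_nat_trans T S F K \<theta>}\<rparr>"


section \<open>Bimonoids\<close>

record ('o, 'a) bimonoid_data =
  Car :: "'o"
  Mul :: "'a"
  Uni :: "'a"
  Com :: "'a"
  Cou :: "'a"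

text \<open>The arrow \<open>(x \<odot> x) \<odot> (x \<odot> x) \<rightarrow> (x \<odot> x) \<odot> (x \<odot> x)\<close> exchanging the two middle factors.\<close>

definition middle_swap :: "('o, 'a, 'z) sym_mon_cat_scheme \<Rightarrow> 'o \<Rightarrow> 'a" where
  "middle_swap S x =
     Inv S (Assoc S x x (x \<odot>\<^bsub>S\<^esub> x)) \<cdot>\<^bsub>S\<^esub>
     (Ident S x \<star>\<^bsub>S\<^esub>
        (Assoc S x x x \<cdot>\<^bsub>S\<^esub> (Sym S x x \<star>\<^bsub>S\<^esub> Ident S x) \<cdot>\<^bsub>S\<^esub> Inv S (Assoc S x x x))) \<cdot>\<^bsub>S\<^esub>
     Assoc S x x (x \<odot>\<^bsub>S\<^esub> x)"

definition bimonoid :: "('o, 'a, 'z) sym_mon_cat_scheme \<Rightarrow> ('o, 'a) bimonoid_data \<Rightarrow> bool" where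
  "bimonoid S B \<longleftrightarrow>
     (let x = Car B; \<mu> = Mul B; \<eta> = Uni B; \<Delta> = Com B; \<epsilon> = Cou B; I = Unit S; i = Ident S x in
       x \<in> Obj S \<and>
       \<mu> \<in> Hom S (x \<odot>\<^bsub>S\<^esub> x) x \<and> \<eta> \<in> Hom S I x \<and> \<Delta> \<in> Hom S x (x \<odot>\<^bsub>S\<^esub> x) \<and> \<epsilon> \<in> Hom S x I \<and>
       \<mu> \<cdot>\<^bsub>S\<^esub> (\<mu> \<star>\<^bsub>S\<^esub> i) = \<mu> \<cdot>\<^bsub>S\<^esub> (i \<star>\<^bsub>S\<^esub> \<mu>) \<cdot>\<^bsub>S\<^esub> Assoc S x x x \<and>
       \<mu> \<cdot>\<^bsub>S\<^esub> (\<eta> \<star>\<^bsub>S\<^esub> i) = LUnit S x \<and>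
       \<mu> \<cdot>\<^bsub>S\<^esub> (i \<star>\<^bsub>S\<^esub> \<eta>) = RUnit S x \<and>
       Assoc S x x x \<cdot>\<^bsub>S\<^esub> (\<Delta> \<star>\<^bsub>S\<^esub> i) \<cdot>\<^bsub>S\<^esub> \<Delta> = (i \<star>\<^bsub>S\<^esub> \<Delta>) \<cdot>\<^bsub>S\<^esub> \<Delta> \<and>
       LUnit S x \<cdot>\<^bsub>S\<^esub> (\<epsilon> \<star>\<^bsub>S\<^esub> i) \<cdot>\<^bsub>S\<^esub> \<Delta> = i \<and>
       RUnit S x \<cdot>\<^bsub>S\<^esub> (i \<star>\<^bsub>S\<^esub> \<epsilon>) \<cdot>\<^bsub>S\<^esub> \<Delta> = i \<and>
       \<Delta> \<cdot>\<^bsub>S\<^esub> \<mu> = (\<mu> \<star>\<^bsub>S\<^esub> \<mu>) \<cdot>\<^bsub>S\<^esub> middle_swap S x \<cdot>\<^bsub>S\<^esub> (\<Delta> \<star>\<^bsub>S\<^esub> \<Delta>) \<and>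
       \<epsilon> \<cdot>\<^bsub>S\<^esub> \<mu> = LUnit S I \<cdot>\<^bsub>S\<^esub> (\<epsilon> \<star>\<^bsub>S\<^esub> \<epsilon>) \<and>
       \<Delta> \<cdot>\<^bsub>S\<^esub> \<eta> = (\<eta> \<star>\<^bsub>S\<^esub> \<eta>) \<cdot>\<^bsub>S\<^esub> Inv S (LUnit S I) \<and>
       \<epsilon> \<cdot>\<^bsub>S\<^esub> \<eta> = Ident S I)"

definition bimonoid_hom ::
  "('o, 'a, 'z) sym_mon_cat_scheme \<Rightarrow> ('o, 'a) bimonoid_data \<Rightarrow> ('o, 'a) bimonoid_data \<Rightarrow> 'a \<Rightarrow> bool"
where
  "bimonoid_hom S A B f \<longleftrightarrow> f \<in> Hom S (Car A) (Car B) \<and>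
     f \<cdot>\<^bsub>S\<^esub> Mul A = Mul B \<cdot>\<^bsub>S\<^esub> (f \<star>\<^bsub>S\<^esub> f) \<and> f \<cdot>\<^bsub>S\<^esub> Uni A = Uni B \<and>
     (f \<star>\<^bsub>S\<^esub> f) \<cdot>\<^bsub>S\<^esub> Com A = Com B \<cdot>\<^bsub>S\<^esub> f \<and> Cou B \<cdot>\<^bsub>S\<^esub> f = Cou A"

definition Bimon ::
  "('o, 'a, 'z) sym_mon_cat_scheme \<Rightarrow>
    (('o, 'a) bimonoid_data, ('o, 'a) bimonoid_data \<times> ('o, 'a) bimonoid_data \<times> 'a) category" where
  "Bimon S =
     \<lparr>Obj = {B. bimonoid S B},
      Arr = {(A, B, f). bimonoid S A \<and> bimonoid S B \<and> bimonoid_hom S A B f},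
      Dom = (\<lambda>(A, B, f). A),
      Cod = (\<lambda>(A, B, f). B),
      Ident = (\<lambda>B. (B, B, Ident S (Car B))),
      Cmp = (\<lambda>(_, D, g) (A, _, f). (A, D, g \<cdot>\<^bsub>S\<^esub> f))\<rparr>"

definition "GBimon G S = functor_category (one_object_category G) (Bimon S)"


section \<open>The PROP of G-labelled noncommutative sets\<close>

text \<open>The sets \<open>{1, \<dots>, n}\<close> are replaced by \<open>{..<n}\<close>.  An ordered labelled set is the list of its
  elements, in increasing order, paired with their labels.  A morphism is recorded by its source
  and by the list of its preimages \<open>f\<^sup>-\<^sup>1(0), f\<^sup>-\<^sup>1(1), \<dots>\<close>, each an ordered labelled set; the
  underlying map of sets is recovered as \<open>lmap f\<close>.\<close>

record 'g lmor =
  src :: nat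
  fibres :: "(nat \<times> 'g) list list"

definition tgt :: "'g lmor \<Rightarrow> nat" where
  "tgt f = length (fibres f)"

definition fibre :: "'g lmor \<Rightarrow> nat \<Rightarrow> (nat \<times> 'g) list" where
  "fibre f i = fibres f ! i"

definition is_lmor :: "('g, 'z) monoid_scheme \<Rightarrow> 'g lmor \<Rightarrow> bool" where
  "is_lmor G f \<longleftrightarrow> distinct (map fst (concat (fibres f))) \<and>
     fst ` set (concat (fibres f)) = {..<src f} \<and> snd ` set (concat (fibres f)) \<subseteq> carrier G"

definition lmap :: "'g lmor \<Rightarrow> nat \<Rightarrow> nat" where
  "lmap f j = (THE i. i < tgt f \<and> j \<in> fst ` set (fibre f i))"

definition lact :: "('g, 'z) monoid_scheme \<Rightarrow> 'g \<Rightarrow> (nat \<times> 'g) list \<Rightarrow> (nat \<times> 'g) list" where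
  "lact G g xs = map (\<lambda>(j, a). (j, g \<otimes>\<^bsub>G\<^esub> a)) xs"

definition lcomp :: "('g, 'z) monoid_scheme \<Rightarrow> 'g lmor \<Rightarrow> 'g lmor \<Rightarrow> 'g lmor" where
  "lcomp G f2 f1 =
     \<lparr>src = src f1, fibres = map (\<lambda>xs. concat (map (\<lambda>(j, a). lact G a (fibre f1 j)) xs)) (fibres f2)\<rparr>"

definition lid :: "('g, 'z) monoid_scheme \<Rightarrow> nat \<Rightarrow> 'g lmor" where
  "lid G n = \<lparr>src = n, fibres = map (\<lambda>i. [(i, \<one>\<^bsub>G\<^esub>)]) [0..<n]\<rparr>"

definition ltensor :: "'g lmor \<Rightarrow> 'g lmor \<Rightarrow> 'g lmor" where
  "ltensor f g =
     \<lparr>src = src f + src g, fibres = fibres f @ map (map (\<lambda>(j, a). (src f + j, a))) (fibres g)\<rparr>"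

definition lsym :: "('g, 'z) monoid_scheme \<Rightarrow> nat \<Rightarrow> nat \<Rightarrow> 'g lmor" where
  "lsym G m n =
     \<lparr>src = m + n, fibres = map (\<lambda>i. [(m + i, \<one>\<^bsub>G\<^esub>)]) [0..<n] @ map (\<lambda>i. [(i, \<one>\<^bsub>G\<^esub>)]) [0..<m]\<rparr>"

definition lbij :: "('g, 'z) monoid_scheme \<Rightarrow> nat \<Rightarrow> 'g lmor \<Rightarrow> bool" where
  "lbij G p h \<longleftrightarrow> is_lmor G h \<and> src h = p \<and> tgt h = p \<and> bij_betw (lmap h) {..<p} {..<p}"

definition unlabelled :: "('g, 'z) monoid_scheme \<Rightarrow> 'g lmor \<Rightarrow> bool" where
  "unlabelled G f \<longleftrightarrow> snd ` set (concat (fibres f)) \<subseteq> {\<one>\<^bsub>G\<^esub>}"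


section \<open>Bimorphisms and the composite PROP\<close>

text \<open>A square with top \<open>f1: n \<rightarrow> p\<close>, bottom \<open>f: m \<rightarrow> q\<close>, left \<open>\<phi>1: n \<rightarrow> m\<close> and right \<open>\<phi>: p \<rightarrow> q\<close>.
  As \<open>fibre\<close> lists a preimage in order and with labels, the last two conditions say that \<open>f1\<close>
  and \<open>\<phi>1\<close> induce isomorphisms of ordered labelled sets.\<close>

definition bimorphism ::
  "('g, 'z) monoid_scheme \<Rightarrow> 'g lmor \<Rightarrow> 'g lmor \<Rightarrow> 'g lmor \<Rightarrow> 'g lmor \<Rightarrow> bool" where
  "bimorphism G f1 f \<phi>1 \<phi> \<longleftrightarrow>
     is_lmor G f1 \<and> is_lmor G f \<and> is_lmor G \<phi>1 \<and> is_lmor G \<phi> \<and>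
     src f1 = src \<phi>1 \<and> tgt \<phi>1 = src f \<and> tgt f1 = src \<phi> \<and> tgt f = tgt \<phi> \<and>
     bij_betw (\<lambda>k. (lmap \<phi>1 k, lmap f1 k)) {..<src f1}
       {(x, y). x < src f \<and> y < src \<phi> \<and> lmap f x = lmap \<phi> y} \<and>
     (\<forall>x < src f. map (\<lambda>(k, a). (lmap f1 k, a)) (fibre \<phi>1 x) = fibre \<phi> (lmap f x)) \<and>
     (\<forall>y < src \<phi>. map (\<lambda>(k, a). (lmap \<phi>1 k, a)) (fibre f1 y) = fibre f (lmap \<phi> y))"

text \<open>A span from \<open>n\<close> to \<open>m\<close> is a pair \<open>(\<phi>, f)\<close> with \<open>\<phi>: p \<rightarrow> n\<close> and \<open>f: p \<rightarrow> m\<close>.\<close>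

type_synonym 'g lspan = "'g lmor \<times> 'g lmor"

definition is_span :: "('g, 'z) monoid_scheme \<Rightarrow> 'g lspan \<Rightarrow> bool" where
  "is_span G s \<longleftrightarrow> is_lmor G (fst s) \<and> is_lmor G (snd s) \<and> src (fst s) = src (snd s)"

definition span_equiv :: "('g, 'z) monoid_scheme \<Rightarrow> 'g lspan \<Rightarrow> 'g lspan \<Rightarrow> bool" where
  "span_equiv G s t \<longleftrightarrow> is_span G s \<and> is_span G t \<and>
     (\<exists>h. lbij G (src (fst t)) h \<and> lcomp G (fst t) h = fst s \<and> lcomp G (snd t) h = snd s)"

definition span_class :: "('g, 'z) monoid_scheme \<Rightarrow> 'g lspan \<Rightarrow> 'g lspan set" where
  "span_class G s = {t. span_equiv G t s}"

text \<open>\<open>span_comp G t s r\<close>: the span \<open>r\<close> is a composite of \<open>s\<close> followed by \<open>t\<close>, the inner cospan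
  being replaced by a span by means of a bimorphism.  Since pullbacks are only determined up to
  a bijection, so is \<open>r\<close>.\<close>

definition span_comp ::
  "('g, 'z) monoid_scheme \<Rightarrow> 'g lspan \<Rightarrow> 'g lspan \<Rightarrow> 'g lspan \<Rightarrow> bool" where
  "span_comp G t s r \<longleftrightarrow> (\<exists>f1 \<phi>1. bimorphism G f1 (snd s) \<phi>1 (fst t) \<and>
     r = (lcomp G (fst s) \<phi>1, lcomp G (snd t) f1))"

text \<open>Composition of classes uses representatives \<open>(\<phi>, f)\<close> of the second span for which all labels
  of \<open>\<phi>\<close> are \<open>1\<close>.  Every class has such representatives, and the class of the composite does not
  depend on their choice.  For commutative \<open>G\<close> any other representative gives the same result,
  but not in general: if \<open>n = m = p = 1\<close> the class of \<open>(\<phi>, f)\<close> is determined by the element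
  \<open>f \<phi>\<^sup>-\<^sup>1\<close> of \<open>G\<close>, and for \<open>s = (1, a)\<close> and \<open>t = (b, b)\<close>, where \<open>t\<close> is equivalent to the identity
  span, the composite \<open>(b, b a)\<close> has the class of \<open>b a b\<^sup>-\<^sup>1\<close>.\<close>

definition GFas_composite ::
  "('g, 'z) monoid_scheme \<Rightarrow> (nat, 'g lspan set) sym_mon_cat" where
  "GFas_composite G =
     \<lparr>Obj = UNIV,
      Arr = span_class G ` {s. is_span G s},
      Dom = (\<lambda>A. THE n. \<exists>s \<in> A. n = tgt (fst s)),
      Cod = (\<lambda>A. THE m. \<exists>s \<in> A. m = tgt (snd s)),
      Ident = (\<lambda>n. span_class G (lid G n, lid G n)),
      Cmp = (\<lambda>B A. \<Union> {span_class G r | r s t. s \<in> A \<and> t \<in> B \<and> unlabelled G (fst t) \<and> span_comp G t s r}),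
      TObj = (+),
      TArr = (\<lambda>A B. \<Union> {span_class G (ltensor (fst s) (fst t), ltensor (snd s) (snd t)) | s t.
                  s \<in> A \<and> t \<in> B}),
      Unit = 0,
      Assoc = (\<lambda>l m n. span_class G (lid G (l + m + n), lid G (l + m + n))),
      LUnit = (\<lambda>n. span_class G (lid G n, lid G n)),
      RUnit = (\<lambda>n. span_class G (lid G n, lid G n)),
      Sym = (\<lambda>m n. span_class G (lid G (m + n), lsym G m n))\<rparr>"


section \<open>Algebras in strict symmetric monoidal categories\<close>

context symmetric_strict_monoidal_category
begin

lemma tpow_in: "X \<in> Obj S \<Longrightarrow> tpow S X n \<in> Obj S"
proof (induction n)
  case (Suc n)
  then show ?case by (cases n) (auto intro: TObj_in)
qed (simp add: Unit_in)

lemma tpow_Suc_strict: "X \<in> Obj S \<Longrightarrow> tpow S X (Suc n) = tpow S X n \<odot> X"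
  by (cases n) (auto simp: strict_left)

lemma tpow_add_strict: "X \<in> Obj S \<Longrightarrow> tpow S X m \<odot> tpow S X n = tpow S X (m + n)"
  by (induction n) (simp_all add: strict_right tpow_in tpow_Suc_strict strict_assoc[symmetric])

lemma Inv_Ident: "x \<in> Obj S \<Longrightarrow> Inv S (Ident S x) = Ident S x"
proof -
  assume x: "x \<in> Obj S"
  have D: "Dom S (Ident S x) = x" "Cod S (Ident S x) = x" "Ident S x \<in> Arr S"
    using Ident_in[OF x] by (auto simp: Hom_def)
  show ?thesis
    unfolding Inv_def inverse_arrows_def D
    using Ident_in[OF x] by (intro the_equality) (auto simp: Ident_left Ident_right D)
qed

lemma tcan_strict:
  assumes X: "X \<in> Obj S" shows "tcan S X m n = Ident S (tpow S X (m + n))"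
proof (induction n)
  case 0
  then show ?case using X by (simp add: RUnit_strict tpow_in)
next
  case (Suc n)
  show ?case
  proof (cases m)
    case 0
    then show ?thesis using X tpow_in[of X "Suc n"] by (simp add: LUnit_strict)
  next
    case m: (Suc m')
    show ?thesis
    proof (cases n)
      case 0
      then show ?thesis using m by simp
    next
      case n: (Suc n')
      have o: "tpow S X (Suc m' + Suc n') \<in> Obj S" "tpow S X (Suc (Suc m' + Suc n')) \<in> Obj S"
        using X by (blast intro: tpow_in)+
      have "tpow S X (Suc m') \<odot> tpow S X (Suc n') \<odot> X = tpow S X (Suc (Suc m' + Suc n'))"
        using X tpow_add_strict[OF X, of "Suc m'" "Suc (Suc n')"] by simp
      moreover have "tpow S X (Suc m' + Suc n') \<odot> X = tpow S X (Suc (Suc m' + Suc n'))"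
        using tpow_Suc_strict[OF X] by metis
      ultimately show ?thesis
        using Suc.IH X o
        by (simp only: m n tcan.simps Assoc_strict tpow_in Inv_Ident TArr_Ident Ident_left[OF Ident_in]
              add_Suc_right)
    qed
  qed
qed

lemma symmetric_strict_monoidal_functor_strict:
  assumes T: "prop_category T"
  shows "symmetric_strict_monoidal_functor T S F \<longleftrightarrow>
     is_functor T S F \<and> FObj F 0 = Unit S \<and>
     (\<forall>m n. FObj F (m + n) = FObj F m \<odot> FObj F n) \<and>
     (\<forall>f \<in> Arr T. \<forall>g \<in> Arr T. FArr F (f \<star>\<^bsub>T\<^esub> g) = FArr F f \<star> FArr F g) \<and>
     (\<forall>m n. FArr F (Sym T m n) = Sym S (FObj F m) (FObj F n))"
proof (cases "is_functor T S F")
  case F: True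
  interpret T: prop_category T by fact
  define X where "X = FObj F 1"
  have O: "FObj F n \<in> Obj S" for n
    using F by (auto simp: is_functor_def T.Obj_PROP)
  then have X: "X \<in> Obj S" by (simp add: X_def)
  have A: "FArr F f \<in> Hom S (FObj F m) (FObj F n)" if "f \<in> Hom T m n" for f m n
    using F that by (auto simp: is_functor_def)
  have pow: "(\<forall>n. FObj F n = tpow S X n) \<longleftrightarrow>
      FObj F 0 = Unit S \<and> (\<forall>m n. FObj F (m + n) = FObj F m \<odot> FObj F n)" (is "?l \<longleftrightarrow> ?r")
  proof
    assume ?l
    then show ?r using tpow_add_strict[OF X] by simp
  next
    assume r: ?r
    have "FObj F n = tpow S X n" for n
    proof (induction n)
      case (Suc n)
      have "FObj F (Suc n) = FObj F n \<odot> X" using r by (metis X_def Suc_eq_plus1)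
      then show ?case using Suc tpow_Suc_strict[OF X] by simp
    qed (use r in simp)
    then show ?l by blast
  qed
  have ten: "(\<forall>m n m' n'. \<forall>f \<in> Hom T m m'. \<forall>g \<in> Hom T n n'.
      FArr F (f \<star>\<^bsub>T\<^esub> g) \<cdot> tcan S X m n = tcan S X m' n' \<cdot> (FArr F f \<star> FArr F g)) \<longleftrightarrow>
      (\<forall>f \<in> Arr T. \<forall>g \<in> Arr T. FArr F (f \<star>\<^bsub>T\<^esub> g) = FArr F f \<star> FArr F g)"
    if l: "\<forall>n. FObj F n = tpow S X n"
  proof -
    have "FArr F (f \<star>\<^bsub>T\<^esub> g) \<cdot> tcan S X m n = FArr F (f \<star>\<^bsub>T\<^esub> g) \<and>
          tcan S X m' n' \<cdot> (FArr F f \<star> FArr F g) = FArr F f \<star> FArr F g"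
      if f: "f \<in> Hom T m m'" and g: "g \<in> Hom T n n'" for m n m' n' f g
    proof -
      have "FArr F (f \<star>\<^bsub>T\<^esub> g) \<in> Hom S (tpow S X (m + n)) (tpow S X (m' + n'))"
        using A[OF T.TArr_in[OF f g]] l by (simp add: T.TObj_PROP)
      moreover have "FArr F f \<star> FArr F g \<in> Hom S (tpow S X (m + n)) (tpow S X (m' + n'))"
        using TArr_in[OF A[OF f] A[OF g]] l by (simp add: tpow_add_strict[OF X])
      ultimately show ?thesis
        by (simp add: tcan_strict[OF X] Ident_left Ident_right)
    qed
    note * = this
    have H: "f \<in> Hom T (Dom T f) (Cod T f)" if "f \<in> Arr T" for f
      using that by (simp add: Hom_def)
    show ?thesis
    proof (intro iffI ballI allI)
      fix f g
      assume "\<forall>m n m' n'. \<forall>f \<in> Hom T m m'. \<forall>g \<in> Hom T n n'.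
          FArr F (f \<star>\<^bsub>T\<^esub> g) \<cdot> tcan S X m n = tcan S X m' n' \<cdot> (FArr F f \<star> FArr F g)"
        and fg: "f \<in> Arr T" "g \<in> Arr T"
      then have "FArr F (f \<star>\<^bsub>T\<^esub> g) \<cdot> tcan S X (Dom T f) (Dom T g) =
          tcan S X (Cod T f) (Cod T g) \<cdot> (FArr F f \<star> FArr F g)"
        using H by blast
      then show "FArr F (f \<star>\<^bsub>T\<^esub> g) = FArr F f \<star> FArr F g"
        using *[OF H[OF fg(1)] H[OF fg(2)]] by simp
    next
      fix m n m' n' f g
      assume a: "\<forall>f \<in> Arr T. \<forall>g \<in> Arr T. FArr F (f \<star>\<^bsub>T\<^esub> g) = FArr F f \<star> FArr F g"
        and f: "f \<in> Hom T m m'" and g: "g \<in> Hom T n n'"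
      have "f \<in> Arr T" "g \<in> Arr T" using f g by (auto simp: Hom_def)
      then show "FArr F (f \<star>\<^bsub>T\<^esub> g) \<cdot> tcan S X m n = tcan S X m' n' \<cdot> (FArr F f \<star> FArr F g)"
        using *[OF f g] a by simp
    qed
  qed
  have sym: "(FArr F (Sym T m n) \<cdot> tcan S X m n = tcan S X n m \<cdot> Sym S (FObj F m) (FObj F n)) \<longleftrightarrow>
      FArr F (Sym T m n) = Sym S (FObj F m) (FObj F n)"
    if l: "\<forall>n. FObj F n = tpow S X n" for m n
  proof -
    have "Sym T m n \<in> Hom T (m + n) (n + m)"
      using T.Sym_in[of m n] by (simp add: T.Obj_PROP T.TObj_PROP)
    from A[OF this] have "FArr F (Sym T m n) \<in> Hom S (tpow S X (m + n)) (tpow S X (n + m))"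
      using l by simp
    moreover have "Sym S (FObj F m) (FObj F n) \<in> Hom S (tpow S X (m + n)) (tpow S X (n + m))"
      using Sym_in[OF O[of m] O[of n]] l by (simp add: tpow_add_strict[OF X])
    ultimately show ?thesis
      by (simp add: tcan_strict[OF X] Ident_left Ident_right)
  qed
  have "symmetric_strict_monoidal_functor T S F \<longleftrightarrow> (\<forall>n. FObj F n = tpow S X n) \<and>
      (\<forall>m n m' n'. \<forall>f \<in> Hom T m m'. \<forall>g \<in> Hom T n n'.
        FArr F (f \<star>\<^bsub>T\<^esub> g) \<cdot> tcan S X m n = tcan S X m' n' \<cdot> (FArr F f \<star> FArr F g)) \<and>
      (\<forall>m n. FArr F (Sym T m n) \<cdot> tcan S X m n = tcan S X n m \<cdot> Sym S (FObj F m) (FObj F n))"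
    using F T symmetric_monoidal_category_axioms
    by (simp only: symmetric_strict_monoidal_functor_def Let_def X_def simp_thms)
  also have "\<dots> \<longleftrightarrow> (\<forall>n. FObj F n = tpow S X n) \<and>
      (\<forall>f \<in> Arr T. \<forall>g \<in> Arr T. FArr F (f \<star>\<^bsub>T\<^esub> g) = FArr F f \<star> FArr F g) \<and>
      (\<forall>m n. FArr F (Sym T m n) = Sym S (FObj F m) (FObj F n))"
  proof (intro conj_cong refl)
    assume l: "\<forall>n. FObj F n = tpow S X n"
    show "(\<forall>m n. FArr F (Sym T m n) \<cdot> tcan S X m n = tcan S X n m \<cdot> Sym S (FObj F m) (FObj F n)) \<longleftrightarrow>
        (\<forall>m n. FArr F (Sym T m n) = Sym S (FObj F m) (FObj F n))"
      by (simp only: sym[OF l])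
  qed (rule ten)
  finally show ?thesis
    using F by (simp only: pow simp_thms conj_assoc)
qed (simp add: symmetric_strict_monoidal_functor_def)

lemma monoidal_nat_trans_strict:
  assumes F: "symmetric_strict_monoidal_functor T S F"
    and K: "symmetric_strict_monoidal_functor T S K"
  shows "monoidal_nat_trans T S F K \<theta> \<longleftrightarrow> nat_trans T S F K \<theta> \<and>
     \<theta> 0 = Ident S (Unit S) \<and> (\<forall>m n. \<theta> (m + n) = \<theta> m \<star> \<theta> n)"
proof (cases "nat_trans T S F K \<theta>")
  case t: True
  interpret T: prop_category T using F by (simp add: symmetric_strict_monoidal_functor_def)
  have O: "FObj F 1 \<in> Obj S" "FObj K 1 \<in> Obj S"
    using t by (auto simp: nat_trans_def is_functor_def T.Obj_PROP)
  have p: "FObj F n = tpow S (FObj F 1) n" "FObj K n = tpow S (FObj K 1) n" for n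
    using F K unfolding symmetric_strict_monoidal_functor_def Let_def by blast+
  have th: "\<theta> n \<in> Hom S (tpow S (FObj F 1) n) (tpow S (FObj K 1) n)" for n
    using t unfolding nat_trans_def T.Obj_PROP p(1)[symmetric] p(2)[symmetric] by blast
  have tt: "\<theta> m \<star> \<theta> n \<in> Hom S (tpow S (FObj F 1) (m + n)) (tpow S (FObj K 1) (m + n))" for m n
    using TArr_in[OF th[of m] th[of n]] by (simp only: tpow_add_strict[OF O(1)] tpow_add_strict[OF O(2)])
  have "(\<theta> (m + n) \<cdot> tcan S (FObj F 1) m n = tcan S (FObj K 1) m n \<cdot> (\<theta> m \<star> \<theta> n)) \<longleftrightarrow>
      \<theta> (m + n) = \<theta> m \<star> \<theta> n" for m n
    by (simp only: tcan_strict[OF O(1)] tcan_strict[OF O(2)] Ident_left[OF tt] Ident_right[OF th])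
  then show ?thesis by (simp add: monoidal_nat_trans_def)
qed (simp add: monoidal_nat_trans_def)

end

end

theory Submission
  imports Defs "HOL-Library.Multiset"
begin

text \<open>Up to equivalence the left leg of a span is unlabelled; what remains are two lists of words in the
  elements of the middle object, and two such spans are equivalent iff they differ by a renaming of
  these elements.  In a PROP with a bimonoid on which \<open>G\<close> acts, such a span is evaluated to iterated
  comultiplications, followed by a permutation, followed by the action of the labels and by iterated
  multiplications.  By the bimonoid law in all arities, evaluation turns the distributive law that
  defines the composition of spans into composition.  Conversely every span is the value of itself
  in the composite PROP, so that this PROP is generated by its bimonoid and by \<open>G\<close>.  Hence it is the
  free PROP on a bimonoid with \<open>G\<close>-action.

  If \<open>S\<close> is not strict, then the arrows between tensor powers of an object \<open>X\<close>, with the tensor product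
  conjugated by the coherence isomorphisms, still form a strict PROP.  Algebras with value \<open>X\<close> at \<open>1\<close>
  are the PROP morphisms into it, and bimonoids on \<open>X\<close> are the bimonoids in it.  So evaluation at \<open>1\<close> is
  bijective on objects, and also on arrows, since a monoidal transformation consists of the tensor
  powers of its component at \<open>1\<close>.\<close>

section \<open>Calculus in a PROP\<close>

text \<open>The obstacle is the numbering of strands. A pullback of \<open>{..<m}\<close> and
  \<open>{..<p}\<close> has no preferred numbering, so every identity between composites of spans
  would involve choices. With strands of an arbitrary type the pullback is a set of pairs:
  associativity becomes rebracketing of tuples, interchange becomes an injection of a sum of
  products into a product of sums, and numberings are confined to the comparison with the classes
  that form \<open>GFas_composite\<close>. For the same reason permutations in a PROP are indexed by
  two listings of the same names and not by functions on indices, so that permutations of blocks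
  need no arithmetic.

  Labels can be moved to the right leg because a relabelling multiplies both legs from the right by
  the same element. This is also why composites are formed over an unlabelled left leg: a label
  there would end up between two labels of the right leg, and it cannot be moved out of a
  noncommutative product.\<close>

context category
begin

lemma cmp_arr [simp]:
  assumes "f \<in> Arr C" "g \<in> Arr C" "Cod C f = Dom C g"
  shows "g \<cdot> f \<in> Arr C" "Dom C (g \<cdot> f) = Dom C f" "Cod C (g \<cdot> f) = Cod C g"
  using Cmp_in[of f "Dom C f" "Cod C f" g "Cod C g"] assms by (auto simp: Hom_def)

lemma cmp_Ident [simp]:
  "f \<in> Arr C \<Longrightarrow> Dom C f = n \<Longrightarrow> f \<cdot> Ident C n = f"
  "f \<in> Arr C \<Longrightarrow> Cod C f = n \<Longrightarrow> Ident C n \<cdot> f = f"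
  using Ident_left Ident_right by (auto simp: Hom_def)

lemma cmp_assoc:
  "\<lbrakk>f \<in> Arr C; g \<in> Arr C; h \<in> Arr C; Cod C f = Dom C g; Cod C g = Dom C h\<rbrakk> \<Longrightarrow>
    (h \<cdot> g) \<cdot> f = h \<cdot> (g \<cdot> f)"
  using Cmp_assoc[of f "Dom C f" "Cod C f" g "Cod C g" h "Cod C h"] by (auto simp: Hom_def)

lemma Ident_arr':
  assumes "x \<in> Obj C"
  shows "Ident C x \<in> Arr C" "Dom C (Ident C x) = x" "Cod C (Ident C x) = x"
  using Ident_in[OF assms] by (auto simp: Hom_def)

end

context symmetric_monoidal_category
begin

lemma ten_cmp:
  "\<lbrakk>f \<in> Arr S; g \<in> Arr S; f' \<in> Arr S; g' \<in> Arr S; Cod S f = Dom S g; Cod S f' = Dom S g'\<rbrakk> \<Longrightarrow>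
    (g \<star> g') \<cdot> (f \<star> f') = (g \<cdot> f) \<star> (g' \<cdot> f')"
  using interchange[of f "Dom S f" "Cod S f" g "Cod S g" f' "Dom S f'" "Cod S f'" g' "Cod S g'"]
  by (auto simp: Hom_def)

lemma ten_arr':
  assumes "f \<in> Arr S" "g \<in> Arr S"
  shows "f \<star> g \<in> Arr S" "Dom S (f \<star> g) = Dom S f \<odot> Dom S g" "Cod S (f \<star> g) = Cod S f \<odot> Cod S g"
  using TArr_in[of f "Dom S f" "Cod S f" g "Dom S g" "Cod S g"] assms by (auto simp: Hom_def)

end

text \<open>Two listings of the same finite set. Such a pair stands for a permutation without
  mentioning positions in either list.\<close>

definition rearr :: "'s list \<Rightarrow> 's list \<Rightarrow> bool" where
  "rearr xs ys \<longleftrightarrow> distinct xs \<and> distinct ys \<and> set xs = set ys"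

lemma rearr_length: "rearr xs ys \<Longrightarrow> length xs = length ys"
  unfolding rearr_def by (metis distinct_card)

lemma rearr_Cons: "rearr xs (y # ys) \<Longrightarrow> rearr (remove1 y xs) ys"
  by (auto simp: rearr_def)

lemma rearr_remove1: "rearr xs ys \<Longrightarrow> rearr (remove1 y xs) (remove1 y ys)"
  by (auto simp: rearr_def)

text \<open>Concatenating the blocks in another order gives the same multiset, so distinctness of
  one listing passes to the other.\<close>

lemma rearr_concat:
  assumes "rearr xs ys" "distinct (concat (map d xs))"
  shows "rearr (concat (map d xs)) (concat (map d ys))"
proof -
  have "mset xs = mset ys" using assms(1) set_eq_iff_mset_eq_distinct unfolding rearr_def by blast
  then have m: "mset (concat (map d xs)) = mset (concat (map d ys))"
    by (simp add: mset_concat flip: sum_mset_sum_list)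
  then show ?thesis using assms(2) mset_eq_imp_distinct_iff[OF m] mset_eq_setD[OF m]
    by (simp add: rearr_def)
qed

section \<open>Symmetries and permutations in a strict PROP\<close>

context prop_category
begin

lemma Ident_arr [simp]: "Ident T n \<in> Arr T" "Dom T (Ident T n) = n" "Cod T (Ident T n) = n"
  using Ident_in[of n] by (auto simp: Obj_PROP Hom_def)

lemma ten_arr [simp]:
  assumes "f \<in> Arr T" "g \<in> Arr T"
  shows "f \<star> g \<in> Arr T" "Dom T (f \<star> g) = Dom T f + Dom T g" "Cod T (f \<star> g) = Cod T f + Cod T g"
  using TArr_in[of f "Dom T f" "Cod T f" g "Dom T g" "Cod T g"] assms by (auto simp: Hom_def TObj_PROP)

lemma Sym_arr [simp]:
  "Sym T m n \<in> Arr T" "Dom T (Sym T m n) = m + n" "Cod T (Sym T m n) = n + m"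
  using Sym_in[of m n] by (auto simp: Obj_PROP Hom_def TObj_PROP)

lemma Ident_ten [simp]: "Ident T m \<star> Ident T n = Ident T (m + n)"
  using TArr_Ident[of m n] by (simp add: Obj_PROP TObj_PROP)

lemma ten_assoc:
  "\<lbrakk>f \<in> Arr T; g \<in> Arr T; h \<in> Arr T\<rbrakk> \<Longrightarrow> (f \<star> g) \<star> h = f \<star> (g \<star> h)"
  using Assoc_natural[of f "Dom T f" "Cod T f" g "Dom T g" "Cod T g" h "Dom T h" "Cod T h"]
  by (simp add: Hom_def Assoc_strict Obj_PROP TObj_PROP add.assoc)

lemma ten_0 [simp]: "f \<in> Arr T \<Longrightarrow> Ident T 0 \<star> f = f" "f \<in> Arr T \<Longrightarrow> f \<star> Ident T 0 = f"
  using LUnit_natural[of f "Dom T f" "Cod T f"] RUnit_natural[of f "Dom T f" "Cod T f"]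
  by (simp_all add: Hom_def LUnit_strict RUnit_strict Obj_PROP Unit_PROP)

lemma Sym_nat:
  "\<lbrakk>f \<in> Arr T; g \<in> Arr T; Cod T f = m; Cod T g = n\<rbrakk> \<Longrightarrow>
    Sym T m n \<cdot> (f \<star> g) = (g \<star> f) \<cdot> Sym T (Dom T f) (Dom T g)"
  using Sym_natural[of f "Dom T f" "Cod T f" g "Dom T g" "Cod T g"] by (auto simp: Hom_def)

lemma Sym_inv [simp]: "Sym T n m \<cdot> Sym T m n = Ident T (m + n)"
  using Sym_Sym[of m n] by (simp add: Obj_PROP TObj_PROP)

lemma Sym_add_right:
  "Sym T x (y + z) = (Ident T y \<star> Sym T x z) \<cdot> (Sym T x y \<star> Ident T z)"
  using hexagon[of x y z] by (simp add: Obj_PROP TObj_PROP Assoc_strict add_ac)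

text \<open>Only one hexagon is assumed. The other one follows because the right hand side is a left
  inverse of \<open>Sym T z (x + y)\<close>, which \<open>Sym_add_right\<close> factors, and
  \<open>Sym T (x + y) z\<close> is the inverse of that arrow.\<close>

lemma Sym_add_left:
  "Sym T (x + y) z = (Sym T x z \<star> Ident T y) \<cdot> (Ident T x \<star> Sym T y z)"
proof -
  have 1: "Sym T (x + y) z \<cdot> Sym T z (x + y) = Ident T (z + x + y)"
    by (simp add: add_ac)
  have "((Sym T x z \<star> Ident T y) \<cdot> (Ident T x \<star> Sym T y z)) \<cdot> Sym T z (x + y)
      = (Sym T x z \<star> Ident T y) \<cdot> ((Ident T x \<star> Sym T y z) \<cdot> (Ident T x \<star> Sym T z y)) \<cdot> (Sym T z x \<star> Ident T y)"
    by (simp add: Sym_add_right cmp_assoc add_ac)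
  also have "\<dots> = Ident T (z + x + y)"
    by (simp add: ten_cmp add_ac)
  finally have 2: "((Sym T x z \<star> Ident T y) \<cdot> (Ident T x \<star> Sym T y z)) \<cdot> Sym T z (x + y) = Ident T (z + x + y)" .
  let ?r = "(Sym T x z \<star> Ident T y) \<cdot> (Ident T x \<star> Sym T y z)"
  have "?r = ?r \<cdot> (Sym T z (x + y) \<cdot> Sym T (x + y) z)"
    by (simp add: add_ac)
  also have "\<dots> = (?r \<cdot> Sym T z (x + y)) \<cdot> Sym T (x + y) z"
    by (subst cmp_assoc) (auto simp: add_ac)
  also have "\<dots> = Sym T (x + y) z"
    by (subst 2) (simp add: add_ac)
  finally show ?thesis ..
qed

text \<open>The hexagon with two zero arguments makes \<open>Sym T n 0\<close> idempotent, and an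
  invertible idempotent is an identity.\<close>

lemma Sym_0 [simp]: "Sym T n 0 = Ident T n" "Sym T 0 n = Ident T n"
proof -
  have "Sym T n (0 + 0) = Sym T n 0 \<cdot> Sym T n 0"
    by (subst Sym_add_right) simp
  then have *: "Sym T n 0 \<cdot> Sym T n 0 = Sym T n 0" by simp
  have "Sym T n 0 = (Sym T 0 n \<cdot> Sym T n 0) \<cdot> Sym T n 0"
    by simp
  also have "\<dots> = Sym T 0 n \<cdot> (Sym T n 0 \<cdot> Sym T n 0)"
    by (subst cmp_assoc) auto
  also have "\<dots> = Ident T n"
    unfolding * by simp
  finally show "Sym T n 0 = Ident T n" .
  then show "Sym T 0 n = Ident T n" using Sym_inv[of 0 n] by simp
qed

subsection \<open>Tensor products of lists\<close>

primrec tens :: "'a list \<Rightarrow> 'a" where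
  "tens [] = Ident T 0"
| "tens (u # us) = u \<star> tens us"

lemma tens_arr [simp]:
  assumes "set us \<subseteq> Arr T"
  shows "tens us \<in> Arr T" "Dom T (tens us) = sum_list (map (Dom T) us)"
    "Cod T (tens us) = sum_list (map (Cod T) us)"
  using assms by (induction us) auto

lemma tens_append:
  "\<lbrakk>set us \<subseteq> Arr T; set vs \<subseteq> Arr T\<rbrakk> \<Longrightarrow> tens (us @ vs) = tens us \<star> tens vs"
  by (induction us) (auto simp: ten_assoc)

lemma tens_concat:
  "(\<And>us. us \<in> set uss \<Longrightarrow> set us \<subseteq> Arr T) \<Longrightarrow> tens (concat uss) = tens (map tens uss)"
  by (induction uss) (auto simp: tens_append UN_least)

lemma tens_cmp:
  assumes "\<And>x. x \<in> set xs \<Longrightarrow> f x \<in> Arr T" "\<And>x. x \<in> set xs \<Longrightarrow> g x \<in> Arr T"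
    "\<And>x. x \<in> set xs \<Longrightarrow> Cod T (f x) = Dom T (g x)"
  shows "tens (map g xs) \<cdot> tens (map f xs) = tens (map (\<lambda>x. g x \<cdot> f x) xs)"
  using assms
proof (induction xs)
  case (Cons x xs)
  then have "sum_list (map (Cod T \<circ> f) xs) = sum_list (map (Dom T \<circ> g) xs)"
    by (intro arg_cong[of _ _ sum_list]) simp
  then show ?case using Cons by (simp add: ten_cmp image_subset_iff)
qed simp

lemma tens_Ident [simp]: "tens (map (\<lambda>x. Ident T (k x)) xs) = Ident T (sum_list (map k xs))"
  by (induction xs) simp_all

subsection \<open>Permutations of lists of distinct elements\<close>

definition bring :: "'s \<Rightarrow> 's list \<Rightarrow> 'a" where
  "bring y xs = Sym T (length (takeWhile (\<lambda>x. x \<noteq> y) xs)) 1 \<star>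
     Ident T (length (tl (dropWhile (\<lambda>x. x \<noteq> y) xs)))"

text \<open>The target list drives the recursion, as in selection sort: its head is fetched to the
  front of the source by one symmetry. Functoriality is \<open>perm_cmp\<close>, and independence of
  the names is \<open>perm_map\<close>.\<close>

primrec perm :: "'s list \<Rightarrow> 's list \<Rightarrow> 'a" where
  "perm xs [] = Ident T 0"
| "perm xs (y # ys) = (Ident T 1 \<star> perm (remove1 y xs) ys) \<cdot> bring y xs"

lemma bring_append:
  assumes "y \<notin> set as"
  shows "bring y (as @ y # bs) = Sym T (length as) 1 \<star> Ident T (length bs)"
proof -
  have "takeWhile (\<lambda>x. x \<noteq> y) (as @ y # bs) = as" "dropWhile (\<lambda>x. x \<noteq> y) (as @ y # bs) = y # bs"
    using assms by (auto simp: takeWhile_append takeWhile_eq_all_conv dropWhile_append)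
  then show ?thesis by (simp add: bring_def)
qed

lemma bring_first [simp]: "bring y (y # ys) = Ident T (Suc (length ys))"
  by (simp add: bring_def)

lemma bring_arr [simp]:
  assumes "y \<in> set xs"
  shows "bring y xs \<in> Arr T" "Dom T (bring y xs) = length xs" "Cod T (bring y xs) = length xs"
proof -
  obtain as bs where "xs = as @ y # bs" "y \<notin> set as" using assms by (meson split_list_first)
  then show "bring y xs \<in> Arr T" "Dom T (bring y xs) = length xs" "Cod T (bring y xs) = length xs"
    by (simp_all add: bring_append)
qed

lemma perm_arr [simp]:
  assumes "rearr xs ys"
  shows "perm xs ys \<in> Arr T" "Dom T (perm xs ys) = length xs" "Cod T (perm xs ys) = length ys"
proof -
  have "perm xs ys \<in> Arr T \<and> Dom T (perm xs ys) = length ys \<and> Cod T (perm xs ys) = length ys"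
    using assms
  proof (induction ys arbitrary: xs)
    case (Cons y ys)
    have "y \<in> set xs" using Cons.prems by (auto simp: rearr_def)
    with Cons.IH[OF rearr_Cons[OF Cons.prems]] rearr_length[OF Cons.prems] show ?case
      by simp
  qed (auto simp: rearr_def)
  then show "perm xs ys \<in> Arr T" "Dom T (perm xs ys) = length xs" "Cod T (perm xs ys) = length ys"
    using rearr_length[OF assms] by auto
qed

lemma perm_refl [simp]: "distinct xs \<Longrightarrow> perm xs xs = Ident T (length xs)"
  by (induction xs) simp_all

text \<open>A crossing with a longer block splits by \<open>Sym_add_left\<close> into the crossing
  with its tail and one transposition.\<close>

lemma bring_Cons:
  assumes "x \<noteq> y" "y \<in> set xs"
  shows "bring y (x # xs) = (Sym T 1 1 \<star> Ident T (length xs - 1)) \<cdot> (Ident T 1 \<star> bring y xs)"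
proof -
  obtain as bs where *: "xs = as @ y # bs" "y \<notin> set as" using assms by (meson split_list_first)
  let ?a = "length as" and ?b = "length bs"
  have "Sym T (Suc ?a) 1 = (Sym T 1 1 \<star> Ident T ?a) \<cdot> (Ident T 1 \<star> Sym T ?a 1)"
    using Sym_add_left[of 1 ?a 1] by simp
  then have "bring y (x # xs) =
      ((Sym T 1 1 \<star> Ident T ?a) \<cdot> (Ident T 1 \<star> Sym T ?a 1)) \<star> (Ident T ?b \<cdot> Ident T ?b)"
    using bring_append[of y "x # as" bs] * assms by simp
  also have "\<dots> = ((Sym T 1 1 \<star> Ident T ?a) \<star> Ident T ?b) \<cdot> ((Ident T 1 \<star> Sym T ?a 1) \<star> Ident T ?b)"
    by (subst ten_cmp) auto
  finally show ?thesis using * by (simp add: ten_assoc bring_append)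
qed

text \<open>Both sides move \<open>z\<close> and \<open>y\<close> to the front.\<close>

lemma bring_bring_append:
  assumes "distinct (as @ y # bs @ z # cs)"
  shows "(Sym T 1 1 \<star> Ident T (length (as @ bs @ cs))) \<cdot> (Ident T 1 \<star> bring z (as @ bs @ z # cs))
      \<cdot> bring y (as @ y # bs @ z # cs)
    = (Ident T 1 \<star> bring y (as @ y # bs @ cs)) \<cdot> bring z (as @ y # bs @ z # cs)"
proof -
  let ?a = "length as" and ?b = "length bs" and ?c = "length cs"
  let ?s = "Sym T ?a 1 \<star> Ident T ?b"
  have z: "bring z (as @ bs @ z # cs) = Sym T (?a + ?b) 1 \<star> Ident T ?c"
      "bring z (as @ y # bs @ z # cs) = Sym T (Suc (?a + ?b)) 1 \<star> Ident T ?c"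
    using bring_append[of z "as @ bs" cs] bring_append[of z "as @ y # bs" cs] assms by auto
  have y: "bring y (as @ y # bs @ z # cs) = Sym T ?a 1 \<star> Ident T (Suc (?b + ?c))"
      "bring y (as @ y # bs @ cs) = Sym T ?a 1 \<star> Ident T (?b + ?c)"
    using bring_append[of y as] assms by auto
  \<comment> \<open>Naturality of the symmetry carries \<open>?s\<close>, which moves
    \<open>y\<close> to the front, past the wire of \<open>z\<close>.\<close>
  have S: "Sym T (Suc (?a + ?b)) 1 \<cdot> (?s \<star> Ident T 1) = (Ident T 1 \<star> ?s) \<cdot> Sym T (Suc (?a + ?b)) 1"
    using Sym_nat[of ?s "Ident T 1"] by simp
  have "bring z (y # as @ bs @ z # cs) =
      (Sym T 1 1 \<star> Ident T (length (as @ bs @ cs))) \<cdot> (Ident T 1 \<star> bring z (as @ bs @ z # cs))"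
    using bring_Cons[of y z "as @ bs @ z # cs"] assms by auto
  moreover have "bring z (y # as @ bs @ z # cs) = bring z (as @ y # bs @ z # cs)"
    unfolding z using bring_append[of z "y # as @ bs" cs] assms by auto
  ultimately have "bring z (as @ y # bs @ z # cs) =
      (Sym T 1 1 \<star> Ident T (length (as @ bs @ cs))) \<cdot> (Ident T 1 \<star> bring z (as @ bs @ z # cs))"
    by simp
  then have "(Sym T 1 1 \<star> Ident T (length (as @ bs @ cs))) \<cdot> (Ident T 1 \<star> bring z (as @ bs @ z # cs))
      \<cdot> bring y (as @ y # bs @ z # cs)
    = bring z (as @ y # bs @ z # cs) \<cdot> bring y (as @ y # bs @ z # cs)"
    by (simp add: cmp_assoc)
  also have "\<dots> = (Sym T (Suc (?a + ?b)) 1 \<star> Ident T ?c) \<cdot> ((?s \<star> Ident T 1) \<star> Ident T ?c)"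
    unfolding y z by (simp add: ten_assoc)
  also have "\<dots> = (Sym T (Suc (?a + ?b)) 1 \<cdot> (?s \<star> Ident T 1)) \<star> (Ident T ?c \<cdot> Ident T ?c)"
    by (subst ten_cmp) auto
  also have "\<dots> = ((Ident T 1 \<star> ?s) \<star> Ident T ?c) \<cdot> (Sym T (Suc (?a + ?b)) 1 \<star> Ident T ?c)"
    unfolding S by (subst ten_cmp) auto
  also have "\<dots> = (Ident T 1 \<star> bring y (as @ y # bs @ cs)) \<cdot> bring z (as @ y # bs @ z # cs)"
    unfolding y z by (simp add: ten_assoc)
  finally show ?thesis .
qed

lemma bring_bring:
  assumes "distinct xs" "y \<in> set xs" "z \<in> set xs" "y \<noteq> z"
  shows "(Sym T 1 1 \<star> Ident T (length xs - 2)) \<cdot> (Ident T 1 \<star> bring z (remove1 y xs)) \<cdot> bring y xs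
    = (Ident T 1 \<star> bring y (remove1 z xs)) \<cdot> bring z xs"
proof -
  obtain us vs where x: "xs = us @ y # vs" "y \<notin> set us"
    using assms by (meson split_list_first)
  show ?thesis
  proof (cases "z \<in> set us")
    case False
    then obtain bs cs where "vs = bs @ z # cs" "z \<notin> set bs"
      using x assms by (metis Un_iff set_ConsD set_append split_list_first)
    then show ?thesis using bring_bring_append[of us y bs z cs] x assms False
      by (auto simp: remove1_append)
  next
    \<comment> \<open>Here \<open>z\<close> comes before \<open>y\<close>. The equation with
      \<open>y\<close> and \<open>z\<close> exchanged is known already, and composing it with the
      transposition, an involution, gives the claim.\<close>
    case True
    then obtain as bs where "us = as @ z # bs" "z \<notin> set as"
      by (meson split_list_first)
    then have e: "xs = as @ z # bs @ y # vs" "remove1 z xs = as @ bs @ y # vs" "remove1 y xs = as @ z # bs @ vs"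
        "distinct (as @ z # bs @ y # vs)"
      using x assms by (auto simp: remove1_append)
    let ?S = "Sym T 1 1 \<star> Ident T (length (as @ bs @ vs))"
    let ?B = "(Ident T 1 \<star> bring y (remove1 z xs)) \<cdot> bring z xs"
    have B: "?B \<in> Arr T" "Cod T ?B = Suc (Suc (length (as @ bs @ vs)))"
      using e(2) by (simp_all add: e(1))
    have 1: "(Ident T 1 \<star> bring z (remove1 y xs)) \<cdot> bring y xs = ?S \<cdot> ?B"
      using bring_bring_append[OF e(4)] e by simp
    have 2: "Sym T 1 1 \<star> Ident T (length xs - 2) = ?S"
      by (simp add: e)
    have "?S \<cdot> ?S \<cdot> ?B = (?S \<cdot> ?S) \<cdot> ?B"
      using B by (subst cmp_assoc) auto
    also have "?S \<cdot> ?S = Ident T (Suc (Suc (length (as @ bs @ vs))))"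
      by (simp add: ten_cmp)
    finally show ?thesis unfolding 1 2 using B by simp
  qed
qed

text \<open>The inductive heart of \<open>perm_cmp\<close>: \<open>z\<close> may be fetched before
  or after the rearrangement. If the head of \<open>ys\<close> is some \<open>y\<close> other than
  \<open>z\<close>, then \<open>bring_bring\<close> exchanges the two fetches.\<close>

lemma bring_perm:
  assumes "rearr xs ys" "z \<in> set ys"
  shows "bring z ys \<cdot> perm xs ys = (Ident T 1 \<star> perm (remove1 z xs) (remove1 z ys)) \<cdot> bring z xs"
  using assms
proof (induction ys arbitrary: xs)
  case (Cons y ys)
  note r = Cons.prems(1)
  have yx: "y \<in> set xs" "z \<in> set xs" "distinct xs" "y \<notin> set ys" using Cons.prems by (auto simp: rearr_def)
  note l = rearr_length[OF r] and r' = rearr_Cons[OF r]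
  show ?case
  proof (cases "y = z")
    case True
    then show ?thesis using r r' l yx by (simp add: length_remove1)
  next
    case False
    define n where "n = length ys - 1"
    have z: "z \<in> set ys" "z \<in> set (remove1 y xs)" "y \<in> set (remove1 z xs)" using Cons.prems False yx by auto
    have n: "length ys = Suc n" "length xs = Suc (Suc n)"
      using z l length_pos_if_in_set[of z ys] by (auto simp: n_def)
    have rz: "rearr (remove1 z (remove1 y xs)) (remove1 z ys)"
      by (rule rearr_remove1[OF r'])
    let ?p = "perm (remove1 z (remove1 y xs)) (remove1 z ys)"
    have p: "?p \<in> Arr T" "Dom T ?p = n" "Cod T ?p = n"
      using rz z rearr_length[OF rz] n by (simp_all add: length_remove1)
    have le: "length (remove1 y xs) = Suc n" "length (remove1 z xs) = Suc n"
      using n yx by (simp_all add: length_remove1)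
    have "bring z (y # ys) \<cdot> perm xs (y # ys) =
        ((Sym T 1 1 \<star> Ident T n) \<cdot> (Ident T 1 \<star> bring z ys)) \<cdot> ((Ident T 1 \<star> perm (remove1 y xs) ys) \<cdot> bring y xs)"
      using bring_Cons[of y z ys] False z n by simp
    also have "\<dots> = (Sym T 1 1 \<star> Ident T n) \<cdot> ((Ident T 1 \<star> bring z ys) \<cdot> (Ident T 1 \<star> perm (remove1 y xs) ys)) \<cdot> bring y xs"
      using z r' n yx le by (simp add: cmp_assoc)
    also have "(Ident T 1 \<star> bring z ys) \<cdot> (Ident T 1 \<star> perm (remove1 y xs) ys)
        = Ident T 1 \<star> ((Ident T 1 \<star> ?p) \<cdot> bring z (remove1 y xs))"
      using z r' n le Cons.IH[OF r' z(1)] by (simp add: ten_cmp)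
    also have "\<dots> = (Ident T 1 \<star> (Ident T 1 \<star> ?p)) \<cdot> (Ident T 1 \<star> bring z (remove1 y xs))"
      using z p le by (subst ten_cmp) auto
    also have "Ident T 1 \<star> (Ident T 1 \<star> ?p) = Ident T 2 \<star> ?p"
      using p by (simp add: ten_assoc[symmetric] numeral_2_eq_2)
    also have "(Sym T 1 1 \<star> Ident T n) \<cdot> ((Ident T 2 \<star> ?p) \<cdot> (Ident T 1 \<star> bring z (remove1 y xs))) \<cdot> bring y xs
       = ((Sym T 1 1 \<star> Ident T n) \<cdot> (Ident T 2 \<star> ?p)) \<cdot> (Ident T 1 \<star> bring z (remove1 y xs)) \<cdot> bring y xs"
      using z p le n yx by (simp add: cmp_assoc)
    also have "(Sym T 1 1 \<star> Ident T n) \<cdot> (Ident T 2 \<star> ?p) = (Ident T 2 \<star> ?p) \<cdot> (Sym T 1 1 \<star> Ident T n)"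
      using p by (simp add: ten_cmp numeral_2_eq_2)
    also have "((Ident T 2 \<star> ?p) \<cdot> (Sym T 1 1 \<star> Ident T n)) \<cdot> (Ident T 1 \<star> bring z (remove1 y xs)) \<cdot> bring y xs
       = (Ident T 2 \<star> ?p) \<cdot> ((Sym T 1 1 \<star> Ident T n) \<cdot> (Ident T 1 \<star> bring z (remove1 y xs)) \<cdot> bring y xs)"
      using z p le n yx by (simp add: cmp_assoc)
    also have "(Sym T 1 1 \<star> Ident T n) \<cdot> (Ident T 1 \<star> bring z (remove1 y xs)) \<cdot> bring y xs
       = (Ident T 1 \<star> bring y (remove1 z xs)) \<cdot> bring z xs"
      using bring_bring[of xs y z] yx False n by simp
    also have "(Ident T 2 \<star> ?p) \<cdot> ((Ident T 1 \<star> bring y (remove1 z xs)) \<cdot> bring z xs)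
        = ((Ident T 1 \<star> (Ident T 1 \<star> ?p)) \<cdot> (Ident T 1 \<star> bring y (remove1 z xs))) \<cdot> bring z xs"
      using z p le n yx by (simp add: cmp_assoc ten_assoc[symmetric] numeral_2_eq_2)
    also have "(Ident T 1 \<star> (Ident T 1 \<star> ?p)) \<cdot> (Ident T 1 \<star> bring y (remove1 z xs))
        = Ident T 1 \<star> ((Ident T 1 \<star> ?p) \<cdot> bring y (remove1 z xs))"
      using z p le by (subst ten_cmp) auto
    also have "(Ident T 1 \<star> ?p) \<cdot> bring y (remove1 z xs) = perm (remove1 z xs) (remove1 z (y # ys))"
      using False by (simp add: remove1_commute)
    finally show ?thesis .
  qed
qed simp

text \<open>By \<open>bring_perm\<close> the fetch of the head \<open>z\<close> commutes past the
  first rearrangement; what remains are rearrangements of the lists without \<open>z\<close>, to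
  which the induction applies.\<close>

lemma perm_cmp:
  assumes "rearr xs ys" "rearr ys zs"
  shows "perm ys zs \<cdot> perm xs ys = perm xs zs"
  using assms
proof (induction zs arbitrary: xs ys)
  case Nil
  then show ?case by (simp add: rearr_def)
next
  case (Cons z zs)
  have z: "z \<in> set ys" "z \<in> set xs" using Cons.prems by (auto simp: rearr_def)
  note r = rearr_Cons[OF Cons.prems(2)] rearr_remove1[OF Cons.prems(1), of z]
  note l = rearr_length[OF r(1)] rearr_length[OF r(2)] rearr_length[OF Cons.prems(1)] rearr_length[OF Cons.prems(2)]
  have "perm ys (z # zs) \<cdot> perm xs ys = (Ident T 1 \<star> perm (remove1 z ys) zs) \<cdot> (bring z ys \<cdot> perm xs ys)"
    using r z Cons.prems l by (simp add: cmp_assoc)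
  also have "\<dots> = ((Ident T 1 \<star> perm (remove1 z ys) zs) \<cdot> (Ident T 1 \<star> perm (remove1 z xs) (remove1 z ys))) \<cdot> bring z xs"
    using r z l Cons.prems by (simp add: bring_perm cmp_assoc)
  also have "\<dots> = (Ident T 1 \<star> perm (remove1 z xs) zs) \<cdot> bring z xs"
    using r l by (simp add: ten_cmp Cons.IH[OF r(2,1)])
  finally show ?case by simp
qed

lemma bring_append_left:
  assumes "z \<in> set xs"
  shows "bring z (xs @ ys) = bring z xs \<star> Ident T (length ys)"
proof -
  obtain as bs where "xs = as @ z # bs" "z \<notin> set as" using assms by (meson split_list_first)
  then show ?thesis using bring_append[of z as "bs @ ys"] by (simp add: bring_append ten_assoc)
qed

lemma perm_append:
  assumes "rearr xs ys" "rearr xs' ys'" "set xs \<inter> set xs' = {}"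
  shows "perm (xs @ xs') (ys @ ys') = perm xs ys \<star> perm xs' ys'"
  using assms
proof (induction ys arbitrary: xs)
  case Nil
  then show ?case by (simp add: rearr_def)
next
  case (Cons y ys)
  note r = rearr_Cons[OF Cons.prems(1)]
  have y: "y \<in> set xs" using Cons.prems by (auto simp: rearr_def)
  note l = rearr_length[OF r(1)] rearr_length[OF Cons.prems(1)] rearr_length[OF Cons.prems(2)]
  have "set (remove1 y xs) \<inter> set xs' = {}"
    using Cons.prems(3) set_remove1_subset[of y xs] by blast
  then have "perm (xs @ xs') ((y # ys) @ ys') =
      ((Ident T 1 \<star> perm (remove1 y xs) ys) \<star> perm xs' ys') \<cdot> (bring y xs \<star> Ident T (length xs'))"
    using y r Cons.prems(2) by (simp add: remove1_append Cons.IH[OF r] bring_append_left ten_assoc)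
  also have "\<dots> = perm xs (y # ys) \<star> perm xs' ys'"
    using y r Cons.prems l by (subst ten_cmp) auto
  finally show ?case .
qed

lemma perm_Sym:
  assumes "distinct (xs @ ys)"
  shows "perm (xs @ ys) (ys @ xs) = Sym T (length xs) (length ys)"
  using assms
proof (induction ys)
  case (Cons y ys)
  have "perm (xs @ y # ys) (y # ys @ xs) =
      (Ident T 1 \<star> Sym T (length xs) (length ys)) \<cdot> (Sym T (length xs) 1 \<star> Ident T (length ys))"
    using Cons by (simp add: remove1_append bring_append)
  also have "\<dots> = Sym T (length xs) (1 + length ys)"
    by (rule Sym_add_right[symmetric])
  finally show ?case by simp
qed simp

lemma perm_map:
  assumes "inj_on \<rho> (set xs)" "rearr xs ys"
  shows "perm (map \<rho> xs) (map \<rho> ys) = perm xs ys"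
  using assms
proof (induction ys arbitrary: xs)
  case (Cons y ys)
  obtain as bs where x: "xs = as @ y # bs" "y \<notin> set as"
    using Cons.prems split_list_first[of y xs] by (auto simp: rearr_def)
  have n: "\<rho> y \<notin> set (map \<rho> as)" using Cons.prems(1) x by (auto simp: inj_on_def)
  have i: "inj_on \<rho> (set (as @ bs))" using Cons.prems(1) x by (auto simp: inj_on_def)
  have r: "rearr (as @ bs) ys" using rearr_Cons[OF Cons.prems(2)] x by (simp add: remove1_append)
  show ?case using x n Cons.IH[OF i r] bring_append[OF n] 
    by (simp add: remove1_append bring_append image_iff)
qed simp

text \<open>Every element \<open>x\<close> is replaced by a block, \<open>d x\<close> at the source
  and \<open>e x\<close> at the target, joined by an arrow \<open>u x\<close>. All later exchanges
  of operations with permutations are instances: single elements at the target for multiplications,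
  at the source for comultiplications, and on both sides for labels.\<close>

lemma perm_natural:
  assumes "rearr xs ys" "distinct (concat (map d xs))" "distinct (concat (map e xs))"
    and u: "\<And>x. x \<in> set xs \<Longrightarrow> u x \<in> Arr T \<and> Dom T (u x) = length (d x) \<and> Cod T (u x) = length (e x)"
  shows "tens (map u ys) \<cdot> perm (concat (map d xs)) (concat (map d ys))
    = perm (concat (map e xs)) (concat (map e ys)) \<cdot> tens (map u xs)"
  using assms
proof (induction ys arbitrary: xs)
  case Nil
  then show ?case by (simp add: rearr_def)
next
  case (Cons y ys)
  obtain as bs where x: "xs = as @ y # bs" "y \<notin> set as"
    using Cons.prems split_list_first[of y xs] by (auto simp: rearr_def)
  have r: "rearr (as @ bs) ys" using rearr_Cons[OF Cons.prems(1)] x by (simp add: remove1_append)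
  \<comment> \<open>The block of \<open>y\<close> is moved to the front by one symmetry and the
    other blocks are rearranged afterwards; this is the recursion of \<open>perm\<close> with blocks
    in place of elements.\<close>
  have split: "perm (concat (map f xs)) (concat (map f (y # ys))) =
      (Ident T (length (f y)) \<star> perm (concat (map f (as @ bs))) (concat (map f ys))) \<cdot>
      (Sym T (length (concat (map f as))) (length (f y)) \<star> Ident T (length (concat (map f bs))))"
    if "distinct (concat (map f xs))" for f :: "_ \<Rightarrow> 'x list"
  proof -
    let ?A = "concat (map f as)" and ?B = "concat (map f bs)" and ?R = "concat (map f ys)"
    have d: "distinct (?A @ f y @ ?B)" using that x by simp
    have R: "rearr (?A @ ?B) ?R" using rearr_concat[OF r, of f] d by auto
    have "set ?R = set (?A @ ?B)" using R unfolding rearr_def by simp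
    then have yR: "set (f y) \<inter> set ?R = {}" using d by auto
    have "distinct ?R" using R by (simp only: rearr_def)
    with yR \<open>set ?R = set (?A @ ?B)\<close>
    have r1: "rearr (?A @ f y @ ?B) (f y @ ?A @ ?B)" "rearr (f y @ ?A @ ?B) (f y @ ?R)"
      "rearr (f y) (f y)" "rearr ?B ?B" "rearr (?A @ f y) (f y @ ?A)"
      using d unfolding rearr_def by (simp_all only: distinct_append set_append) auto
    have "perm (?A @ f y @ ?B) (f y @ ?R) = perm (f y @ ?A @ ?B) (f y @ ?R) \<cdot> perm (?A @ f y @ ?B) (f y @ ?A @ ?B)"
      using perm_cmp[OF r1(1,2)] by simp
    also have "perm (f y @ ?A @ ?B) (f y @ ?R) = Ident T (length (f y)) \<star> perm (?A @ ?B) ?R"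
      using d R r1 by (subst perm_append) auto
    also have "perm (?A @ f y @ ?B) (f y @ ?A @ ?B) = Sym T (length ?A) (length (f y)) \<star> Ident T (length ?B)"
    proof -
      have "set (?A @ f y) \<inter> set ?B = {}" "distinct (?A @ f y)" using d by auto
      then show ?thesis using d perm_append[OF r1(5,4)] perm_Sym[of ?A "f y"] by simp
    qed
    finally show ?thesis by (simp add: x)
  qed
  have d: "distinct (concat (map d (as @ bs)))" "distinct (concat (map e (as @ bs)))"
    using Cons.prems(2,3) unfolding x by auto
  have U: "u y \<in> Arr T" "Dom T (u y) = length (d y)" "Cod T (u y) = length (e y)"
    using Cons.prems(4)[of y] x by auto
  have ua: "set (map u as) \<subseteq> Arr T" "set (map u bs) \<subseteq> Arr T" "set (map u ys) \<subseteq> Arr T"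
    using Cons.prems(4) Cons.prems(1) x by (auto simp: rearr_def)
  have len: "sum_list (map (Dom T) (map u zs)) = length (concat (map d zs))"
      "sum_list (map (Cod T) (map u zs)) = length (concat (map e zs))" if "set zs \<subseteq> set xs" for zs
    using that Cons.prems(4) by (induction zs) auto
  have sub: "set as \<subseteq> set xs" "set bs \<subseteq> set xs" "set ys \<subseteq> set xs"
    using x Cons.prems(1) by (auto simp: rearr_def)
  let ?ua = "tens (map u as)" and ?ub = "tens (map u bs)" and ?uy = "tens (map u ys)"
  have T: "?ua \<in> Arr T" "Dom T ?ua = length (concat (map d as))" "Cod T ?ua = length (concat (map e as))"
     "?ub \<in> Arr T" "Dom T ?ub = length (concat (map d bs))" "Cod T ?ub = length (concat (map e bs))"
     "?uy \<in> Arr T" "Dom T ?uy = length (concat (map d ys))" "Cod T ?uy = length (concat (map e ys))"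
    using ua sub by (auto simp del: map_map simp: len)
  let ?pd = "perm (concat (map d (as @ bs))) (concat (map d ys))"
  let ?pe = "perm (concat (map e (as @ bs))) (concat (map e ys))"
  have R: "rearr (concat (map d (as @ bs))) (concat (map d ys))" "rearr (concat (map e (as @ bs))) (concat (map e ys))"
    using rearr_concat[OF r] d by auto
  have P: "?pd \<in> Arr T" "Dom T ?pd = length (concat (map d as)) + length (concat (map d bs))" "Cod T ?pd = length (concat (map d ys))"
     "?pe \<in> Arr T" "Dom T ?pe = length (concat (map e as)) + length (concat (map e bs))" "Cod T ?pe = length (concat (map e ys))"
    using perm_arr[OF R(1)] perm_arr[OF R(2)] by simp_all
  have "tens (map u (y # ys)) \<cdot> perm (concat (map d xs)) (concat (map d (y # ys)))
    = ((u y \<star> ?uy) \<cdot> (Ident T (length (d y)) \<star> ?pd)) \<cdot>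
      (Sym T (length (concat (map d as))) (length (d y)) \<star> Ident T (length (concat (map d bs))))"
    unfolding split[OF Cons.prems(2)] using T P U by (subst cmp_assoc) auto
  also have "(u y \<star> ?uy) \<cdot> (Ident T (length (d y)) \<star> ?pd) = u y \<star> (?uy \<cdot> ?pd)"
    using T P U by (simp add: ten_cmp)
  also have "?uy \<cdot> ?pd = ?pe \<cdot> tens (map u (as @ bs))"
    by (rule Cons.IH[OF r d]) (use Cons.prems(4) x in auto)
  also have "tens (map u (as @ bs)) = ?ua \<star> ?ub"
    using ua by (simp add: tens_append)
  also have "u y \<star> (?pe \<cdot> (?ua \<star> ?ub)) = (Ident T (length (e y)) \<star> ?pe) \<cdot> ((u y \<star> ?ua) \<star> ?ub)"
    using T P U by (simp add: ten_cmp ten_assoc)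
  also have "((Ident T (length (e y)) \<star> ?pe) \<cdot> ((u y \<star> ?ua) \<star> ?ub)) \<cdot>
      (Sym T (length (concat (map d as))) (length (d y)) \<star> Ident T (length (concat (map d bs))))
    = (Ident T (length (e y)) \<star> ?pe) \<cdot> (((u y \<star> ?ua) \<cdot> Sym T (length (concat (map d as))) (length (d y))) \<star> ?ub)"
    using T P U by (simp add: cmp_assoc ten_cmp)
  also have "(u y \<star> ?ua) \<cdot> Sym T (length (concat (map d as))) (length (d y)) =
     Sym T (length (concat (map e as))) (length (e y)) \<cdot> (?ua \<star> u y)"
    using Sym_nat[of ?ua "u y"] T U by simp
  also have "(Sym T (length (concat (map e as))) (length (e y)) \<cdot> (?ua \<star> u y)) \<star> ?ub
    = (Sym T (length (concat (map e as))) (length (e y)) \<star> Ident T (length (concat (map e bs)))) \<cdot> ((?ua \<star> u y) \<star> ?ub)"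
    using T U by (simp add: ten_cmp)
  also have "(?ua \<star> u y) \<star> ?ub = tens (map u xs)"
    using ua U T unfolding x by (simp add: tens_append ten_assoc)
  also have "(Ident T (length (e y)) \<star> ?pe) \<cdot> (Sym T (length (concat (map e as))) (length (e y)) \<star> Ident T (length (concat (map e bs)))) \<cdot> tens (map u xs)
    = perm (concat (map e xs)) (concat (map e (y # ys))) \<cdot> tens (map u xs)"
    unfolding split[OF Cons.prems(3)] using T U P ua unfolding x
    by (subst cmp_assoc) (auto simp: tens_append)
  finally show ?case .
qed

end

section \<open>Spans with arbitrary strands\<close>

text \<open>If \<open>xss\<close> lists the fibres of a map, then this is the map: it sends an
  element to the index of the fibre that contains it. It takes over the part of \<open>lmap\<close>
  for strands of any type.\<close>

definition occ :: "'s list list \<Rightarrow> 's \<Rightarrow> nat" where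
  "occ xss x = length (takeWhile (\<lambda>xs. x \<notin> set xs) xss)"

lemma occ_eq:
  assumes "distinct (concat xss)" "j < length xss" "x \<in> set (xss ! j)"
  shows "occ xss x = j"
  using assms
proof (induction xss arbitrary: j)
  case (Cons xs xss)
  show ?case
  proof (cases j)
    case 0
    then show ?thesis using Cons.prems by (simp add: occ_def)
  next
    case (Suc k)
    then have "x \<in> set (concat xss)" "occ xss x = k" using Cons by auto
    then show ?thesis using Cons.prems Suc by (auto simp: occ_def)
  qed
qed simp

lemma occ_less:
  assumes "x \<in> set (concat xss)"
  shows "occ xss x < length xss" "x \<in> set (xss ! occ xss x)"
proof -
  have "\<exists>xs \<in> set xss. \<not> x \<notin> set xs" using assms by auto
  then show l: "occ xss x < length xss"
    unfolding occ_def by (induction xss) auto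
  show "x \<in> set (xss ! occ xss x)"
    using nth_length_takeWhile[of "\<lambda>xs. x \<notin> set xs" xss] l unfolding occ_def by simp
qed

text \<open>Passes from families indexed by the points of the base to families indexed by strands,
  where a strand finds its base point through \<open>occ\<close>.\<close>

lemma map_concat_occ:
  assumes "distinct (concat xss)" "n = length xss"
  shows "concat (map (\<lambda>j. map (f j) (xss ! j)) [0..<n]) = map (\<lambda>x. f (occ xss x) x) (concat xss)"
proof -
  have "map (\<lambda>j. map (f j) (xss ! j)) [0..<n] = map (\<lambda>j. map (\<lambda>x. f (occ xss x) x) (xss ! j)) [0..<n]"
    using assms by (intro map_cong refl) (auto simp: occ_eq)
  also have "\<dots> = map (map (\<lambda>x. f (occ xss x) x)) (map (nth xss) [0..<n])" by simp
  also have "map (nth xss) [0..<n] = xss" using assms map_nth by simp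
  finally show ?thesis by (simp add: map_concat)
qed

text \<open>A span of ordered labelled sets whose left leg is unlabelled, with strands (elements of the
  middle object) of any type: the list of the fibres of each leg.\<close>

type_synonym ('s, 'g) gspan = "'s list list \<times> ('s \<times> 'g) list list"

definition gvalid :: "('g, 'w) monoid_scheme \<Rightarrow> ('s, 'g) gspan \<Rightarrow> bool" where
  "gvalid G s \<longleftrightarrow> rearr (concat (fst s)) (map fst (concat (snd s))) \<and>
     snd ` set (concat (snd s)) \<subseteq> carrier G"

definition gact :: "('g, 'w) monoid_scheme \<Rightarrow> 'g \<Rightarrow> ('s \<times> 'g) list \<Rightarrow> ('s \<times> 'g) list" where
  "gact G g w = map (\<lambda>(x, a). (x, g \<otimes>\<^bsub>G\<^esub> a)) w"

text \<open>The pullback consists of pairs, so no numbering has to be chosen. As in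
  \<open>lcomp\<close>, a label \<open>b\<close> of the second right leg multiplies the labels
  \<open>a\<close> of the fibre that is substituted for its strand; the left legs carry no
  labels.\<close>

definition gcomp ::
  "('g, 'w) monoid_scheme \<Rightarrow> ('t, 'g) gspan \<Rightarrow> ('s, 'g) gspan \<Rightarrow> ('s \<times> 't, 'g) gspan" where
  "gcomp G t s =
     (map (\<lambda>xs. concat (map (\<lambda>x. map (Pair x) (fst t ! occ (map (map fst) (snd s)) x)) xs)) (fst s),
      map (\<lambda>v. concat (map (\<lambda>(y, b). map (\<lambda>(x, a). ((x, y), b \<otimes>\<^bsub>G\<^esub> a)) (snd s ! occ (fst t) y)) v))
        (snd t))"

definition labelled :: "('g, 'w) monoid_scheme \<Rightarrow> ('s \<times> 'g) list \<Rightarrow> bool" where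
  "labelled G w \<longleftrightarrow> snd ` set w \<subseteq> carrier G"

lemma labelled_simps [simp]:
  "labelled G []" "labelled G ((x, a) # w) \<longleftrightarrow> a \<in> carrier G \<and> labelled G w"
  "labelled G (v @ w) \<longleftrightarrow> labelled G v \<and> labelled G w"
  by (auto simp: labelled_def)

lemma labelledD: "labelled G w \<Longrightarrow> (x, a) \<in> set w \<Longrightarrow> a \<in> carrier G"
  by (force simp: labelled_def)

lemma labelled_gact: "group G \<Longrightarrow> g \<in> carrier G \<Longrightarrow> labelled G w \<Longrightarrow> labelled G (gact G g w)"
  by (induction w) (auto simp: gact_def intro: monoid.m_closed[OF group.is_monoid])

lemma labelled_concat: "labelled G (concat ws) \<longleftrightarrow> (\<forall>w \<in> set ws. labelled G w)"
  by (induction ws) auto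

lemma labelled_subst:
  assumes "group G" "labelled G v" "\<And>y b. (y, b) \<in> set v \<Longrightarrow> labelled G (s y)"
  shows "labelled G (concat (map (\<lambda>(y, b). gact G b (s y)) v))"
  using assms(2,3)
proof (induction v)
  case (Cons p v)
  obtain y b where p: "p = (y, b)" by fastforce
  have "labelled G (concat (map (\<lambda>(y, b). gact G b (s y)) v))"
    using Cons.prems p by (intro Cons.IH) auto
  moreover have "labelled G (gact G b (s y))"
    using Cons.prems p assms(1) by (intro labelled_gact) auto
  ultimately show ?case using p by simp
qed simp

text \<open>Over one point of the base the pullback is a grid, which one leg reads by rows and the
  other one by columns.\<close>

lemma rearr_grid:
  assumes "distinct xs" "distinct ys"
  shows "rearr (concat (map (\<lambda>x. map (Pair x) ys) xs)) (concat (map (\<lambda>y. map (\<lambda>x. (x, y)) xs) ys))"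
proof -
  have "distinct (concat (map (\<lambda>x. map (Pair x) ys) xs))"
    using assms by (induction xs) (auto simp: distinct_map inj_on_def)
  moreover have "distinct (concat (map (\<lambda>y. map (\<lambda>x. (x, y)) xs) ys))"
    using assms(2,1) by (induction ys) (auto simp: distinct_map inj_on_def)
  ultimately show ?thesis by (auto simp: rearr_def)
qed

section \<open>Evaluation in a PROP with a bimonoid\<close>

context prop_category
begin

lemma tens_map_arr [simp]:
  assumes "\<And>x. x \<in> set xs \<Longrightarrow> f x \<in> Arr T"
  shows "tens (map f xs) \<in> Arr T" "Dom T (tens (map f xs)) = (\<Sum>x\<leftarrow>xs. Dom T (f x))"
    "Cod T (tens (map f xs)) = (\<Sum>x\<leftarrow>xs. Cod T (f x))"
  using assms by (induction xs) auto

lemma tens_map_hom: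
  assumes "\<And>x. x \<in> set xs \<Longrightarrow> f x \<in> Arr T \<and> Dom T (f x) = d x \<and> Cod T (f x) = c x"
  shows "tens (map f xs) \<in> Arr T" "Dom T (tens (map f xs)) = sum_list (map d xs)"
    "Cod T (tens (map f xs)) = sum_list (map c xs)"
  using assms by (induction xs) auto

end

text \<open>A functor from \<open>G\<close> to bimonoids, with the generator of a PROP as underlying
  object: associators and unitors have disappeared, and the middle swap is one symmetry between two
  identities.\<close>

locale gbimonoid_in_prop = prop_category T for T :: "(nat, 'a, 'z) sym_mon_cat_scheme" (structure) +
  fixes G :: "('g, 'w) monoid_scheme" and \<mu> \<eta> \<Delta> \<epsilon> :: 'a and act :: "'g \<Rightarrow> 'a"
  assumes grp: "group G"
    and gen_in: "\<mu> \<in> Hom T (Suc (Suc 0)) (Suc 0)" "\<eta> \<in> Hom T 0 (Suc 0)"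
      "\<Delta> \<in> Hom T (Suc 0) (Suc (Suc 0))" "\<epsilon> \<in> Hom T (Suc 0) 0"
      "g \<in> carrier G \<Longrightarrow> act g \<in> Hom T (Suc 0) (Suc 0)"
    and mu_assoc: "\<mu> \<cdot> (\<mu> \<star> Ident T 1) = \<mu> \<cdot> (Ident T 1 \<star> \<mu>)"
    and mu_left: "\<mu> \<cdot> (\<eta> \<star> Ident T 1) = Ident T 1"
    and mu_right: "\<mu> \<cdot> (Ident T 1 \<star> \<eta>) = Ident T 1"
    and De_assoc: "(\<Delta> \<star> Ident T 1) \<cdot> \<Delta> = (Ident T 1 \<star> \<Delta>) \<cdot> \<Delta>"
    and De_left: "(\<epsilon> \<star> Ident T 1) \<cdot> \<Delta> = Ident T 1"
    and De_right: "(Ident T 1 \<star> \<epsilon>) \<cdot> \<Delta> = Ident T 1"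
    and De_mu: "\<Delta> \<cdot> \<mu> = (\<mu> \<star> \<mu>) \<cdot> (Ident T 1 \<star> (Sym T 1 1 \<star> Ident T 1)) \<cdot> (\<Delta> \<star> \<Delta>)"
    and ep_mu: "\<epsilon> \<cdot> \<mu> = \<epsilon> \<star> \<epsilon>"
    and De_eta: "\<Delta> \<cdot> \<eta> = \<eta> \<star> \<eta>"
    and ep_eta: "\<epsilon> \<cdot> \<eta> = Ident T 0"
    and act_mu: "g \<in> carrier G \<Longrightarrow> act g \<cdot> \<mu> = \<mu> \<cdot> (act g \<star> act g)"
    and act_eta: "g \<in> carrier G \<Longrightarrow> act g \<cdot> \<eta> = \<eta>"
    and act_De: "g \<in> carrier G \<Longrightarrow> (act g \<star> act g) \<cdot> \<Delta> = \<Delta> \<cdot> act g"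
    and act_ep: "g \<in> carrier G \<Longrightarrow> \<epsilon> \<cdot> act g = \<epsilon>"
    and act_one: "act \<one>\<^bsub>G\<^esub> = Ident T 1"
    and act_mult: "\<lbrakk>g \<in> carrier G; h \<in> carrier G\<rbrakk> \<Longrightarrow> act (g \<otimes>\<^bsub>G\<^esub> h) = act g \<cdot> act h"
begin

lemma gen_arr [simp]:
  "\<mu> \<in> Arr T" "Dom T \<mu> = Suc (Suc 0)" "Cod T \<mu> = Suc 0"
  "\<eta> \<in> Arr T" "Dom T \<eta> = 0" "Cod T \<eta> = Suc 0"
  "\<Delta> \<in> Arr T" "Dom T \<Delta> = Suc 0" "Cod T \<Delta> = Suc (Suc 0)"
  "\<epsilon> \<in> Arr T" "Dom T \<epsilon> = Suc 0" "Cod T \<epsilon> = 0"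
  "g \<in> carrier G \<Longrightarrow> act g \<in> Arr T" "g \<in> carrier G \<Longrightarrow> Dom T (act g) = Suc 0"
  "g \<in> carrier G \<Longrightarrow> Cod T (act g) = Suc 0"
  using gen_in by (auto simp: Hom_def)

primrec mul :: "nat \<Rightarrow> 'a" where
  "mul 0 = \<eta>"
| "mul (Suc n) = \<mu> \<cdot> (Ident T 1 \<star> mul n)"

primrec com :: "nat \<Rightarrow> 'a" where
  "com 0 = \<epsilon>"
| "com (Suc n) = (Ident T 1 \<star> com n) \<cdot> \<Delta>"

lemma mul_arr [simp]: "mul n \<in> Arr T" "Dom T (mul n) = n" "Cod T (mul n) = Suc 0"
proof -
  have "mul n \<in> Arr T \<and> Dom T (mul n) = n \<and> Cod T (mul n) = Suc 0"
    by (induction n) auto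
  then show "mul n \<in> Arr T" "Dom T (mul n) = n" "Cod T (mul n) = Suc 0" by auto
qed

lemma com_arr [simp]: "com n \<in> Arr T" "Dom T (com n) = Suc 0" "Cod T (com n) = n"
proof -
  have "com n \<in> Arr T \<and> Dom T (com n) = Suc 0 \<and> Cod T (com n) = n"
    by (induction n) auto
  then show "com n \<in> Arr T" "Dom T (com n) = Suc 0" "Cod T (com n) = n" by auto
qed

lemma mul_1 [simp]: "mul (Suc 0) = Ident T (Suc 0)"
  using mu_right by simp

lemma com_1 [simp]: "com (Suc 0) = Ident T (Suc 0)"
  using De_right by simp

text \<open>General associativity: an iterated product may be cut anywhere, the unit law covering an
  empty first part.\<close>

lemma mul_add: "mul (a + b) = \<mu> \<cdot> (mul a \<star> mul b)"
proof (induction a)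
  case 0
  have "\<mu> \<cdot> (\<eta> \<star> mul b) = \<mu> \<cdot> ((\<eta> \<star> Ident T 1) \<cdot> (Ident T 0 \<star> mul b))"
    by (subst ten_cmp) auto
  also have "\<dots> = mul b"
    by (subst cmp_assoc[symmetric]) (use mu_left in auto)
  finally show ?case by simp
next
  case (Suc a)
  have "mul (Suc a + b) = \<mu> \<cdot> (Ident T 1 \<star> (\<mu> \<cdot> (mul a \<star> mul b)))"
    using Suc by simp
  also have "Ident T 1 \<star> (\<mu> \<cdot> (mul a \<star> mul b)) = (Ident T 1 \<star> \<mu>) \<cdot> ((Ident T 1 \<star> mul a) \<star> mul b)"
    by (subst ten_assoc) (auto simp: ten_cmp)
  also have "\<mu> \<cdot> \<dots> = (\<mu> \<cdot> (Ident T 1 \<star> \<mu>)) \<cdot> ((Ident T 1 \<star> mul a) \<star> mul b)"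
    by (subst cmp_assoc) auto
  also have "\<dots> = \<mu> \<cdot> ((\<mu> \<star> Ident T 1) \<cdot> ((Ident T 1 \<star> mul a) \<star> mul b))"
    unfolding mu_assoc[symmetric] by (subst cmp_assoc) auto
  also have "\<dots> = \<mu> \<cdot> (mul (Suc a) \<star> mul b)"
    by (subst ten_cmp) auto
  finally show ?case .
qed

lemma com_add: "com (a + b) = (com a \<star> com b) \<cdot> \<Delta>"
proof (induction a)
  case 0
  have "(\<epsilon> \<star> com b) \<cdot> \<Delta> = ((Ident T 0 \<star> com b) \<cdot> (\<epsilon> \<star> Ident T 1)) \<cdot> \<Delta>"
    by (subst ten_cmp) auto
  also have "\<dots> = com b"
    by (subst cmp_assoc) (use De_left in auto)
  finally show ?case by simp
next
  case (Suc a)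
  have "com (Suc a + b) = (Ident T 1 \<star> ((com a \<star> com b) \<cdot> \<Delta>)) \<cdot> \<Delta>"
    using Suc by simp
  also have "Ident T 1 \<star> ((com a \<star> com b) \<cdot> \<Delta>) = ((Ident T 1 \<star> com a) \<star> com b) \<cdot> (Ident T 1 \<star> \<Delta>)"
    by (subst ten_assoc) (auto simp: ten_cmp)
  also have "\<dots> \<cdot> \<Delta> = ((Ident T 1 \<star> com a) \<star> com b) \<cdot> ((Ident T 1 \<star> \<Delta>) \<cdot> \<Delta>)"
    by (subst cmp_assoc) auto
  also have "\<dots> = (((Ident T 1 \<star> com a) \<star> com b) \<cdot> (\<Delta> \<star> Ident T 1)) \<cdot> \<Delta>"
    unfolding De_assoc[symmetric] by (subst cmp_assoc) auto
  also have "\<dots> = (com (Suc a) \<star> com b) \<cdot> \<Delta>"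
    by (subst ten_cmp) auto
  finally show ?case .
qed

lemma mul_sum: "mul (sum_list (map f xs)) = mul (length xs) \<cdot> tens (map (\<lambda>x. mul (f x)) xs)"
proof (induction xs)
  case (Cons x xs)
  let ?T = "tens (map (\<lambda>x. mul (f x)) xs)"
  have T: "?T \<in> Arr T" "Cod T ?T = length xs" by (auto simp: sum_list_triv)
  have "mul (sum_list (map f (x # xs))) = \<mu> \<cdot> (mul (f x) \<star> (mul (length xs) \<cdot> ?T))"
    using Cons by (simp add: mul_add)
  also have "mul (f x) \<star> (mul (length xs) \<cdot> ?T) = (Ident T 1 \<star> mul (length xs)) \<cdot> (mul (f x) \<star> ?T)"
    using T by (simp add: ten_cmp)
  also have "\<mu> \<cdot> \<dots> = mul (length (x # xs)) \<cdot> tens (map (\<lambda>x. mul (f x)) (x # xs))"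
    using T by (simp add: cmp_assoc)
  finally show ?case .
qed simp

lemma com_sum: "com (sum_list (map f xs)) = tens (map (\<lambda>x. com (f x)) xs) \<cdot> com (length xs)"
proof (induction xs)
  case (Cons x xs)
  let ?T = "tens (map (\<lambda>x. com (f x)) xs)"
  have T: "?T \<in> Arr T" "Dom T ?T = length xs" by (auto simp: sum_list_triv)
  have "com (sum_list (map f (x # xs))) = (com (f x) \<star> (?T \<cdot> com (length xs))) \<cdot> \<Delta>"
    using Cons by (simp add: com_add)
  also have "com (f x) \<star> (?T \<cdot> com (length xs)) = (com (f x) \<star> ?T) \<cdot> (Ident T 1 \<star> com (length xs))"
    using T by (simp add: ten_cmp)
  also have "\<dots> \<cdot> \<Delta> = tens (map (\<lambda>x. com (f x)) (x # xs)) \<cdot> com (length (x # xs))"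
    using T by (simp add: cmp_assoc)
  finally show ?case .
qed simp

text \<open>Iterates the fact that \<open>act g\<close> is a monoid map. The list \<open>xs\<close>
  is an index set for the copies of \<open>act g\<close>, which lets the result be combined with
  \<open>tens_cmp\<close>.\<close>

lemma act_mul:
  assumes g: "g \<in> carrier G"
  shows "act g \<cdot> mul (length xs) = mul (length xs) \<cdot> tens (map (\<lambda>_. act g) xs)"
proof (induction xs)
  case Nil
  then show ?case using g by (simp add: act_eta)
next
  case (Cons x xs)
  let ?T = "tens (map (\<lambda>_. act g) xs)"
  have T: "?T \<in> Arr T" "Dom T ?T = length xs" "Cod T ?T = length xs"
    using g by (induction xs) auto
  have "act g \<cdot> mul (length (x # xs)) = (act g \<cdot> \<mu>) \<cdot> (Ident T 1 \<star> mul (length xs))"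
    using g by (simp add: cmp_assoc)
  also have "\<dots> = \<mu> \<cdot> (act g \<star> (act g \<cdot> mul (length xs)))"
    using g by (simp add: act_mu cmp_assoc ten_cmp)
  also have "act g \<star> (act g \<cdot> mul (length xs)) = (Ident T 1 \<star> mul (length xs)) \<cdot> (act g \<star> ?T)"
    using g T by (simp add: ten_cmp Cons)
  finally show ?case using g T by (simp add: cmp_assoc)
qed

lemma act_com:
  assumes g: "g \<in> carrier G"
  shows "com (length xs) \<cdot> act g = tens (map (\<lambda>_. act g) xs) \<cdot> com (length xs)"
proof (induction xs)
  case Nil
  then show ?case using g by (simp add: act_ep)
next
  case (Cons x xs)
  let ?T = "tens (map (\<lambda>_. act g) xs)"
  have T: "?T \<in> Arr T" "Dom T ?T = length xs" "Cod T ?T = length xs"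
    using g by (induction xs) auto
  have "com (length (x # xs)) \<cdot> act g = (Ident T 1 \<star> com (length xs)) \<cdot> (\<Delta> \<cdot> act g)"
    using g by (simp add: cmp_assoc)
  also have "\<dots> = (act g \<star> (com (length xs) \<cdot> act g)) \<cdot> \<Delta>"
    using g by (simp add: act_De[symmetric] cmp_assoc[symmetric] ten_cmp)
  also have "act g \<star> (com (length xs) \<cdot> act g) = (act g \<star> ?T) \<cdot> (Ident T 1 \<star> com (length xs))"
    using g T by (simp add: ten_cmp Cons)
  finally show ?case using g T by (simp add: cmp_assoc)
qed

lemma com_eta: "com (length ys) \<cdot> \<eta> = tens (map (\<lambda>_. \<eta>) ys)"
proof (induction ys)
  case (Cons y ys)
  have "com (length (y # ys)) \<cdot> \<eta> = (Ident T 1 \<star> com (length ys)) \<cdot> (\<eta> \<star> \<eta>)"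
    by (simp add: cmp_assoc De_eta)
  also have "\<dots> = \<eta> \<star> (com (length ys) \<cdot> \<eta>)" by (simp add: ten_cmp)
  finally show ?case by (simp add: Cons)
qed (simp add: ep_eta)

text \<open>The bimonoid law for a comultiplication of any arity. The tags \<open>u\<close> and
  \<open>v\<close> name the two factors of the product, so that the shuffle is a rearrangement of
  tagged strands.\<close>

lemma com_mu:
  assumes "distinct ys" "u \<noteq> v"
  shows "com (length ys) \<cdot> \<mu> = tens (map (\<lambda>_. \<mu>) ys) \<cdot>
    perm (map (Pair u) ys @ map (Pair v) ys) (concat (map (\<lambda>y. [(u, y), (v, y)]) ys)) \<cdot>
    (com (length ys) \<star> com (length ys))"
  using assms(1)
proof (induction ys)
  case Nil
  then show ?case by (simp add: ep_mu)
next
  case (Cons y ys)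
  let ?c = "com (length ys)" and ?U = "map (Pair u) ys" and ?V = "map (Pair v) ys"
  let ?L = "concat (map (\<lambda>y. [(u, y), (v, y)]) ys)" and ?R = "tens (map (\<lambda>_. \<mu>) ys)" and ?b = "length ys"
  let ?I = "Ident T 1"
  have r: "rearr (?U @ ?V) ?L"
  proof -
    have "distinct ?L" using Cons.prems assms(2) by (induction ys) auto
    then show ?thesis using Cons.prems assms(2) by (auto simp: rearr_def distinct_map inj_on_def)
  qed
  let ?P = "perm (?U @ ?V) ?L"
  have L: "length ?L = ?b + ?b" using rearr_length[OF r] by simp
  have P: "?P \<in> Arr T" "Dom T ?P = ?b + ?b" "Cod T ?P = ?b + ?b" using r L by auto
  have R: "?R \<in> Arr T" "Dom T ?R = ?b + ?b" "Cod T ?R = ?b"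
    by (induction ys) auto
  have "com (length (y # ys)) \<cdot> \<mu> = (?I \<star> ?c) \<cdot> ((\<mu> \<star> \<mu>) \<cdot> (?I \<star> (Sym T 1 1 \<star> ?I)) \<cdot> (\<Delta> \<star> \<Delta>))"
    by (simp add: cmp_assoc De_mu[simplified])
  also have "\<dots> = ((?I \<star> ?c) \<cdot> (\<mu> \<star> \<mu>)) \<cdot> ((?I \<star> (Sym T 1 1 \<star> ?I)) \<cdot> (\<Delta> \<star> \<Delta>))"
    by (simp add: cmp_assoc)
  also have "(?I \<star> ?c) \<cdot> (\<mu> \<star> \<mu>) = \<mu> \<star> (?R \<cdot> (?P \<cdot> (?c \<star> ?c)))"
    using Cons by (simp add: ten_cmp)
  also have "\<mu> \<star> (?R \<cdot> (?P \<cdot> (?c \<star> ?c))) = (\<mu> \<star> ?R) \<cdot> (Ident T 2 \<star> ?P) \<cdot> (Ident T 2 \<star> (?c \<star> ?c))"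
    using R P by (simp add: ten_cmp numeral_2_eq_2)
  also have "Ident T 2 \<star> (?c \<star> ?c) = ?I \<star> ((?I \<star> ?c) \<star> ?c)"
    by (simp add: ten_assoc[symmetric] numeral_2_eq_2)
  also have "((\<mu> \<star> ?R) \<cdot> (Ident T 2 \<star> ?P) \<cdot> (?I \<star> ((?I \<star> ?c) \<star> ?c))) \<cdot> ((?I \<star> (Sym T 1 1 \<star> ?I)) \<cdot> (\<Delta> \<star> \<Delta>))
    = (\<mu> \<star> ?R) \<cdot> (Ident T 2 \<star> ?P) \<cdot> (((?I \<star> ((?I \<star> ?c) \<star> ?c)) \<cdot> (?I \<star> (Sym T 1 1 \<star> ?I))) \<cdot> (\<Delta> \<star> \<Delta>))"
    using R P by (simp add: cmp_assoc numeral_2_eq_2)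
  also have "(?I \<star> ((?I \<star> ?c) \<star> ?c)) \<cdot> (?I \<star> (Sym T 1 1 \<star> ?I)) = ?I \<star> (((?I \<star> ?c) \<cdot> Sym T 1 1) \<star> ?c)"
    by (simp add: ten_cmp)
  \<comment> \<open>The remaining comultiplication slides through the transposition, which thereby
    becomes the crossing of one wire with \<open>?b\<close> wires.\<close>
  also have "(?I \<star> ?c) \<cdot> Sym T 1 1 = Sym T ?b 1 \<cdot> (?c \<star> ?I)"
    using Sym_nat[of ?c ?I ?b 1] by simp
  also have "?I \<star> ((Sym T ?b 1 \<cdot> (?c \<star> ?I)) \<star> ?c) =
      (?I \<star> (Sym T ?b 1 \<star> Ident T ?b)) \<cdot> ((?I \<star> ?c) \<star> (?I \<star> ?c))"
    by (simp add: ten_cmp ten_assoc[of ?I ?c, simplified] ten_assoc[of ?c ?I, simplified, symmetric])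
  also have "((?I \<star> (Sym T ?b 1 \<star> Ident T ?b)) \<cdot> ((?I \<star> ?c) \<star> (?I \<star> ?c))) \<cdot> (\<Delta> \<star> \<Delta>)
    = (?I \<star> (Sym T ?b 1 \<star> Ident T ?b)) \<cdot> (com (length (y # ys)) \<star> com (length (y # ys)))"
    by (simp add: cmp_assoc ten_cmp)
  also have "(\<mu> \<star> ?R) \<cdot> (Ident T 2 \<star> ?P) \<cdot> \<dots> = (\<mu> \<star> ?R) \<cdot>
      ((Ident T 2 \<star> ?P) \<cdot> (?I \<star> (Sym T ?b 1 \<star> Ident T ?b))) \<cdot> (com (length (y # ys)) \<star> com (length (y # ys)))"
    using R P by (simp add: cmp_assoc numeral_2_eq_2)
  \<comment> \<open>The crossing moves \<open>(v, y)\<close> in front of all strands tagged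
    \<open>u\<close> except \<open>(u, y)\<close>; then \<open>?P\<close> shuffles the remaining
    ones. Together this is the shuffle for the longer list.\<close>
  also have "(Ident T 2 \<star> ?P) \<cdot> (?I \<star> (Sym T ?b 1 \<star> Ident T ?b)) =
     perm (map (Pair u) (y # ys) @ map (Pair v) (y # ys)) (concat (map (\<lambda>y. [(u, y), (v, y)]) (y # ys)))"
  proof -
    let ?p = "(u, y)" and ?q = "(v, y)"
    have d: "distinct (?p # ?q # ?U @ ?V)"
      using Cons.prems assms(2) by (auto simp: distinct_map inj_on_def)
    have s: "set ?L = set (?U @ ?V)" using r by (simp add: rearr_def)
    have dL: "distinct ?L" using r by (simp add: rearr_def)
    have r': "rearr [?p] [?p]" "rearr (?U @ [?q]) ([?q] @ ?U)" "rearr ?V ?V" "rearr [?p, ?q] [?p, ?q]"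
       "rearr ((?U @ [?q]) @ ?V) (([?q] @ ?U) @ ?V)"
      using d by (auto simp: rearr_def)
    have "perm ([?p] @ (?U @ [?q]) @ ?V) ([?p] @ ([?q] @ ?U) @ ?V) = perm [?p] [?p] \<star> perm (?U @ [?q]) ([?q] @ ?U) \<star> perm ?V ?V"
      using d by (subst perm_append[OF r'(1,5)], force) (subst perm_append[OF r'(2,3)], auto)
    also have "perm (?U @ [?q]) ([?q] @ ?U) = Sym T ?b 1"
      using d perm_Sym[of ?U "[?q]"] by auto
    finally have 1: "?I \<star> (Sym T ?b 1 \<star> Ident T ?b) = perm ([?p] @ (?U @ [?q]) @ ?V) ([?p] @ ([?q] @ ?U) @ ?V)"
      using d by (simp add: distinct_map)
    have 2: "Ident T 2 \<star> ?P = perm ([?p, ?q] @ (?U @ ?V)) ([?p, ?q] @ ?L)"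
      using d by (subst perm_append[OF r'(4) r]) (auto simp: numeral_2_eq_2)
    have "rearr ([?p] @ (?U @ [?q]) @ ?V) ([?p, ?q] @ (?U @ ?V))" "rearr ([?p, ?q] @ (?U @ ?V)) ([?p, ?q] @ ?L)"
      unfolding rearr_def set_append s using d dL s by auto
    from perm_cmp[OF this] show ?thesis unfolding 1 2 by simp
  qed
  finally show ?case by simp
qed

text \<open>The strands \<open>(x, y)\<close> are rearranged from lexicographic to colexicographic order.\<close>

lemma com_mul:
  fixes xs :: "'s list" and ys :: "'t list"
  assumes "distinct xs" "distinct ys"
  shows "com (length ys) \<cdot> mul (length xs) = tens (map (\<lambda>_. mul (length xs)) ys) \<cdot>
    perm (concat (map (\<lambda>x. map (Pair x) ys) xs)) (concat (map (\<lambda>y. map (\<lambda>x. (x, y)) xs) ys)) \<cdot>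
    tens (map (\<lambda>_. com (length ys)) xs)"
  using assms(1)
proof (induction xs)
  case Nil
  have e: "concat (map (\<lambda>y. []) ys) = ([] :: ('s \<times> 't) list)" by simp
  moreover have "tens (map (\<lambda>_. \<eta>) ys) \<cdot> Ident T 0 = tens (map (\<lambda>_. \<eta>) ys)"
    by (rule cmp_Ident) (auto simp: o_def)
  ultimately show ?case by (simp add: com_eta e)
next
  case (Cons x xs)
  let ?b = "length ys" and ?a = "length xs" and ?I = "Ident T 1"
  let ?X = "concat (map (\<lambda>x. map (Pair x) ys) xs)" and ?Y = "concat (map (\<lambda>y. map (\<lambda>x. (x, y)) xs) ys)"
  let ?M = "tens (map (\<lambda>_. mul ?a) ys)" and ?C = "tens (map (\<lambda>_. com ?b) xs)" and ?P = "perm ?X ?Y"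
  have rXY: "rearr ?X ?Y" using rearr_grid Cons.prems assms(2) by auto
  have lX: "length ?X = ?a * ?b" by (induction xs) auto
  have P: "?P \<in> Arr T" "Dom T ?P = ?a * ?b" "Cod T ?P = ?a * ?b"
    using rXY rearr_length[OF rXY] lX by simp_all
  have M: "?M \<in> Arr T" "Dom T ?M = ?a * ?b" "Cod T ?M = ?b"
    and C: "?C \<in> Arr T" "Dom T ?C = ?a" "Cod T ?C = ?a * ?b"
    by (auto simp: sum_list_triv)
  \<comment> \<open>The tag \<open>False\<close> marks the factor \<open>x\<close>, the tag
    \<open>True\<close> the product over \<open>xs\<close>; \<open>com_mu\<close> asks for two
    different tags.\<close>
  let ?L = "map (Pair False) ys @ map (Pair True) ys" and ?L' = "concat (map (\<lambda>y. [(False, y), (True, y)]) ys)"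
  have rL: "rearr ?L ?L'"
  proof -
    have "distinct ?L'" using assms(2) by (induction ys) auto
    then show ?thesis using assms(2) by (auto simp: rearr_def distinct_map inj_on_def)
  qed
  let ?R = "tens (map (\<lambda>_. \<mu>) ys)" and ?Q = "perm ?L ?L'"
  have Q: "?Q \<in> Arr T" "Dom T ?Q = ?b + ?b" "Cod T ?Q = ?b + ?b"
    using rL rearr_length[OF rL] by simp_all
  have R: "?R \<in> Arr T" "Dom T ?R = ?b + ?b" "Cod T ?R = ?b"
    by (induction ys) auto
  \<comment> \<open>Tagged strands are expanded to strands of the grid: one tagged
    \<open>False\<close> is the strand over \<open>x\<close>, one tagged \<open>True\<close> is a
    whole column over \<open>xs\<close>, which \<open>u\<close> multiplies together.\<close>
  define d where "d = (\<lambda>(i, y :: 't). if i then map (\<lambda>x. (x, y)) xs else [(x, y)])"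
  define u where "u = (\<lambda>(i, y :: 't). if i then mul ?a else ?I)"
  have dL: "concat (map d ?L) = map (Pair x) ys @ ?Y" "concat (map d ?L') = concat (map (\<lambda>y. map (\<lambda>x. (x, y)) (x # xs)) ys)"
    by (simp_all add: d_def o_def map_concat concat_map_singleton) (induction ys, auto)
  have dd: "distinct (concat (map d ?L))"
    unfolding dL using rXY Cons.prems assms(2) by (auto simp: rearr_def distinct_map inj_on_def)
  \<comment> \<open>Naturality exchanges the shuffle of the two factors with the multiplications
    over \<open>xs\<close>; after that both rearrangements are adjacent and compose.\<close>
  have nat: "tens (map u ?L') \<cdot> perm (concat (map d ?L)) (concat (map d ?L')) = ?Q \<cdot> tens (map u ?L)"
  proof -
    have e: "distinct (concat (map (\<lambda>z. [z]) ?L))"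
      using rL by (simp only: concat_map_singleton map_ident rearr_def)
    have "u z \<in> Arr T \<and> Dom T (u z) = length (d z) \<and> Cod T (u z) = length [z]" if "z \<in> set ?L" for z
      using that by (auto simp: d_def u_def)
    from perm_natural[OF rL dd e this] show ?thesis
      by (simp only: concat_map_singleton map_ident)
  qed
  have uL: "tens (map u ?L) = Ident T ?b \<star> ?M"
    by (simp add: u_def o_def tens_append image_subset_iff sum_list_triv)
  have uL': "tens (map u ?L') = tens (map (\<lambda>_. ?I \<star> mul ?a) ys)"
    by (induction ys) (auto simp: u_def ten_assoc image_subset_iff)
  have rg: "rearr (concat (map (\<lambda>x. map (Pair x) ys) (x # xs))) (map (Pair x) ys @ ?Y)"
    "rearr (map (Pair x) ys @ ?Y) (concat (map (\<lambda>y. map (\<lambda>x. (x, y)) (x # xs)) ys))"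
    using rearr_grid[OF Cons.prems assms(2)] rXY dd unfolding dL rearr_def by auto
  let ?Q' = "perm (map (Pair x) ys @ ?Y) (concat (map (\<lambda>y. map (\<lambda>x. (x, y)) (x # xs)) ys))"
  let ?U = "tens (map (\<lambda>_. ?I \<star> mul ?a) ys)"
  have Q': "?Q' \<in> Arr T" "Dom T ?Q' = ?b + ?a * ?b" "Cod T ?Q' = ?b + ?a * ?b"
    using rg(2) rearr_length[OF rg(2)] lX rearr_length[OF rXY] by simp_all
  have U: "?U \<in> Arr T" "Dom T ?U = ?b + ?a * ?b" "Cod T ?U = ?b + ?b"
    by (induction ys) auto
  have "com ?b \<cdot> mul (length (x # xs)) = (com ?b \<cdot> \<mu>) \<cdot> (?I \<star> mul ?a)"
    by (simp add: cmp_assoc)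
  also have "\<dots> = (?R \<cdot> ?Q) \<cdot> ((com ?b \<star> com ?b) \<cdot> (?I \<star> mul ?a))"
    using com_mu[OF assms(2), of False True] Q R by (simp add: cmp_assoc)
  also have "(com ?b \<star> com ?b) \<cdot> (?I \<star> mul ?a) = com ?b \<star> (?M \<cdot> (?P \<cdot> ?C))"
    using Cons by (simp add: ten_cmp)
  also have "com ?b \<star> (?M \<cdot> (?P \<cdot> ?C)) = (Ident T ?b \<star> ?M) \<cdot> (Ident T ?b \<star> ?P) \<cdot> (com ?b \<star> ?C)"
    using M P C by (simp add: ten_cmp)
  also have "(?R \<cdot> ?Q) \<cdot> \<dots> = ?R \<cdot> (?Q \<cdot> (Ident T ?b \<star> ?M)) \<cdot> (Ident T ?b \<star> ?P) \<cdot> (com ?b \<star> ?C)"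
    using M P C R Q by (simp add: cmp_assoc)
  also have "?Q \<cdot> (Ident T ?b \<star> ?M) = ?U \<cdot> ?Q'"
    using nat unfolding dL uL uL' by simp
  also have "?R \<cdot> (?U \<cdot> ?Q') \<cdot> (Ident T ?b \<star> ?P) \<cdot> (com ?b \<star> ?C)
      = (?R \<cdot> ?U) \<cdot> (?Q' \<cdot> (Ident T ?b \<star> ?P)) \<cdot> (com ?b \<star> ?C)"
    using U P C R Q' by (simp add: cmp_assoc)
  also have "?R \<cdot> ?U = tens (map (\<lambda>_. mul (length (x # xs))) ys)"
    by (subst tens_cmp) auto
  also have "Ident T ?b \<star> ?P = perm (map (Pair x) ys @ ?X) (map (Pair x) ys @ ?Y)"
    using assms(2) Cons.prems by (subst perm_append[OF _ rXY]) (auto simp: rearr_def distinct_map inj_on_def)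
  also have "?Q' \<cdot> \<dots> = perm (concat (map (\<lambda>x. map (Pair x) ys) (x # xs))) (concat (map (\<lambda>y. map (\<lambda>x. (x, y)) (x # xs)) ys))"
    using perm_cmp[OF rg] by simp
  finally show ?case by simp
qed


subsection \<open>Words and the evaluation of spans\<close>

text \<open>The value of one fibre of a right leg: the labels act, then the results are multiplied
  in the order of the fibre.\<close>

definition word :: "('s \<times> 'g) list \<Rightarrow> 'a" where
  "word w = mul (length w) \<cdot> tens (map (\<lambda>(x, a). act a) w)"

lemma act_tens [simp]:
  assumes "labelled G w"
  shows "tens (map (\<lambda>(x, a). act a) w) \<in> Arr T" "Dom T (tens (map (\<lambda>(x, a). act a) w)) = length w"
    "Cod T (tens (map (\<lambda>(x, a). act a) w)) = length w"
  using assms by (induction w) auto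

lemma word_arr [simp]:
  assumes "labelled G w"
  shows "word w \<in> Arr T" "Dom T (word w) = length w" "Cod T (word w) = Suc 0"
  using assms by (simp_all add: word_def)

lemma length_gact [simp]: "length (gact G g w) = length w"
  by (simp add: gact_def)

text \<open>Since \<open>act g\<close> is a monoid map, the left action on labels becomes
  composition with \<open>act g\<close> after the product.\<close>

lemma word_gact:
  assumes g: "g \<in> carrier G" and w: "labelled G w"
  shows "word (gact G g w) = act g \<cdot> word w"
proof -
  have "tens (map (\<lambda>(x, a). act a) (gact G g w)) = tens (map (\<lambda>(x, a). act g \<cdot> act a) w)"
    using w g by (induction w) (auto simp: gact_def act_mult)
  also have "\<dots> = tens (map (\<lambda>_. act g) w) \<cdot> tens (map (\<lambda>(x, a). act a) w)"
    using w g by (subst tens_cmp) (auto simp: split_def dest: labelledD)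
  finally have "word (gact G g w) = mul (length w) \<cdot> (tens (map (\<lambda>_. act g) w) \<cdot> tens (map (\<lambda>(x, a). act a) w))"
    by (simp add: word_def)
  also have "\<dots> = (act g \<cdot> mul (length w)) \<cdot> tens (map (\<lambda>(x, a). act a) w)"
    unfolding act_mul[OF g] using w g by (subst cmp_assoc) (auto simp: sum_list_triv)
  finally show ?thesis using w g by (simp add: word_def cmp_assoc)
qed

lemma word_concat:
  assumes "labelled G (concat ws)"
  shows "word (concat ws) = mul (length ws) \<cdot> tens (map word ws)"
proof -
  let ?A = "\<lambda>w. tens (map (\<lambda>(x, a). act a) w)"
  have l: "\<And>w. w \<in> set ws \<Longrightarrow> labelled G w" using assms by (simp add: labelled_concat)
  have "tens (map (\<lambda>(x, a). act a) (concat ws)) = tens (map ?A ws)"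
    unfolding map_concat using l by (subst tens_concat) (fastforce simp: o_def labelled_def dest: l)+
  moreover have "length (concat ws) = sum_list (map length ws)" by (simp add: length_concat)
  ultimately have "word (concat ws) = (mul (length ws) \<cdot> tens (map (\<lambda>w. mul (length w)) ws)) \<cdot> tens (map ?A ws)"
    unfolding word_def using mul_sum[of length ws] by simp
  also have "\<dots> = mul (length ws) \<cdot> (tens (map (\<lambda>w. mul (length w)) ws) \<cdot> tens (map ?A ws))"
    using l by (subst cmp_assoc) (auto simp: sum_list_triv intro!: arg_cong[of _ _ sum_list])
  also have "tens (map (\<lambda>w. mul (length w)) ws) \<cdot> tens (map ?A ws) = tens (map word ws)"
    using l by (subst tens_cmp) (auto simp: word_def[abs_def])
  finally show ?thesis .
qed

text \<open>One fibre of a composite of right legs: the words of the inner leg are substituted into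
  a word of the outer one, and \<open>word_gact\<close> absorbs the labels of the latter.\<close>

lemma word_subst:
  assumes v: "labelled G v" and s: "\<And>y. y \<in> fst ` set v \<Longrightarrow> labelled G (s y)"
  shows "word v \<cdot> tens (map (\<lambda>(y, b). word (s y)) v) = word (concat (map (\<lambda>(y, b). gact G b (s y)) v))"
proof -
  have s': "labelled G (s y)" if "(y, b) \<in> set v" for y b using s that by force
  have s2: "labelled G (s (fst p))" "snd p \<in> carrier G" if "p \<in> set v" for p
    using s v that by (auto simp: labelled_def)
  have "word v \<cdot> tens (map (\<lambda>(y, b). word (s y)) v)
    = mul (length v) \<cdot> (tens (map (\<lambda>(y, b). act b) v) \<cdot> tens (map (\<lambda>(y, b). word (s y)) v))"
    unfolding word_def[of v] using v
    by (subst cmp_assoc) (simp_all add: split_def sum_list_triv s2 cong: map_cong)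
  also have "tens (map (\<lambda>(y, b). act b) v) \<cdot> tens (map (\<lambda>(y, b). word (s y)) v)
    = tens (map (\<lambda>(y, b). act b \<cdot> word (s y)) v)"
    using v by (simp add: split_def s2 tens_cmp)
  also have "map (\<lambda>(y, b). act b \<cdot> word (s y)) v = map word (map (\<lambda>(y, b). gact G b (s y)) v)"
    using s2 by (auto simp: word_gact)
  also have "mul (length v) \<cdot> tens (map word (map (\<lambda>(y, b). gact G b (s y)) v))
     = word (concat (map (\<lambda>(y, b). gact G b (s y)) v))"
    using labelled_subst[OF grp v s'] by (subst word_concat) auto
  finally show ?thesis .
qed

text \<open>The labelled form of \<open>com_mul\<close>. As \<open>act\<close> is compatible with
  comultiplication, \<open>act_com\<close> copies each label onto all strands of its row, and
  \<open>perm_natural\<close> carries the copies through the rearrangement to the words.\<close>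

lemma com_word_aux:
  fixes xs :: "'s list" and ys :: "'t list"
  assumes l: "\<And>x. x \<in> set xs \<Longrightarrow> l x \<in> carrier G" and d: "distinct xs" "distinct ys"
  defines "w \<equiv> map (\<lambda>x. (x, l x)) xs"
  shows "com (length ys) \<cdot> word w = tens (map (\<lambda>_. word w) ys) \<cdot>
    perm (concat (map (\<lambda>x. map (Pair x) ys) xs)) (concat (map (\<lambda>y. map (\<lambda>x. (x, y)) xs) ys)) \<cdot>
    tens (map (\<lambda>_. com (length ys)) xs)"
proof -
  let ?b = "length ys" and ?a = "length xs"
  let ?M = "tens (map (\<lambda>_. mul ?a) ys)" and ?C = "tens (map (\<lambda>_. com ?b) xs)"
  let ?X = "concat (map (\<lambda>x. map (Pair x) ys) xs)" and ?Y = "concat (map (\<lambda>y. map (\<lambda>x. (x, y)) xs) ys)"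
  let ?P = "perm ?X ?Y" and ?A = "tens (map (\<lambda>x. act (l x)) xs)"
  have r: "rearr ?X ?Y" using rearr_grid[OF d] .
  have X: "length ?X = ?a * ?b" by (induction xs) auto
  have P: "?P \<in> Arr T" "Dom T ?P = ?a * ?b" "Cod T ?P = ?a * ?b"
    using r X rearr_length[OF r] by simp_all
  have M: "?M \<in> Arr T" "Dom T ?M = ?a * ?b" "Cod T ?M = ?b"
    and C: "?C \<in> Arr T" "Dom T ?C = ?a" "Cod T ?C = ?a * ?b"
    by (auto simp: sum_list_triv)
  have A: "?A \<in> Arr T" "Dom T ?A = ?a" "Cod T ?A = ?a"
    by (simp_all add: l sum_list_triv cong: map_cong)
  define u where "u = (\<lambda>(x, y :: 't). act (l x))"
  have uA: "u z \<in> Arr T" "Dom T (u z) = Suc 0" "Cod T (u z) = Suc 0" if "z \<in> set ?X" for z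
    using that l by (auto simp: u_def)
  have UX: "tens (map u ?X) \<in> Arr T" "Dom T (tens (map u ?X)) = ?a * ?b" "Cod T (tens (map u ?X)) = ?a * ?b"
    using X uA by (simp_all add: sum_list_triv cong: map_cong del: set_concat map_concat)
  have uY: "tens (map u ?Y) = tens (map (\<lambda>_. ?A) ys)"
    unfolding map_concat by (subst tens_concat) (auto simp: u_def l o_def)
  have uX: "tens (map u ?X) = tens (map (\<lambda>x. tens (map (\<lambda>_. act (l x)) ys)) xs)"
    unfolding map_concat by (subst tens_concat) (auto simp: u_def l o_def)
  have w: "word w = mul ?a \<cdot> ?A" by (simp add: word_def w_def o_def)
  have UY: "tens (map u ?Y) \<in> Arr T" "Dom T (tens (map u ?Y)) = ?a * ?b" "Cod T (tens (map u ?Y)) = ?a * ?b"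
    unfolding uY using A by (simp_all add: sum_list_triv)
  have n: "tens (map u ?Y) \<cdot> ?P = ?P \<cdot> tens (map u ?X)"
  proof -
    have e: "distinct (concat (map (\<lambda>z. [z]) ?X))"
      using r by (simp only: concat_map_singleton map_ident rearr_def)
    have "u z \<in> Arr T \<and> Dom T (u z) = length [z] \<and> Cod T (u z) = length [z]" if "z \<in> set ?X" for z
      using uA[OF that] by simp
    from perm_natural[OF r e e this] show ?thesis
      by (simp only: concat_map_singleton map_ident)
  qed
  have "com ?b \<cdot> word w = (com ?b \<cdot> mul ?a) \<cdot> ?A"
    unfolding w using A by (simp add: cmp_assoc)
  also have "\<dots> = ?M \<cdot> ?P \<cdot> (?C \<cdot> ?A)"
    unfolding com_mul[OF d] using A M P C by (simp add: cmp_assoc)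
  also have "?C \<cdot> ?A = tens (map (\<lambda>x. tens (map (\<lambda>_. act (l x)) ys) \<cdot> com ?b) xs)"
    by (simp add: tens_cmp l act_com cong: map_cong)
  also have "\<dots> = tens (map u ?X) \<cdot> ?C"
    unfolding uX using l by (simp add: tens_cmp sum_list_triv)
  also have "?P \<cdot> (tens (map u ?X) \<cdot> ?C) = (tens (map u ?Y) \<cdot> ?P) \<cdot> ?C"
    unfolding n using UX P C by (subst cmp_assoc) auto
  also have "?M \<cdot> \<dots> = (?M \<cdot> tens (map u ?Y)) \<cdot> (?P \<cdot> ?C)"
    using UY P C M by (simp only: cmp_assoc cmp_arr)
  also have "?M \<cdot> tens (map u ?Y) = tens (map (\<lambda>_. word w) ys)"
    unfolding w uY using A by (simp add: tens_cmp)
  finally show ?thesis .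
qed

lemma com_word:
  fixes w :: "('s \<times> 'g) list" and ys :: "'t list"
  assumes w: "labelled G w" and d: "distinct (map fst w)" "distinct ys"
  shows "com (length ys) \<cdot> word w = tens (map (\<lambda>_. word w) ys) \<cdot>
    perm (concat (map (\<lambda>x. map (Pair x) ys) (map fst w))) (concat (map (\<lambda>y. map (\<lambda>x. (x, y)) (map fst w)) ys)) \<cdot>
    tens (map (\<lambda>_. com (length ys)) (map fst w))"
proof -
  \<comment> \<open>The strands of \<open>w\<close> are distinct, so that its labels are a function
    of the strand.\<close>
  define l where "l x = the (map_of w x)" for x
  have l: "l x = a" if "(x, a) \<in> set w" for x a
    using that d(1) by (simp add: l_def)
  then have e: "map (\<lambda>x. (x, l x)) (map fst w) = w"
    by (auto intro!: map_idI)
  have "l x \<in> carrier G" if "x \<in> set (map fst w)" for x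
    using that l labelledD[OF w] by auto
  from com_word_aux[of "map fst w" l ys, OF this d] show ?thesis unfolding e .
qed

lemma perm_concat:
  assumes "\<And>j. j \<in> set js \<Longrightarrow> rearr (X j) (Y j)" "distinct (concat (map X js))"
  shows "tens (map (\<lambda>j. perm (X j) (Y j)) js) = perm (concat (map X js)) (concat (map Y js))
    \<and> rearr (concat (map X js)) (concat (map Y js))"
  using assms
proof (induction js)
  case Nil
  then show ?case by (simp add: rearr_def)
next
  case (Cons j js)
  then have r: "rearr (concat (map X js)) (concat (map Y js))" "rearr (X j) (Y j)" by auto
  moreover from r Cons.prems have "rearr (X j @ concat (map X js)) (Y j @ concat (map Y js))"
    unfolding rearr_def by (simp only: set_append distinct_append list.map concat.simps) 
  ultimately show ?case using Cons by (simp add: perm_append)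
qed

definition ev :: "('s, 'g) gspan \<Rightarrow> 'a" where
  "ev s = tens (map word (snd s)) \<cdot> perm (concat (fst s)) (map fst (concat (snd s))) \<cdot>
     tens (map (\<lambda>xs. com (length xs)) (fst s))"

end

section \<open>Orders on the strands of a composite span\<close>

lemma concat_map_concat':
  "concat (map f (concat xss)) = concat (map (\<lambda>xs. concat (map f xs)) xss)"
  "concat (map (\<lambda>j. concat (map (g j) (h j))) js) = concat (concat (map (\<lambda>j. map (g j) (h j)) js))"
  by (induction xss, simp_all) (induction js, simp_all)

lemma length_concat_map: "length (concat (map f xs)) = (\<Sum>x\<leftarrow>xs. length (f x))"
  by (simp add: length_concat o_def)

lemma distinct_concat_Pair:
  assumes "distinct xs" "\<And>x. x \<in> set xs \<Longrightarrow> distinct (ys x)"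
  shows "distinct (concat (map (\<lambda>x. map (Pair x) (ys x)) xs))"
  using assms by (induction xs) (auto simp: distinct_map inj_on_def)

lemma gvalidD:
  assumes "gvalid G s"
  shows "distinct (concat (fst s))" "distinct (concat (map (map fst) (snd s)))"
    "set (concat (map (map fst) (snd s))) = set (concat (fst s))"
    "rearr (concat (fst s)) (concat (map (map fst) (snd s)))"
    "labelled G (concat (snd s))" "w \<in> set (snd s) \<Longrightarrow> labelled G w" "w \<in> set (snd s) \<Longrightarrow> distinct (map fst w)"
proof -
  show "distinct (concat (fst s))" and d: "distinct (concat (map (map fst) (snd s)))"
    "set (concat (map (map fst) (snd s))) = set (concat (fst s))"
    "rearr (concat (fst s)) (concat (map (map fst) (snd s)))"
    "labelled G (concat (snd s))"
    using assms unfolding gvalid_def labelled_def rearr_def map_concat by auto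
  then show "w \<in> set (snd s) \<Longrightarrow> labelled G w" by (simp add: labelled_concat)
  show "w \<in> set (snd s) \<Longrightarrow> distinct (map fst w)" using d(1)
    by (auto simp: distinct_concat_iff)
qed

text \<open>The two concatenations have the same elements and, blockwise, the same length; a list as
  long as its set of elements is distinct.\<close>

lemma rearr_concat_list:
  assumes "\<And>j. j \<in> set js \<Longrightarrow> rearr (X j) (Y j)" "distinct (concat (map X js))"
  shows "rearr (concat (map X js)) (concat (map Y js))"
proof -
  have "set (concat (map X js)) = set (concat (map Y js))"
    using assms(1) by (auto simp: rearr_def)
  moreover have "length (concat (map X js)) = length (concat (map Y js))"
    using assms(1) rearr_length by (fastforce simp: length_concat intro!: arg_cong[of _ _ sum_list])
  ultimately show ?thesis
    using assms(2) unfolding rearr_def by (metis card_distinct distinct_card)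
qed

text \<open>The combinatorial part of the distributive law: the grids over all points of the base,
  put one after the other, list the pullback once along the right leg of the first span and once
  along the left leg of the second.\<close>

lemma distrib_concat:
  fixes W :: "('s \<times> 'g) list list" and P :: "'t list list"
  assumes l: "length W = length P" and W: "distinct (concat (map (map fst) W))" and P: "distinct (concat P)"
  defines "d \<equiv> \<lambda>x. map (Pair x) (P ! occ (map (map fst) W) x)"
    and "e \<equiv> \<lambda>y. map (\<lambda>x. (x, y)) (map fst (W ! occ P y))"
  shows "concat (map (\<lambda>j. concat (map (\<lambda>x. map (Pair x) (P ! j)) (map (map fst) W ! j))) [0..<length W])
      = concat (map d (concat (map (map fst) W)))" (is "?XV = _")
    and "concat (map (\<lambda>j. concat (map (\<lambda>y. map (\<lambda>x. (x, y)) (map (map fst) W ! j)) (P ! j))) [0..<length W])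
      = concat (map e (concat P))" (is "?YP = _")
    and "rearr (concat (map d (concat (map (map fst) W)))) (concat (map e (concat P)))"
proof -
  let ?n = "length W" and ?V = "map (map fst) W"
  let ?js = "[0..<length W]"
  show XV: "?XV = concat (map d (concat ?V))"
    unfolding concat_map_concat'(2) d_def
    by (subst map_concat_occ[OF W, symmetric, of ?n]) simp_all
  show YP: "?YP = concat (map e (concat P))"
  proof -
    have "?YP = concat (map (\<lambda>j. concat (map (\<lambda>y. map (\<lambda>x. (x, y)) (map fst (W ! j))) (P ! j))) ?js)"
      by (intro arg_cong[of _ _ concat] map_cong) auto
    then show ?thesis unfolding e_def
      by (simp only: concat_map_concat' map_concat_occ[OF P, of ?n "\<lambda>j y. map (\<lambda>x. (x, y)) (map fst (W ! j))", OF l])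
  qed
  have dV: "distinct (?V ! j)" if "j < ?n" for j
    using W that distinct_concat_iff[of ?V] nth_mem[of j ?V] by auto
  have dP: "distinct (P ! j)" if "j < ?n" for j
    using P that l distinct_concat_iff[of P] nth_mem[of j P] by auto
  have "distinct (concat (map d (concat ?V)))"
    unfolding d_def
  proof (rule distinct_concat_Pair[OF W])
    fix x assume "x \<in> set (concat ?V)"
    from occ_less[OF this] show "distinct (P ! occ ?V x)" using dP by simp
  qed
  then have D: "distinct ?XV" unfolding XV .
  show "rearr (concat (map d (concat ?V))) (concat (map e (concat P)))"
    unfolding XV[symmetric] YP[symmetric]
  proof (rule rearr_concat_list)
    fix j assume "j \<in> set ?js"
    then have j: "j < ?n" by simp
    show "rearr (concat (map (\<lambda>x. map (Pair x) (P ! j)) (?V ! j))) (concat (map (\<lambda>y. map (\<lambda>x. (x, y)) (?V ! j)) (P ! j)))"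
      by (rule rearr_grid[OF dV[OF j] dP[OF j]])
  qed (rule D)
qed

lemma gcomp_strands:
  "concat (fst (gcomp G t s)) =
     concat (map (\<lambda>x. map (Pair x) (fst t ! occ (map (map fst) (snd s)) x)) (concat (fst s)))"
  "map fst (concat (snd (gcomp G t s))) =
     concat (map (\<lambda>y. map (\<lambda>x. (x, y)) (map fst (snd s ! occ (fst t) y))) (concat (map (map fst) (snd t))))"
  by (simp_all add: gcomp_def map_concat concat_map_concat' o_def split_def)

text \<open>The strands of the composite in four orders: along the left and the right leg of
  \<open>s\<close>, then along the left and the right leg of \<open>t\<close>. The outer steps come
  from \<open>s\<close> and \<open>t\<close>, the middle one from the distributive law.\<close>

lemma gcomp_rearr:
  assumes s: "gvalid G s" and t: "gvalid G t" and l: "length (snd s) = length (fst t)"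
  defines "d \<equiv> \<lambda>x. map (Pair x) (fst t ! occ (map (map fst) (snd s)) x)"
    and "e \<equiv> \<lambda>y. map (\<lambda>x. (x, y)) (map fst (snd s ! occ (fst t) y))"
  shows "rearr (concat (map d (concat (fst s)))) (concat (map d (concat (map (map fst) (snd s)))))" (is "rearr ?a ?b")
    "rearr (concat (map d (concat (map (map fst) (snd s))))) (concat (map e (concat (fst t))))" (is "rearr _ ?c")
    "rearr (concat (map e (concat (fst t)))) (concat (map e (concat (map (map fst) (snd t)))))" (is "rearr _ ?d")
proof -
  note vs = gvalidD[OF s] and vt = gvalidD[OF t]
  show r3: "rearr ?b ?c"
    unfolding d_def e_def by (rule distrib_concat(3)[OF l vs(2) vt(1)])
  show r4: "rearr ?c ?d"
    by (rule rearr_concat[OF vt(4)]) (use r3 in \<open>simp add: rearr_def\<close>)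
  show r2: "rearr ?a ?b"
  proof -
    have "rearr (concat (map (map fst) (snd s))) (concat (fst s))" using vs(4) by (simp only: rearr_def)
    from rearr_concat[OF this, of d] r3 show ?thesis by (simp only: rearr_def)
  qed
qed

lemma gvalid_gcomp:
  assumes G: "group G" and s: "gvalid G s" and t: "gvalid G t" and l: "length (snd s) = length (fst t)"
  shows "gvalid G (gcomp G t s)"
proof -
  note r = gcomp_rearr[OF s t l]
  note vs = gvalidD[OF s] and vt = gvalidD[OF t]
  have "b \<otimes>\<^bsub>G\<^esub> a \<in> carrier G" if "v \<in> set (snd t)" "(y, b) \<in> set v" "(x, a) \<in> set (snd s ! occ (fst t) y)" for v y b x a
  proof -
    have "b \<in> carrier G" using vt(6)[OF that(1)] that(2) by (rule labelledD)
    moreover have "y \<in> set (concat (map (map fst) (snd t)))" using that(1,2) by force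
    then have "y \<in> set (concat (fst t))" unfolding vt(3) .
    from occ_less(1)[OF this] have "a \<in> carrier G"
      using labelledD[OF vs(6) that(3)] l by simp
    ultimately show ?thesis using G by (simp add: group.is_monoid monoid.m_closed)
  qed
  then have "snd ` set (concat (snd (gcomp G t s))) \<subseteq> carrier G"
    by (fastforce simp: gcomp_def)
  moreover have "rearr (concat (fst (gcomp G t s))) (map fst (concat (snd (gcomp G t s))))"
    unfolding gcomp_strands using r unfolding rearr_def by simp
  ultimately show ?thesis by (simp only: gvalid_def simp_thms)
qed

section \<open>Evaluation respects composition\<close>

context gbimonoid_in_prop
begin

lemma ev_arr [simp]:
  assumes "gvalid G s"
  shows "ev s \<in> Arr T" "Dom T (ev s) = length (fst s)" "Cod T (ev s) = length (snd s)"
proof -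
  note v = gvalidD[OF assms]
  have l: "length (concat (map (map fst) (snd s))) = (\<Sum>w\<leftarrow>snd s. length w)"
    by (simp add: length_concat o_def)
  have l': "length (concat (fst s)) = (\<Sum>w\<leftarrow>fst s. length w)"
    by (simp add: length_concat)
  have "tens (map word (snd s)) \<in> Arr T" "Dom T (tens (map word (snd s))) = length (concat (map (map fst) (snd s)))"
    "Cod T (tens (map word (snd s))) = length (snd s)"
    unfolding l using v(6) by (simp_all add: sum_list_triv cong: map_cong)
  moreover have "perm (concat (fst s)) (map fst (concat (snd s))) \<in> Arr T"
    "Dom T (perm (concat (fst s)) (map fst (concat (snd s)))) = length (concat (fst s))"
    "Cod T (perm (concat (fst s)) (map fst (concat (snd s)))) = length (concat (map (map fst) (snd s)))"
    using v(4) perm_arr[OF v(4)] by (simp_all add: map_concat)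
  moreover have "tens (map (\<lambda>xs. com (length xs)) (fst s)) \<in> Arr T"
    "Dom T (tens (map (\<lambda>xs. com (length xs)) (fst s))) = length (fst s)"
    "Cod T (tens (map (\<lambda>xs. com (length xs)) (fst s))) = length (concat (fst s))"
    unfolding l' by (simp_all add: sum_list_triv)
  ultimately show "ev s \<in> Arr T" "Dom T (ev s) = length (fst s)" "Cod T (ev s) = length (snd s)"
    by (simp_all add: ev_def)
qed

text \<open>Gives the two families in \<open>mul_com_distrib\<close> a common index, the point of
  the base.\<close>

lemma tens_nth: "tens (map f xs) = tens (map (\<lambda>j. f (xs ! j)) [0..<length xs])"
proof -
  have "map f xs = map f (map (nth xs) [0..<length xs])" by (simp add: map_nth)
  then show ?thesis by (simp add: o_def)
qed

text \<open>The counterpart of the distributive law by which spans are composed.\<close>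

lemma mul_com_distrib:
  fixes W :: "('s \<times> 'g) list list" and P :: "'t list list"
  assumes l: "length W = length P" and W: "distinct (concat (map (map fst) W))"
    and lab: "labelled G (concat W)" and P: "distinct (concat P)"
  defines "d \<equiv> \<lambda>x. map (Pair x) (P ! occ (map (map fst) W) x)"
    and "e \<equiv> \<lambda>y. map (\<lambda>x. (x, y)) (map fst (W ! occ P y))"
  shows "tens (map (\<lambda>ys. com (length ys)) P) \<cdot> tens (map word W) =
     tens (map (\<lambda>y. word (W ! occ P y)) (concat P)) \<cdot>
     perm (concat (map d (concat (map (map fst) W)))) (concat (map e (concat P))) \<cdot>
     tens (map (\<lambda>x. com (length (P ! occ (map (map fst) W) x))) (concat (map (map fst) W)))"
proof -
  let ?n = "length W" and ?V = "map (map fst) W"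
  let ?js = "[0..<length W]"
  let ?A = "\<lambda>j. tens (map (\<lambda>y. word (W ! j)) (P ! j))"
  let ?X = "\<lambda>j. concat (map (\<lambda>x. map (Pair x) (P ! j)) (?V ! j))"
  let ?Y = "\<lambda>j. concat (map (\<lambda>y. map (\<lambda>x. (x, y)) (?V ! j)) (P ! j))"
  let ?B = "\<lambda>j. perm (?X j) (?Y j)"
  let ?C = "\<lambda>j. tens (map (\<lambda>x. com (length (P ! j))) (?V ! j))"
  have lW: "labelled G (W ! j)" if "j < ?n" for j using lab that by (simp add: labelled_concat)
  have dV: "distinct (?V ! j)" if "j < ?n" for j
    using W that distinct_concat_iff[of ?V] nth_mem[of j ?V] by auto
  have dP: "distinct (P ! j)" if "j < ?n" for j
    using P that l distinct_concat_iff[of P] nth_mem[of j P] by auto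
  have r: "rearr (?X j) (?Y j)" if "j < ?n" for j
    using rearr_grid[OF dV dP] that by blast
  have X: "length (?X j) = length (W ! j) * length (P ! j)" "length (?Y j) = length (P ! j) * length (W ! j)" if "j < ?n" for j
    using that by (simp_all add: length_concat o_def sum_list_triv)
  \<comment> \<open>Over each point of the base the bimonoid law in all arities applies; the rest of
    the proof collects these factors into three tensor products.\<close>
  have ABC: "com (length (P ! j)) \<cdot> word (W ! j) = ?A j \<cdot> ?B j \<cdot> ?C j" if "j < ?n" for j
    using com_word[OF lW[OF that] _ dP[OF that]] dV[OF that] that by simp
  have A: "?A j \<in> Arr T" "Dom T (?A j) = length (P ! j) * length (W ! j)" "Cod T (?A j) = length (P ! j)" if "j < ?n" for j
    using lW[OF that] by (simp_all add: sum_list_triv)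
  have B: "?B j \<in> Arr T" "Dom T (?B j) = length (W ! j) * length (P ! j)" "Cod T (?B j) = length (P ! j) * length (W ! j)" if "j < ?n" for j
    using perm_arr[OF r[OF that]] X[OF that] by simp_all
  have C: "?C j \<in> Arr T" "Dom T (?C j) = length (W ! j)" "Cod T (?C j) = length (W ! j) * length (P ! j)" if "j < ?n" for j
    using that by (simp_all add: sum_list_triv)
  note dc = distrib_concat[OF l W P, folded d_def e_def]
  have "distinct (concat (map d (concat ?V)))" using dc(3) by (simp only: rearr_def)
  then have p: "tens (map ?B ?js) = perm (concat (map d (concat ?V))) (concat (map e (concat P)))"
    using perm_concat[of ?js ?X ?Y] r unfolding dc(1,2) by auto
  have tA: "tens (map ?A ?js) = tens (map (\<lambda>y. word (W ! occ P y)) (concat P))"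
  proof -
    have "tens (map tens (map (\<lambda>j. map (\<lambda>y. word (W ! j)) (P ! j)) ?js)) = tens (concat (map (\<lambda>j. map (\<lambda>y. word (W ! j)) (P ! j)) ?js))"
      by (rule tens_concat[symmetric]) (auto simp: lW)
    then show ?thesis
      by (simp add: o_def map_concat_occ[OF P l, of "\<lambda>j y. word (W ! j)"])
  qed
  have tC: "tens (map ?C ?js) = tens (map (\<lambda>x. com (length (P ! occ ?V x))) (concat ?V))"
  proof -
    have "tens (map tens (map (\<lambda>j. map (\<lambda>x. com (length (P ! j))) (?V ! j)) ?js)) = tens (concat (map (\<lambda>j. map (\<lambda>x. com (length (P ! j))) (?V ! j)) ?js))"
      by (rule tens_concat[symmetric]) auto
    then show ?thesis
      by (simp only: map_concat_occ[OF W length_map[symmetric], of "\<lambda>j x. com (length (P ! j))"] map_map o_def)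
  qed
  have "tens (map (\<lambda>ys. com (length ys)) P) \<cdot> tens (map word W) =
     tens (map (\<lambda>j. com (length (P ! j))) ?js) \<cdot> tens (map (\<lambda>j. word (W ! j)) ?js)"
    unfolding tens_nth[of _ P] tens_nth[of _ W] l ..
  also have "\<dots> = tens (map (\<lambda>j. com (length (P ! j)) \<cdot> word (W ! j)) ?js)"
    using lW by (subst tens_cmp) auto
  also have "\<dots> = tens (map (\<lambda>j. ?A j \<cdot> (?B j \<cdot> ?C j)) ?js)"
    using ABC by (intro arg_cong[of _ _ tens] map_cong) auto
  also have "\<dots> = tens (map ?A ?js) \<cdot> tens (map (\<lambda>j. ?B j \<cdot> ?C j) ?js)"
    by (rule tens_cmp[symmetric]; simp only: set_upt atLeastLessThan_iff A B C cmp_arr mult.commute)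
  also have "tens (map (\<lambda>j. ?B j \<cdot> ?C j) ?js) = tens (map ?B ?js) \<cdot> tens (map ?C ?js)"
    by (rule tens_cmp[symmetric]; simp only: set_upt atLeastLessThan_iff A B C)
  finally show "tens (map (\<lambda>ys. com (length ys)) P) \<cdot> tens (map word W) =
     tens (map (\<lambda>y. word (W ! occ P y)) (concat P)) \<cdot>
     perm (concat (map d (concat (map (map fst) W)))) (concat (map e (concat P))) \<cdot>
     tens (map (\<lambda>x. com (length (P ! occ (map (map fst) W) x))) (concat (map (map fst) W)))"
    unfolding p tA tC .
qed

lemma word_cong:
  assumes "map snd v = map snd w"
  shows "word v = word w"
proof -
  have "word v = mul (length (map snd v)) \<cdot> tens (map act (map snd v))" 
    by (simp add: word_def o_def split_def)
  moreover have "word w = mul (length (map snd w)) \<cdot> tens (map act (map snd w))"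
    by (simp add: word_def o_def split_def)
  ultimately show ?thesis by (simp only: assms)
qed

text \<open>In the composite of the two values the inner products followed by coproducts are
  rewritten by \<open>mul_com_distrib\<close>. Naturality moves the new comultiplications to the
  source and the new words to the target, where they merge with the outer ones, and the permutations
  between the four orders of \<open>gcomp_rearr\<close> compose to one.\<close>

lemma ev_gcomp:
  assumes s: "gvalid G s" and t: "gvalid G t" and l: "length (snd s) = length (fst t)"
  shows "ev (gcomp G t s) = ev t \<cdot> ev s"
proof -
  obtain F W where s_eq: "s = (F, W)" by fastforce
  obtain P V where t_eq: "t = (P, V)" by fastforce
  note vs = gvalidD[OF s, unfolded s_eq fst_conv snd_conv]
  note vt = gvalidD[OF t, unfolded t_eq fst_conv snd_conv]
  have l': "length W = length P" using l by (simp add: s_eq t_eq)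
  let ?vW = "concat (map (map fst) W)" and ?vV = "concat (map (map fst) V)"
  let ?oW = "occ (map (map fst) W)" and ?oP = "occ P"
  define d where "d = (\<lambda>x. map (Pair x) (P ! ?oW x))"
  define e where "e = (\<lambda>y. map (\<lambda>x. (x, y)) (map fst (W ! ?oP y)))"
  define u where "u = (\<lambda>y. word (W ! ?oP y))"
  define k where "k = (\<lambda>x. com (length (P ! ?oW x)))"
  note D = mul_com_distrib[OF l' vs(2) vs(5) vt(1), folded d_def e_def u_def k_def]
  note r2 = gcomp_rearr(1)[OF s t l, unfolded s_eq t_eq fst_conv snd_conv, folded d_def e_def]
    and r3 = gcomp_rearr(2)[OF s t l, unfolded s_eq t_eq fst_conv snd_conv, folded d_def e_def]
    and r4 = gcomp_rearr(3)[OF s t l, unfolded s_eq t_eq fst_conv snd_conv, folded d_def e_def]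
  define V' where "V' = map (\<lambda>v. concat (map (\<lambda>(y, b). map (\<lambda>(x, a). ((x, y), b \<otimes>\<^bsub>G\<^esub> a)) (W ! ?oP y)) v)) V"
  define F' where "F' = map (\<lambda>xs. concat (map d xs)) F"
  have g: "gcomp G t s = (F', V')"
    by (simp add: gcomp_def s_eq t_eq F'_def V'_def d_def)
  note cF = gcomp_strands(1)[of G t s, unfolded g, unfolded s_eq t_eq fst_conv snd_conv, folded d_def]
    and cV = gcomp_strands(2)[of G t s, unfolded g, unfolded s_eq t_eq fst_conv snd_conv, folded e_def]
  have oP: "?oP y < length W" if "(y, b) \<in> set v" "v \<in> set V" for y b v
  proof -
    have "y \<in> set ?vV" using that by force
    then have "y \<in> set (concat P)" using vt(3) by blast
    from occ_less(1)[OF this] show ?thesis using l' by simp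
  qed
  \<comment> \<open>The strands of \<open>gcomp\<close> are pairs while those of
    \<open>word_subst\<close> are not; \<open>word_cong\<close> compares the two words through their
    labels.\<close>
  have wV: "word v \<cdot> tens (map u (map fst v)) = word (concat (map (\<lambda>(y, b). map (\<lambda>(x, a). ((x, y), b \<otimes>\<^bsub>G\<^esub> a)) (W ! ?oP y)) v))"
    if v: "v \<in> set V" for v
  proof -
    have lv: "labelled G v" using vt(6) v .
    have ly: "labelled G (W ! ?oP y)" if "y \<in> fst ` set v" for y
      using that oP[OF _ v] vs(6) by force
    let ?c = "concat (map (\<lambda>(y, b). gact G b (W ! ?oP y)) v)"
    let ?c' = "concat (map (\<lambda>(y, b). map (\<lambda>(x, a). ((x, y), b \<otimes>\<^bsub>G\<^esub> a)) (W ! ?oP y)) v)"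
    have sn: "map snd ?c' = map snd ?c"
      by (simp add: map_concat o_def split_def gact_def)
    have "map u (map fst v) = map (\<lambda>(y, b). word (W ! ?oP y)) v"
      by (simp add: u_def split_def)
    then show "word v \<cdot> tens (map u (map fst v)) = word ?c'"
      by (simp only: word_cong[OF sn] word_subst[OF lv ly])
  qed
  let ?MV = "tens (map word V)" and ?MW = "tens (map word W)"
  let ?DP = "tens (map (\<lambda>ys. com (length ys)) P)" and ?DF = "tens (map (\<lambda>ys. com (length ys)) F)"
  let ?PV = "perm (concat P) ?vV" and ?PF = "perm (concat F) ?vW"
  let ?p2 = "perm (concat (map d (concat F))) (concat (map d ?vW))"
  let ?p3 = "perm (concat (map d ?vW)) (concat (map e (concat P)))"
  let ?p4 = "perm (concat (map e (concat P))) (concat (map e ?vV))"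
  let ?uP = "tens (map u (concat P))" and ?uV = "tens (map u ?vV)"
  let ?kW = "tens (map k ?vW)" and ?kF = "tens (map k (concat F))"
  have u: "u y \<in> Arr T" "Dom T (u y) = length (e y)" "Cod T (u y) = 1" if "y \<in> set (concat P)" for y
  proof -
    have "?oP y < length W" using occ_less(1)[OF that] l' by simp
    then have "labelled G (W ! ?oP y)" using vs(6) by simp
    then show "u y \<in> Arr T" "Dom T (u y) = length (e y)" "Cod T (u y) = 1"
      by (simp_all add: u_def e_def)
  qed
  have k: "k x \<in> Arr T" "Cod T (k x) = length (d x)" "Dom T (k x) = 1" for x
    by (simp_all add: k_def d_def)
  have sP: "set ?vV = set (concat P)" by (fact vt(3))
  have n1: "?PV \<cdot> ?uP = ?uV \<cdot> ?p4"
  proof -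
    have s: "distinct (concat (map (\<lambda>z. [z]) (concat P)))" using vt(1) by (simp only: concat_map_singleton map_ident)
    have "u x \<in> Arr T \<and> Dom T (u x) = length (e x) \<and> Cod T (u x) = length [x]" if "x \<in> set (concat P)" for x
      using u[OF that] by simp
    from perm_natural[OF vt(4) _ s this] r4 show ?thesis
      by (simp only: concat_map_singleton map_ident rearr_def)
  qed
  have n2: "?kW \<cdot> ?PF = ?p2 \<cdot> ?kF"
  proof -
    have s: "distinct (concat (map (\<lambda>z. [z]) (concat F)))" using vs(1) by (simp only: concat_map_singleton map_ident)
    have "k x \<in> Arr T \<and> Dom T (k x) = length [x] \<and> Cod T (k x) = length (d x)" for x
      using k by simp
    from perm_natural[OF vs(4) s _ this] r2 show ?thesis
      by (simp only: concat_map_singleton map_ident rearr_def)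
  qed
  have p: "?p4 \<cdot> ?p3 \<cdot> ?p2 = perm (concat F') (map fst (concat V'))"
  proof -
    have "rearr (concat (map d (concat F))) (concat (map e (concat P)))"
      using r2 r3 by (simp only: rearr_def)
    then show ?thesis
      unfolding cF cV by (simp only: perm_cmp[OF r2 r3] perm_cmp[OF _ r4])
  qed
  have MV: "?MV \<cdot> ?uV = tens (map word V')"
  proof -
    have uv: "u y \<in> Arr T" "Cod T (u y) = 1" if "v \<in> set V" "y \<in> set (map fst v)" for v y
    proof -
      have "y \<in> set ?vV" using that by auto
      then have "y \<in> set (concat P)" unfolding sP .
      then show "u y \<in> Arr T" "Cod T (u y) = 1" by (rule u)+
    qed
    have "?uV = tens (map (\<lambda>v. tens (map u (map fst v))) V)"
    proof -
      have "set us \<subseteq> Arr T" if us: "us \<in> set (map (map u) (map (map fst) V))" for us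
      proof -
        obtain v where "v \<in> set V" "us = map u (map fst v)" using us by auto
        then show ?thesis using uv(1)[of v] by (simp only: set_map image_subset_iff) blast
      qed
      then show ?thesis
        unfolding map_concat by (subst tens_concat) (simp_all add: o_def)
    qed
    also have "?MV \<cdot> \<dots> = tens (map (\<lambda>v. word v \<cdot> tens (map u (map fst v))) V)"
    proof (rule tens_cmp)
      fix v assume v: "v \<in> set V"
      show "tens (map u (map fst v)) \<in> Arr T"
        by (rule tens_map_arr(1)) (rule uv(1)[OF v])
      show "word v \<in> Arr T"
        using v vt(6) by simp
      have "map (\<lambda>y. Cod T (u y)) (map fst v) = map (\<lambda>_. 1) (map fst v)"
        using uv(2)[OF v] by (rule map_cong[OF refl])
      then show "Cod T (tens (map u (map fst v))) = Dom T (word v)"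
        using v vt(6) tens_map_arr(3)[of "map fst v" u, OF uv(1)[OF v]] by (simp add: sum_list_triv del: map_map map_eq_conv)
    qed
    also have "\<dots> = tens (map word V')"
      unfolding V'_def using wV by (simp add: o_def cong: map_cong)
    finally show ?thesis .
  qed
  \<comment> \<open>General coassociativity merges the comultiplications of the first left leg with
    the new ones.\<close>
  have DF: "?kF \<cdot> ?DF = tens (map (\<lambda>ys. com (length ys)) F')"
  proof -
    have "?kF = tens (map (\<lambda>xs. tens (map k xs)) F)"
      unfolding map_concat using k by (subst tens_concat) (auto simp: o_def)
    also have "\<dots> \<cdot> ?DF = tens (map (\<lambda>xs. tens (map k xs) \<cdot> com (length xs)) F)"
      by (rule tens_cmp) (simp_all add: k sum_list_triv)
    also have "(\<lambda>xs. tens (map k xs) \<cdot> com (length xs)) = (\<lambda>xs. com (length (concat (map d xs))))"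
    proof
      fix xs
      show "tens (map k xs) \<cdot> com (length xs) = com (length (concat (map d xs)))"
        using com_sum[of "\<lambda>x. length (P ! ?oW x)" xs]
        by (simp add: k_def[abs_def] d_def length_concat o_def)
    qed
    finally show ?thesis by (simp add: F'_def o_def)
  qed
  have ar: "?MV \<in> Arr T" "Dom T ?MV = length (concat V)" "?MW \<in> Arr T" "Dom T ?MW = length (concat W)" "Cod T ?MW = length W"
    "?DP \<in> Arr T" "Dom T ?DP = length P" "Cod T ?DP = length (concat P)" "?DF \<in> Arr T" "Cod T ?DF = length (concat F)"
    using vt(6) vs(6) by (simp_all add: length_concat sum_list_triv cong: map_cong)
  have lens: "length (concat F) = length (concat W)" "length (concat P) = length (concat V)"
    "length ?vW = length (concat W)" "length ?vV = length (concat V)"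
    using rearr_length[OF vs(4)] rearr_length[OF vt(4)] by (simp_all add: length_concat o_def)
  have pa: "?PV \<in> Arr T" "Dom T ?PV = length (concat V)" "Cod T ?PV = length (concat V)"
    "?PF \<in> Arr T" "Dom T ?PF = length (concat W)" "Cod T ?PF = length (concat W)"
    using perm_arr[OF vs(4)] perm_arr[OF vt(4)] lens by simp_all
  note p2 = perm_arr[OF r2] and p3 = perm_arr[OF r3] and p4 = perm_arr[OF r4]
  have uV: "u y \<in> Arr T \<and> Dom T (u y) = length (e y) \<and> Cod T (u y) = 1" if "y \<in> set ?vV" for y
    using u[of y] that unfolding sP by blast
  have uP: "u y \<in> Arr T \<and> Dom T (u y) = length (e y) \<and> Cod T (u y) = 1" if "y \<in> set (concat P)" for y
    using u[OF that] by blast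
  have kx: "k x \<in> Arr T \<and> Dom T (k x) = 1 \<and> Cod T (k x) = length (d x)" for x
    using k by simp
  have ta: "?uP \<in> Arr T" "Dom T ?uP = length (concat (map e (concat P)))" "Cod T ?uP = length (concat V)"
    unfolding length_concat_map using tens_map_hom[of "concat P" u, OF uP] lens(2) by (simp_all only: sum_list_triv of_nat_id mult_1_right)
  have tb: "?uV \<in> Arr T" "Dom T ?uV = length (concat (map e ?vV))" "Cod T ?uV = length (concat V)"
    unfolding length_concat_map using tens_map_hom[of ?vV u, OF uV] lens(4) by (simp_all only: sum_list_triv of_nat_id mult_1_right)
  have tc: "?kW \<in> Arr T" "Dom T ?kW = length (concat W)" "Cod T ?kW = length (concat (map d ?vW))"
    "?kF \<in> Arr T" "Dom T ?kF = length (concat F)" "Cod T ?kF = length (concat (map d (concat F)))"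
    unfolding length_concat_map using tens_map_hom[of ?vW k, OF kx] tens_map_hom[of "concat F" k, OF kx] lens(3) by (simp_all only: sum_list_triv of_nat_id mult_1_right)
  have "ev t \<cdot> ev s = (?MV \<cdot> (?PV \<cdot> ?DP)) \<cdot> (?MW \<cdot> (?PF \<cdot> ?DF))"
    by (simp add: ev_def s_eq t_eq map_concat)
  also have "\<dots> = ?MV \<cdot> (?PV \<cdot> ((?DP \<cdot> ?MW) \<cdot> (?PF \<cdot> ?DF)))"
    using ar pa lens l' by (simp only: cmp_assoc cmp_arr)
  also have "?DP \<cdot> ?MW = ?uP \<cdot> (?p3 \<cdot> ?kW)" by (fact D)
  also have "?MV \<cdot> (?PV \<cdot> ((?uP \<cdot> (?p3 \<cdot> ?kW)) \<cdot> (?PF \<cdot> ?DF))) = ?MV \<cdot> ((?PV \<cdot> ?uP) \<cdot> (?p3 \<cdot> ((?kW \<cdot> ?PF) \<cdot> ?DF)))"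
    using ar pa lens ta tc p3 by (simp only: cmp_assoc cmp_arr)
  also have "\<dots> = (?MV \<cdot> ?uV) \<cdot> ((?p4 \<cdot> (?p3 \<cdot> ?p2)) \<cdot> (?kF \<cdot> ?DF))"
    unfolding n1 n2 using ar lens tb tc p2 p3 p4 by (simp only: cmp_assoc cmp_arr)
  finally show "ev (gcomp G t s) = ev t \<cdot> ev s"
    unfolding MV DF p by (simp add: ev_def g)
qed

end

section \<open>Renaming, tensor products, identities and symmetries of spans with arbitrary
  strands\<close>

definition grename :: "('s \<Rightarrow> 't) \<Rightarrow> ('s, 'g) gspan \<Rightarrow> ('t, 'g) gspan" where
  "grename \<rho> s = (map (map \<rho>) (fst s), map (map (\<lambda>(x, a). (\<rho> x, a))) (snd s))"

definition gtensor :: "('s, 'g) gspan \<Rightarrow> ('t, 'g) gspan \<Rightarrow> ('s + 't, 'g) gspan" where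
  "gtensor s t =
     (map (map Inl) (fst s) @ map (map Inr) (fst t),
      map (map (\<lambda>(x, a). (Inl x, a))) (snd s) @ map (map (\<lambda>(x, a). (Inr x, a))) (snd t))"

definition gid :: "('g, 'w) monoid_scheme \<Rightarrow> nat \<Rightarrow> (nat, 'g) gspan" where
  "gid G n = (map (\<lambda>i. [i]) [0..<n], map (\<lambda>i. [(i, \<one>\<^bsub>G\<^esub>)]) [0..<n])"

definition gsym :: "('g, 'w) monoid_scheme \<Rightarrow> nat \<Rightarrow> nat \<Rightarrow> (nat, 'g) gspan" where
  "gsym G m n = (map (\<lambda>i. [i]) [0..<m + n],
     map (\<lambda>i. [(i, \<one>\<^bsub>G\<^esub>)]) [m..<m + n] @ map (\<lambda>i. [(i, \<one>\<^bsub>G\<^esub>)]) [0..<m])"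

lemma map_fst_concat: "map fst (concat ws) = concat (map (map fst) ws)"
  by (simp add: map_concat)

lemma rename_simps:
  "map fst (map (\<lambda>(x, a). (\<rho> x, a)) w) = map \<rho> (map fst w)"
  "snd ` set (map (\<lambda>(x, a). (\<rho> x, a)) w) = snd ` set w"
  by (auto simp: image_image split_def)

lemma concat_map_single: "concat (map (\<lambda>x. [f x]) xs) = map f xs"
  by (induction xs) auto

lemma rearr_map: "inj_on \<rho> (set xs) \<Longrightarrow> rearr xs ys \<Longrightarrow> rearr (map \<rho> xs) (map \<rho> ys)"
  unfolding rearr_def by (metis distinct_map list.set_map)

lemma rearr_append:
  "\<lbrakk>rearr xs ys; rearr xs' ys'; set xs \<inter> set xs' = {}\<rbrakk> \<Longrightarrow> rearr (xs @ xs') (ys @ ys')"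
  by (auto simp: rearr_def)

lemma gvalid_grename:
  assumes "gvalid G s" "inj_on \<rho> (set (concat (fst s)))"
  shows "gvalid G (grename \<rho> s)"
proof -
  have "rearr (map \<rho> (concat (fst s))) (map \<rho> (map fst (concat (snd s))))"
    using assms unfolding gvalid_def by (intro rearr_map) auto
  then show ?thesis
    using assms unfolding gvalid_def grename_def
    by (simp only: fst_conv snd_conv rename_simps map_concat[symmetric])
qed

lemma gvalid_gtensor:
  assumes "gvalid G s" "gvalid G t"
  shows "gvalid G (gtensor s t)"
proof -
  have "rearr (map Inl (concat (fst s)) @ map Inr (concat (fst t)))
     (map Inl (map fst (concat (snd s))) @ map Inr (map fst (concat (snd t))))"
    using assms unfolding gvalid_def by (intro rearr_append rearr_map) auto
  then show ?thesis
    using assms unfolding gvalid_def gtensor_def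
    by (simp only: fst_conv snd_conv concat_append map_append rename_simps map_concat[symmetric] set_append image_Un Un_subset_iff simp_thms)
qed

lemma gvalid_gid: "group G \<Longrightarrow> gvalid G (gid G n)"
  by (auto simp: gvalid_def gid_def rearr_def map_concat o_def concat_map_single group.is_monoid intro: monoid.one_closed)

lemma gvalid_gsym: "group G \<Longrightarrow> gvalid G (gsym G m n)"
  by (auto simp: gvalid_def gsym_def rearr_def map_concat o_def concat_map_single group.is_monoid intro: monoid.one_closed)

context gbimonoid_in_prop
begin

lemma word_rename [simp]: "word (map (\<lambda>(x, a). (f x, a)) w) = word w"
  by (rule word_cong) auto

text \<open>By \<open>perm_map\<close> a rearrangement is unchanged by injective renaming, and words
  see labels only. This makes evaluation constant on classes.\<close>

lemma ev_grename:
  assumes "gvalid G s" "inj_on \<rho> (set (concat (fst s)))"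
  shows "ev (grename \<rho> s) = ev s"
proof -
  have "perm (map \<rho> (concat (fst s))) (map \<rho> (map fst (concat (snd s)))) = perm (concat (fst s)) (map fst (concat (snd s)))"
    using assms by (intro perm_map) (auto simp: gvalid_def)
  moreover have "map word (map (map (\<lambda>(x, a). (\<rho> x, a))) (snd s)) = map word (snd s)"
    by (auto intro!: word_cong)
  ultimately show ?thesis
    unfolding ev_def grename_def fst_conv snd_conv rename_simps map_concat[symmetric]
    by (simp only: map_map o_def length_map)
qed

lemma ev_gtensor:
  assumes s: "gvalid G s" and t: "gvalid G t"
  shows "ev (gtensor s t) = ev s \<star> ev t"
proof -
  let ?Ms = "tens (map word (snd s))" and ?Mt = "tens (map word (snd t))"
  let ?Ds = "tens (map (\<lambda>xs. com (length xs)) (fst s))" and ?Dt = "tens (map (\<lambda>xs. com (length xs)) (fst t))"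
  let ?Ps = "perm (concat (fst s)) (map fst (concat (snd s)))" and ?Pt = "perm (concat (fst t)) (map fst (concat (snd t)))"
  have r: "rearr (concat (fst s)) (map fst (concat (snd s)))" "rearr (concat (fst t)) (map fst (concat (snd t)))"
    using s t by (simp_all add: gvalid_def)
  note vs = gvalidD[OF s] and vt = gvalidD[OF t]
  have ri: "rearr (map Inl (concat (fst s))) (map Inl (map fst (concat (snd s))))"
    "rearr (map Inr (concat (fst t))) (map Inr (map fst (concat (snd t))))"
    using rearr_map[OF inj_on_subset[OF inj_Inl subset_UNIV] r(1)] rearr_map[OF inj_on_subset[OF inj_Inr subset_UNIV] r(2)] by simp_all
  have P: "perm (map Inl (concat (fst s)) @ map Inr (concat (fst t)))
     (map Inl (map fst (concat (snd s))) @ map Inr (map fst (concat (snd t)))) = ?Ps \<star> ?Pt"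
  proof -
    have "set (map Inl (concat (fst s))) \<inter> set (map Inr (concat (fst t))) = {}" by auto
    from perm_append[OF ri this] show ?thesis
      by (simp only: perm_map[OF inj_on_subset[OF inj_Inl subset_UNIV] r(1)]
          perm_map[OF inj_on_subset[OF inj_Inr subset_UNIV] r(2)])
  qed
  have M: "tens (map word (snd (gtensor s t))) = ?Ms \<star> ?Mt"
  proof -
    show ?thesis using vs(6) vt(6)
      by (simp add: gtensor_def o_def) (subst tens_append, auto)
  qed
  have D: "tens (map (\<lambda>xs. com (length xs)) (fst (gtensor s t))) = ?Ds \<star> ?Dt"
    by (simp add: gtensor_def o_def) (subst tens_append, auto)
  have a: "?Ms \<in> Arr T" "Dom T ?Ms = length (map fst (concat (snd s)))" "?Mt \<in> Arr T" "Dom T ?Mt = length (map fst (concat (snd t)))"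
    "?Ds \<in> Arr T" "Cod T ?Ds = length (concat (fst s))" "?Dt \<in> Arr T" "Cod T ?Dt = length (concat (fst t))"
    using vs(6) vt(6) by (simp_all add: length_concat cong: map_cong)
  have "ev (gtensor s t) = (?Ms \<star> ?Mt) \<cdot> ((?Ps \<star> ?Pt) \<cdot> (?Ds \<star> ?Dt))"
    unfolding ev_def M D P[symmetric]
    by (simp only: gtensor_def fst_conv snd_conv concat_append map_append rename_simps map_concat[symmetric])
  also have "\<dots> = ev s \<star> ev t"
    using a perm_arr[OF r(1)] perm_arr[OF r(2)] by (simp add: ev_def ten_cmp)
  finally show ?thesis .
qed

lemma word_single: "word [(x, \<one>\<^bsub>G\<^esub>)] = Ident T 1"
  by (simp add: word_def act_one del: mul.simps)

text \<open>A fibre with a single unlabelled strand contributes an identity on either leg, so that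
  the permutation is left.\<close>

lemma ev_singles:
  assumes "rearr xs ys"
  shows "ev (map (\<lambda>x. [x]) xs, map (\<lambda>y. [(y, \<one>\<^bsub>G\<^esub>)]) ys) = perm xs ys"
  using assms
  by (simp add: ev_def o_def word_single concat_map_single sum_list_triv del: com.simps)

lemma ev_gid: "ev (gid G n) = Ident T n"
  unfolding gid_def by (subst ev_singles) (auto simp: rearr_def)

lemma ev_gsym: "ev (gsym G m n) = Sym T m n"
proof -
  have "[0..<m + n] = [0..<m] @ [m..<m + n]" using upt_add_eq_append[of 0 m n] by simp
  then have "perm [0..<m + n] ([m..<m + n] @ [0..<m]) = Sym T m n"
    using perm_Sym[of "[0..<m]" "[m..<m + n]"] by auto
  then show ?thesis
    unfolding gsym_def map_append[symmetric] by (subst ev_singles) (auto simp: rearr_def)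
qed

text \<open>The value of a span is assembled from generators, symmetries and identities. Applied in
  the composite PROP, where a class is the value of its span, this becomes
  \<open>TG_induct\<close>.\<close>

lemma ev_induct:
  assumes s: "gvalid G s"
    and I: "\<And>n. Q (Ident T n)" and S: "\<And>m n. Q (Sym T m n)"
    and gen: "Q \<mu>" "Q \<eta>" "Q \<Delta>" "Q \<epsilon>" "\<And>g. g \<in> carrier G \<Longrightarrow> Q (act g)"
    and c: "\<And>f g. \<lbrakk>f \<in> Arr T; g \<in> Arr T; Cod T f = Dom T g; Q f; Q g\<rbrakk> \<Longrightarrow> Q (g \<cdot> f)"
    and t: "\<And>f g. \<lbrakk>f \<in> Arr T; g \<in> Arr T; Q f; Q g\<rbrakk> \<Longrightarrow> Q (f \<star> g)"
  shows "Q (ev s)"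
proof -
  have T: "Q (tens us)" if "\<And>u. u \<in> set us \<Longrightarrow> u \<in> Arr T \<and> Q u" for us
    using that by (induction us) (auto intro!: t I simp: image_subset_iff subset_iff)
  have mul: "Q (mul n)" for n
    by (induction n) (auto intro!: t c I gen simp del: One_nat_def)
  have com: "Q (com n)" for n
    by (induction n) (auto intro!: t c I gen)
  have perm: "Q (perm xs ys)" if "rearr xs ys" for xs ys :: "'x list"
    using that
  proof (induction ys arbitrary: xs)
    case (Cons y ys)
    have y: "y \<in> set xs" using Cons.prems by (auto simp: rearr_def)
    note r = rearr_Cons[OF Cons.prems]
    have "Q (bring y xs)" unfolding bring_def by (auto intro!: t I S)
    then show ?case using y r rearr_length[OF r] rearr_length[OF Cons.prems] Cons.IH[OF r]
      by (auto intro!: c t I)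
  qed (simp add: I)
  have word: "Q (word w)" if "labelled G w" for w :: "('x \<times> 'g) list"
    unfolding word_def using that
    by (intro c T mul) (auto dest: labelledD intro: gen)
  note v = gvalidD[OF s]
  have r: "rearr (concat (fst s)) (map fst (concat (snd s)))" using s by (simp add: gvalid_def)
  show ?thesis
    unfolding ev_def using v(6) r rearr_length[OF r]
    by (intro c T perm) (auto simp: word com length_concat simp del: map_concat cong: map_cong)
qed

end

section \<open>Spans and their equivalence classes\<close>

definition strands :: "('s, 'g) gspan \<Rightarrow> 's set" where
  "strands s = set (concat (fst s))"

text \<open>The span with middle object \<open>n\<close> obtained by numbering the strands by \<open>\<rho>\<close> and changing
  the labels of both legs by \<open>c\<close>.\<close>

definition lift :: "('g, 'w) monoid_scheme \<Rightarrow> ('s \<Rightarrow> nat) \<Rightarrow> ('s \<Rightarrow> 'g) \<Rightarrow> nat \<Rightarrow> ('s, 'g) gspan \<Rightarrow> 'g lspan" where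
  "lift G \<rho> c n s =
     (\<lparr>src = n, fibres = map (map (\<lambda>x. (\<rho> x, c x))) (fst s)\<rparr>,
      \<lparr>src = n, fibres = map (map (\<lambda>(x, a). (\<rho> x, a \<otimes>\<^bsub>G\<^esub> c x))) (snd s)\<rparr>)"

text \<open>An orbit under renumbering and relabelling; \<open>span_class_gcls\<close> shows that it
  is the equivalence class of each of its members.\<close>

definition gcls :: "('g, 'w) monoid_scheme \<Rightarrow> ('s, 'g) gspan \<Rightarrow> 'g lspan set" where
  "gcls G s = {lift G \<rho> c n s | \<rho> c n. bij_betw \<rho> (strands s) {..<n} \<and> c ` strands s \<subseteq> carrier G}"

lemma gclsI: "bij_betw \<rho> (strands s) {..<n} \<Longrightarrow> c ` strands s \<subseteq> carrier G \<Longrightarrow> lift G \<rho> c n s \<in> gcls G s"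
  unfolding gcls_def by blast

lemma gclsE:
  assumes "A \<in> gcls G s"
  obtains \<rho> c n where "A = lift G \<rho> c n s" "bij_betw \<rho> (strands s) {..<n}" "c ` strands s \<subseteq> carrier G"
  using assms unfolding gcls_def by blast

lemma lmap_eq:
  assumes "is_lmor G f" "i < tgt f" "j \<in> fst ` set (fibre f i)"
  shows "lmap f j = i"
  unfolding lmap_def
proof (rule the_equality)
  show "i < tgt f \<and> j \<in> fst ` set (fibre f i)" using assms by simp
  fix i' assume i': "i' < tgt f \<and> j \<in> fst ` set (fibre f i')"
  have d: "distinct (concat (map (map fst) (fibres f)))"
    using assms(1) by (simp add: is_lmor_def map_concat)
  have "occ (map (map fst) (fibres f)) j = k" if "k < tgt f" "j \<in> fst ` set (fibre f k)" for k
    using that by (intro occ_eq[OF d]) (auto simp: tgt_def fibre_def)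
  from this[of i] this[of i'] assms i' show "i' = i" by simp
qed

lemma strands_snd: "gvalid G s \<Longrightarrow> strands s = fst ` set (concat (snd s))"
  unfolding gvalid_def rearr_def strands_def set_map by simp

lemma finite_strands [simp]: "finite (strands s)"
  by (simp add: strands_def)

lemma is_lmor_fst_lift:
  assumes s: "gvalid G s" and \<rho>: "bij_betw \<rho> (strands s) {..<n}" and c: "c ` strands s \<subseteq> carrier G"
  shows "is_lmor G (fst (lift G \<rho> c n s))"
proof -
  have e: "concat (fibres (fst (lift G \<rho> c n s))) = map (\<lambda>x. (\<rho> x, c x)) (concat (fst s))"
    by (simp add: lift_def map_concat)
  have "distinct (concat (fst s))" using s by (simp add: gvalid_def rearr_def)
  then show ?thesis
    unfolding is_lmor_def e using \<rho> c
    by (auto simp: lift_def bij_betw_def strands_def distinct_map o_def image_image simp del: set_concat)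
qed

lemma is_lmor_snd_lift:
  assumes G: "group G" and s: "gvalid G s" and \<rho>: "bij_betw \<rho> (strands s) {..<n}" and c: "c ` strands s \<subseteq> carrier G"
  shows "is_lmor G (snd (lift G \<rho> c n s))"
proof -
  have e: "concat (fibres (snd (lift G \<rho> c n s))) = map (\<lambda>(x, a). (\<rho> x, a \<otimes>\<^bsub>G\<^esub> c x)) (concat (snd s))"
    by (simp add: lift_def map_concat)
  have m: "map fst (map (\<lambda>(x, a). (\<rho> x, a \<otimes>\<^bsub>G\<^esub> c x)) (concat (snd s))) = map \<rho> (map fst (concat (snd s)))"
    by auto
  have d: "distinct (map fst (concat (snd s)))" "snd ` set (concat (snd s)) \<subseteq> carrier G"
    using s by (simp_all add: gvalid_def rearr_def)
  have "distinct (map \<rho> (map fst (concat (snd s))))"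
    using d \<rho> unfolding strands_snd[OF s] bij_betw_def by (simp only: distinct_map[of \<rho>] set_map)
  moreover have "set (map \<rho> (map fst (concat (snd s)))) = {..<n}"
    using \<rho> unfolding strands_snd[OF s] bij_betw_def by (simp only: set_map)
  moreover have "a \<otimes>\<^bsub>G\<^esub> c x \<in> carrier G" if "(x, a) \<in> set (concat (snd s))" for x a
  proof -
    have "x \<in> strands s" "a \<in> carrier G" using d(2) that unfolding strands_snd[OF s] by force+
    then show ?thesis using c G by (auto simp: group.is_monoid monoid.m_closed)
  qed
  ultimately show ?thesis
    unfolding is_lmor_def e m set_map[of fst, symmetric] by (auto simp: lift_def simp del: set_concat)
qed

lemma is_span_lift:
  assumes "group G" "gvalid G s" "bij_betw \<rho> (strands s) {..<n}" "c ` strands s \<subseteq> carrier G"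
  shows "is_span G (lift G \<rho> c n s)"
  using is_lmor_fst_lift[OF assms(2-4)] is_lmor_snd_lift[OF assms] by (simp add: is_span_def) (simp add: lift_def)

lemma tgt_lift [simp]:
  "tgt (fst (lift G \<rho> c n s)) = length (fst s)" "tgt (snd (lift G \<rho> c n s)) = length (snd s)"
  "src (fst (lift G \<rho> c n s)) = n" "src (snd (lift G \<rho> c n s)) = n"
  by (simp_all add: lift_def tgt_def)

lemma fibre_lift:
  "i < length (fst s) \<Longrightarrow> fibre (fst (lift G \<rho> c n s)) i = map (\<lambda>x. (\<rho> x, c x)) (fst s ! i)"
  "i < length (snd s) \<Longrightarrow> fibre (snd (lift G \<rho> c n s)) i = map (\<lambda>(x, a). (\<rho> x, a \<otimes>\<^bsub>G\<^esub> c x)) (snd s ! i)"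
  by (simp_all add: lift_def fibre_def)

lemma lmap_lift:
  assumes G: "group G" and s: "gvalid G s" and \<rho>: "bij_betw \<rho> (strands s) {..<n}" and c: "c ` strands s \<subseteq> carrier G"
    and x: "x \<in> strands s"
  shows "lmap (fst (lift G \<rho> c n s)) (\<rho> x) = occ (fst s) x"
    and "lmap (snd (lift G \<rho> c n s)) (\<rho> x) = occ (map (map fst) (snd s)) x"
proof -
  have "x \<in> set (concat (fst s))" using x by (simp add: strands_def)
  from occ_less[OF this] show "lmap (fst (lift G \<rho> c n s)) (\<rho> x) = occ (fst s) x"
    by (intro lmap_eq[OF is_lmor_fst_lift[OF s \<rho> c]]) (force simp: fibre_lift)+
  have "x \<in> set (concat (map (map fst) (snd s)))" using x unfolding strands_snd[OF s] map_fst_concat[symmetric] by simp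
  from occ_less[OF this] show "lmap (snd (lift G \<rho> c n s)) (\<rho> x) = occ (map (map fst) (snd s)) x"
    by (intro lmap_eq[OF is_lmor_snd_lift[OF G s \<rho> c]]) (force simp: fibre_lift)+
qed

lemma numbering_exists: "\<exists>\<rho>. bij_betw \<rho> (strands s) {..<card (strands s)}"
  using ex_bij_betw_finite_nat[OF finite_strands, of s] by (simp add: atLeast0LessThan)

lemma gcls_ex:
  assumes "group G"
  obtains \<rho> n where "bij_betw \<rho> (strands s) {..<n}" "(\<lambda>_. \<one>\<^bsub>G\<^esub>) ` strands s \<subseteq> carrier G"
    "lift G \<rho> (\<lambda>_. \<one>\<^bsub>G\<^esub>) n s \<in> gcls G s"
proof -
  obtain \<rho> where "bij_betw \<rho> (strands s) {..<card (strands s)}" using numbering_exists by blast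
  moreover have "(\<lambda>_. \<one>\<^bsub>G\<^esub>) ` strands s \<subseteq> carrier G" using assms by (auto simp: group.is_monoid intro: monoid.one_closed)
  ultimately show thesis using that gclsI by meson
qed

lemma strands_grename: "strands (grename \<rho> s) = \<rho> ` strands s"
  by (auto simp: strands_def grename_def)

lemma lift_grename: "lift G \<sigma> c n (grename \<rho> s) = lift G (\<sigma> \<circ> \<rho>) (c \<circ> \<rho>) n s"
  by (simp add: lift_def grename_def o_def split_def)

lemma lift_cong:
  assumes "gvalid G s" "\<And>x. x \<in> strands s \<Longrightarrow> \<rho> x = \<rho>' x" "\<And>x. x \<in> strands s \<Longrightarrow> c x = c' x"
  shows "lift G \<rho> c n s = lift G \<rho>' c' n s"
proof -
  have "x \<in> strands s" if "(x, a) \<in> set w" "w \<in> set (snd s)" for x a w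
    using that unfolding strands_snd[OF assms(1)] by force
  moreover have "x \<in> strands s" if "x \<in> set w" "w \<in> set (fst s)" for x w
    using that unfolding strands_def by auto
  ultimately show ?thesis using assms(2,3)
    by (simp add: lift_def) (intro conjI ballI; force)
qed

lemma gcls_grename:
  assumes s: "gvalid G s" and \<rho>: "inj_on \<rho> (strands s)"
  shows "gcls G (grename \<rho> s) = gcls G s"
proof (intro equalityI subsetI)
  fix A assume "A \<in> gcls G (grename \<rho> s)"
  then obtain \<sigma> c n where A: "A = lift G \<sigma> c n (grename \<rho> s)" "bij_betw \<sigma> (\<rho> ` strands s) {..<n}"
    "c ` \<rho> ` strands s \<subseteq> carrier G"
    by (metis gclsE strands_grename)
  have "bij_betw (\<sigma> \<circ> \<rho>) (strands s) {..<n}"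
    using A(2) \<rho> by (metis bij_betw_imageI bij_betw_trans)
  then show "A \<in> gcls G s"
    unfolding A(1) lift_grename using A(3) by (intro gclsI) (auto simp: image_image)
next
  fix A assume "A \<in> gcls G s"
  then obtain \<sigma> c n where A: "A = lift G \<sigma> c n s" "bij_betw \<sigma> (strands s) {..<n}" "c ` strands s \<subseteq> carrier G"
    by (rule gclsE)
  let ?\<theta> = "inv_into (strands s) \<rho>"
  have b: "bij_betw ?\<theta> (\<rho> ` strands s) (strands s)"
    using \<rho> by (simp add: bij_betw_inv_into inj_on_imp_bij_betw)
  have "bij_betw (\<sigma> \<circ> ?\<theta>) (strands (grename \<rho> s)) {..<n}"
    unfolding strands_grename using b A(2) by (rule bij_betw_trans)
  moreover have "(c \<circ> ?\<theta>) ` strands (grename \<rho> s) \<subseteq> carrier G"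
    unfolding strands_grename using A(3) \<rho> by auto
  moreover have "lift G (\<sigma> \<circ> ?\<theta>) (c \<circ> ?\<theta>) n (grename \<rho> s) = A"
    unfolding A(1) lift_grename using \<rho> by (intro lift_cong[OF s]) auto
  ultimately show "A \<in> gcls G (grename \<rho> s)" unfolding gcls_def by blast
qed

text \<open>A common member provides the renaming: number the strands of \<open>s\<close>, then read
  these numbers in \<open>t\<close>. The left legs show that the two relabellings correspond under
  it, and therefore they cancel on the right legs, leaving the original labels.\<close>

lemma gcls_eqD:
  assumes G: "group G" and s: "gvalid G s" and t: "gvalid G t"
    and A: "A \<in> gcls G s" "A \<in> gcls G t"
  obtains \<theta> where "inj_on \<theta> (strands s)" "t = grename \<theta> s"
proof -
  interpret group G by fact
  obtain \<rho> c n where r: "A = lift G \<rho> c n s" "bij_betw \<rho> (strands s) {..<n}" "c ` strands s \<subseteq> carrier G"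
    using A(1) by (rule gclsE)
  obtain \<sigma> d m where q: "A = lift G \<sigma> d m t" "bij_betw \<sigma> (strands t) {..<m}" "d ` strands t \<subseteq> carrier G"
    using A(2) by (rule gclsE)
  have nm: "m = n" and f: "map (map (\<lambda>x. (\<rho> x, c x))) (fst s) = map (map (\<lambda>x. (\<sigma> x, d x))) (fst t)"
    and w: "map (map (\<lambda>(x, a). (\<rho> x, a \<otimes>\<^bsub>G\<^esub> c x))) (snd s) = map (map (\<lambda>(x, a). (\<sigma> x, a \<otimes>\<^bsub>G\<^esub> d x))) (snd t)"
    using r(1) q(1) by (simp_all add: lift_def)
  let ?i = "inv_into (strands t) \<sigma>"
  define \<theta> where "\<theta> = ?i \<circ> \<rho>"
  have i: "?i (\<sigma> x) = x" if "x \<in> strands t" for x using q(2) that by (simp add: bij_betw_def)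
  have b: "bij_betw \<theta> (strands s) (strands t)"
    unfolding \<theta>_def using r(2) bij_betw_inv_into[OF q(2)] nm by (auto intro: bij_betw_trans)
  have d: "d (\<theta> x) = c x" if "x \<in> strands s" for x
  proof -
    have "(\<rho> x, c x) \<in> set (concat (map (map (\<lambda>x. (\<rho> x, c x))) (fst s)))"
      using that by (auto simp: strands_def)
    then obtain y where "y \<in> strands t" "\<rho> x = \<sigma> y" "c x = d y"
      unfolding f by (auto simp: strands_def)
    then show ?thesis using i by (simp add: \<theta>_def)
  qed
  have "map (map (?i \<circ> fst)) (map (map (\<lambda>x. (\<sigma> x, d x))) (fst t)) = fst t"
    by (auto simp: o_def intro!: map_idI i) (auto simp: strands_def)
  then have "fst t = map (map (?i \<circ> fst)) (map (map (\<lambda>x. (\<sigma> x, d x))) (fst t))" ..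
  also have "\<dots> = map (map \<theta>) (fst s)"
    unfolding f[symmetric] by (simp add: \<theta>_def o_def)
  finally have 1: "fst t = map (map \<theta>) (fst s)" .
  \<comment> \<open>Undoes numbering and relabelling of the right leg of \<open>t\<close>: the
    factor \<open>d\<close> is divided off on the right.\<close>
  define h where "h = (\<lambda>(k, b). (?i k, b \<otimes>\<^bsub>G\<^esub> inv\<^bsub>G\<^esub> (d (?i k))))"
  have ht: "h (\<sigma> x, a \<otimes>\<^bsub>G\<^esub> d x) = (x, a)" if "(x, a) \<in> set w" "w \<in> set (snd t)" for x a w
  proof -
    have x: "x \<in> strands t" unfolding strands_snd[OF t] using that by force
    have "a \<in> carrier G" using gvalidD(6)[OF t that(2)] that(1) by (rule labelledD)
    then show ?thesis using x q(3) by (auto simp: h_def i m_assoc)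
  qed
  have hs: "h (\<rho> x, a \<otimes>\<^bsub>G\<^esub> c x) = (\<theta> x, a)" if "(x, a) \<in> set w" "w \<in> set (snd s)" for x a w
  proof -
    have x: "x \<in> strands s" unfolding strands_snd[OF s] using that by force
    have "a \<in> carrier G" using gvalidD(6)[OF s that(2)] that(1) by (rule labelledD)
    then show ?thesis using x r(3) d[OF x] by (auto simp: h_def \<theta>_def m_assoc)
  qed
  have "map (map h) (map (map (\<lambda>(x, a). (\<sigma> x, a \<otimes>\<^bsub>G\<^esub> d x))) (snd t)) = snd t"
    using ht by (auto simp: o_def intro!: map_idI)
  then have "snd t = map (map h) (map (map (\<lambda>(x, a). (\<sigma> x, a \<otimes>\<^bsub>G\<^esub> d x))) (snd t))" ..
  also have "\<dots> = map (map (\<lambda>(x, a). (\<theta> x, a))) (snd s)"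
    unfolding w[symmetric] using hs by (auto simp: o_def)
  finally have "t = grename \<theta> s" using 1 by (simp add: grename_def prod_eq_iff)
  moreover have "inj_on \<theta> (strands s)" using b by (simp add: bij_betw_def)
  ultimately show thesis using that by blast
qed


section \<open>Labelled bijections acting on spans\<close>

lemma lbij_fibre:
  assumes "lbij G n h" "j < n"
  obtains k a where "fibre h j = [(k, a)]" "k < n" "a \<in> carrier G"
proof -
  have h: "is_lmor G h" "tgt h = n" "src h = n" "bij_betw (lmap h) {..<n} {..<n}" using assms(1) by (auto simp: lbij_def)
  have mem: "fibre h j \<in> set (fibres h)" using assms(2) h(2) by (simp add: tgt_def fibre_def)
  have d: "distinct (map fst (fibre h j))"
  proof -
    have "distinct (concat (map (map fst) (fibres h)))"
      using h(1) by (simp add: is_lmor_def map_concat)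
    then show ?thesis using mem unfolding distinct_concat_iff by auto
  qed
  have sub: "k < n" "a \<in> carrier G" if "(k, a) \<in> set (fibre h j)" for k a
  proof -
    have "(k, a) \<in> set (concat (fibres h))" using that mem by auto
    then show "k < n" "a \<in> carrier G" using h(1,3) unfolding is_lmor_def by force+
  qed
  have l: "lmap h k = j" if "k \<in> fst ` set (fibre h j)" for k
    using lmap_eq[OF h(1)] assms(2) h(2) that by blast
  have inj: "k = k'" if "(k, a) \<in> set (fibre h j)" "(k', a') \<in> set (fibre h j)" for k k' a a'
  proof -
    have "lmap h k = j" "lmap h k' = j" using l that by force+
    then show ?thesis using h(4) sub(1) that unfolding bij_betw_def inj_on_def by (metis lessThan_iff)
  qed
  have "j \<in> lmap h ` {..<n}" using h(4) assms(2) by (simp add: bij_betw_def)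
  then obtain k where k: "k < n" "lmap h k = j" by auto
  then have "k \<in> set (map fst (concat (fibres h)))" using h(1,3) by (simp add: is_lmor_def del: set_concat)
  then have "k \<in> set (concat (map (map fst) (fibres h)))" by (simp only: map_concat)
  from occ_less[OF this] obtain i where i: "i < n" "k \<in> fst ` set (fibre h i)"
    using h(2) by (auto simp: fibre_def tgt_def)
  then have "i = j" using lmap_eq[OF h(1)] h(2) k(2) by blast
  with i obtain a where a: "(k, a) \<in> set (fibre h j)" by auto
  have "set (map fst (fibre h j)) = {k}" using a inj by force
  then have "length (fibre h j) = 1"
    using distinct_card[OF d] by simp
  then obtain p where "fibre h j = [p]" by (auto simp: length_Suc_conv)
  then have "fibre h j = [(k, a)]" using a by simp
  then show thesis using that sub a by blast
qed

text \<open>Precomposition acts at the inner end of both legs, hence multiplies their labels from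
  the right by the same \<open>g x\<close>. This is the origin of the form of
  \<open>lift\<close>.\<close>

lemma lcomp_lift_bij:
  assumes G: "group G" and s: "gvalid G s" and c: "c ` strands s \<subseteq> carrier G" and g: "g ` strands s \<subseteq> carrier G"
    and \<rho>: "\<rho> ` strands s \<subseteq> {..<n}"
    and h: "\<And>x. x \<in> strands s \<Longrightarrow> fibre h (\<rho> x) = [(\<sigma> x, g x)]" "src h = m"
  shows "(lcomp G (fst (lift G \<rho> c n s)) h, lcomp G (snd (lift G \<rho> c n s)) h) = lift G \<sigma> (\<lambda>x. c x \<otimes>\<^bsub>G\<^esub> g x) m s"
proof -
  have m: "x \<in> strands s" "a \<in> carrier G" if "(x, a) \<in> set w" "w \<in> set (snd s)" for x a w
    using that labelledD[OF gvalidD(6)[OF s that(2)]] unfolding strands_snd[OF s] by force+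
  have m': "x \<in> strands s" if "x \<in> set w" "w \<in> set (fst s)" for x w
    using that unfolding strands_def by auto
  have "concat (map (\<lambda>(j, a). lact G a (fibre h j)) (map (\<lambda>x. (\<rho> x, c x)) w)) = map (\<lambda>x. (\<sigma> x, c x \<otimes>\<^bsub>G\<^esub> g x)) w"
    if "w \<in> set (fst s)" for w
  proof -
    have "map (\<lambda>(j, a). lact G a (fibre h j)) (map (\<lambda>x. (\<rho> x, c x)) w) = map (\<lambda>x. [(\<sigma> x, c x \<otimes>\<^bsub>G\<^esub> g x)]) w"
      using h m'[OF _ that] by (auto simp: lact_def)
    then show ?thesis by (simp only: concat_map_single)
  qed
  moreover have "concat (map (\<lambda>(j, a). lact G a (fibre h j)) (map (\<lambda>(x, a). (\<rho> x, a \<otimes>\<^bsub>G\<^esub> c x)) w))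
      = map (\<lambda>(x, a). (\<sigma> x, a \<otimes>\<^bsub>G\<^esub> (c x \<otimes>\<^bsub>G\<^esub> g x))) w"
    if "w \<in> set (snd s)" for w
  proof -
    have "a \<otimes>\<^bsub>G\<^esub> c x \<otimes>\<^bsub>G\<^esub> g x = a \<otimes>\<^bsub>G\<^esub> (c x \<otimes>\<^bsub>G\<^esub> g x)" if "(x, a) \<in> set w" for x a
      using m[OF that \<open>w \<in> set (snd s)\<close>] c g G by (intro monoid.m_assoc group.is_monoid) auto
    then have "map (\<lambda>(j, a). lact G a (fibre h j)) (map (\<lambda>(x, a). (\<rho> x, a \<otimes>\<^bsub>G\<^esub> c x)) w)
       = map (\<lambda>z. [(\<lambda>(x, a). (\<sigma> x, a \<otimes>\<^bsub>G\<^esub> (c x \<otimes>\<^bsub>G\<^esub> g x))) z]) w"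
      using h m[OF _ that] by (auto simp: lact_def)
    then show ?thesis by (simp only: concat_map_single)
  qed
  ultimately show ?thesis
    using h(2) by (simp add: lcomp_def) (simp add: lift_def)
qed

text \<open>Relabelling and renumbering the strands is the action of the bijections.\<close>

lemma span_class_gcls:
  assumes G: "group G" and s: "gvalid G s" and A: "A \<in> gcls G s"
  shows "span_class G A = gcls G s"
proof -
  interpret group G by fact
  obtain \<rho> c n where r: "A = lift G \<rho> c n s" "bij_betw \<rho> (strands s) {..<n}" "c ` strands s \<subseteq> carrier G"
    using A by (rule gclsE)
  have \<rho>n: "\<rho> ` strands s \<subseteq> {..<n}" using r(2) by (simp add: bij_betw_def)
  have spA: "is_span G A" unfolding r(1) by (rule is_span_lift[OF G s r(2,3)])
  show ?thesis
  proof (intro equalityI subsetI)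
    fix B assume "B \<in> span_class G A"
    then obtain h where h: "lbij G n h" "lcomp G (fst A) h = fst B" "lcomp G (snd A) h = snd B"
      by (auto simp: span_class_def span_equiv_def r(1))
    \<comment> \<open>A labelled bijection is a renumbering \<open>k\<close> together with a label
      \<open>l\<close> at every point, both read off its singleton fibres.\<close>
    define k where "k j = fst (hd (fibre h j))" for j
    define l where "l j = snd (hd (fibre h j))" for j
    have kl: "fibre h j = [(k j, l j)]" "k j < n" "l j \<in> carrier G" if "j < n" for j
      using lbij_fibre[OF h(1) that] by (metis k_def l_def fst_conv snd_conv list.sel(1))+
    have hl: "is_lmor G h" "tgt h = n" "src h = n" using h(1) by (auto simp: lbij_def)
    have "lmap h (k j) = j" if "j < n" for j
      by (rule lmap_eq[OF hl(1)]) (use that hl(2) kl(1) in simp_all)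
    then have "inj_on k {..<n}" by (metis inj_onI lessThan_iff)
    moreover have "k ` {..<n} \<subseteq> {..<n}" using kl(2) by auto
    ultimately have bk: "bij_betw k {..<n} {..<n}"
      unfolding bij_betw_def using endo_inj_surj[of "{..<n}" k] by simp
    have "B = lift G (k \<circ> \<rho>) (\<lambda>x. c x \<otimes>\<^bsub>G\<^esub> l (\<rho> x)) n s"
      using lcomp_lift_bij[OF G s r(3), of "l \<circ> \<rho>" \<rho> n h "k \<circ> \<rho>" n] \<rho>n kl hl(3) h(2,3) r(1)
      by (auto simp: image_subset_iff o_def prod_eq_iff)
    moreover have "bij_betw (k \<circ> \<rho>) (strands s) {..<n}" using r(2) bk by (rule bij_betw_trans)
    moreover have "(\<lambda>x. c x \<otimes>\<^bsub>G\<^esub> l (\<rho> x)) ` strands s \<subseteq> carrier G"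
      using r(3) \<rho>n kl(3) by auto
    ultimately show "B \<in> gcls G s" unfolding gcls_def by blast
  next
    fix B assume "B \<in> gcls G s"
    then obtain \<sigma> d m where q: "B = lift G \<sigma> d m s" "bij_betw \<sigma> (strands s) {..<m}" "d ` strands s \<subseteq> carrier G"
      by (rule gclsE)
    have mn: "m = n" using bij_betw_same_card[OF q(2)] bij_betw_same_card[OF r(2)] by simp
    let ?i = "inv_into (strands s) \<rho>"
    have i: "?i (\<rho> x) = x" if "x \<in> strands s" for x using r(2) that by (simp add: bij_betw_def)
    have bi: "bij_betw ?i {..<n} (strands s)" using r(2) by (rule bij_betw_inv_into)
    then have i': "?i j \<in> strands s" if "j < n" for j using that by (auto simp: bij_betw_def)
    \<comment> \<open>The only candidate: over the number of a strand in \<open>A\<close> lies its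
      number in \<open>B\<close>, with the label \<open>g\<close> that solves
      \<open>c x \<otimes> g = d x\<close>.\<close>
    define h where "h = \<lparr>src = n, fibres = map (\<lambda>j. [(\<sigma> (?i j), inv\<^bsub>G\<^esub> c (?i j) \<otimes>\<^bsub>G\<^esub> d (?i j))]) [0..<n]\<rparr>"
    have b: "bij_betw (\<sigma> \<circ> ?i) {..<n} {..<n}" using bi q(2) unfolding mn by (rule bij_betw_trans)
    have "is_lmor G h"
      unfolding is_lmor_def
    proof (intro conjI)
      have m: "map fst (concat (fibres h)) = map (\<sigma> \<circ> ?i) [0..<n]" by (simp add: h_def map_concat concat_map_single o_def)
      show "distinct (map fst (concat (fibres h)))" unfolding m
        using b by (simp add: distinct_map bij_betw_def atLeast0LessThan)
      have "fst ` set (concat (fibres h)) = set (map (\<sigma> \<circ> ?i) [0..<n])" using m by (metis list.set_map)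
      also have "\<dots> = {..<n}" using b by (simp add: bij_betw_def atLeast0LessThan)
      finally show "fst ` set (concat (fibres h)) = {..<src h}" by (simp add: h_def)
      show "snd ` set (concat (fibres h)) \<subseteq> carrier G"
        using i' r(3) q(3) by (auto simp: h_def image_subset_iff)
    qed
    have hf: "fibre h j = [(\<sigma> (?i j), inv\<^bsub>G\<^esub> c (?i j) \<otimes>\<^bsub>G\<^esub> d (?i j))]" if "j < n" for j
      using that by (simp add: h_def fibre_def)
    have "lmap h (\<sigma> (?i j)) = j" if "j < n" for j
      by (rule lmap_eq[OF \<open>is_lmor G h\<close>]) (use that hf in \<open>simp_all add: h_def tgt_def\<close>)
    then have "bij_betw (lmap h \<circ> (\<sigma> \<circ> ?i)) {..<n} {..<n}"
      by (intro bij_betwI') auto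
    then have "bij_betw (lmap h) {..<n} {..<n}"
      using bij_betw_comp_iff[OF b] by blast
    then have "lbij G n h" using \<open>is_lmor G h\<close> by (simp add: lbij_def h_def tgt_def)
    have "(lcomp G (fst A) h, lcomp G (snd A) h) = lift G \<sigma> (\<lambda>x. c x \<otimes>\<^bsub>G\<^esub> (inv\<^bsub>G\<^esub> c x \<otimes>\<^bsub>G\<^esub> d x)) n s"
      unfolding r(1) by (rule lcomp_lift_bij[OF G s r(3) _ \<rho>n]) (use hf i r(3) q(3) \<rho>n in \<open>auto simp: h_def image_subset_iff\<close>)
    also have "\<dots> = B"
      unfolding q(1) mn using r(3) q(3) by (intro lift_cong[OF s]) (auto simp: image_subset_iff m_assoc[symmetric])
    finally have "lcomp G (fst A) h = fst B" "lcomp G (snd A) h = snd B" by auto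
    moreover have "is_span G B" unfolding q(1) by (rule is_span_lift[OF G s q(2,3)])
    ultimately show "B \<in> span_class G A"
      using spA \<open>lbij G n h\<close> by (auto simp: span_class_def span_equiv_def r(1))
  qed
qed

text \<open>The inverse of the left label of a strand is multiplied into its right label from the
  right, which makes the left leg unlabelled without leaving the class. The numbers themselves serve
  as strands.\<close>

lemma span_in_gcls:
  assumes G: "group G" and A: "is_span G A"
  obtains s :: "(nat, 'g) gspan" where "gvalid G s" "A \<in> gcls G (s :: (nat, 'g) gspan)"
proof -
  interpret group G by fact
  define n where "n = src (fst A)"
  have l1: "distinct (map fst (concat (fibres (fst A))))" "set (map fst (concat (fibres (fst A)))) = {..<n}"
      "snd ` set (concat (fibres (fst A))) \<subseteq> carrier G"
    and l2: "distinct (map fst (concat (fibres (snd A))))" "set (map fst (concat (fibres (snd A)))) = {..<n}"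
      "snd ` set (concat (fibres (snd A))) \<subseteq> carrier G"
    and n: "src (fst A) = n" "src (snd A) = n"
    using A by (simp_all only: is_span_def is_lmor_def n_def set_map)
  define l where "l x = the (map_of (concat (fibres (fst A))) x)" for x
  have l: "l x = a" if "(x, a) \<in> set (concat (fibres (fst A)))" for x a
    using that l1(1) by (simp add: l_def del: set_concat)
  have lG: "l x \<in> carrier G" if "x < n" for x
  proof -
    have "x \<in> fst ` set (concat (fibres (fst A)))" using that l1(2) by simp
    then obtain a where "(x, a) \<in> set (concat (fibres (fst A)))" by (auto simp del: set_concat)
    moreover from this have "snd (x, a) \<in> carrier G" using l1(3) by blast
    ultimately show ?thesis using l by simp
  qed
  define s where "s = (map (map fst) (fibres (fst A)), map (map (\<lambda>(x, a). (x, a \<otimes>\<^bsub>G\<^esub> inv\<^bsub>G\<^esub> l x))) (fibres (snd A)))"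
  have s1: "concat (fst s) = map fst (concat (fibres (fst A)))"
    and s2: "concat (snd s) = map (\<lambda>(x, a). (x, a \<otimes>\<^bsub>G\<^esub> inv\<^bsub>G\<^esub> l x)) (concat (fibres (snd A)))"
    by (simp_all add: s_def map_concat)
  have s3: "map fst (concat (snd s)) = map fst (concat (fibres (snd A)))"
    unfolding s2 by auto
  have mem: "x < n" "a \<in> carrier G" if "(x, a) \<in> set (concat (fibres (snd A)))" for x a
    using l2(2,3) that by force+
  have "snd ` set (concat (snd s)) \<subseteq> carrier G"
    unfolding s2 using mem lG by (auto simp del: set_concat)
  then have v: "gvalid G s"
    unfolding gvalid_def rearr_def s3 s1 using l1 l2 by simp
  have st: "strands s = {..<n}" unfolding strands_def s1 by (fact l1(2))
  have "lift G (\<lambda>x. x) l n s = A"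
  proof -
    have "map (map (\<lambda>x. (x, l x))) (fst s) = fibres (fst A)"
      unfolding s_def by (auto simp: o_def intro!: map_idI l)
    moreover have "a \<otimes>\<^bsub>G\<^esub> inv\<^bsub>G\<^esub> l x \<otimes>\<^bsub>G\<^esub> l x = a" if "(x, a) \<in> set w" "w \<in> set (fibres (snd A))" for x a w
    proof -
      have "(x, a) \<in> set (concat (fibres (snd A)))" using that by auto
      from mem[OF this] lG show ?thesis by (simp add: m_assoc)
    qed
    then have "map (map (\<lambda>(x, a). (x, a \<otimes>\<^bsub>G\<^esub> l x))) (snd s) = fibres (snd A)"
      unfolding s_def by (force simp: o_def split_def intro!: map_idI)
    ultimately show ?thesis unfolding lift_def using n by (simp add: prod_eq_iff)
  qed
  moreover have "bij_betw (\<lambda>x. x) (strands s) {..<n}" unfolding st by (simp add: bij_betw_def)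
  moreover have "l ` strands s \<subseteq> carrier G" unfolding st using lG by auto
  ultimately have "A \<in> gcls G s" unfolding gcls_def by blast
  with v that show thesis by blast
qed

section \<open>Composites of classes of spans\<close>

lemma strandsD:
  assumes "gvalid G s" "x \<in> strands s"
  shows "occ (fst s) x < length (fst s)" "x \<in> set (fst s ! occ (fst s) x)"
    "occ (map (map fst) (snd s)) x < length (snd s)" "x \<in> fst ` set (snd s ! occ (map (map fst) (snd s)) x)"
proof -
  have "x \<in> set (concat (fst s))" using assms by (simp add: strands_def)
  from occ_less[OF this] show "occ (fst s) x < length (fst s)" "x \<in> set (fst s ! occ (fst s) x)" .
  have "x \<in> set (concat (map (map fst) (snd s)))"
    using assms(2) unfolding strands_snd[OF assms(1)] map_fst_concat[symmetric] by simp
  from occ_less[OF this] show "occ (map (map fst) (snd s)) x < length (snd s)" "x \<in> fst ` set (snd s ! occ (map (map fst) (snd s)) x)"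
    by auto
qed

lemma strandsI:
  "xs \<in> set (fst s) \<Longrightarrow> x \<in> set xs \<Longrightarrow> x \<in> strands s"
  "gvalid G s \<Longrightarrow> w \<in> set (snd s) \<Longrightarrow> (x, a) \<in> set w \<Longrightarrow> x \<in> strands s"
proof -
  show "xs \<in> set (fst s) \<Longrightarrow> x \<in> set xs \<Longrightarrow> x \<in> strands s" by (auto simp: strands_def)
  show "gvalid G s \<Longrightarrow> w \<in> set (snd s) \<Longrightarrow> (x, a) \<in> set w \<Longrightarrow> x \<in> strands s"
    unfolding strands_snd by force
qed

lemma occ_eq_strands:
  assumes "gvalid G s" "i < length (fst s)" "x \<in> set (fst s ! i)"
  shows "occ (fst s) x = i"
  using occ_eq[OF gvalidD(1)[OF assms(1)] assms(2,3)] .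

lemma occ_eq_strands':
  assumes "gvalid G s" "i < length (snd s)" "(x, a) \<in> set (snd s ! i)"
  shows "occ (map (map fst) (snd s)) x = i"
  using occ_eq[OF gvalidD(2)[OF assms(1)], of i x] assms(2,3) by force

lemma strands_gcomp:
  assumes s: "gvalid G s" and t: "gvalid G t" and l: "length (snd s) = length (fst t)"
  shows "strands (gcomp G t s) = {(x, y). x \<in> strands s \<and> y \<in> strands t \<and> occ (map (map fst) (snd s)) x = occ (fst t) y}"
proof -
  have "(x, y) \<in> strands (gcomp G t s) \<longleftrightarrow> x \<in> strands s \<and> y \<in> set (fst t ! occ (map (map fst) (snd s)) x)" for x y
    unfolding strands_def gcomp_strands by auto
  moreover have "y \<in> set (fst t ! occ (map (map fst) (snd s)) x) \<longleftrightarrow> y \<in> strands t \<and> occ (map (map fst) (snd s)) x = occ (fst t) y"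
    if "x \<in> strands s" for x y
  proof -
    have "occ (map (map fst) (snd s)) x < length (fst t)" using strandsD(3)[OF s that] l by simp
    then show ?thesis using occ_eq_strands[OF t] strandsD(2)[OF t] strandsI(1) by (metis nth_mem)
  qed
  ultimately show ?thesis by auto
qed

text \<open>A bimorphism comes with some numbering of the pullback. Its bijection onto pairs turns
  this into a numbering of the strands of \<open>gcomp\<close>, and its two conditions on fibres
  determine the new legs; hence the choices do not affect the class.\<close>

lemma span_comp_gcls:
  assumes G: "group G" and s: "gvalid G s" and t: "gvalid G t" and l: "length (snd s) = length (fst t)"
    and A: "A \<in> gcls G s" and B: "B \<in> gcls G t" and u: "unlabelled G (fst B)" and r: "span_comp G B A R"
  shows "R \<in> gcls G (gcomp G t s)"
proof -
  interpret group G by fact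
  obtain \<rho> c n where p: "A = lift G \<rho> c n s" "bij_betw \<rho> (strands s) {..<n}" "c ` strands s \<subseteq> carrier G"
    using A by (rule gclsE)
  obtain \<sigma> d m where q: "B = lift G \<sigma> d m t" "bij_betw \<sigma> (strands t) {..<m}" "d ` strands t \<subseteq> carrier G"
    using B by (rule gclsE)
  \<comment> \<open>Here the unlabelled left leg enters. With labels \<open>d\<close> the composite
    would carry \<open>c x \<otimes> d y\<close> on the left and
    \<open>b \<otimes> d y \<otimes> a \<otimes> c x\<close> on the right, which in general is no
    common relabelling of \<open>gcomp\<close>.\<close>
  have d1: "d y = \<one>\<^bsub>G\<^esub>" if "y \<in> strands t" for y
  proof -
    have "snd (\<sigma> y, d y) \<in> snd ` set (concat (fibres (fst B)))"
      using that unfolding q(1) lift_def strands_def by force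
    then show ?thesis using u unfolding unlabelled_def by auto
  qed
  obtain f1 \<phi>1 where b: "bimorphism G f1 (snd A) \<phi>1 (fst B)" "R = (lcomp G (fst A) \<phi>1, lcomp G (snd B) f1)"
    using r by (auto simp: span_comp_def)
  define N where "N = src f1"
  let ?S = "strands (gcomp G t s)"
  let ?oW = "occ (map (map fst) (snd s))" and ?oP = "occ (fst t)"
  note lA = lmap_lift[OF G s p(2,3), folded p(1)] and lB = lmap_lift[OF G t q(2,3), folded q(1)]
  have bm: "is_lmor G f1" "is_lmor G \<phi>1" "src \<phi>1 = N" "tgt \<phi>1 = n" "tgt f1 = m"
    "bij_betw (\<lambda>k. (lmap \<phi>1 k, lmap f1 k)) {..<N} {(i, j). i < n \<and> j < m \<and> lmap (snd A) i = lmap (fst B) j}"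
    "\<And>i. i < n \<Longrightarrow> map (\<lambda>(k, a). (lmap f1 k, a)) (fibre \<phi>1 i) = fibre (fst B) (lmap (snd A) i)"
    "\<And>j. j < m \<Longrightarrow> map (\<lambda>(k, a). (lmap \<phi>1 k, a)) (fibre f1 j) = fibre (snd A) (lmap (fst B) j)"
    using b(1) unfolding bimorphism_def N_def p(1) q(1) by auto
  let ?b = "\<lambda>k. (lmap \<phi>1 k, lmap f1 k)"
  let ?Q = "{(i, j). i < n \<and> j < m \<and> lmap (snd A) i = lmap (fst B) j}"
  have "bij_betw (\<lambda>(x, y). (\<rho> x, \<sigma> y)) ?S ?Q"
  proof (rule bij_betw_imageI)
    show "inj_on (\<lambda>(x, y). (\<rho> x, \<sigma> y)) ?S"
      using p(2) q(2) unfolding strands_gcomp[OF s t l] by (auto simp: inj_on_def bij_betw_def)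
    show "(\<lambda>(x, y). (\<rho> x, \<sigma> y)) ` ?S = ?Q"
    proof (intro equalityI subsetI)
      fix z assume "z \<in> (\<lambda>(x, y). (\<rho> x, \<sigma> y)) ` ?S"
      then show "z \<in> ?Q"
        using p(2) q(2) lA(2) lB(1) unfolding strands_gcomp[OF s t l] by (auto simp: bij_betw_def)
    next
      fix z assume "z \<in> ?Q"
      then obtain i j where z: "z = (i, j)" "i < n" "j < m" "lmap (snd A) i = lmap (fst B) j" by auto
      then obtain x y where xy: "x \<in> strands s" "i = \<rho> x" "y \<in> strands t" "j = \<sigma> y"
        using p(2) q(2) unfolding bij_betw_def by (metis imageE lessThan_iff)
      then have "(x, y) \<in> ?S" using z lA(2) lB(1) unfolding strands_gcomp[OF s t l] by auto
      then show "z \<in> (\<lambda>(x, y). (\<rho> x, \<sigma> y)) ` ?S" using z xy by force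
    qed
  qed
  then have bS: "bij_betw (inv_into {..<N} ?b \<circ> (\<lambda>(x, y). (\<rho> x, \<sigma> y))) ?S {..<N}"
    using bij_betw_inv_into[OF bm(6)] by (rule bij_betw_trans)
  \<comment> \<open>The number that the bimorphism gives to the strand \<open>(x, y)\<close> of the
    pullback.\<close>
  define \<tau> where "\<tau> = inv_into {..<N} ?b \<circ> (\<lambda>(x, y). (\<rho> x, \<sigma> y))"
  have ib: "inv_into {..<N} ?b (lmap \<phi>1 k, lmap f1 k) = k" if "k < N" for k
    using bm(6) that by (intro inv_into_f_eq) (auto simp: bij_betw_def)
  have fN: "k < N" if "(k, a) \<in> set (fibre f i)" "i < tgt f" "is_lmor G f" "src f = N" for f k i a
  proof -
    have "(k, a) \<in> set (concat (fibres f))" using that(1,2) by (auto simp: fibre_def tgt_def)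
    then show ?thesis using that(3,4) unfolding is_lmor_def by force
  qed
  have F1: "fibre \<phi>1 (\<rho> x) = map (\<lambda>y. (\<tau> (x, y), \<one>\<^bsub>G\<^esub>)) (fst t ! ?oW x)" if x: "x \<in> strands s" for x
  proof -
    have i: "\<rho> x < n" using p(2) x by (auto simp: bij_betw_def)
    have o: "?oW x < length (fst t)" using strandsD(3)[OF s x] l by simp
    have "fibre \<phi>1 (\<rho> x) = map (\<lambda>(j, a). (inv_into {..<N} ?b (\<rho> x, j), a)) (map (\<lambda>(k, a). (lmap f1 k, a)) (fibre \<phi>1 (\<rho> x)))"
    proof -
      have "inv_into {..<N} ?b (\<rho> x, lmap f1 k) = k" if "(k, a) \<in> set (fibre \<phi>1 (\<rho> x))" for k a
      proof -
        have "lmap \<phi>1 k = \<rho> x" using lmap_eq[OF bm(2), of "\<rho> x" k] i bm(4) that by force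
        then show ?thesis using ib fN[OF that _ bm(2,3)] i bm(4) by metis
      qed
      then show ?thesis by (auto simp: o_def intro!: map_idI[symmetric])
    qed
    also have "map (\<lambda>(k, a). (lmap f1 k, a)) (fibre \<phi>1 (\<rho> x)) = map (\<lambda>y. (\<sigma> y, d y)) (fst t ! ?oW x)"
      using bm(7)[OF i] lA(2)[OF x] o by (simp add: q(1) fibre_lift)
    finally show ?thesis
      using d1 strandsI(1)[OF nth_mem[OF o]] by (auto simp: \<tau>_def)
  qed
  have F2: "fibre f1 (\<sigma> y) = map (\<lambda>(x, a). (\<tau> (x, y), a \<otimes>\<^bsub>G\<^esub> c x)) (snd s ! ?oP y)" if y: "y \<in> strands t" for y
  proof -
    have i: "\<sigma> y < m" using q(2) y by (auto simp: bij_betw_def)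
    have o: "?oP y < length (snd s)" using strandsD(1)[OF t y] l by simp
    have "fibre f1 (\<sigma> y) = map (\<lambda>(j, a). (inv_into {..<N} ?b (j, \<sigma> y), a)) (map (\<lambda>(k, a). (lmap \<phi>1 k, a)) (fibre f1 (\<sigma> y)))"
    proof -
      have "inv_into {..<N} ?b (lmap \<phi>1 k, \<sigma> y) = k" if "(k, a) \<in> set (fibre f1 (\<sigma> y))" for k a
      proof -
        have "lmap f1 k = \<sigma> y" using lmap_eq[OF bm(1), of "\<sigma> y" k] i bm(5) that by force
        then show ?thesis using ib fN[OF that _ bm(1)] i bm(5) N_def by metis
      qed
      then show ?thesis by (auto simp: o_def intro!: map_idI[symmetric])
    qed
    also have "map (\<lambda>(k, a). (lmap \<phi>1 k, a)) (fibre f1 (\<sigma> y)) = map (\<lambda>(x, a). (\<rho> x, a \<otimes>\<^bsub>G\<^esub> c x)) (snd s ! ?oP y)"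
      using bm(8)[OF i] lB(1)[OF y] o by (simp add: p(1) fibre_lift)
    finally show ?thesis by (auto simp: \<tau>_def)
  qed
  \<comment> \<open>A strand \<open>(x, y)\<close> of the composite inherits the relabelling
    \<open>c x\<close> of \<open>s\<close>, on both legs.\<close>
  have 1: "fst R = fst (lift G \<tau> (\<lambda>z. c (fst z)) N (gcomp G t s))"
  proof -
    have "concat (map (\<lambda>(j, a). lact G a (fibre \<phi>1 j)) (map (\<lambda>x. (\<rho> x, c x)) xs)) =
      map (\<lambda>z. (\<tau> z, c (fst z))) (concat (map (\<lambda>x. map (Pair x) (fst t ! ?oW x)) xs))" if "xs \<in> set (fst s)" for xs
    proof -
      have "lact G (c x) (fibre \<phi>1 (\<rho> x)) = map (\<lambda>z. (\<tau> z, c (fst z))) (map (Pair x) (fst t ! ?oW x))" if "x \<in> set xs" for x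
        using F1[OF strandsI(1)[OF \<open>xs \<in> set (fst s)\<close> that]] p(3) strandsI(1)[OF \<open>xs \<in> set (fst s)\<close> that]
        by (auto simp: lact_def image_subset_iff)
      then have "map (\<lambda>(j, a). lact G a (fibre \<phi>1 j)) (map (\<lambda>x. (\<rho> x, c x)) xs) =
          map (map (\<lambda>z. (\<tau> z, c (fst z)))) (map (\<lambda>x. map (Pair x) (fst t ! ?oW x)) xs)"
        by simp
      then show ?thesis by (simp only: map_concat)
    qed
    then show ?thesis
      unfolding b(2) fst_conv lcomp_def p(1) by (simp add: lift_def gcomp_def bm(3))
  qed
  have 2: "snd R = snd (lift G \<tau> (\<lambda>z. c (fst z)) N (gcomp G t s))"
  proof -
    have "concat (map (\<lambda>(j, a). lact G a (fibre f1 j)) (map (\<lambda>(y, b). (\<sigma> y, b \<otimes>\<^bsub>G\<^esub> d y)) v)) =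
      map (\<lambda>(z, a). (\<tau> z, a \<otimes>\<^bsub>G\<^esub> c (fst z))) (concat (map (\<lambda>(y, b). map (\<lambda>(x, a). ((x, y), b \<otimes>\<^bsub>G\<^esub> a)) (snd s ! ?oP y)) v))"
      if v: "v \<in> set (snd t)" for v
    proof -
      have "lact G (b \<otimes>\<^bsub>G\<^esub> d y) (fibre f1 (\<sigma> y)) =
        map (\<lambda>(z, a). (\<tau> z, a \<otimes>\<^bsub>G\<^esub> c (fst z))) (map (\<lambda>(x, a). ((x, y), b \<otimes>\<^bsub>G\<^esub> a)) (snd s ! ?oP y))"
        if yb: "(y, b) \<in> set v" for y b
      proof -
        have y: "y \<in> strands t" using strandsI(2)[OF t v yb] .
        have bG: "b \<in> carrier G" using gvalidD(6)[OF t v] yb by (rule labelledD)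
        have o: "?oP y < length (snd s)" using strandsD(1)[OF t y] l by simp
        have "b \<otimes>\<^bsub>G\<^esub> (a \<otimes>\<^bsub>G\<^esub> c x) = b \<otimes>\<^bsub>G\<^esub> a \<otimes>\<^bsub>G\<^esub> c x" if "(x, a) \<in> set (snd s ! ?oP y)" for x a
          using labelledD[OF gvalidD(6)[OF s nth_mem[OF o]] that] bG strandsI(2)[OF s nth_mem[OF o] that] p(3)
          by (auto simp: m_assoc)
        then show ?thesis using F2[OF y] d1[OF y] bG by (auto simp: lact_def)
      qed
      then have "map (\<lambda>(j, a). lact G a (fibre f1 j)) (map (\<lambda>(y, b). (\<sigma> y, b \<otimes>\<^bsub>G\<^esub> d y)) v) =
          map (map (\<lambda>(z, a). (\<tau> z, a \<otimes>\<^bsub>G\<^esub> c (fst z)))) (map (\<lambda>(y, b). map (\<lambda>(x, a). ((x, y), b \<otimes>\<^bsub>G\<^esub> a)) (snd s ! ?oP y)) v)"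
        by auto
      then show ?thesis by (simp only: map_concat)
    qed
    then show ?thesis
      unfolding b(2) snd_conv lcomp_def q(1) by (simp add: lift_def gcomp_def N_def)
  qed
  have "R = lift G \<tau> (\<lambda>z. c (fst z)) N (gcomp G t s)"
    using 1 2 by (simp add: prod_eq_iff)
  moreover have "(\<lambda>z. c (fst z)) ` ?S \<subseteq> carrier G"
    using p(3) unfolding strands_gcomp[OF s t l] by auto
  moreover have "bij_betw \<tau> ?S {..<N}" using bS unfolding \<tau>_def .
  ultimately show ?thesis unfolding gcls_def by blast
qed

text \<open>The existence part of the star condition. Composition of classes is a union over all
  composites, so at least one has to be exhibited.\<close>

lemma span_comp_ex:
  assumes G: "group G" and s: "gvalid G s" and t: "gvalid G t" and l: "length (snd s) = length (fst t)"
  obtains A B R where "A \<in> gcls G s" "B \<in> gcls G t" "unlabelled G (fst B)" "span_comp G B A R"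
proof -
  interpret group G by fact
  let ?one = "\<lambda>_. \<one>\<^bsub>G\<^esub>"
  obtain \<rho> n where p: "bij_betw \<rho> (strands s) {..<n}" "?one ` strands s \<subseteq> carrier G" "lift G \<rho> ?one n s \<in> gcls G s"
    using gcls_ex[OF G] by blast
  obtain \<sigma> m where q: "bij_betw \<sigma> (strands t) {..<m}" "?one ` strands t \<subseteq> carrier G" "lift G \<sigma> ?one m t \<in> gcls G t"
    using gcls_ex[OF G] by blast
  let ?S = "strands (gcomp G t s)" and ?A = "lift G \<rho> ?one n s" and ?B = "lift G \<sigma> ?one m t"
  obtain \<tau> where \<tau>0: "bij_betw \<tau> ?S {..<card ?S}" using numbering_exists[of "gcomp G t s"] ..
  define N where "N = card ?S"
  have \<tau>: "bij_betw \<tau> ?S {..<N}" unfolding N_def by (fact \<tau>0)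
  let ?oW = "occ (map (map fst) (snd s))" and ?oP = "occ (fst t)"
  let ?i = "inv_into (strands s) \<rho>" and ?j = "inv_into (strands t) \<sigma>"
  have i: "?i (\<rho> x) = x" if "x \<in> strands s" for x using p(1) that by (simp add: bij_betw_def)
  have j: "?j (\<sigma> x) = x" if "x \<in> strands t" for x using q(1) that by (simp add: bij_betw_def)
  have bi: "bij_betw ?i {..<n} (strands s)" and bj: "bij_betw ?j {..<m} (strands t)"
    using p(1) q(1) by (auto intro: bij_betw_inv_into)
  then have i': "?i k \<in> strands s" if "k < n" for k using that by (auto simp: bij_betw_def)
  have j': "?j k \<in> strands t" if "k < m" for k using bj that by (auto simp: bij_betw_def)
  \<comment> \<open>The pullback with the fibres induced from the given legs, carried over to
    numbers by an arbitrary numbering \<open>\<tau>\<close>. With trivial relabellings of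
    \<open>s\<close> and \<open>t\<close>, the leg \<open>\<phi>1\<close> is unlabelled and
    \<open>f1\<close> keeps the labels of \<open>s\<close>.\<close>
  define \<phi>1 where "\<phi>1 = \<lparr>src = N, fibres = map (\<lambda>k. map (\<lambda>y. (\<tau> (?i k, y), \<one>\<^bsub>G\<^esub>)) (fst t ! ?oW (?i k))) [0..<n]\<rparr>"
  define f1 where "f1 = \<lparr>src = N, fibres = map (\<lambda>k. map (\<lambda>(x, a). (\<tau> (x, ?j k), a)) (snd s ! ?oP (?j k))) [0..<m]\<rparr>"
  note lA = lmap_lift[OF G s p(1,2)] and lB = lmap_lift[OF G t q(1,2)]
  note S = strands_gcomp[OF s t l]
  have inS: "(x, y) \<in> ?S" if "x \<in> strands s" "y \<in> set (fst t ! ?oW x)" for x y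
  proof -
    have "?oW x < length (fst t)" using strandsD(3)[OF s that(1)] l by simp
    then show ?thesis using that occ_eq_strands[OF t] strandsI(1) unfolding S by fastforce
  qed
  have inS': "(x, y) \<in> ?S" "a \<in> carrier G" if "y \<in> strands t" "(x, a) \<in> set (snd s ! ?oP y)" for x y a
  proof -
    have o: "?oP y < length (snd s)" using strandsD(1)[OF t that(1)] l by simp
    then show "(x, y) \<in> ?S" using that occ_eq_strands'[OF s o that(2)] strandsI(2)[OF s nth_mem[OF o]] unfolding S by auto
    show "a \<in> carrier G" using labelledD[OF gvalidD(6)[OF s nth_mem[OF o]] that(2)] .
  qed
  have L1: "is_lmor G \<phi>1"
    unfolding is_lmor_def
  proof (intro conjI)
    let ?xs = "concat (map (\<lambda>k. map (Pair (?i k)) (fst t ! ?oW (?i k))) [0..<n])"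
    have m: "map fst (concat (fibres \<phi>1)) = map \<tau> ?xs"
      by (simp add: \<phi>1_def map_concat o_def)
    have "?xs = concat (map (\<lambda>x. map (Pair x) (fst t ! ?oW x)) (map ?i [0..<n]))" by (simp add: o_def)
    moreover have "distinct (map ?i [0..<n])" using bi by (simp add: distinct_map bij_betw_def atLeast0LessThan)
    moreover have "distinct (fst t ! ?oW x)" if "x \<in> set (map ?i [0..<n])" for x
    proof -
      have "x \<in> strands s" using that i' by auto
      from strandsD(3)[OF s this] l have "fst t ! ?oW x \<in> set (fst t)" by simp
      then show ?thesis using gvalidD(1)[OF t] unfolding distinct_concat_iff by simp
    qed
    ultimately have d: "distinct ?xs" by (simp only: distinct_concat_Pair)
    have se: "set ?xs = ?S"
    proof (intro equalityI subsetI)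
      fix z assume "z \<in> set ?xs" then show "z \<in> ?S" using inS i' by auto
    next
      fix z assume "z \<in> ?S"
      then obtain x y where z: "z = (x, y)" "x \<in> strands s" "y \<in> strands t" "?oW x = ?oP y" unfolding S by auto
      then have "y \<in> set (fst t ! ?oW x)" using strandsD(2)[OF t] by simp
      moreover have "\<rho> x < n" using z(2) p(1) by (auto simp: bij_betw_def)
      ultimately show "z \<in> set ?xs" using z i by (auto intro!: bexI[of _ "\<rho> x"])
    qed
    show "distinct (map fst (concat (fibres \<phi>1)))"
      using d \<tau> unfolding m distinct_map se bij_betw_def by blast
    have "set (map fst (concat (fibres \<phi>1))) = {..<N}"
      using \<tau> unfolding m set_map se bij_betw_def by blast
    then show "fst ` set (concat (fibres \<phi>1)) = {..<src \<phi>1}"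
      unfolding set_map by (simp add: \<phi>1_def)
    show "snd ` set (concat (fibres \<phi>1)) \<subseteq> carrier G" by (auto simp: \<phi>1_def)
  qed
  have L2: "is_lmor G f1"
    unfolding is_lmor_def
  proof (intro conjI)
    let ?ys = "map ?j [0..<m]"
    let ?xs = "concat (map (\<lambda>y. map (\<lambda>x. (x, y)) (map fst (snd s ! ?oP y))) ?ys)"
    have m: "map fst (concat (fibres f1)) = map \<tau> ?xs"
      by (simp add: f1_def map_concat o_def split_def)
    have "distinct ?ys" using bj by (simp add: distinct_map bij_betw_def atLeast0LessThan)
    moreover have "distinct (map fst (snd s ! ?oP y))" if "y \<in> set ?ys" for y
    proof -
      have "y \<in> strands t" using that j' by auto
      from strandsD(1)[OF t this] l show ?thesis using gvalidD(7)[OF s] by simp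
    qed
    ultimately have d: "distinct ?xs"
      by (induction ("?ys")) (auto simp: distinct_map inj_on_def)
    have se: "set ?xs = ?S"
    proof (intro equalityI subsetI)
      fix z assume "z \<in> set ?xs" then show "z \<in> ?S" using inS' j' by auto
    next
      fix z assume "z \<in> ?S"
      then obtain x y where z: "z = (x, y)" "x \<in> strands s" "y \<in> strands t" "?oW x = ?oP y" unfolding S by auto
      then have "x \<in> fst ` set (snd s ! ?oP y)" using strandsD(4)[OF s] by metis
      moreover have "\<sigma> y < m" using z(3) q(1) by (auto simp: bij_betw_def)
      ultimately show "z \<in> set ?xs" using z j by (auto intro!: bexI[of _ "\<sigma> y"])
    qed
    show "distinct (map fst (concat (fibres f1)))"
      using d \<tau> unfolding m distinct_map se bij_betw_def by blast
    have "set (map fst (concat (fibres f1))) = {..<N}"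
      using \<tau> unfolding m set_map se bij_betw_def by blast
    then show "fst ` set (concat (fibres f1)) = {..<src f1}"
      unfolding set_map by (simp add: f1_def)
    show "snd ` set (concat (fibres f1)) \<subseteq> carrier G" by (auto simp: f1_def intro: inS'(2)[OF j'])
  qed
  have f\<phi>: "fibre \<phi>1 (\<rho> x) = map (\<lambda>y. (\<tau> (x, y), \<one>\<^bsub>G\<^esub>)) (fst t ! ?oW x)" "\<rho> x < n" if "x \<in> strands s" for x
  proof -
    show "\<rho> x < n" using that p(1) by (auto simp: bij_betw_def)
    then show "fibre \<phi>1 (\<rho> x) = map (\<lambda>y. (\<tau> (x, y), \<one>\<^bsub>G\<^esub>)) (fst t ! ?oW x)"
      using i[OF that] by (simp add: \<phi>1_def fibre_def)
  qed
  have ff: "fibre f1 (\<sigma> y) = map (\<lambda>(x, a). (\<tau> (x, y), a)) (snd s ! ?oP y)" "\<sigma> y < m" if "y \<in> strands t" for y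
  proof -
    show "\<sigma> y < m" using that q(1) by (auto simp: bij_betw_def)
    then show "fibre f1 (\<sigma> y) = map (\<lambda>(x, a). (\<tau> (x, y), a)) (snd s ! ?oP y)"
      using j[OF that] by (simp add: f1_def fibre_def)
  qed
  have l\<phi>: "lmap \<phi>1 (\<tau> (x, y)) = \<rho> x" and lf: "lmap f1 (\<tau> (x, y)) = \<sigma> y" if "(x, y) \<in> ?S" for x y
  proof -
    have xy: "x \<in> strands s" "y \<in> strands t" "?oW x = ?oP y" using that unfolding S by auto
    show "lmap \<phi>1 (\<tau> (x, y)) = \<rho> x"
      by (rule lmap_eq[OF L1]) (use f\<phi>[OF xy(1)] strandsD(2)[OF t xy(2)] xy(3) in \<open>force simp: \<phi>1_def tgt_def\<close>)+
    show "lmap f1 (\<tau> (x, y)) = \<sigma> y"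
      by (rule lmap_eq[OF L2]) (use ff[OF xy(2)] strandsD(4)[OF s xy(1)] xy(3) in \<open>force simp: f1_def tgt_def\<close>)+
  qed
  let ?Q = "{(x, y). x < n \<and> y < m \<and> lmap (snd ?A) x = lmap (fst ?B) y}"
  have "bij_betw ((\<lambda>k. (lmap \<phi>1 k, lmap f1 k)) \<circ> \<tau>) ?S ?Q"
  proof (rule bij_betw_imageI)
    show "inj_on ((\<lambda>k. (lmap \<phi>1 k, lmap f1 k)) \<circ> \<tau>) ?S"
    proof (rule inj_onI, clarify)
      fix x y x' y' assume a: "(x, y) \<in> ?S" "(x', y') \<in> ?S"
        "((\<lambda>k. (lmap \<phi>1 k, lmap f1 k)) \<circ> \<tau>) (x, y) = ((\<lambda>k. (lmap \<phi>1 k, lmap f1 k)) \<circ> \<tau>) (x', y')"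
      then have "\<rho> x = \<rho> x'" "\<sigma> y = \<sigma> y'" by (simp_all add: l\<phi> lf)
      then show "x = x' \<and> y = y'" using a(1,2) p(1) q(1) unfolding S by (auto simp: bij_betw_def inj_on_def)
    qed
    show "((\<lambda>k. (lmap \<phi>1 k, lmap f1 k)) \<circ> \<tau>) ` ?S = ?Q"
    proof (intro equalityI subsetI)
      fix z assume "z \<in> ((\<lambda>k. (lmap \<phi>1 k, lmap f1 k)) \<circ> \<tau>) ` ?S"
      then obtain x y where "(x, y) \<in> ?S" "z = (\<rho> x, \<sigma> y)" using l\<phi> lf by auto
      then show "z \<in> ?Q" using f\<phi>(2) ff(2) lA(2) lB(1) unfolding S by auto
    next
      fix z assume "z \<in> ?Q"
      then obtain k k' where z: "z = (k, k')" "k < n" "k' < m" "lmap (snd ?A) k = lmap (fst ?B) k'" by auto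
      moreover from z have "k \<in> \<rho> ` strands s" "k' \<in> \<sigma> ` strands t"
        using p(1) q(1) by (simp_all add: bij_betw_def)
      ultimately obtain x y where xy: "x \<in> strands s" "k = \<rho> x" "y \<in> strands t" "k' = \<sigma> y" by blast
      from xy have "(x, y) \<in> ?S" using z lA(2) lB(1) unfolding S by auto
      then show "z \<in> ((\<lambda>k. (lmap \<phi>1 k, lmap f1 k)) \<circ> \<tau>) ` ?S" using z xy l\<phi> lf by force
    qed
  qed
  then have bQ: "bij_betw (\<lambda>k. (lmap \<phi>1 k, lmap f1 k)) {..<N} ?Q"
    using bij_betw_comp_iff[OF \<tau>] by blast
  have c1: "map (\<lambda>(k, a). (lmap f1 k, a)) (fibre \<phi>1 k) = fibre (fst ?B) (lmap (snd ?A) k)" if "k < n" for k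
  proof -
    have "k \<in> \<rho> ` strands s" using that p(1) by (simp add: bij_betw_def)
    then obtain x where x: "x \<in> strands s" "k = \<rho> x" by blast
    have "?oW x < length (fst t)" using strandsD(3)[OF s x(1)] l by simp
    then show ?thesis using inS[OF x(1)] lf unfolding x(2) f\<phi>(1)[OF x(1)] lA(2)[OF x(1)]
      by (simp add: fibre_lift)
  qed
  have c2: "map (\<lambda>(k, a). (lmap \<phi>1 k, a)) (fibre f1 k) = fibre (snd ?A) (lmap (fst ?B) k)" if "k < m" for k
  proof -
    have "k \<in> \<sigma> ` strands t" using that q(1) by (simp add: bij_betw_def)
    then obtain y where y: "y \<in> strands t" "k = \<sigma> y" by blast
    have "?oP y < length (snd s)" using strandsD(1)[OF t y(1)] l by simp
    then show ?thesis using inS'[OF y(1)] l\<phi> unfolding y(2) ff(1)[OF y(1)] lB(1)[OF y(1)]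
      by (auto simp: fibre_lift)
  qed
  have "bimorphism G f1 (snd ?A) \<phi>1 (fst ?B)"
    unfolding bimorphism_def
    using L1 L2 is_lmor_snd_lift[OF G s p(1,2)] is_lmor_fst_lift[OF t q(1,2)] bQ c1 c2 l
    by (simp add: f1_def \<phi>1_def tgt_def[of "\<lparr>src = _, fibres = _\<rparr>"])
  then have "span_comp G ?B ?A (lcomp G (fst ?A) \<phi>1, lcomp G (snd ?B) f1)"
    by (auto simp: span_comp_def)
  moreover have "unlabelled G (fst ?B)" by (auto simp: unlabelled_def lift_def)
  ultimately show thesis using that p(3) q(3) by blast
qed

lemma gcls_eqI: "gvalid G s \<Longrightarrow> inj_on \<rho> (strands s) \<Longrightarrow> t = grename \<rho> s \<Longrightarrow> gcls G t = gcls G s"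
  using gcls_grename by blast

subsection \<open>The structure of the composite PROP on classes\<close>

context group
begin

lemma span_class_of: "gvalid G s \<Longrightarrow> A \<in> gcls G s \<Longrightarrow> span_class G A = gcls G s"
  by (rule span_class_gcls[OF is_group])

lemma Arr_gcls: "gvalid G s \<Longrightarrow> gcls G s \<in> Arr (GFas_composite G)"
proof -
  assume s: "gvalid G s"
  obtain \<rho> n where r: "bij_betw \<rho> (strands s) {..<n}" "(\<lambda>_. \<one>) ` strands s \<subseteq> carrier G" "lift G \<rho> (\<lambda>_. \<one>) n s \<in> gcls G s"
    by (rule gcls_ex[OF is_group])
  from span_class_of[OF s r(3)] is_span_lift[OF is_group s r(1,2)] show ?thesis
    by (auto simp: GFas_composite_def)
qed

lemma Arr_gclsE:
  assumes "f \<in> Arr (GFas_composite G)"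
  obtains s :: "(nat, 'a) gspan" where "gvalid G s" "f = gcls G s"
proof -
  obtain A where A: "f = span_class G A" "is_span G A" using assms by (auto simp: GFas_composite_def)
  from span_in_gcls[OF is_group A(2)] obtain s :: "(nat, 'a) gspan" where "gvalid G s" "A \<in> gcls G s" .
  then show thesis using that span_class_of A(1) by metis
qed

lemma Dom_gcls: "Dom (GFas_composite G) (gcls G s) = length (fst s)"
  and Cod_gcls: "Cod (GFas_composite G) (gcls G s) = length (snd s)"
proof -
  obtain \<rho> n where r: "lift G \<rho> (\<lambda>_. \<one>) n s \<in> gcls G s"
    by (rule gcls_ex[OF is_group])
  have t: "tgt (fst A) = length (fst s)" "tgt (snd A) = length (snd s)" if "A \<in> gcls G s" for A
    using that by (auto elim!: gclsE)
  show "Dom (GFas_composite G) (gcls G s) = length (fst s)"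
    by (simp add: GFas_composite_def) (rule the_equality; use r t in force)
  show "Cod (GFas_composite G) (gcls G s) = length (snd s)"
    by (simp add: GFas_composite_def) (rule the_equality; use r t in force)
qed

text \<open>All admissible composites lie in one class and there is at least one, so the union that
  defines \<open>Cmp\<close> is this class.\<close>

lemma Cmp_gcls:
  assumes s: "gvalid G s" and t: "gvalid G t" and l: "length (snd s) = length (fst t)"
  shows "Cmp (GFas_composite G) (gcls G t) (gcls G s) = gcls G (gcomp G t s)"
proof -
  have v: "gvalid G (gcomp G t s)" by (rule gvalid_gcomp[OF is_group s t l])
  have "span_class G r = gcls G (gcomp G t s)"
    if "A \<in> gcls G s" "B \<in> gcls G t" "unlabelled G (fst B)" "span_comp G B A r" for r A B
    using span_class_of[OF v span_comp_gcls[OF is_group s t l that]] .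
  moreover obtain A B r where "A \<in> gcls G s" "B \<in> gcls G t" "unlabelled G (fst B)" "span_comp G B A r"
    by (rule span_comp_ex[OF is_group s t l])
  ultimately have "{span_class G r | r A B. A \<in> gcls G s \<and> B \<in> gcls G t \<and> unlabelled G (fst B) \<and> span_comp G B A r} = {gcls G (gcomp G t s)}"
    by blast
  then show ?thesis by (simp add: GFas_composite_def)
qed

lemma TArr_gcls:
  assumes s: "gvalid G s" and t: "gvalid G t"
  shows "TArr (GFas_composite G) (gcls G s) (gcls G t) = gcls G (gtensor s t)"
proof -
  have v: "gvalid G (gtensor s t)" by (rule gvalid_gtensor[OF s t])
  have st: "strands (gtensor s t) = Inl ` strands s \<union> Inr ` strands t"
    by (auto simp: strands_def gtensor_def)
  have "(ltensor (fst A) (fst B), ltensor (snd A) (snd B)) \<in> gcls G (gtensor s t)"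
    if A: "A \<in> gcls G s" and B: "B \<in> gcls G t" for A B
  proof -
    obtain \<rho> c n where p: "A = lift G \<rho> c n s" "bij_betw \<rho> (strands s) {..<n}" "c ` strands s \<subseteq> carrier G"
      using A by (rule gclsE)
    obtain \<sigma> d m where q: "B = lift G \<sigma> d m t" "bij_betw \<sigma> (strands t) {..<m}" "d ` strands t \<subseteq> carrier G"
      using B by (rule gclsE)
    \<comment> \<open>As in \<open>ltensor\<close>, the strands of the second span are numbered
      after those of the first.\<close>
    let ?\<tau> = "case_sum \<rho> (\<lambda>y. n + \<sigma> y)"
    have "bij_betw ?\<tau> (strands (gtensor s t)) {..<n + m}"
    proof (rule bij_betw_imageI)
      show "inj_on ?\<tau> (strands (gtensor s t))"
      proof (rule inj_onI)
        fix z z' assume z: "z \<in> strands (gtensor s t)" "z' \<in> strands (gtensor s t)" "?\<tau> z = ?\<tau> z'"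
        have i: "inj_on \<rho> (strands s)" "inj_on \<sigma> (strands t)"
          using p(2) q(2) by (auto simp: bij_betw_def)
        have lt: "\<rho> x < n" if "x \<in> strands s" for x
          using p(2) that by (auto simp: bij_betw_def)
        show "z = z'" using z unfolding st
          by (elim UnE imageE) (use lt in \<open>fastforce dest: inj_onD[OF i(1)] inj_onD[OF i(2)]\<close>)+
      qed
      have "?\<tau> ` strands (gtensor s t) = \<rho> ` strands s \<union> (\<lambda>k. n + k) ` \<sigma> ` strands t"
        by (simp add: st image_Un image_image)
      also have "\<dots> = {..<n} \<union> (\<lambda>k. n + k) ` {..<m}"
        using p(2) q(2) by (simp add: bij_betw_def)
      also have "\<dots> = {..<n + m}"
      proof -
        have "k \<in> (\<lambda>k. n + k) ` {..<m}" if "k < n + m" "\<not> k < n" for k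
          using that by (intro image_eqI[of _ _ "k - n"]) auto
        then show ?thesis by auto
      qed
      finally show "?\<tau> ` strands (gtensor s t) = {..<n + m}" .
    qed
    moreover have "case_sum c d ` strands (gtensor s t) \<subseteq> carrier G" using p(3) q(3) unfolding st by auto
    moreover have "(ltensor (fst A) (fst B), ltensor (snd A) (snd B)) = lift G ?\<tau> (case_sum c d) (n + m) (gtensor s t)"
      unfolding p(1) q(1) by (simp add: lift_def gtensor_def ltensor_def o_def split_def)
    ultimately show ?thesis using gclsI by simp
  qed
  then have *: "span_class G (ltensor (fst A) (fst B), ltensor (snd A) (snd B)) = gcls G (gtensor s t)"
    if "A \<in> gcls G s" "B \<in> gcls G t" for A B
    using span_class_of[OF v] that by blast
  obtain \<rho> n where "lift G \<rho> (\<lambda>_. \<one>) n s \<in> gcls G s" by (rule gcls_ex[OF is_group])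
  moreover obtain \<rho>' n' where "lift G \<rho>' (\<lambda>_. \<one>) n' t \<in> gcls G t" by (rule gcls_ex[OF is_group])
  ultimately have "{span_class G (ltensor (fst A) (fst B), ltensor (snd A) (snd B)) | A B. A \<in> gcls G s \<and> B \<in> gcls G t} = {gcls G (gtensor s t)}"
    using * by blast
  then show ?thesis by (simp add: GFas_composite_def)
qed

text \<open>Permutations as spans: output \<open>k\<close> is input \<open>js ! k\<close>.
  Identities and symmetries both have this form, so that laws about them reduce to computations with
  lists of indices.\<close>

definition gperm :: "nat list \<Rightarrow> (nat, 'a) gspan" where
  "gperm js = (map (\<lambda>i. [i]) [0..<length js], map (\<lambda>i. [(i, \<one>)]) js)"

lemma gid_eq: "gid G n = gperm [0..<n]"
  by (simp add: gid_def gperm_def)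

lemma gsym_eq: "gsym G m n = gperm ([m..<m + n] @ [0..<m])"
proof -
  have "length ([m..<m + n] @ [0..<m]) = m + n" by simp
  then show ?thesis by (simp only: gsym_def gperm_def map_append)
qed

lemma gvalid_gperm: "distinct js \<Longrightarrow> set js = {..<length js} \<Longrightarrow> gvalid G (gperm js)"
proof -
  assume js: "distinct js" "set js = {..<length js}"
  have "concat (fst (gperm js)) = [0..<length js]" "concat (snd (gperm js)) = map (\<lambda>i. (i, \<one>)) js"
    by (simp_all add: gperm_def concat_map_single)
  moreover have "map fst (map (\<lambda>i. (i, \<one>)) js) = js" by (simp add: o_def)
  moreover have "snd ` set (map (\<lambda>i. (i, \<one>)) js) \<subseteq> carrier G" by auto
  moreover have "rearr [0..<length js] js" unfolding rearr_def js(2) using js(1) by (simp add: atLeast0LessThan)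
  ultimately show ?thesis unfolding gvalid_def by simp
qed

lemma span_class_gperm:
  assumes js: "distinct js" "set js = {..<length js}"
  shows "span_class G (lid G (length js), \<lparr>src = length js, fibres = map (\<lambda>i. [(i, \<one>)]) js\<rparr>) = gcls G (gperm js)"
proof (rule span_class_of[OF gvalid_gperm[OF js]])
  have "lift G (\<lambda>i. i) (\<lambda>_. \<one>) (length js) (gperm js) = (lid G (length js), \<lparr>src = length js, fibres = map (\<lambda>i. [(i, \<one>)]) js\<rparr>)"
    by (simp add: lift_def gperm_def lid_def o_def)
  moreover have "strands (gperm js) = {..<length js}" by (auto simp: strands_def gperm_def)
  ultimately show "(lid G (length js), \<lparr>src = length js, fibres = map (\<lambda>i. [(i, \<one>)]) js\<rparr>) \<in> gcls G (gperm js)"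
    using gclsI[of "\<lambda>i. i" "gperm js" "length js" "\<lambda>_. \<one>" G] by (auto simp: bij_betw_def)
qed

lemma Ident_gcls: "Ident (GFas_composite G) n = gcls G (gid G n)"
proof -
  have "distinct [0..<n]" "set [0..<n] = {..<length [0..<n]}" "length [0..<n] = n" by auto
  then show ?thesis
    using span_class_gperm[of "[0..<n]"]
    by (simp only: GFas_composite_def gid_eq lid_def sym_mon_cat.select_convs category.select_convs)
qed

lemma Sym_gcls: "Sym (GFas_composite G) m n = gcls G (gsym G m n)"
proof -
  have "map (\<lambda>i. [(m + i, \<one>)]) [0..<n] = map (\<lambda>i. [(i, \<one>)]) [m..<m + n]"
    by (induction n) simp_all
  moreover have "set ([m..<m + n] @ [0..<m]) = {..<length ([m..<m + n] @ [0..<m])}"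
    by auto
  moreover have "distinct ([m..<m + n] @ [0..<m])" by simp
  moreover have "length ([m..<m + n] @ [0..<m]) = m + n" by simp
  ultimately show ?thesis
    using span_class_gperm[of "[m..<m + n] @ [0..<m]"]
    by (simp only: GFas_composite_def gsym_eq lsym_def map_append sym_mon_cat.select_convs)
qed

text \<open>A permutation has one strand over every point, so each strand of \<open>s\<close> meets
  exactly one of them. Up to this partner, only the order of the output fibres has changed.\<close>

lemma gcomp_gperm_left:
  assumes s: "gvalid G s" and js: "length js = length (snd s)" "set js \<subseteq> {..<length js}"
  shows "gcomp G (gperm js) s = grename (\<lambda>x. (x, occ (map (map fst) (snd s)) x)) (fst s, map (nth (snd s)) js)"
proof -
  have o: "occ (map (\<lambda>i. [i]) [0..<length js]) i = i" if "i < length js" for i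
    using that by (intro occ_eq) (auto simp: o_def concat_map_single)
  have "map (\<lambda>xs. concat (map (\<lambda>x. map (Pair x) (map (\<lambda>i. [i]) [0..<length js] ! occ (map (map fst) (snd s)) x)) xs)) (fst s)
     = map (map (\<lambda>x. (x, occ (map (map fst) (snd s)) x))) (fst s)"
  proof (rule map_cong[OF refl])
    fix xs assume xs: "xs \<in> set (fst s)"
    have "map (\<lambda>x. map (Pair x) (map (\<lambda>i. [i]) [0..<length js] ! occ (map (map fst) (snd s)) x)) xs
       = map (\<lambda>x. [(x, occ (map (map fst) (snd s)) x)]) xs"
      using strandsD(3)[OF s strandsI(1)[OF xs]] js by simp
    then show "concat (map (\<lambda>x. map (Pair x) (map (\<lambda>i. [i]) [0..<length js] ! occ (map (map fst) (snd s)) x)) xs)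
      = map (\<lambda>x. (x, occ (map (map fst) (snd s)) x)) xs"
      by (simp only: concat_map_single)
  qed
  moreover have "map (\<lambda>v. concat (map (\<lambda>(y, b). map (\<lambda>(x, a). ((x, y), b \<otimes> a)) (snd s ! occ (map (\<lambda>i. [i]) [0..<length js]) y)) v)) (map (\<lambda>i. [(i, \<one>)]) js)
     = map (map (\<lambda>(x, a). ((x, occ (map (map fst) (snd s)) x), a))) (map (nth (snd s)) js)"
  proof -
    have "map (\<lambda>(x, a). ((x, j), \<one> \<otimes> a)) (snd s ! j) = map (\<lambda>(x, a). ((x, occ (map (map fst) (snd s)) x), a)) (snd s ! j)"
      if "j \<in> set js" for j
    proof -
      have j: "j < length (snd s)" using that js by auto
      show ?thesis
        using labelledD[OF gvalidD(6)[OF s nth_mem[OF j]]] occ_eq_strands'[OF s j] by auto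
    qed
    then show ?thesis using o js(2) by (auto simp: subset_iff)
  qed
  ultimately show ?thesis by (simp add: gcomp_def gperm_def grename_def)
qed

text \<open>Dually the input fibres are reordered, but by the inverse permutation: input
  \<open>i\<close> leads to the position of \<open>i\<close> in \<open>js\<close>.\<close>

lemma gcomp_gperm_right:
  assumes s: "gvalid G s" and js: "length js = length (fst s)" "set js = {..<length js}" "distinct js"
  shows "gcomp G s (gperm js) = grename (\<lambda>y. (js ! occ (fst s) y, y))
    (map (\<lambda>i. fst s ! occ (map (\<lambda>j. [j]) js) i) [0..<length js], snd s)"
proof -
  have o: "occ (map (\<lambda>j. [j]) js) (js ! k) = k" if "k < length js" for k
    using that js(3) by (intro occ_eq) (auto simp: o_def concat_map_single)
  have "map (Pair i) (fst s ! occ (map (\<lambda>j. [j]) js) i) = map (\<lambda>y. (js ! occ (fst s) y, y)) (fst s ! occ (map (\<lambda>j. [j]) js) i)"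
    if "i < length js" for i
  proof -
    obtain k where k: "k < length js" "i = js ! k" using \<open>i < length js\<close> js(2) by (metis in_set_conv_nth lessThan_iff)
    then show ?thesis using o occ_eq_strands[OF s] js(1) by auto
  qed
  moreover have "concat (map (\<lambda>(y, b). map (\<lambda>(x, a). ((x, y), b \<otimes> a)) (map (\<lambda>i. [(i, \<one>)]) js ! occ (fst s) y)) v)
     = map (\<lambda>(y, b). ((js ! occ (fst s) y, y), b)) v" if v: "v \<in> set (snd s)" for v
  proof -
    have "map (\<lambda>(y, b). map (\<lambda>(x, a). ((x, y), b \<otimes> a)) (map (\<lambda>i. [(i, \<one>)]) js ! occ (fst s) y)) v
       = map (\<lambda>z. [(\<lambda>(y, b). ((js ! occ (fst s) y, y), b)) z]) v"
      using strandsD(1)[OF s strandsI(2)[OF s v]] labelledD[OF gvalidD(6)[OF s v]] js(1) by auto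
    then show ?thesis by (simp only: concat_map_single)
  qed
  ultimately show ?thesis by (simp add: gcomp_def gperm_def grename_def o_def)
qed

end

section \<open>Associativity and interchange for composites of spans\<close>

lemma concat_map_bind: "concat (map f (concat (map g xs))) = concat (map (\<lambda>x. concat (map f (g x))) xs)"
  by (induction xs) simp_all

lemma mset_concat_cong: "mset xss = mset yss \<Longrightarrow> mset (concat xss) = mset (concat yss)"
  by (metis mset_concat mset_map sum_mset_sum_list)

context group
begin

lemma gcomp_lengths [simp]:
  "length (fst (gcomp G t s)) = length (fst s)"
  "length (snd (gcomp G t s)) = length (snd t)"
  by (simp_all add: gcomp_def)

lemma gtensor_sel:
  "fst (gtensor s t) = map (map Inl) (fst s) @ map (map Inr) (fst t)"
  "snd (gtensor s t) = map (map (\<lambda>(x, a). (Inl x, a))) (snd s) @ map (map (\<lambda>(x, a). (Inr x, a))) (snd t)"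
  by (simp_all add: gtensor_def)

lemma gcomp_sel:
  "fst (gcomp G t s) = map (\<lambda>xs. concat (map (\<lambda>x. map (Pair x) (fst t ! occ (map (map fst) (snd s)) x)) xs)) (fst s)"
  "snd (gcomp G t s) = map (\<lambda>v. concat (map (\<lambda>(y, b). map (\<lambda>(x, a). ((x, y), b \<otimes> a)) (snd s ! occ (fst t) y)) v)) (snd t)"
  by (simp_all add: gcomp_def)

text \<open>The underlying maps of a composite are the outer legs after the projections of the
  pullback.\<close>

lemma occ_gcomp:
  assumes s: "gvalid G s" and t: "gvalid G t" and l: "length (snd s) = length (fst t)"
    and z: "(x, y) \<in> strands (gcomp G t s)"
  shows "occ (fst (gcomp G t s)) (x, y) = occ (fst s) x"
    and "occ (map (map fst) (snd (gcomp G t s))) (x, y) = occ (map (map fst) (snd t)) y"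
proof -
  have v: "gvalid G (gcomp G t s)" by (rule gvalid_gcomp[OF is_group s t l])
  have xy: "x \<in> strands s" "y \<in> strands t" "occ (map (map fst) (snd s)) x = occ (fst t) y"
    using z unfolding strands_gcomp[OF s t l] by auto
  have "(x, y) \<in> set (fst (gcomp G t s) ! occ (fst s) x)"
    using strandsD(1,2)[OF s xy(1)] strandsD(2)[OF t xy(2)] xy(3) by (auto simp: gcomp_def intro!: bexI[of _ x])
  then show "occ (fst (gcomp G t s)) (x, y) = occ (fst s) x"
    using strandsD(1)[OF s xy(1)] by (intro occ_eq_strands[OF v]) (auto simp: gcomp_def)
  obtain b where b: "(y, b) \<in> set (snd t ! occ (map (map fst) (snd t)) y)" using strandsD(4)[OF t xy(2)] by auto
  obtain a where a: "(x, a) \<in> set (snd s ! occ (fst t) y)" using strandsD(4)[OF s xy(1)] xy(3) by auto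
  have "((x, y), b \<otimes> a) \<in> set (snd (gcomp G t s) ! occ (map (map fst) (snd t)) y)"
    using strandsD(3)[OF t xy(2)] a b by (force simp: gcomp_def)
  then show "occ (map (map fst) (snd (gcomp G t s))) (x, y) = occ (map (map fst) (snd t)) y"
    using strandsD(3)[OF t xy(2)] by (intro occ_eq_strands'[OF v]) (auto simp: gcomp_def)
qed

text \<open>Iterated pullbacks agree up to rebracketing of triples, and both orders of substitution
  list each fibre in the same way; the labels agree by associativity in \<open>G\<close>.\<close>

lemma gcomp_assoc:
  assumes s: "gvalid G s" and t: "gvalid G t" and u: "gvalid G u"
    and l: "length (snd s) = length (fst t)" and l': "length (snd t) = length (fst u)"
  shows "gcomp G (gcomp G u t) s = grename (\<lambda>((x, y), z). (x, (y, z))) (gcomp G u (gcomp G t s))"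
proof (rule prod_eqI)
  let ?oW = "occ (map (map fst) (snd s))" and ?oV = "occ (map (map fst) (snd t))"
  let ?oP = "occ (fst t)" and ?oR = "occ (fst u)"
  let ?\<rho> = "\<lambda>((x, y), z). (x, (y, z))"
  have vt: "gvalid G (gcomp G t s)" "gvalid G (gcomp G u t)"
    by (intro gvalid_gcomp is_group s t u l l')+
  show "fst (gcomp G (gcomp G u t) s) = fst (grename ?\<rho> (gcomp G u (gcomp G t s)))"
  proof -
    have "concat (map (\<lambda>x. map (Pair x) (fst (gcomp G u t) ! ?oW x)) xs) =
      map ?\<rho> (concat (map (\<lambda>z. map (Pair z) (fst u ! occ (map (map fst) (snd (gcomp G t s))) z)) (concat (map (\<lambda>x. map (Pair x) (fst t ! ?oW x)) xs))))"
      if xs: "xs \<in> set (fst s)" for xs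
    proof -
      have "map (Pair x) (fst (gcomp G u t) ! ?oW x) =
        map ?\<rho> (concat (map (\<lambda>z. map (Pair z) (fst u ! occ (map (map fst) (snd (gcomp G t s))) z)) (map (Pair x) (fst t ! ?oW x))))"
        if x: "x \<in> set xs" for x
      proof -
        have xS: "x \<in> strands s" using strandsI(1)[OF xs x] .
        have o: "?oW x < length (fst t)" using strandsD(3)[OF s xS] l by simp
        have "(x, y) \<in> strands (gcomp G t s)" if "y \<in> set (fst t ! ?oW x)" for y
          unfolding strands_gcomp[OF s t l] using xS strandsI(1)[OF nth_mem[OF o] that] occ_eq_strands[OF t o that] by simp
        then have eq: "map (\<lambda>y. map (Pair (x, y)) (fst u ! occ (map (map fst) (snd (gcomp G t s))) (x, y))) (fst t ! ?oW x)
          = map (\<lambda>y. map (Pair (x, y)) (fst u ! ?oV y)) (fst t ! ?oW x)"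
          using occ_gcomp(2)[OF s t l] by simp
        have "map ?\<rho> (concat (map (\<lambda>z. map (Pair z) (fst u ! occ (map (map fst) (snd (gcomp G t s))) z)) (map (Pair x) (fst t ! ?oW x))))
          = map ?\<rho> (concat (map (\<lambda>y. map (Pair (x, y)) (fst u ! occ (map (map fst) (snd (gcomp G t s))) (x, y))) (fst t ! ?oW x)))"
          by (simp only: map_map o_def)
        also have "\<dots> = map (Pair x) (concat (map (\<lambda>y. map (Pair y) (fst u ! ?oV y)) (fst t ! ?oW x)))"
          unfolding eq by (simp add: map_concat o_def)
        also have "concat (map (\<lambda>y. map (Pair y) (fst u ! ?oV y)) (fst t ! ?oW x)) = fst (gcomp G u t) ! ?oW x"
          using o by (simp add: gcomp_def)
        finally show ?thesis ..
      qed
      then have "map (\<lambda>x. map (Pair x) (fst (gcomp G u t) ! ?oW x)) xs =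
        map (\<lambda>x. map ?\<rho> (concat (map (\<lambda>z. map (Pair z) (fst u ! occ (map (map fst) (snd (gcomp G t s))) z)) (map (Pair x) (fst t ! ?oW x))))) xs"
        by (intro map_cong refl)
      then show ?thesis by (simp only: concat_map_concat' map_concat map_map o_def)
    qed
    then show ?thesis
      unfolding gcomp_def[of G "gcomp G u t" s] grename_def gcomp_def[of G u "gcomp G t s"] fst_conv
      by (simp add: gcomp_def[of G t s] o_def)
  qed
  show "snd (gcomp G (gcomp G u t) s) = snd (grename ?\<rho> (gcomp G u (gcomp G t s)))"
  proof -
    have "concat (map (\<lambda>(yz, b). map (\<lambda>(x, a). ((x, yz), b \<otimes> a)) (snd s ! occ (fst (gcomp G u t)) yz))
         (concat (map (\<lambda>(z, c). map (\<lambda>(y, b). ((y, z), c \<otimes> b)) (snd t ! ?oR z)) w)))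
      = map (\<lambda>(q, a). (?\<rho> q, a)) (concat (map (\<lambda>(z, c). map (\<lambda>(xy, b). ((xy, z), c \<otimes> b)) (snd (gcomp G t s) ! ?oR z)) w))"
      if w: "w \<in> set (snd u)" for w
    proof -
      have "concat (map (\<lambda>(yz, b). map (\<lambda>(x, a). ((x, yz), b \<otimes> a)) (snd s ! occ (fst (gcomp G u t)) yz)) (map (\<lambda>(y, b). ((y, z), c \<otimes> b)) (snd t ! ?oR z)))
        = map (\<lambda>(q, a). (?\<rho> q, a)) (map (\<lambda>(xy, b). ((xy, z), c \<otimes> b)) (snd (gcomp G t s) ! ?oR z))"
        if zc: "(z, c) \<in> set w" for z c
      proof -
        have zS: "z \<in> strands u" using strandsI(2)[OF u w zc] .
        have o: "?oR z < length (snd t)" using strandsD(1)[OF u zS] l' by simp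
        have c: "c \<in> carrier G" using labelledD[OF gvalidD(6)[OF u w] zc] .
        have e: "snd (gcomp G t s) ! ?oR z = concat (map (\<lambda>(y, b). map (\<lambda>(x, a). ((x, y), b \<otimes> a)) (snd s ! ?oP y)) (snd t ! ?oR z))"
          using o by (simp add: gcomp_def)
        have "map (\<lambda>(x, a). ((x, (y, z)), (c \<otimes> b) \<otimes> a)) (snd s ! occ (fst (gcomp G u t)) (y, z))
          = map (\<lambda>(x, a). ((x, (y, z)), c \<otimes> (b \<otimes> a))) (snd s ! ?oP y)" if yb: "(y, b) \<in> set (snd t ! ?oR z)" for y b
        proof -
          have y: "y \<in> strands t" using strandsI(2)[OF t nth_mem[OF o] yb] .
          have b: "b \<in> carrier G" using labelledD[OF gvalidD(6)[OF t nth_mem[OF o]] yb] .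
          have "(y, z) \<in> strands (gcomp G u t)"
            unfolding strands_gcomp[OF t u l'] using y zS occ_eq_strands'[OF t o yb] by simp
          then have "occ (fst (gcomp G u t)) (y, z) = ?oP y" by (rule occ_gcomp(1)[OF t u l'])
          moreover have "?oP y < length (snd s)" using strandsD(1)[OF t y] l by simp
          ultimately show ?thesis
            using labelledD[OF gvalidD(6)[OF s nth_mem]] b c by (auto simp: m_assoc)
        qed
        then have "map (\<lambda>(y, b). map (\<lambda>(x, a). ((x, (y, z)), (c \<otimes> b) \<otimes> a)) (snd s ! occ (fst (gcomp G u t)) (y, z))) (snd t ! ?oR z)
          = map (\<lambda>(y, b). map (\<lambda>(x, a). ((x, (y, z)), c \<otimes> (b \<otimes> a))) (snd s ! ?oP y)) (snd t ! ?oR z)"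
          by auto
        then show ?thesis unfolding e
          by (simp add: map_concat o_def split_def) (auto intro!: arg_cong[of _ _ concat])
      qed
      then have "map (\<lambda>(z, c). concat (map (\<lambda>(yz, b). map (\<lambda>(x, a). ((x, yz), b \<otimes> a)) (snd s ! occ (fst (gcomp G u t)) yz)) (map (\<lambda>(y, b). ((y, z), c \<otimes> b)) (snd t ! ?oR z)))) w
        = map (\<lambda>(z, c). map (\<lambda>(q, a). (?\<rho> q, a)) (map (\<lambda>(xy, b). ((xy, z), c \<otimes> b)) (snd (gcomp G t s) ! ?oR z))) w"
        by auto
      then show ?thesis unfolding concat_map_bind by (simp only: map_concat map_map o_def split_def)
    qed
    then show ?thesis
      unfolding gcomp_def[of G "gcomp G u t" s] grename_def gcomp_def[of G u "gcomp G t s"] snd_conv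
      by (simp add: gcomp_def[of G u t] o_def)
  qed
qed

lemma gcls_assoc:
  assumes s: "gvalid G s" and t: "gvalid G t" and u: "gvalid G u"
    and l: "length (snd s) = length (fst t)" and l': "length (snd t) = length (fst u)"
  shows "gcls G (gcomp G (gcomp G u t) s) = gcls G (gcomp G u (gcomp G t s))"
proof (rule gcls_eqI[OF _ _ gcomp_assoc[OF assms]])
  show "gvalid G (gcomp G u (gcomp G t s))"
    by (intro gvalid_gcomp is_group s t u l) (simp add: l')
qed (auto simp: inj_on_def)

lemma strands_gtensor: "strands (gtensor s t) = Inl ` strands s \<union> Inr ` strands t"
  by (auto simp: strands_def gtensor_def)

lemma gtensor_lengths [simp]:
  "length (fst (gtensor s t)) = length (fst s) + length (fst t)"
  "length (snd (gtensor s t)) = length (snd s) + length (snd t)"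
  by (simp_all add: gtensor_def)

lemma gtensor_nth:
  "i < length (fst s) \<Longrightarrow> fst (gtensor s t) ! i = map Inl (fst s ! i)"
  "j < length (fst t) \<Longrightarrow> fst (gtensor s t) ! (length (fst s) + j) = map Inr (fst t ! j)"
  "k < length (snd s) \<Longrightarrow> snd (gtensor s t) ! k = map (\<lambda>(x, a). (Inl x, a)) (snd s ! k)"
  "h < length (snd t) \<Longrightarrow> snd (gtensor s t) ! (length (snd s) + h) = map (\<lambda>(x, a). (Inr x, a)) (snd t ! h)"
  by (simp_all add: gtensor_def nth_append)

lemma occ_gtensor:
  assumes s: "gvalid G s" and t: "gvalid G t"
  shows "x \<in> strands s \<Longrightarrow> occ (fst (gtensor s t)) (Inl x) = occ (fst s) x"
    "y \<in> strands t \<Longrightarrow> occ (fst (gtensor s t)) (Inr y) = length (fst s) + occ (fst t) y"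
    "x \<in> strands s \<Longrightarrow> occ (map (map fst) (snd (gtensor s t))) (Inl x) = occ (map (map fst) (snd s)) x"
    "y \<in> strands t \<Longrightarrow> occ (map (map fst) (snd (gtensor s t))) (Inr y) = length (snd s) + occ (map (map fst) (snd t)) y"
proof -
  note v = gvalid_gtensor[OF s t]
  show "occ (fst (gtensor s t)) (Inl x) = occ (fst s) x" if "x \<in> strands s"
    using strandsD[OF s that] by (intro occ_eq_strands[OF v]) (auto simp: gtensor_nth)
  show "occ (fst (gtensor s t)) (Inr y) = length (fst s) + occ (fst t) y" if "y \<in> strands t"
    using strandsD[OF t that] by (intro occ_eq_strands[OF v]) (auto simp: gtensor_nth)
  show "occ (map (map fst) (snd (gtensor s t))) (Inl x) = occ (map (map fst) (snd s)) x" if x: "x \<in> strands s"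
  proof -
    obtain a where "(x, a) \<in> set (snd s ! occ (map (map fst) (snd s)) x)" using strandsD(4)[OF s x] by auto
    then show ?thesis using strandsD(3)[OF s x]
      by (intro occ_eq_strands'[OF v, of _ _ a]) (force simp: gtensor_nth)+
  qed
  show "occ (map (map fst) (snd (gtensor s t))) (Inr y) = length (snd s) + occ (map (map fst) (snd t)) y" if y: "y \<in> strands t"
  proof -
    obtain a where "(y, a) \<in> set (snd t ! occ (map (map fst) (snd t)) y)" using strandsD(4)[OF t y] by auto
    then show ?thesis using strandsD(3)[OF t y]
      by (intro occ_eq_strands'[OF v, of _ _ a]) (force simp: gtensor_nth)+
  qed
qed

text \<open>Pullbacks distribute over disjoint unions: a pair with components from different
  summands never lies over a common point, so this injection reaches all strands.\<close>

definition interchange_strand :: "('s \<times> 't) + ('u \<times> 'v) \<Rightarrow> ('s + 'u) \<times> ('t + 'v)" where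
  "interchange_strand z = (case z of Inl (x, y) \<Rightarrow> (Inl x, Inl y) | Inr (x, y) \<Rightarrow> (Inr x, Inr y))"

lemma gcomp_gtensor:
  assumes s: "gvalid G s" and t: "gvalid G t" and l: "length (snd s) = length (fst t)"
    and s': "gvalid G s'" and t': "gvalid G t'" and l': "length (snd s') = length (fst t')"
  shows "gcomp G (gtensor t t') (gtensor s s') = grename interchange_strand (gtensor (gcomp G t s) (gcomp G t' s'))"
proof (rule prod_eqI)
  note o = occ_gtensor[OF s s'] occ_gtensor[OF t t']
  have f1: "map (Pair (Inl x)) (fst (gtensor t t') ! occ (map (map fst) (snd (gtensor s s'))) (Inl x))
     = map (interchange_strand \<circ> Inl) (map (Pair x) (fst t ! occ (map (map fst) (snd s)) x))" if "x \<in> strands s" for x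
    using o(3)[OF that] strandsD(3)[OF s that] l by (simp add: gtensor_nth interchange_strand_def)
  have f2: "map (Pair (Inr x)) (fst (gtensor t t') ! occ (map (map fst) (snd (gtensor s s'))) (Inr x))
     = map (interchange_strand \<circ> Inr) (map (Pair x) (fst t' ! occ (map (map fst) (snd s')) x))" if "x \<in> strands s'" for x
    using o(4)[OF that] strandsD(3)[OF s' that] l l' by (simp add: gtensor_nth interchange_strand_def)
  have "concat (map (\<lambda>x. map (Pair x) (fst (gtensor t t') ! occ (map (map fst) (snd (gtensor s s'))) x)) (map Inl xs))
    = map (interchange_strand \<circ> Inl) (concat (map (\<lambda>x. map (Pair x) (fst t ! occ (map (map fst) (snd s)) x)) xs))"
    if "xs \<in> set (fst s)" for xs
  proof -
    have "map (\<lambda>x. map (Pair x) (fst (gtensor t t') ! occ (map (map fst) (snd (gtensor s s'))) x)) (map Inl xs)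
      = map (\<lambda>x. map (Pair (Inl x)) (fst (gtensor t t') ! occ (map (map fst) (snd (gtensor s s'))) (Inl x))) xs" by simp
    also have "\<dots> = map (\<lambda>x. map (interchange_strand \<circ> Inl) (map (Pair x) (fst t ! occ (map (map fst) (snd s)) x))) xs"
      by (rule map_cong[OF refl f1[OF strandsI(1)[OF that]]])
    finally show ?thesis by (simp only: map_concat map_map o_def)
  qed
  moreover have "concat (map (\<lambda>x. map (Pair x) (fst (gtensor t t') ! occ (map (map fst) (snd (gtensor s s'))) x)) (map Inr xs))
    = map (interchange_strand \<circ> Inr) (concat (map (\<lambda>x. map (Pair x) (fst t' ! occ (map (map fst) (snd s')) x)) xs))"
    if "xs \<in> set (fst s')" for xs
  proof -
    have "map (\<lambda>x. map (Pair x) (fst (gtensor t t') ! occ (map (map fst) (snd (gtensor s s'))) x)) (map Inr xs)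
      = map (\<lambda>x. map (Pair (Inr x)) (fst (gtensor t t') ! occ (map (map fst) (snd (gtensor s s'))) (Inr x))) xs" by simp
    also have "\<dots> = map (\<lambda>x. map (interchange_strand \<circ> Inr) (map (Pair x) (fst t' ! occ (map (map fst) (snd s')) x))) xs"
      by (rule map_cong[OF refl f2[OF strandsI(1)[OF that]]])
    finally show ?thesis by (simp only: map_concat map_map o_def)
  qed
  ultimately show "fst (gcomp G (gtensor t t') (gtensor s s')) = fst (grename interchange_strand (gtensor (gcomp G t s) (gcomp G t' s')))"
    unfolding gcomp_sel(1)[of "gtensor t t'"] grename_def fst_conv gtensor_sel(1)[of s s'] gtensor_sel(1)[of "gcomp G t s"]
      gcomp_sel(1)[of t s] gcomp_sel(1)[of t' s'] map_append map_map o_def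
    by (simp add: o_def)
  let ?i = "\<lambda>(x, a). (interchange_strand x, a)"
  have g1: "map (\<lambda>(x, a). ((x, Inl y), b \<otimes> a)) (snd (gtensor s s') ! occ (fst (gtensor t t')) (Inl y))
     = map ?i (map (\<lambda>(x, a). (Inl x, a)) (map (\<lambda>(x, a). ((x, y), b \<otimes> a)) (snd s ! occ (fst t) y)))" if "y \<in> strands t" for y b
    using o(5)[OF that] strandsD(1)[OF t that] l by (auto simp: gtensor_nth interchange_strand_def)
  have g2: "map (\<lambda>(x, a). ((x, Inr y), b \<otimes> a)) (snd (gtensor s s') ! occ (fst (gtensor t t')) (Inr y))
     = map ?i (map (\<lambda>(x, a). (Inr x, a)) (map (\<lambda>(x, a). ((x, y), b \<otimes> a)) (snd s' ! occ (fst t') y)))" if "y \<in> strands t'" for y b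
    using o(6)[OF that] strandsD(1)[OF t' that] gtensor_nth(4)[of "occ (fst t') y" s' s] l l'
    by (auto simp: interchange_strand_def)
  have "concat (map (\<lambda>(y, b). map (\<lambda>(x, a). ((x, y), b \<otimes> a)) (snd (gtensor s s') ! occ (fst (gtensor t t')) y)) (map (\<lambda>(x, a). (Inl x, a)) v))
    = map ?i (map (\<lambda>(x, a). (Inl x, a)) (concat (map (\<lambda>(y, b). map (\<lambda>(x, a). ((x, y), b \<otimes> a)) (snd s ! occ (fst t) y)) v)))"
    if v: "v \<in> set (snd t)" for v
  proof -
    have "map (\<lambda>(y, b). map (\<lambda>(x, a). ((x, y), b \<otimes> a)) (snd (gtensor s s') ! occ (fst (gtensor t t')) y)) (map (\<lambda>(x, a). (Inl x, a)) v)
      = map (\<lambda>z. map ?i (map (\<lambda>(x, a). (Inl x, a)) ((\<lambda>(y, b). map (\<lambda>(x, a). ((x, y), b \<otimes> a)) (snd s ! occ (fst t) y)) z))) v"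
      by (simp only: map_map[of _ "\<lambda>(x, a). (Inl x, a)" v]) (rule map_cong[OF refl], clarsimp simp only: o_def prod.case g1[OF strandsI(2)[OF t v]])
    then show ?thesis by (simp only: map_concat map_map o_def)
  qed
  moreover have "concat (map (\<lambda>(y, b). map (\<lambda>(x, a). ((x, y), b \<otimes> a)) (snd (gtensor s s') ! occ (fst (gtensor t t')) y)) (map (\<lambda>(x, a). (Inr x, a)) v))
    = map ?i (map (\<lambda>(x, a). (Inr x, a)) (concat (map (\<lambda>(y, b). map (\<lambda>(x, a). ((x, y), b \<otimes> a)) (snd s' ! occ (fst t') y)) v)))"
    if v: "v \<in> set (snd t')" for v
  proof -
    have "map (\<lambda>(y, b). map (\<lambda>(x, a). ((x, y), b \<otimes> a)) (snd (gtensor s s') ! occ (fst (gtensor t t')) y)) (map (\<lambda>(x, a). (Inr x, a)) v)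
      = map (\<lambda>z. map ?i (map (\<lambda>(x, a). (Inr x, a)) ((\<lambda>(y, b). map (\<lambda>(x, a). ((x, y), b \<otimes> a)) (snd s' ! occ (fst t') y)) z))) v"
      by (simp only: map_map[of _ "\<lambda>(x, a). (Inr x, a)" v]) (rule map_cong[OF refl], clarsimp simp only: o_def prod.case g2[OF strandsI(2)[OF t' v]])
    then show ?thesis by (simp only: map_concat map_map o_def)
  qed
  ultimately show "snd (gcomp G (gtensor t t') (gtensor s s')) = snd (grename interchange_strand (gtensor (gcomp G t s) (gcomp G t' s')))"
    unfolding gcomp_sel(2)[of "gtensor t t'"] grename_def snd_conv gtensor_sel(2)[of t t'] gtensor_sel(2)[of "gcomp G t s"]
      gcomp_sel(2)[of t s] gcomp_sel(2)[of t' s'] map_append map_map o_def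
    by (simp add: o_def)
qed

lemma gcls_interchange:
  assumes s: "gvalid G s" and t: "gvalid G t" and l: "length (snd s) = length (fst t)"
    and s': "gvalid G s'" and t': "gvalid G t'" and l': "length (snd s') = length (fst t')"
  shows "gcls G (gcomp G (gtensor t t') (gtensor s s')) = gcls G (gtensor (gcomp G t s) (gcomp G t' s'))"
  by (rule gcls_eqI[OF _ _ gcomp_gtensor[OF assms]])
    (intro gvalid_gtensor gvalid_gcomp is_group assms, auto simp: inj_on_def interchange_strand_def split: sum.splits)

lemma gcls_gtensor_assoc:
  assumes "gvalid G s" "gvalid G t" "gvalid G u"
  shows "gcls G (gtensor (gtensor s t) u) = gcls G (gtensor s (gtensor t u))"
proof (rule gcls_eqI[symmetric])
  let ?\<rho> = "case_sum (case_sum Inl (Inr \<circ> Inl)) (Inr \<circ> Inr)"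
  show "inj_on ?\<rho> (strands (gtensor (gtensor s t) u))" by (auto simp: inj_on_def split: sum.splits)
  show "gtensor s (gtensor t u) = grename ?\<rho> (gtensor (gtensor s t) u)"
    by (simp add: gtensor_def grename_def o_def split_def)
qed (intro gvalid_gtensor assms)

lemma gcls_gtensor_0:
  assumes "gvalid G s"
  shows "gcls G (gtensor (gid G 0) s) = gcls G s" "gcls G (gtensor s (gid G 0)) = gcls G s"
proof -
  show "gcls G (gtensor (gid G 0) s) = gcls G s"
    by (rule gcls_eqI[OF assms, of Inr]) (simp_all add: gtensor_def gid_def grename_def)
  show "gcls G (gtensor s (gid G 0)) = gcls G s"
    by (rule gcls_eqI[OF assms, of Inl]) (simp_all add: gtensor_def gid_def grename_def)
qed

text \<open>Reordering the fibres keeps the multiset of strands, which gives validity of the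
  reordered span; the class is then unchanged by dropping the partner of each strand.\<close>

lemma gcls_gperm_left:
  assumes s: "gvalid G s" and js: "length js = length (snd s)" "set js = {..<length js}" "distinct js"
  shows "gcls G (gcomp G (gperm js) s) = gcls G (fst s, map (nth (snd s)) js)"
    and "gvalid G (fst s, map (nth (snd s)) js)"
proof -
  have m: "mset (map (nth (snd s)) js) = mset (snd s)"
  proof -
    have "mset js = mset [0..<length (snd s)]"
      using js by (metis atLeast_upt distinct_upt set_eq_iff_mset_eq_distinct)
    then have "mset (map (nth (snd s)) js) = mset (map (nth (snd s)) [0..<length (snd s)])"
      by (simp only: mset_map)
    then show ?thesis by (simp only: map_nth)
  qed
  have mc: "mset (concat (map (nth (snd s)) js)) = mset (concat (snd s))"
    using m by (rule mset_concat_cong)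
  then have mf: "mset (map fst (concat (map (nth (snd s)) js))) = mset (map fst (concat (snd s)))"
    by (simp only: mset_map)
  show v: "gvalid G (fst s, map (nth (snd s)) js)"
    using s mset_eq_imp_distinct_iff[OF mf] mset_eq_setD[OF mf] mset_eq_setD[OF mc]
    unfolding gvalid_def rearr_def fst_conv snd_conv by simp
  show "gcls G (gcomp G (gperm js) s) = gcls G (fst s, map (nth (snd s)) js)"
    by (rule gcls_eqI[OF v _ gcomp_gperm_left[OF s js(1)]]) (use js(2) in \<open>auto simp: inj_on_def\<close>)
qed

lemma gcls_gperm_right:
  assumes s: "gvalid G s" and js: "length js = length (fst s)" "set js = {..<length js}" "distinct js"
  shows "gcls G (gcomp G s (gperm js)) = gcls G (map (\<lambda>i. fst s ! occ (map (\<lambda>j. [j]) js) i) [0..<length js], snd s)"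
    and "gvalid G (map (\<lambda>i. fst s ! occ (map (\<lambda>j. [j]) js) i) [0..<length js], snd s)"
proof -
  have o: "occ (map (\<lambda>j. [j]) js) (js ! k) = k" if "k < length js" for k
    using that js(3) by (intro occ_eq) (auto simp: o_def concat_map_single)
  let ?f = "\<lambda>i. fst s ! occ (map (\<lambda>j. [j]) js) i"
  have m: "mset (map ?f [0..<length js]) = mset (fst s)"
  proof -
    have "mset [0..<length js] = mset js"
      using js by (metis atLeast_upt distinct_upt set_eq_iff_mset_eq_distinct)
    then have "mset (map ?f [0..<length js]) = mset (map ?f js)"
      by (simp only: mset_map)
    also have "map ?f js = fst s"
      using o js(1) by (intro nth_equalityI) auto
    finally show ?thesis .
  qed
  have mc: "mset (concat (map ?f [0..<length js])) = mset (concat (fst s))"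
    using m by (rule mset_concat_cong)
  show v: "gvalid G (map ?f [0..<length js], snd s)"
    using s mset_eq_imp_distinct_iff[OF mc] mset_eq_setD[OF mc]
    unfolding gvalid_def rearr_def fst_conv snd_conv by simp
  show "gcls G (gcomp G s (gperm js)) = gcls G (map ?f [0..<length js], snd s)"
    by (rule gcls_eqI[OF v _ gcomp_gperm_right[OF s js]]) (auto simp: inj_on_def)
qed

end

section \<open>The composite PROP satisfies the laws of a PROP\<close>

context group
begin

abbreviation "TG \<equiv> GFas_composite G"

lemma TG_sel [simp]:
  "Obj TG = UNIV" "TObj TG m n = m + n" "Unit TG = 0"
  "Assoc TG l m n = Ident TG (l + m + n)" "LUnit TG n = Ident TG n" "RUnit TG n = Ident TG n"
  by (simp_all add: GFas_composite_def)

lemma Hom_gclsI: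
  "gvalid G s \<Longrightarrow> length (fst s) = m \<Longrightarrow> length (snd s) = n \<Longrightarrow> gcls G s \<in> Hom TG m n"
  by (simp add: Hom_def Arr_gcls Dom_gcls Cod_gcls)

lemma Hom_gclsE:
  assumes "f \<in> Hom TG m n"
  obtains s :: "(nat, 'a) gspan" where "gvalid G s" "f = gcls G s" "length (fst s) = m" "length (snd s) = n"
proof -
  obtain s :: "(nat, 'a) gspan" where "gvalid G s" "f = gcls G s"
    using assms by (auto simp: Hom_def elim: Arr_gclsE)
  then show thesis using that assms by (auto simp: Hom_def Dom_gcls Cod_gcls)
qed

lemma gid_lengths [simp]: "length (fst (gid G n)) = n" "length (snd (gid G n)) = n"
  by (simp_all add: gid_def)

lemma gsym_lengths [simp]: "length (fst (gsym G m n)) = m + n" "length (snd (gsym G m n)) = n + m"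
  by (simp_all add: gsym_def)

lemma gperm_lengths [simp]: "length (fst (gperm js)) = length js" "length (snd (gperm js)) = length js"
  by (simp_all add: gperm_def)

lemmas gvalid_gid' = gvalid_gid[OF is_group] and gvalid_gsym' = gvalid_gsym[OF is_group]

lemma gcls_gid_left: "gvalid G s \<Longrightarrow> length (snd s) = n \<Longrightarrow> gcls G (gcomp G (gid G n) s) = gcls G s"
  unfolding gid_eq by (subst gcls_gperm_left) (auto simp: map_nth)

lemma gcls_gid_right: "gvalid G s \<Longrightarrow> length (fst s) = n \<Longrightarrow> gcls G (gcomp G s (gid G n)) = gcls G s"
proof -
  assume s: "gvalid G s" "length (fst s) = n"
  have "occ (map (\<lambda>j. [j]) [0..<n]) i = i" if "i < n" for i
    using that by (intro occ_eq) auto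
  then have "map (\<lambda>i. fst s ! occ (map (\<lambda>j. [j]) [0..<n]) i) [0..<n] = map (nth (fst s)) [0..<n]"
    by simp
  also have "\<dots> = fst s" using s(2) map_nth[of "fst s"] by simp
  finally show ?thesis
    unfolding gid_eq using s by (subst gcls_gperm_right) auto
qed

lemma gcls_gtensor_gperm:
  assumes "distinct js" "set js = {..<length js}" "distinct ks" "set ks = {..<length ks}"
  shows "gcls G (gtensor (gperm js) (gperm ks)) = gcls G (gperm (js @ map (\<lambda>k. length js + k) ks))"
proof (rule gcls_eqI[symmetric])
  let ?\<rho> = "case_sum id (\<lambda>k. length js + k)"
  show "gvalid G (gtensor (gperm js) (gperm ks))"
    by (intro gvalid_gtensor gvalid_gperm assms)
  have st: "strands (gperm js) = {..<length js}" for js by (auto simp: strands_def gperm_def)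
  show "inj_on ?\<rho> (strands (gtensor (gperm js) (gperm ks)))"
    unfolding strands_gtensor st by (auto simp: inj_on_def)
  have "[0..<length js + length ks] = [0..<length js] @ map (\<lambda>k. length js + k) [0..<length ks]"
    by (rule nth_equalityI) (auto simp: nth_append)
  then show "gperm (js @ map (\<lambda>k. length js + k) ks) = grename ?\<rho> (gtensor (gperm js) (gperm ks))"
    by (simp add: gperm_def gtensor_def grename_def o_def)
qed

lemma gcls_gcomp_gperm:
  assumes "distinct js" "set js = {..<length js}" "distinct ks" "set ks = {..<length ks}" "length ks = length js"
  shows "gcls G (gcomp G (gperm ks) (gperm js)) = gcls G (gperm (map (nth js) ks))"
proof -
  have "(fst (gperm js), map (nth (snd (gperm js))) ks) = gperm (map (nth js) ks)"
    using assms by (auto simp: gperm_def)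
  then show ?thesis
    using gcls_gperm_left[OF gvalid_gperm[OF assms(1,2)], of ks] assms by simp
qed

text \<open>The symmetry permutes outputs on one side and inputs on the other. Both results have the
  inputs of \<open>s\<close> before those of \<open>t\<close> and the outputs of \<open>t\<close>
  before those of \<open>s\<close>; they differ by exchanging \<open>Inl\<close> and
  \<open>Inr\<close>.\<close>

lemma gcls_sym_nat:
  assumes s: "gvalid G s" and t: "gvalid G t"
  shows "gcls G (gcomp G (gsym G (length (snd s)) (length (snd t))) (gtensor s t))
    = gcls G (gcomp G (gtensor t s) (gsym G (length (fst s)) (length (fst t))))"
proof -
  let ?x = "length (fst s)" and ?y = "length (fst t)" and ?x' = "length (snd s)" and ?y' = "length (snd t)"
  let ?js = "[?x'..<?x' + ?y'] @ [0..<?x']" and ?ks = "[?x..<?x + ?y] @ [0..<?x]"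
  let ?\<rho> = "case_sum Inr Inl"
  have v: "gvalid G (gtensor s t)" "gvalid G (gtensor t s)" using gvalid_gtensor s t by blast+
  have js: "length ?js = length (snd (gtensor s t))" "set ?js = {..<length ?js}" "distinct ?js"
    and ks: "length ?ks = length (fst (gtensor t s))" "set ?ks = {..<length ?ks}" "distinct ?ks"
    by auto
  have L: "map (nth (snd (gtensor s t))) ?js = map (map (\<lambda>(x, a). (Inr x, a))) (snd t) @ map (map (\<lambda>(x, a). (Inl x, a))) (snd s)"
    by (rule nth_equalityI) (auto simp: nth_append gtensor_sel)
  have o: "occ (map (\<lambda>j. [j]) ?ks) i = (if i < ?x then ?y + i else i - ?x)" if "i < ?x + ?y" for i
    using that by (intro occ_eq) (auto simp: concat_map_single nth_append)
  have R: "map (\<lambda>i. fst (gtensor t s) ! occ (map (\<lambda>j. [j]) ?ks) i) [0..<length ?ks]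
    = map (map Inr) (fst s) @ map (map Inl) (fst t)"
  proof (rule nth_equalityI)
    fix i assume "i < length (map (\<lambda>i. fst (gtensor t s) ! occ (map (\<lambda>j. [j]) ?ks) i) [0..<length ?ks])"
    then have i: "i < ?x + ?y" by simp
    show "map (\<lambda>i. fst (gtensor t s) ! occ (map (\<lambda>j. [j]) ?ks) i) [0..<length ?ks] ! i
      = (map (map Inr) (fst s) @ map (map Inl) (fst t)) ! i"
      using i o[OF i] by (auto simp: nth_append gtensor_sel simp del: map_append)
  qed simp
  have "gcls G (gcomp G (gsym G ?x' ?y') (gtensor s t)) =
      gcls G (fst (gtensor s t), map (map (\<lambda>(x, a). (Inr x, a))) (snd t) @ map (map (\<lambda>(x, a). (Inl x, a))) (snd s))"
    unfolding gsym_eq gcls_gperm_left(1)[OF v(1) js] L ..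
  moreover have "gcls G (gcomp G (gtensor t s) (gsym G ?x ?y)) =
      gcls G (map (map Inr) (fst s) @ map (map Inl) (fst t), snd (gtensor t s))"
    unfolding gsym_eq gcls_gperm_right(1)[OF v(2) ks] R ..
  moreover have "gcls G (map (map Inr) (fst s) @ map (map Inl) (fst t), snd (gtensor t s))
      = gcls G (fst (gtensor s t), map (map (\<lambda>(x, a). (Inr x, a))) (snd t) @ map (map (\<lambda>(x, a). (Inl x, a))) (snd s))"
  proof (rule gcls_eqI)
    show "gvalid G (fst (gtensor s t), map (map (\<lambda>(x, a). (Inr x, a))) (snd t) @ map (map (\<lambda>(x, a). (Inl x, a))) (snd s))"
      using gcls_gperm_left(2)[OF v(1) js] unfolding L .
    show "inj_on ?\<rho> (strands (fst (gtensor s t), map (map (\<lambda>(x, a). (Inr x, a))) (snd t) @ map (map (\<lambda>(x, a). (Inl x, a))) (snd s)))"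
      by (auto simp: inj_on_def split: sum.splits)
    show "(map (map Inr) (fst s) @ map (map Inl) (fst t), snd (gtensor t s)) =
      grename ?\<rho> (fst (gtensor s t), map (map (\<lambda>(x, a). (Inr x, a))) (snd t) @ map (map (\<lambda>(x, a). (Inl x, a))) (snd s))"
      by (simp add: grename_def gtensor_sel o_def split_def)
  qed
  ultimately show ?thesis by simp
qed

lemma gcls_sym_sym: "gcls G (gcomp G (gsym G n m) (gsym G m n)) = gcls G (gid G (m + n))"
proof -
  have "map (nth ([m..<m + n] @ [0..<m])) ([n..<n + m] @ [0..<n]) = [0..<m + n]"
    by (rule nth_equalityI) (auto simp: nth_append)
  then show ?thesis
    unfolding gsym_eq gid_eq by (subst gcls_gcomp_gperm) auto
qed

text \<open>All factors are permutations, so the index lists are compared entry by entry.\<close>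

lemma gcls_hexagon:
  "gcls G (gcomp G (gtensor (gid G y) (gsym G x z)) (gtensor (gsym G x y) (gid G z))) = gcls G (gsym G x (y + z))"
proof -
  let ?js = "([x..<x + y] @ [0..<x]) @ map (\<lambda>k. length ([x..<x + y] @ [0..<x]) + k) [0..<z]"
  let ?ks = "[0..<y] @ map (\<lambda>k. length [0..<y] + k) ([x..<x + z] @ [0..<x])"
  have g: "gcls G (gtensor (gsym G x y) (gid G z)) = gcls G (gperm ?js)"
    unfolding gsym_eq gid_eq by (rule gcls_gtensor_gperm) auto
  have h: "gcls G (gtensor (gid G y) (gsym G x z)) = gcls G (gperm ?ks)"
    unfolding gsym_eq gid_eq by (rule gcls_gtensor_gperm) auto
  have js: "distinct ?js" "set ?js = {..<length ?js}" and ks: "distinct ?ks" "set ?ks = {..<length ?ks}"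
    by (auto simp: distinct_map inj_on_def image_iff)
  have l: "length ?ks = length ?js" by simp
  have vg: "gvalid G (gtensor (gsym G x y) (gid G z))" "gvalid G (gtensor (gid G y) (gsym G x z))"
    by (intro gvalid_gtensor gvalid_gid' gvalid_gsym')+
  have "gcls G (gcomp G (gtensor (gid G y) (gsym G x z)) (gtensor (gsym G x y) (gid G z)))
    = Cmp TG (gcls G (gtensor (gid G y) (gsym G x z))) (gcls G (gtensor (gsym G x y) (gid G z)))"
    by (rule Cmp_gcls[symmetric, OF vg]) simp
  also have "\<dots> = Cmp TG (gcls G (gperm ?ks)) (gcls G (gperm ?js))" unfolding g h ..
  also have "\<dots> = gcls G (gcomp G (gperm ?ks) (gperm ?js))"
    by (rule Cmp_gcls[OF gvalid_gperm[OF js] gvalid_gperm[OF ks]]) simp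
  also have "\<dots> = gcls G (gperm (map (nth ?js) ?ks))"
    by (rule gcls_gcomp_gperm[OF js ks l])
  also have "map (nth ?js) ?ks = [x..<x + (y + z)] @ [0..<x]"
    by (rule nth_equalityI) (auto simp: nth_append)
  finally show ?thesis unfolding gsym_eq .
qed

lemma category_TG: "category TG"
proof
  fix f g h x y z w
  show "Dom TG f \<in> Obj TG" "Cod TG f \<in> Obj TG" by simp_all
  show "Ident TG x \<in> Hom TG x x"
    unfolding Ident_gcls by (rule Hom_gclsI[OF gvalid_gid']) simp_all
  show "Cmp TG g f \<in> Hom TG x z" if "f \<in> Hom TG x y" "g \<in> Hom TG y z"
    using that by (elim Hom_gclsE) (auto simp: Cmp_gcls intro!: Hom_gclsI gvalid_gcomp is_group)
  show "Cmp TG (Ident TG y) f = f" if "f \<in> Hom TG x y"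
    using that by (elim Hom_gclsE) (auto simp: Cmp_gcls Ident_gcls gvalid_gid' gcls_gid_left)
  show "Cmp TG f (Ident TG x) = f" if "f \<in> Hom TG x y"
    using that by (elim Hom_gclsE) (auto simp: Cmp_gcls Ident_gcls gvalid_gid' gcls_gid_right)
  show "Cmp TG (Cmp TG h g) f = Cmp TG h (Cmp TG g f)"
    if "f \<in> Hom TG w x" "g \<in> Hom TG x y" "h \<in> Hom TG y z"
    using that by (elim Hom_gclsE) (simp add: Cmp_gcls gvalid_gcomp is_group gcls_assoc)
qed

lemma prop_category_TG: "prop_category TG"
proof -
  interpret category TG by (rule category_TG)
  have I: "Ident TG n \<in> Hom TG n n" for n using Ident_in by simp
  have iso: "iso_arrow TG (Ident TG n)" for n
    using I[of n] Ident_left[OF I[of n]] unfolding iso_arrow_def inverse_arrows_def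
    by (intro exI[of _ "Ident TG n"]) (simp add: Hom_def)
  have ten: "TArr TG f g \<in> Hom TG (x + x') (y + y')" if "f \<in> Hom TG x y" "g \<in> Hom TG x' y'" for f g x y x' y'
    using that by (elim Hom_gclsE) (auto simp: TArr_gcls intro!: Hom_gclsI gvalid_gtensor)
  have tI: "TArr TG (Ident TG x) (Ident TG y) = Ident TG (x + y)" for x y
  proof -
    have "map (\<lambda>k. x + k) [0..<y] = [x..<x + y]" by (rule nth_equalityI) auto
    then have "[0..<x] @ map (\<lambda>k. length [0..<x] + k) [0..<y] = [0..<x + y]"
      using upt_add_eq_append[of 0 x y] by simp
    then have "gcls G (gtensor (gid G x) (gid G y)) = gcls G (gid G (x + y))"
      unfolding gid_eq by (subst gcls_gtensor_gperm) auto
    then show ?thesis by (simp add: Ident_gcls TArr_gcls gvalid_gid')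
  qed
  have tassoc: "TArr TG (TArr TG f g) h = TArr TG f (TArr TG g h)"
    if "f \<in> Hom TG x x'" "g \<in> Hom TG y y'" "h \<in> Hom TG z z'" for f g h x x' y y' z z'
    using that by (elim Hom_gclsE) (simp add: TArr_gcls gvalid_gtensor gcls_gtensor_assoc)
  have t0: "TArr TG (Ident TG 0) f = f" "TArr TG f (Ident TG 0) = f" if "f \<in> Hom TG x y" for f x y
    using that by (elim Hom_gclsE; simp add: Ident_gcls TArr_gcls gvalid_gid' gcls_gtensor_0)+
  have S: "Sym TG x y \<in> Hom TG (x + y) (y + x)" for x y
    unfolding Sym_gcls by (rule Hom_gclsI[OF gvalid_gsym']) simp_all
  show ?thesis
  proof
    fix f g h f' g' x y z w x' y' z'
    show "TArr TG f g \<in> Hom TG (TObj TG x x') (TObj TG y y')" if "f \<in> Hom TG x y" "g \<in> Hom TG x' y'"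
      using ten[OF that] by simp
    show "TArr TG (Ident TG x) (Ident TG y) = Ident TG (TObj TG x y)"
      by (simp add: tI)
    show "TArr TG (Cmp TG g f) (Cmp TG g' f') = Cmp TG (TArr TG g g') (TArr TG f f')"
      if "f \<in> Hom TG x y" "g \<in> Hom TG y z" "f' \<in> Hom TG x' y'" "g' \<in> Hom TG y' z'"
      using that by (elim Hom_gclsE) (simp add: TArr_gcls Cmp_gcls gvalid_gtensor gvalid_gcomp is_group gcls_interchange)
    show "Assoc TG x y z \<in> Hom TG (TObj TG (TObj TG x y) z) (TObj TG x (TObj TG y z))"
      using I[of "x + y + z"] by (simp add: add.assoc)
    show "Cmp TG (Assoc TG x' y' z') (TArr TG (TArr TG f g) h) = Cmp TG (TArr TG f (TArr TG g h)) (Assoc TG x y z)"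
      if "f \<in> Hom TG x x'" "g \<in> Hom TG y y'" "h \<in> Hom TG z z'"
      using Ident_left[OF ten[OF ten[OF that(1,2)] that(3)]] Ident_right[OF ten[OF that(1) ten[OF that(2,3)]]] tassoc[OF that]
      by (simp add: add.assoc)
    show "LUnit TG x \<in> Hom TG (TObj TG (Unit TG) x) x" "RUnit TG x \<in> Hom TG (TObj TG x (Unit TG)) x"
      using I by simp_all
    show "Cmp TG (LUnit TG y) (TArr TG (Ident TG (Unit TG)) f) = Cmp TG f (LUnit TG x)"
      "Cmp TG (RUnit TG y) (TArr TG f (Ident TG (Unit TG))) = Cmp TG f (RUnit TG x)" if "f \<in> Hom TG x y"
      using t0[OF that] Ident_left[OF that] Ident_right[OF that] by simp_all
    show "iso_arrow TG (Assoc TG x y z)" "iso_arrow TG (LUnit TG x)" "iso_arrow TG (RUnit TG x)"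
      using iso by simp_all
    show "Cmp TG (Assoc TG w x (TObj TG y z)) (Assoc TG (TObj TG w x) y z) =
      Cmp TG (TArr TG (Ident TG w) (Assoc TG x y z)) (Cmp TG (Assoc TG w (TObj TG x y) z) (TArr TG (Assoc TG w x y) (Ident TG z)))"
      using Ident_left[OF I[of "w + x + y + z"]] by (simp add: tI add.assoc)
    show "Cmp TG (TArr TG (Ident TG x) (LUnit TG y)) (Assoc TG x (Unit TG) y) = TArr TG (RUnit TG x) (Ident TG y)"
      using Ident_left[OF I[of "x + y"]] by (simp add: tI)
    show "Sym TG x y \<in> Hom TG (TObj TG x y) (TObj TG y x)" using S by simp
    show "Cmp TG (Sym TG x' y') (TArr TG f g) = Cmp TG (TArr TG g f) (Sym TG x y)"
      if fg: "f \<in> Hom TG x x'" "g \<in> Hom TG y y'"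
    proof -
      obtain s :: "(nat, 'a) gspan" where s: "gvalid G s" "f = gcls G s" "length (fst s) = x" "length (snd s) = x'"
        using fg(1) by (rule Hom_gclsE)
      obtain t :: "(nat, 'a) gspan" where t: "gvalid G t" "g = gcls G t" "length (fst t) = y" "length (snd t) = y'"
        using fg(2) by (rule Hom_gclsE)
      have "Cmp TG (Sym TG x' y') (TArr TG f g) = gcls G (gcomp G (gsym G x' y') (gtensor s t))"
        using s t by (simp add: TArr_gcls Sym_gcls Cmp_gcls gvalid_gtensor gvalid_gsym')
      also have "\<dots> = gcls G (gcomp G (gtensor t s) (gsym G x y))"
        using gcls_sym_nat[OF s(1) t(1)] s t by simp
      also have "\<dots> = Cmp TG (TArr TG g f) (Sym TG x y)"
        using s t by (simp add: TArr_gcls Sym_gcls Cmp_gcls gvalid_gtensor gvalid_gsym')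
      finally show ?thesis .
    qed
    show "Cmp TG (Sym TG y x) (Sym TG x y) = Ident TG (TObj TG x y)"
      by (simp add: Sym_gcls Cmp_gcls gvalid_gsym' Ident_gcls gcls_sym_sym)
    show "Cmp TG (Assoc TG y z x) (Cmp TG (Sym TG x (TObj TG y z)) (Assoc TG x y z)) =
      Cmp TG (TArr TG (Ident TG y) (Sym TG x z)) (Cmp TG (Assoc TG y x z) (TArr TG (Sym TG x y) (Ident TG z)))"
    proof -
      have 1: "TArr TG (Sym TG x y) (Ident TG z) \<in> Hom TG (x + y + z) (y + x + z)" using ten[OF S I] .
      have "Cmp TG (Assoc TG y z x) (Cmp TG (Sym TG x (TObj TG y z)) (Assoc TG x y z)) = Sym TG x (y + z)"
        using S[of x "y + z"] by (simp add: Ident_right add.assoc Ident_left)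
      also have "\<dots> = Cmp TG (TArr TG (Ident TG y) (Sym TG x z)) (TArr TG (Sym TG x y) (Ident TG z))"
        by (simp add: Sym_gcls Ident_gcls TArr_gcls Cmp_gcls gvalid_gsym' gvalid_gid' gvalid_gtensor gcls_hexagon)
      also have "TArr TG (Sym TG x y) (Ident TG z) = Cmp TG (Assoc TG y x z) (TArr TG (Sym TG x y) (Ident TG z))"
        using Ident_left[OF 1] by simp
      finally show ?thesis .
    qed
  qed (simp_all add: add.assoc)
qed

end

subsection \<open>The generic bimonoid\<close>

definition position :: "'s list \<Rightarrow> 's \<Rightarrow> nat" where
  "position xs x = length (takeWhile (\<lambda>y. y \<noteq> x) xs)"

lemma inj_on_position: "inj_on (position xs) (set xs)"
proof (rule inj_onI)
  fix x y assume xy: "x \<in> set xs" "y \<in> set xs" "position xs x = position xs y"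
  have "xs ! position xs z = z" if "z \<in> set xs" for z
    using nth_length_takeWhile[of "\<lambda>y. y \<noteq> z" xs] that takeWhile_eq_all_conv[of "\<lambda>y. y \<noteq> z" xs]
      length_takeWhile_le[of "\<lambda>y. y \<noteq> z" xs] unfolding position_def
    by (metis append_Nil2 append_eq_conv_conj le_neq_implies_less takeWhile_dropWhile_id takeWhile_eq_take)
  then show "x = y" using xy by metis
qed

text \<open>A normal form under renaming of the strands, by which equality of classes of explicit spans is
  checked.\<close>

definition gcanon :: "('s, 'g) gspan \<Rightarrow> (nat, 'g) gspan" where
  "gcanon s = grename (position (concat (fst s))) s"

lemma gcls_gcanon: "gvalid G s \<Longrightarrow> gcls G (gcanon s) = gcls G s"
  unfolding gcanon_def using gcls_grename inj_on_position by (metis strands_def)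

lemma gcls_canonI: "\<lbrakk>gvalid G s; gvalid G t; gcanon s = gcanon t\<rbrakk> \<Longrightarrow> gcls G s = gcls G t"
  using gcls_gcanon by metis

context group
begin

text \<open>The structure maps of the generic bimonoid: products live on the right leg, coproducts
  on the left one, and \<open>sact g\<close> is one strand with label \<open>g\<close>.\<close>

definition "smu = ([[0], [1]], [[(0, \<one>), (1, \<one>)]] :: (nat \<times> 'a) list list)"
definition "seta = ([], [[]] :: (nat \<times> 'a) list list)"
definition "sDe = ([[0, 1]], [[(0, \<one>)], [(1, \<one>)]] :: (nat \<times> 'a) list list)"
definition "sep = ([[]], [] :: (nat \<times> 'a) list list)"
definition "sact g = ([[0]], [[(0, g)]] :: (nat \<times> 'a) list list)"

lemmas s_defs = smu_def seta_def sDe_def sep_def sact_def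

lemma gvalid_s: "gvalid G smu" "gvalid G seta" "gvalid G sDe" "gvalid G sep" "g \<in> carrier G \<Longrightarrow> gvalid G (sact g)"
  by (auto simp: s_defs gvalid_def rearr_def)

lemma s_lengths [simp]:
  "length (fst smu) = 2" "length (snd smu) = 1" "length (fst seta) = 0" "length (snd seta) = 1"
  "length (fst sDe) = 1" "length (snd sDe) = 2" "length (fst sep) = 1" "length (snd sep) = 0"
  "length (fst (sact g)) = 1" "length (snd (sact g)) = 1"
  by (simp_all add: s_defs)

lemmas canon_simps = gcanon_def gcomp_def gtensor_def grename_def position_def gid_def gsym_def s_defs occ_def

text \<open>Each law equates two explicit spans, whose normal forms under \<open>gcanon\<close> are
  computed and coincide. In the bimonoid law the pullback of two maps from two points to one has
  four strands, read by rows and by columns.\<close>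

lemma gbimonoid_TG:
  "gbimonoid_in_prop TG G (gcls G smu) (gcls G seta) (gcls G sDe) (gcls G sep) (\<lambda>g. gcls G (sact g))"
proof -
  note v = gvalid_s gvalid_gid' gvalid_gsym' gvalid_gtensor gvalid_gcomp is_group
  note c = TArr_gcls Cmp_gcls v
  interpret prop_category TG by (rule prop_category_TG)
  show ?thesis
  proof
    show "gcls G smu \<in> Hom TG (Suc (Suc 0)) (Suc 0)" "gcls G seta \<in> Hom TG 0 (Suc 0)"
      "gcls G sDe \<in> Hom TG (Suc 0) (Suc (Suc 0))" "gcls G sep \<in> Hom TG (Suc 0) 0"
      by (intro Hom_gclsI v; simp add: s_defs)+
    show "gcls G (sact g) \<in> Hom TG (Suc 0) (Suc 0)" if "g \<in> carrier G" for g
      by (intro Hom_gclsI v that; simp add: s_defs)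
  next
    show "Cmp TG (gcls G smu) (TArr TG (gcls G smu) (Ident TG 1)) = Cmp TG (gcls G smu) (TArr TG (Ident TG 1) (gcls G smu))"
      unfolding Ident_gcls by (simp add: c) (intro gcls_canonI v; simp add: canon_simps)
    show "Cmp TG (gcls G smu) (TArr TG (gcls G seta) (Ident TG 1)) = Ident TG 1"
      unfolding Ident_gcls by (simp add: c) (intro gcls_canonI v; simp add: canon_simps)
    show "Cmp TG (gcls G smu) (TArr TG (Ident TG 1) (gcls G seta)) = Ident TG 1"
      unfolding Ident_gcls by (simp add: c) (intro gcls_canonI v; simp add: canon_simps)
    show "Cmp TG (TArr TG (gcls G sDe) (Ident TG 1)) (gcls G sDe) = Cmp TG (TArr TG (Ident TG 1) (gcls G sDe)) (gcls G sDe)"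
      unfolding Ident_gcls by (simp add: c) (intro gcls_canonI v; simp add: canon_simps)
    show "Cmp TG (TArr TG (gcls G sep) (Ident TG 1)) (gcls G sDe) = Ident TG 1"
      unfolding Ident_gcls by (simp add: c) (intro gcls_canonI v; simp add: canon_simps)
    show "Cmp TG (TArr TG (Ident TG 1) (gcls G sep)) (gcls G sDe) = Ident TG 1"
      unfolding Ident_gcls by (simp add: c) (intro gcls_canonI v; simp add: canon_simps)
    show "Cmp TG (gcls G sDe) (gcls G smu) = Cmp TG (TArr TG (gcls G smu) (gcls G smu))
      (Cmp TG (TArr TG (Ident TG 1) (TArr TG (Sym TG 1 1) (Ident TG 1))) (TArr TG (gcls G sDe) (gcls G sDe)))"
      unfolding Ident_gcls Sym_gcls by (simp add: c) (intro gcls_canonI v; simp add: canon_simps)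
    show "Cmp TG (gcls G sep) (gcls G smu) = TArr TG (gcls G sep) (gcls G sep)"
      by (simp add: c) (intro gcls_canonI v; simp add: canon_simps)
    show "Cmp TG (gcls G sDe) (gcls G seta) = TArr TG (gcls G seta) (gcls G seta)"
      by (simp add: c) (intro gcls_canonI v; simp add: canon_simps)
    show "Cmp TG (gcls G sep) (gcls G seta) = Ident TG 0"
      unfolding Ident_gcls by (simp add: c) (intro gcls_canonI v; simp add: canon_simps)
    show "gcls G (sact \<one>) = Ident TG 1"
      unfolding Ident_gcls by (simp add: sact_def gid_def)
    fix g assume g: "g \<in> carrier G"
    show "Cmp TG (gcls G (sact g)) (gcls G smu) = Cmp TG (gcls G smu) (TArr TG (gcls G (sact g)) (gcls G (sact g)))"
      by (simp add: c g) (intro gcls_canonI v g; simp add: canon_simps g)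
    show "Cmp TG (gcls G (sact g)) (gcls G seta) = gcls G seta"
      by (simp add: c g) (intro gcls_canonI v g; simp add: canon_simps g)
    show "Cmp TG (TArr TG (gcls G (sact g)) (gcls G (sact g))) (gcls G sDe) = Cmp TG (gcls G sDe) (gcls G (sact g))"
      by (simp add: c g) (intro gcls_canonI v g; simp add: canon_simps g)
    show "Cmp TG (gcls G sep) (gcls G (sact g)) = gcls G sep"
      by (simp add: c g) (intro gcls_canonI v g; simp add: canon_simps g)
    fix h assume h: "h \<in> carrier G"
    show "gcls G (sact (g \<otimes> h)) = Cmp TG (gcls G (sact g)) (gcls G (sact h))"
      by (simp add: c g h) (intro gcls_canonI v g h m_closed; simp add: canon_simps g h)
  qed
qed

end

section \<open>Generation: every class is the value of its own span\<close>

context group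
begin

lemma occ_single:
  assumes "distinct ys" "y \<in> set ys"
  shows "map (\<lambda>j. [j]) ys ! occ (map (\<lambda>j. [j]) ys) y = [y]"
    and "occ (map (\<lambda>j. [j]) ys) y < length ys" "ys ! occ (map (\<lambda>j. [j]) ys) y = y"
proof -
  have "y \<in> set (concat (map (\<lambda>j. [j]) ys))" using assms by simp
  from occ_less[OF this] show "map (\<lambda>j. [j]) ys ! occ (map (\<lambda>j. [j]) ys) y = [y]"
    "occ (map (\<lambda>j. [j]) ys) y < length ys" "ys ! occ (map (\<lambda>j. [j]) ys) y = y" by auto
qed

text \<open>The left leg of the second span is a bijection, so each strand of \<open>s\<close> has
  exactly one partner in the pullback. Forgetting the partner leaves the substitution of words into
  words.\<close>

lemma gcls_gcomp_fwd:
  assumes s: "gvalid G s" and t: "gvalid G (map (\<lambda>y. [y]) ys, V)" and l: "length (snd s) = length ys"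
  defines "r \<equiv> (fst s, map (\<lambda>v. concat (map (\<lambda>(y, b). gact G b (snd s ! occ (map (\<lambda>y. [y]) ys) y)) v)) V)"
  shows "gcls G (gcomp G (map (\<lambda>y. [y]) ys, V) s) = gcls G r"
proof -
  let ?t = "(map (\<lambda>y. [y]) ys, V)"
  let ?oW = "occ (map (map fst) (snd s))" and ?oP = "occ (map (\<lambda>y. [y]) ys)"
  let ?\<rho> = "\<lambda>x. (x, ys ! ?oW x)"
  have vc: "gvalid G (gcomp G ?t s)" using gvalid_gcomp[OF is_group s t] l by simp
  have d: "distinct ys" using gvalidD(1)[OF t] by simp
  have e: "gcomp G ?t s = grename ?\<rho> r"
  proof (rule prod_eqI)
    have "concat (map (\<lambda>x. map (Pair x) (map (\<lambda>y. [y]) ys ! ?oW x)) xs) = map ?\<rho> xs" if "xs \<in> set (fst s)" for xs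
    proof -
      have "map (\<lambda>x. map (Pair x) (map (\<lambda>y. [y]) ys ! ?oW x)) xs = map (\<lambda>x. [?\<rho> x]) xs"
        using strandsD(3)[OF s strandsI(1)[OF that]] l by simp
      then show ?thesis by (simp only: concat_map_single)
    qed
    then show "fst (gcomp G ?t s) = fst (grename ?\<rho> r)" by (simp add: gcomp_sel grename_def r_def)
    have "concat (map (\<lambda>(y, b). map (\<lambda>(x, a). ((x, y), b \<otimes> a)) (snd s ! ?oP y)) v)
      = map (\<lambda>(x, a). (?\<rho> x, a)) (concat (map (\<lambda>(y, b). gact G b (snd s ! ?oP y)) v))" if v: "v \<in> set V" for v
    proof -
      have "map (\<lambda>(x, a). ((x, y), b \<otimes> a)) (snd s ! ?oP y) = map (\<lambda>(x, a). (?\<rho> x, a)) (gact G b (snd s ! ?oP y))"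
        if yb: "(y, b) \<in> set v" for y b
      proof -
        have "y \<in> strands ?t" using strandsI(2)[OF t _ yb] v by simp
        then have y: "y \<in> set ys" by (simp add: strands_def)
        note o = occ_single[OF d y]
        have i: "?oP y < length (snd s)" using o(2) l by simp
        show ?thesis using o(3) occ_eq_strands'[OF s i] by (auto simp: gact_def)
      qed
      then have "map (\<lambda>(y, b). map (\<lambda>(x, a). ((x, y), b \<otimes> a)) (snd s ! ?oP y)) v
        = map (map (\<lambda>(x, a). (?\<rho> x, a))) (map (\<lambda>(y, b). gact G b (snd s ! ?oP y)) v)" by auto
      then show ?thesis by (simp only: map_concat)
    qed
    then show "snd (gcomp G ?t s) = snd (grename ?\<rho> r)" by (simp add: gcomp_sel grename_def r_def)
  qed
  have "r = grename fst (grename ?\<rho> r)" by (simp add: grename_def o_def split_def)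
  then have "r = grename fst (gcomp G ?t s)" unfolding e[symmetric] .
  moreover have "inj_on fst (strands (gcomp G ?t s))"
    unfolding e strands_grename by (auto simp: inj_on_def)
  ultimately show ?thesis using gcls_grename[OF vc] by metis
qed

text \<open>The dual case: the right leg of the first span is an unlabelled bijection, so a strand
  of the pullback is determined by its second component, and the left fibres are substituted into
  each other.\<close>

lemma gcls_gcomp_bwd:
  assumes s: "gvalid G (F, map (\<lambda>x. [(x, \<one>)]) xs)" and t: "gvalid G t" and l: "length xs = length (fst t)"
  defines "r \<equiv> (map (\<lambda>f. concat (map (\<lambda>x. fst t ! occ (map (\<lambda>x. [x]) xs) x) f)) F, snd t)"
  shows "gcls G (gcomp G t (F, map (\<lambda>x. [(x, \<one>)]) xs)) = gcls G r"
proof -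
  let ?s = "(F, map (\<lambda>x. [(x, \<one>)]) xs)"
  let ?oW = "occ (map (\<lambda>x. [x]) xs)" and ?oP = "occ (fst t)"
  let ?\<rho> = "\<lambda>y. (xs ! ?oP y, y)"
  have oW: "occ (map (map fst) (snd ?s)) = ?oW" by (simp add: o_def)
  have vc: "gvalid G (gcomp G t ?s)" using gvalid_gcomp[OF is_group s t] l by simp
  have d: "distinct xs" using gvalidD(2)[OF s] by (simp add: o_def)
  have e: "gcomp G t ?s = grename ?\<rho> r"
  proof (rule prod_eqI)
    have "concat (map (\<lambda>x. map (Pair x) (fst t ! ?oW x)) f) = map ?\<rho> (concat (map (\<lambda>x. fst t ! ?oW x) f))" if f: "f \<in> set F" for f
    proof -
      have "map (Pair x) (fst t ! ?oW x) = map ?\<rho> (fst t ! ?oW x)" if "x \<in> set f" for x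
      proof -
        have "x \<in> strands ?s" using strandsI(1)[of f ?s x] f that by simp
        then have x: "x \<in> set xs" unfolding strands_snd[OF s] by auto
        note o = occ_single[OF d x]
        have i: "?oW x < length (fst t)" using o(2) l by simp
        show ?thesis using o(3) occ_eq_strands[OF t i] by auto
      qed
      then have "map (\<lambda>x. map (Pair x) (fst t ! ?oW x)) f = map (map ?\<rho>) (map (\<lambda>x. fst t ! ?oW x) f)" by auto
      then show ?thesis by (simp only: map_concat)
    qed
    then show "fst (gcomp G t ?s) = fst (grename ?\<rho> r)" unfolding gcomp_sel(1) oW by (simp add: grename_def r_def)
    have "concat (map (\<lambda>(y, b). map (\<lambda>(x, a). ((x, y), b \<otimes> a)) (map (\<lambda>x. [(x, \<one>)]) xs ! ?oP y)) v)
      = map (\<lambda>(x, a). (?\<rho> x, a)) v" if v: "v \<in> set (snd t)" for v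
    proof -
      have "map (\<lambda>(y, b). map (\<lambda>(x, a). ((x, y), b \<otimes> a)) (map (\<lambda>x. [(x, \<one>)]) xs ! ?oP y)) v
        = map (\<lambda>z. [(\<lambda>(x, a). (?\<rho> x, a)) z]) v"
        using strandsD(1)[OF t strandsI(2)[OF t v]] labelledD[OF gvalidD(6)[OF t v]] l by auto
      then show ?thesis by (simp only: concat_map_single)
    qed
    then show "snd (gcomp G t ?s) = snd (grename ?\<rho> r)" by (simp add: gcomp_sel grename_def r_def)
  qed
  have "r = grename snd (grename ?\<rho> r)" by (simp add: grename_def o_def split_def)
  then have "r = grename snd (gcomp G t ?s)" unfolding e[symmetric] .
  moreover have "inj_on snd (strands (gcomp G t ?s))"
    unfolding e strands_grename by (auto simp: inj_on_def)
  ultimately show ?thesis using gcls_grename[OF vc] by metis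
qed

text \<open>For disjoint names the sum type can be collapsed. Tensor products then become
  concatenations over one fixed type of names, which is what the recursions for \<open>perm\<close>,
  \<open>mul\<close> and \<open>com\<close> produce.\<close>

lemma gtensor_disjoint:
  assumes s: "gvalid G s" and t: "gvalid G t" and d: "strands s \<inter> strands t = {}"
  shows "gcls G (gtensor s t) = gcls G (fst s @ fst t, snd s @ snd t)"
    and "gvalid G (fst s @ fst t, snd s @ snd t)"
proof -
  let ?\<rho> = "case_sum id id"
  have "(fst s @ fst t, snd s @ snd t) = grename ?\<rho> (gtensor s t)"
    by (simp add: gtensor_def grename_def o_def split_def)
  moreover have "inj_on ?\<rho> (strands (gtensor s t))"
    unfolding strands_gtensor using d by (auto simp: inj_on_def)
  ultimately show "gcls G (gtensor s t) = gcls G (fst s @ fst t, snd s @ snd t)"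
    "gvalid G (fst s @ fst t, snd s @ snd t)"
    using gcls_grename[OF gvalid_gtensor[OF s t]] gvalid_grename[OF gvalid_gtensor[OF s t], of ?\<rho>] unfolding strands_def by auto
qed

lemma TArr_disjoint:
  assumes "gvalid G s" "gvalid G t" "strands s \<inter> strands t = {}"
  shows "TArr TG (gcls G s) (gcls G t) = gcls G (fst s @ fst t, snd s @ snd t)"
  using TArr_gcls[OF assms(1,2)] gtensor_disjoint[OF assms] by simp

interpretation ev: gbimonoid_in_prop TG G "gcls G smu" "gcls G seta" "gcls G sDe" "gcls G sep" "\<lambda>g. gcls G (sact g)"
  by (rule gbimonoid_TG)

text \<open>The span of which \<open>perm xs ys\<close> will turn out to be the class; unlike
  \<open>gperm\<close> it has the listed names as strands.\<close>

definition wire :: "'s list \<Rightarrow> 's list \<Rightarrow> ('s, 'a) gspan" where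
  "wire xs ys = (map (\<lambda>x. [x]) xs, map (\<lambda>y. [(y, \<one>)]) ys)"

lemma gvalid_wire: "rearr xs ys \<Longrightarrow> gvalid G (wire xs ys)"
  by (auto simp: wire_def gvalid_def concat_map_single o_def)

lemma wire_sel: "fst (wire xs ys) = map (\<lambda>x. [x]) xs" "snd (wire xs ys) = map (\<lambda>y. [(y, \<one>)]) ys"
  "strands (wire xs ys) = set xs"
  by (auto simp: wire_def strands_def)

lemma wire_map: "wire (map \<rho> xs) (map \<rho> ys) = grename \<rho> (wire xs ys)"
  by (simp add: wire_def grename_def o_def)

lemma Ident_wire: "distinct xs \<Longrightarrow> Ident TG (length xs) = gcls G (wire xs xs)"
proof -
  assume d: "distinct xs"
  have "wire xs xs = grename (nth xs) (gid G (length xs))"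
    using wire_map[of "nth xs" "[0..<length xs]" "[0..<length xs]"] by (simp add: map_nth) (simp add: wire_def gid_def)
  moreover have "strands (gid G (length xs)) = {..<length xs}" by (auto simp: strands_def gid_def)
  then have "inj_on (nth xs) (strands (gid G (length xs)))"
    using d by (intro inj_on_nth) auto
  ultimately show ?thesis
    unfolding Ident_gcls by (rule gcls_eqI[OF gvalid_gid', symmetric, rotated])
qed

lemma Sym_wire:
  assumes "distinct (xs @ ys)"
  shows "Sym TG (length xs) (length ys) = gcls G (wire (xs @ ys) (ys @ xs))"
proof -
  let ?n = "length xs" and ?m = "length ys" and ?\<rho> = "nth (xs @ ys)"
  have 1: "map ?\<rho> [0..<?n + ?m] = xs @ ys" using map_nth[of "xs @ ys"] by simp
  have 2: "map ?\<rho> ([?n..<?n + ?m] @ [0..<?n]) = ys @ xs"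
    by (rule nth_equalityI) (auto simp: nth_append)
  have "wire (xs @ ys) (ys @ xs) = grename ?\<rho> (gsym G ?n ?m)"
    using wire_map[of ?\<rho> "[0..<?n + ?m]" "[?n..<?n + ?m] @ [0..<?n]"] unfolding 1 2
    by (simp add: wire_def gsym_def)
  moreover have "strands (gsym G ?n ?m) = {..<length (xs @ ys)}" by (auto simp: strands_def gsym_def)
  then have "inj_on ?\<rho> (strands (gsym G ?n ?m))"
    using assms by (intro inj_on_nth) auto
  ultimately show ?thesis
    unfolding Sym_gcls by (rule gcls_eqI[OF gvalid_gsym', symmetric, rotated])
qed

text \<open>A wiring in front of a pure right leg changes the order of the inputs and leaves the
  words as they are.\<close>

lemma Cmp_wire:
  assumes r: "rearr xs ys" and t: "gvalid G (map (\<lambda>y. [y]) ys, V)"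
  shows "Cmp TG (gcls G (map (\<lambda>y. [y]) ys, V)) (gcls G (wire xs ys)) = gcls G (map (\<lambda>x. [x]) xs, V)"
proof -
  have d: "distinct ys" using r by (simp add: rearr_def)
  have "concat (map (\<lambda>(y, b). gact G b (snd (wire xs ys) ! occ (map (\<lambda>y. [y]) ys) y)) v) = v" if v: "v \<in> set V" for v
  proof -
    have "gact G b (snd (wire xs ys) ! occ (map (\<lambda>y. [y]) ys) y) = [(y, b)]" if yb: "(y, b) \<in> set v" for y b
    proof -
      have "y \<in> strands (map (\<lambda>y. [y]) ys, V)" using strandsI(2)[OF t _ yb] v by simp
      then have y: "y \<in> set ys" by (simp add: strands_def)
      have "b \<in> carrier G" using labelledD[OF gvalidD(6)[OF t] yb] v by simp
      then show ?thesis using occ_single[OF d y] by (simp add: wire_sel gact_def)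
    qed
    then have "map (\<lambda>(y, b). gact G b (snd (wire xs ys) ! occ (map (\<lambda>y. [y]) ys) y)) v = map (\<lambda>z. [z]) v" by auto
    then show ?thesis by (simp only: concat_map_singleton map_ident)
  qed
  then have "map (\<lambda>v. concat (map (\<lambda>(y, b). gact G b (snd (wire xs ys) ! occ (map (\<lambda>y. [y]) ys) y)) v)) V = V"
    by (simp add: map_idI)
  then show ?thesis
    using gcls_gcomp_fwd[OF gvalid_wire[OF r] t] Cmp_gcls[OF gvalid_wire[OF r] t]
    by (simp add: wire_sel)
qed

text \<open>Follows the recursion of \<open>perm\<close>: a fetch is a symmetry next to an identity,
  hence a wiring, and wirings compose by \<open>Cmp_wire\<close>.\<close>

lemma perm_wire:
  assumes "rearr xs ys"
  shows "ev.perm xs ys = gcls G (wire xs ys)"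
  using assms
proof (induction ys arbitrary: xs)
  case Nil
  then show ?case using Ident_wire[of xs] by (simp add: rearr_def)
next
  case (Cons y ys)
  obtain as bs where x: "xs = as @ y # bs" "y \<notin> set as"
    using Cons.prems split_list_first[of y xs] by (auto simp: rearr_def)
  have r: "rearr (as @ bs) ys" using rearr_Cons[OF Cons.prems] x by (simp add: remove1_append)
  have d: "distinct (as @ y # bs)" using Cons.prems x by (simp add: rearr_def)
  have s: "set ys = set (as @ bs)" using r by (simp add: rearr_def)
  have r1: "rearr (as @ [y]) (y # as)" "rearr bs bs" "rearr [y] [y]" "rearr (as @ y # bs) (y # as @ bs)"
     "rearr (y # as @ bs) (y # ys)"
    using d r unfolding rearr_def by auto
  have "ev.bring y xs = TArr TG (gcls G (wire (as @ [y]) (y # as))) (gcls G (wire bs bs))"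
    using Sym_wire[of as "[y]"] Ident_wire[of bs] d x ev.bring_append[of y as bs] by simp
  also have "\<dots> = gcls G (wire (as @ y # bs) (y # as @ bs))"
    using TArr_disjoint[OF gvalid_wire[OF r1(1)] gvalid_wire[OF r1(2)]] d by (simp add: wire_sel) (simp add: wire_def)
  finally have 1: "ev.bring y xs = gcls G (wire (as @ y # bs) (y # as @ bs))" .
  have "TArr TG (Ident TG 1) (ev.perm (as @ bs) ys) = TArr TG (gcls G (wire [y] [y])) (gcls G (wire (as @ bs) ys))"
    using Cons.IH[OF r] Ident_wire[of "[y]"] by simp
  also have "\<dots> = gcls G (wire (y # as @ bs) (y # ys))"
    using TArr_disjoint[OF gvalid_wire[OF r1(3)] gvalid_wire[OF r]] d by (simp add: wire_sel) (simp add: wire_def)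
  finally have 2: "TArr TG (Ident TG 1) (ev.perm (as @ bs) ys) = gcls G (wire (y # as @ bs) (y # ys))" .
  have "ev.perm xs (y # ys) = Cmp TG (gcls G (wire (y # as @ bs) (y # ys))) (gcls G (wire (as @ y # bs) (y # as @ bs)))"
    using 1 2 x by (simp add: remove1_append)
  also have "\<dots> = gcls G (wire (as @ y # bs) (y # ys))"
    using Cmp_wire[OF r1(4), of "snd (wire xs (y # ys))"] gvalid_wire[OF r1(5)] by (simp add: wire_def)
  finally show ?case using x by simp
qed

lemma tens_gcls:
  fixes F :: "'x \<Rightarrow> 's list list" and W :: "'x \<Rightarrow> ('s \<times> 'a) list list"
  assumes "\<And>x. x \<in> set xs \<Longrightarrow> u x = gcls G (F x, W x) \<and> gvalid G (F x, W x)"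
    and "distinct (concat (concat (map F xs)))"
  shows "ev.tens (map u xs) = gcls G (concat (map F xs), concat (map W xs)) \<and>
    gvalid G (concat (map F xs), concat (map W xs))"
  using assms
proof (induction xs)
  case Nil
  \<comment> \<open>The two empty spans have strands of different types. As there are no strands, a
    constant map is an injective renaming.\<close>
  have "gcls G (([], []) :: ('s, 'a) gspan) = gcls G (gid G 0)"
    by (rule gcls_eqI[OF gvalid_gid', of "\<lambda>_. undefined"]) (simp_all add: gid_def grename_def strands_def)
  then show ?case by (simp add: Ident_gcls) (simp add: gvalid_def rearr_def)
next
  case (Cons x xs)
  let ?t = "(concat (map F xs), concat (map W xs))"
  have IH: "ev.tens (map u xs) = gcls G ?t" "gvalid G ?t" using Cons by auto
  have s: "gvalid G (F x, W x)" "u x = gcls G (F x, W x)" using Cons.prems by simp_all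
  have "strands (F x, W x) \<inter> strands ?t = {}" using Cons.prems(2) by (simp add: strands_def)
  then show ?case using TArr_disjoint[OF s(1) IH(2)] gtensor_disjoint(2)[OF s(1) IH(2)] IH(1) s(2) by simp
qed

lemma mul_gcls:
  fixes xs :: "'s list"
  assumes "distinct xs"
  shows "ev.mul (length xs) = gcls G (map (\<lambda>x. [x]) xs, [map (\<lambda>x. (x, \<one>)) xs]) \<and>
    gvalid G (map (\<lambda>x. [x]) xs, [map (\<lambda>x. (x, \<one>)) xs])"
  using assms
proof (induction xs)
  case Nil
  have "gcls G (([], [[]]) :: ('s, 'a) gspan) = gcls G seta"
    by (rule gcls_eqI[OF gvalid_s(2), of "\<lambda>_. undefined"]) (simp_all add: seta_def grename_def strands_def)
  then show ?case by (simp add: gvalid_def rearr_def)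
next
  case (Cons x xs)
  let ?M = "(map (\<lambda>x. [x]) xs, [map (\<lambda>x. (x, \<one>)) xs])" and ?w = "wire [x] [x]"
  have IH: "ev.mul (length xs) = gcls G ?M" "gvalid G ?M" using Cons by auto
  have w: "gvalid G ?w" by (intro gvalid_wire) (simp add: rearr_def)
  have d: "strands ?w \<inter> strands ?M = {}" using Cons.prems by (simp add: wire_sel) (simp add: strands_def)
  let ?s = "(fst ?w @ fst ?M, snd ?w @ snd ?M)"
  note v = gtensor_disjoint(2)[OF w IH(2) d]
  have "TArr TG (Ident TG 1) (ev.mul (length xs)) = gcls G ?s"
    using TArr_disjoint[OF w IH(2) d] Ident_wire[of "[x]"] IH(1) by simp
  then have "ev.mul (length (x # xs)) = gcls G (gcomp G smu ?s)"
    using Cmp_gcls[OF v gvalid_s(1)] by (simp add: wire_sel)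
  also have "\<dots> = gcls G (map (\<lambda>x. [x]) (x # xs), [map (\<lambda>x. (x, \<one>)) (x # xs)])"
    using gcls_gcomp_fwd[OF v, of "[0, 1 :: nat]" "[[(0, \<one>), (1, \<one>)]]"] gvalid_s(1)
    by (simp add: smu_def wire_def occ_def gact_def o_def)
  finally show ?case using Cons.prems by (simp add: rearr_def concat_map_single o_def gvalid_def image_subset_iff)
qed

lemma com_gcls:
  fixes xs :: "'s list"
  assumes "distinct xs"
  shows "ev.com (length xs) = gcls G ([xs], map (\<lambda>x. [(x, \<one>)]) xs) \<and>
    gvalid G ([xs], map (\<lambda>x. [(x, \<one>)]) xs)"
  using assms
proof (induction xs)
  case Nil
  have "gcls G (([[]], []) :: ('s, 'a) gspan) = gcls G sep"
    by (rule gcls_eqI[OF gvalid_s(4), of "\<lambda>_. undefined"]) (simp_all add: sep_def grename_def strands_def)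
  then show ?case by (simp add: gvalid_def rearr_def)
next
  case (Cons x xs)
  let ?M = "([xs], map (\<lambda>x. [(x, \<one>)]) xs)" and ?w = "wire [x] [x]"
  have IH: "ev.com (length xs) = gcls G ?M" "gvalid G ?M" using Cons by auto
  have w: "gvalid G ?w" by (intro gvalid_wire) (simp add: rearr_def)
  have d: "strands ?w \<inter> strands ?M = {}" using Cons.prems by (simp add: wire_sel) (simp add: strands_def)
  let ?s = "(fst ?w @ fst ?M, snd ?w @ snd ?M)"
  note v = gtensor_disjoint(2)[OF w IH(2) d]
  have "TArr TG (Ident TG 1) (ev.com (length xs)) = gcls G ?s"
    using TArr_disjoint[OF w IH(2) d] Ident_wire[of "[x]"] IH(1) by simp
  then have "ev.com (length (x # xs)) = gcls G (gcomp G ?s sDe)"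
    using Cmp_gcls[OF gvalid_s(3) v] by (simp add: wire_sel)
  also have "\<dots> = gcls G ([x # xs], map (\<lambda>x. [(x, \<one>)]) (x # xs))"
    using gcls_gcomp_bwd[of "[[0, 1 :: nat]]" "[0, 1]", OF _ v] gvalid_s(3)
    by (simp add: sDe_def wire_def occ_def)
  finally show ?case using Cons.prems by (simp add: rearr_def concat_map_single o_def gvalid_def image_subset_iff)
qed

text \<open>The labels first act on separate strands, which gives the span \<open>A\<close>; an
  unlabelled product comes after it, and \<open>gcls_gcomp_fwd\<close> gathers the labelled strands
  into one word.\<close>

lemma word_gcls:
  assumes w: "labelled G w" "distinct (map fst w)"
  shows "ev.word w = gcls G (map (\<lambda>x. [x]) (map fst w), [w]) \<and> gvalid G (map (\<lambda>x. [x]) (map fst w), [w])"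
proof -
  let ?xs = "map fst w"
  define A where "A = (map (\<lambda>x. [x]) ?xs, map (\<lambda>z. [z]) w)"
  have 1: "gcls G (sact a) = gcls G ([[x]], [[(x, a)]]) \<and> gvalid G ([[x]], [[(x, a)]])" if "(x, a) \<in> set w" for x a
  proof
    show "gvalid G ([[x]], [[(x, a)]])"
      using labelledD[OF w(1) that] by (simp add: gvalid_def rearr_def)
    then show "gcls G (sact a) = gcls G ([[x]], [[(x, a)]])"
      using labelledD[OF w(1) that]
      by (intro gcls_canonI gvalid_s) (auto simp: gcanon_def grename_def sact_def position_def)
  qed
  have 2: "concat (map (\<lambda>(x, a). [[x]]) w) = map (\<lambda>x. [x]) ?xs" "concat (map (\<lambda>(x, a). [[(x, a)]]) w) = map (\<lambda>z. [z]) w"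
    by (induction w) auto
  have "ev.tens (map (\<lambda>(x, a). gcls G (sact a)) w) = gcls G (concat (map (\<lambda>(x, a). [[x]]) w), concat (map (\<lambda>(x, a). [[(x, a)]]) w)) \<and>
    gvalid G (concat (map (\<lambda>(x, a). [[x]]) w), concat (map (\<lambda>(x, a). [[(x, a)]]) w))"
  proof (rule tens_gcls)
    show "distinct (concat (concat (map (\<lambda>(x, a). [[x]]) w)))" unfolding 2 using w(2) by (simp only: concat_map_singleton map_ident)
  qed (use 1 in auto)
  then have A: "ev.tens (map (\<lambda>(x, a). gcls G (sact a)) w) = gcls G A" "gvalid G A"
    unfolding 2 A_def by simp_all
  note m = mul_gcls[OF w(2)]
  have "ev.word w = gcls G (gcomp G (map (\<lambda>x. [x]) ?xs, [map (\<lambda>x. (x, \<one>)) ?xs]) A)"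
    unfolding ev.word_def A(1) using m Cmp_gcls[OF A(2), of "(map (\<lambda>x. [x]) ?xs, [map (\<lambda>x. (x, \<one>)) ?xs])"]
    by (simp add: A_def)
  also have "\<dots> = gcls G (fst A, map (\<lambda>v. concat (map (\<lambda>(y, b). gact G b (snd A ! occ (map (\<lambda>y. [y]) ?xs) y)) v)) [map (\<lambda>x. (x, \<one>)) ?xs])"
    by (rule gcls_gcomp_fwd[OF A(2)]) (use m in \<open>simp_all add: A_def\<close>)
  also have "map (\<lambda>v. concat (map (\<lambda>(y, b). gact G b (snd A ! occ (map (\<lambda>y. [y]) ?xs) y)) v)) [map (\<lambda>x. (x, \<one>)) ?xs] = [w]"
  proof -
    have "map (\<lambda>(y, b). gact G b (snd A ! occ (map (\<lambda>y. [y]) ?xs) y)) (map (\<lambda>x. (x, \<one>)) ?xs) = map (\<lambda>z. [z]) w"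
    proof (rule nth_equalityI)
      fix i assume "i < length (map (\<lambda>(y, b). gact G b (snd A ! occ (map (\<lambda>y. [y]) ?xs) y)) (map (\<lambda>x. (x, \<one>)) ?xs))"
      then have i: "i < length w" by simp
      have "occ (map (\<lambda>y. [y]) ?xs) (fst (w ! i)) = i"
        using i w(2) by (intro occ_eq) (auto simp del: map_map)
      moreover have "snd (w ! i) \<in> carrier G" using i w(1) by (auto simp: labelled_def image_subset_iff)
      ultimately show "map (\<lambda>(y, b). gact G b (snd A ! occ (map (\<lambda>y. [y]) ?xs) y)) (map (\<lambda>x. (x, \<one>)) ?xs) ! i = map (\<lambda>z. [z]) w ! i"
        using i by (simp add: A_def gact_def split_def del: map_map)
    qed simp
    then show ?thesis by (simp only: concat_map_singleton map_ident list.map)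
  qed
  finally show ?thesis
    using w by (simp add: A_def gvalid_def labelled_def rearr_def del: map_map)
qed

text \<open>The three factors of the value are recognised as spans: a pure right leg, a wiring and a
  pure left leg. The wiring is absorbed into the right leg, and composing with the left leg gives
  back \<open>s\<close>, because all inner fibres are single strands.\<close>

theorem ev_gcls:
  assumes s: "gvalid G s"
  shows "ev.ev s = gcls G s"
proof -
  let ?F = "concat (fst s)" and ?W = "map fst (concat (snd s))"
  note v = gvalidD[OF s]
  have r: "rearr ?F ?W" using s by (simp add: gvalid_def)
  define A where "A = (map (\<lambda>x. [x]) ?W, snd s)"
  define B where "B = (fst s, map (\<lambda>x. [(x, \<one>)]) ?F)"
  have w: "ev.word w = gcls G (map (\<lambda>x. [x]) (map fst w), [w])" "gvalid G (map (\<lambda>x. [x]) (map fst w), [w])" if "w \<in> set (snd s)" for w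
    using word_gcls v(6,7) that by auto
  have c: "concat (map (\<lambda>w. map (\<lambda>x. [x]) (map fst w)) (snd s)) = map (\<lambda>x. [x]) ?W" "concat (map (\<lambda>w. [w]) (snd s)) = snd s"
    "concat (map (\<lambda>xs. [xs]) (fst s)) = fst s" "concat (map (\<lambda>xs. map (\<lambda>x. [(x, \<one>)]) xs) (fst s)) = map (\<lambda>x. [(x, \<one>)]) ?F"
    by (simp_all add: map_concat o_def concat_map_singleton)
  have "ev.tens (map ev.word (snd s)) = gcls G (concat (map (\<lambda>w. map (\<lambda>x. [x]) (map fst w)) (snd s)), concat (map (\<lambda>w. [w]) (snd s))) \<and>
    gvalid G (concat (map (\<lambda>w. map (\<lambda>x. [x]) (map fst w)) (snd s)), concat (map (\<lambda>w. [w]) (snd s)))"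
  proof (rule tens_gcls)
    show "distinct (concat (concat (map (\<lambda>w. map (\<lambda>x. [x]) (map fst w)) (snd s))))"
      unfolding c using r by (simp only: concat_map_singleton map_ident rearr_def)
  qed (use w in blast)
  then have A: "ev.tens (map ev.word (snd s)) = gcls G A" "gvalid G A"
    unfolding c A_def by simp_all
  have d: "distinct xs" if "xs \<in> set (fst s)" for xs using v(1) that by (simp add: distinct_concat_iff)
  have "ev.tens (map (\<lambda>xs. ev.com (length xs)) (fst s)) = gcls G (concat (map (\<lambda>xs. [xs]) (fst s)), concat (map (\<lambda>xs. map (\<lambda>x. [(x, \<one>)]) xs) (fst s))) \<and>
    gvalid G (concat (map (\<lambda>xs. [xs]) (fst s)), concat (map (\<lambda>xs. map (\<lambda>x. [(x, \<one>)]) xs) (fst s)))"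
  proof (rule tens_gcls)
    show "distinct (concat (concat (map (\<lambda>xs. [xs]) (fst s))))" unfolding c by (rule v(1))
  qed (rule com_gcls[OF d])
  then have B: "ev.tens (map (\<lambda>xs. ev.com (length xs)) (fst s)) = gcls G B" "gvalid G B"
    unfolding c B_def by simp_all
  have vW: "gvalid G (map (\<lambda>x. [x]) ?F, snd s)"
    using s by (simp add: gvalid_def)
  have "ev.ev s = Cmp TG (gcls G A) (Cmp TG (gcls G (wire ?F ?W)) (gcls G B))"
    unfolding ev.ev_def A(1) B(1) perm_wire[OF r] ..
  also have "\<dots> = Cmp TG (Cmp TG (gcls G A) (gcls G (wire ?F ?W))) (gcls G B)"
  proof -
    have "length ?W = length ?F" using rearr_length[OF r] by simp
    then show ?thesis
      by (intro ev.cmp_assoc[symmetric] Arr_gcls A(2) B(2) gvalid_wire r)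
        (simp_all add: Dom_gcls Cod_gcls wire_sel A_def B_def)
  qed
  also have "Cmp TG (gcls G A) (gcls G (wire ?F ?W)) = gcls G (map (\<lambda>x. [x]) ?F, snd s)"
    unfolding A_def by (rule Cmp_wire[OF r]) (use A(2) in \<open>simp add: A_def\<close>)
  also have "Cmp TG (gcls G (map (\<lambda>x. [x]) ?F, snd s)) (gcls G B) = gcls G (gcomp G (map (\<lambda>x. [x]) ?F, snd s) B)"
    by (rule Cmp_gcls[OF B(2) vW]) (simp add: B_def)
  also have "\<dots> = gcls G (map (\<lambda>f. concat (map (\<lambda>x. map (\<lambda>x. [x]) ?F ! occ (map (\<lambda>x. [x]) ?F) x) f)) (fst s), snd s)"
    unfolding B_def using gcls_gcomp_bwd[of "fst s" ?F "(map (\<lambda>x. [x]) ?F, snd s)"] B(2) vW by (simp add: B_def)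
  also have "map (\<lambda>f. concat (map (\<lambda>x. map (\<lambda>x. [x]) ?F ! occ (map (\<lambda>x. [x]) ?F) x) f)) (fst s) = fst s"
  proof (rule map_idI)
    fix f assume f: "f \<in> set (fst s)"
    have "map (\<lambda>x. map (\<lambda>x. [x]) ?F ! occ (map (\<lambda>x. [x]) ?F) x) f = map (\<lambda>x. [x]) f"
      using occ_single(1)[OF v(1)] f by (intro map_cong refl) auto
    then show "concat (map (\<lambda>x. map (\<lambda>x. [x]) ?F ! occ (map (\<lambda>x. [x]) ?F) x) f) = f"
      by (simp only: concat_map_singleton map_ident)
  qed
  finally show ?thesis by simp
qed

theorem TG_induct:
  assumes f: "f \<in> Arr TG"
    and I: "\<And>n. Q (Ident TG n)" and S: "\<And>m n. Q (Sym TG m n)"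
    and gen: "Q (gcls G smu)" "Q (gcls G seta)" "Q (gcls G sDe)" "Q (gcls G sep)" "\<And>g. g \<in> carrier G \<Longrightarrow> Q (gcls G (sact g))"
    and c: "\<And>f g. \<lbrakk>f \<in> Arr TG; g \<in> Arr TG; Cod TG f = Dom TG g; Q f; Q g\<rbrakk> \<Longrightarrow> Q (Cmp TG g f)"
    and t: "\<And>f g. \<lbrakk>f \<in> Arr TG; g \<in> Arr TG; Q f; Q g\<rbrakk> \<Longrightarrow> Q (TArr TG f g)"
  shows "Q f"
proof -
  obtain s :: "(nat, 'a) gspan" where s: "gvalid G s" "f = gcls G s" using f by (rule Arr_gclsE)
  show ?thesis
    unfolding s(2) ev_gcls[OF s(1), symmetric]
    by (rule ev.ev_induct[OF s(1)]) (fact I S gen c t)+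
qed

end

section \<open>Coherence\<close>

context category
begin

lemma inverse_arrows_unique:
  assumes "inverse_arrows C f g" "inverse_arrows C f h"
  shows "g = h"
proof -
  have a: "f \<in> Arr C" "g \<in> Arr C" "h \<in> Arr C" "Dom C g = Cod C f" "Cod C g = Dom C f" "Dom C h = Cod C f" "Cod C h = Dom C f"
    "h \<cdot> f = Ident C (Dom C f)" "f \<cdot> g = Ident C (Cod C f)"
    using assms by (auto simp: inverse_arrows_def Hom_def)
  have "g = (h \<cdot> f) \<cdot> g" using a by simp
  also have "\<dots> = h" using a by (subst cmp_assoc) auto
  finally show ?thesis .
qed

lemma Inv_arr:
  assumes "iso_arrow C f"
  shows "f \<in> Arr C" "Inv C f \<in> Arr C" "Dom C (Inv C f) = Cod C f" "Cod C (Inv C f) = Dom C f"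
    "Inv C f \<cdot> f = Ident C (Dom C f)" "f \<cdot> Inv C f = Ident C (Cod C f)" "iso_arrow C (Inv C f)"
proof -
  obtain g where g: "inverse_arrows C f g" using assms by (auto simp: iso_arrow_def)
  then have "Inv C f = g" unfolding Inv_def using inverse_arrows_unique by blast
  with g show *: "f \<in> Arr C" "Inv C f \<in> Arr C" "Dom C (Inv C f) = Cod C f" "Cod C (Inv C f) = Dom C f"
    "Inv C f \<cdot> f = Ident C (Dom C f)" "f \<cdot> Inv C f = Ident C (Cod C f)"
    by (auto simp: inverse_arrows_def Hom_def)
  show "iso_arrow C (Inv C f)" unfolding iso_arrow_def inverse_arrows_def
    using * by (intro exI[of _ f]) (auto simp: Hom_def)
qed

lemma iso_arrowI:
  "\<lbrakk>f \<in> Arr C; g \<in> Arr C; Dom C g = Cod C f; Cod C g = Dom C f; g \<cdot> f = Ident C (Dom C f); f \<cdot> g = Ident C (Cod C f)\<rbrakk>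
    \<Longrightarrow> iso_arrow C f"
  by (auto simp: iso_arrow_def inverse_arrows_def Hom_def)

lemma Inv_cmp:
  assumes "iso_arrow C f" "g \<in> Arr C"
  shows "Cod C g = Dom C f \<Longrightarrow> Inv C f \<cdot> (f \<cdot> g) = g" "Cod C g = Cod C f \<Longrightarrow> f \<cdot> (Inv C f \<cdot> g) = g"
proof -
  note a = Inv_arr[OF assms(1)]
  show "Inv C f \<cdot> (f \<cdot> g) = g" if "Cod C g = Dom C f"
    by (subst cmp_assoc[symmetric]) (use a assms(2) that in simp_all)
  show "f \<cdot> (Inv C f \<cdot> g) = g" if "Cod C g = Cod C f"
    by (subst cmp_assoc[symmetric]) (use a assms(2) that in simp_all)
qed

lemma iso_Ident: "x \<in> Obj C \<Longrightarrow> iso_arrow C (Ident C x)"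
  by (rule iso_arrowI[of _ "Ident C x"]) (simp_all add: Ident_arr')

lemma iso_cmp:
  assumes f: "iso_arrow C f" and g: "iso_arrow C g" and "Cod C f = Dom C g"
  shows "iso_arrow C (g \<cdot> f)"
proof (rule iso_arrowI[of _ "Inv C f \<cdot> Inv C g"])
  note a = Inv_arr(1-6)[OF f] Inv_arr(1-6)[OF g] assms(3)
  have "(Inv C f \<cdot> Inv C g) \<cdot> (g \<cdot> f) = Inv C f \<cdot> (Inv C g \<cdot> (g \<cdot> f))"
    by (rule cmp_assoc) (use a in simp_all)
  also have "Inv C g \<cdot> (g \<cdot> f) = f" by (rule Inv_cmp[OF g]) (use a in simp_all)
  finally show "(Inv C f \<cdot> Inv C g) \<cdot> (g \<cdot> f) = Ident C (Dom C (g \<cdot> f))" using a by simp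
  have "(g \<cdot> f) \<cdot> (Inv C f \<cdot> Inv C g) = g \<cdot> (f \<cdot> (Inv C f \<cdot> Inv C g))"
    by (rule cmp_assoc) (use a in simp_all)
  also have "f \<cdot> (Inv C f \<cdot> Inv C g) = Inv C g" by (rule Inv_cmp[OF f]) (use a in simp_all)
  finally show "(g \<cdot> f) \<cdot> (Inv C f \<cdot> Inv C g) = Ident C (Cod C (g \<cdot> f))" using a by simp
qed (use Inv_arr[OF f] Inv_arr[OF g] assms(3) in simp_all)

lemma iso_cancel_right:
  assumes "iso_arrow C f" "g \<in> Arr C" "h \<in> Arr C" "Dom C g = Cod C f" "Dom C h = Cod C f" "g \<cdot> f = h \<cdot> f"
  shows "g = h"
proof -
  note a = Inv_arr[OF assms(1)] assms
  have "(g \<cdot> f) \<cdot> Inv C f = g" "(h \<cdot> f) \<cdot> Inv C f = h"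
    using a(1-6) assms(2-5) by (simp_all add: cmp_assoc)
  then show ?thesis unfolding assms(6) by (rule trans[OF sym])
qed

lemma iso_cancel_left:
  assumes "iso_arrow C f" "g \<in> Arr C" "h \<in> Arr C" "Cod C g = Dom C f" "Cod C h = Dom C f" "f \<cdot> g = f \<cdot> h"
  shows "g = h"
proof -
  have "Inv C f \<cdot> (f \<cdot> g) = g" "Inv C f \<cdot> (f \<cdot> h) = h"
    using Inv_cmp(1)[OF assms(1)] assms(2-5) by simp_all
  then show ?thesis unfolding assms(6) by (rule trans[OF sym])
qed

end

section \<open>Unit coherence in a symmetric monoidal category\<close>

context symmetric_monoidal_category
begin

lemma Assoc_arr:
  assumes "x \<in> Obj S" "y \<in> Obj S" "z \<in> Obj S"
  shows "Assoc S x y z \<in> Arr S" "Dom S (Assoc S x y z) = (x \<odot> y) \<odot> z" "Cod S (Assoc S x y z) = x \<odot> (y \<odot> z)"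
  using Assoc_in[OF assms] by (auto simp: Hom_def)

lemma LUnit_arr:
  assumes "x \<in> Obj S"
  shows "LUnit S x \<in> Arr S" "Dom S (LUnit S x) = Unit S \<odot> x" "Cod S (LUnit S x) = x"
  using LUnit_in[OF assms] by (auto simp: Hom_def)

lemma RUnit_arr:
  assumes "x \<in> Obj S"
  shows "RUnit S x \<in> Arr S" "Dom S (RUnit S x) = x \<odot> Unit S" "Cod S (RUnit S x) = x"
  using RUnit_in[OF assms] by (auto simp: Hom_def)

lemma Sym_arr':
  assumes "x \<in> Obj S" "y \<in> Obj S"
  shows "Sym S x y \<in> Arr S" "Dom S (Sym S x y) = x \<odot> y" "Cod S (Sym S x y) = y \<odot> x"
  using Sym_in[OF assms] by (auto simp: Hom_def)

lemmas arrs = Assoc_arr LUnit_arr RUnit_arr Sym_arr' Ident_arr' ten_arr' TObj_in Unit_in Dom_in Cod_in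

lemma Assoc_nat:
  "\<lbrakk>f \<in> Arr S; g \<in> Arr S; h \<in> Arr S; Cod S f = x; Cod S g = y; Cod S h = z\<rbrakk> \<Longrightarrow>
    Assoc S x y z \<cdot> ((f \<star> g) \<star> h) = (f \<star> (g \<star> h)) \<cdot> Assoc S (Dom S f) (Dom S g) (Dom S h)"
  using Assoc_natural[of f "Dom S f" "Cod S f" g "Dom S g" "Cod S g" h "Dom S h" "Cod S h"] by (auto simp: Hom_def)

lemma LUnit_nat: "f \<in> Arr S \<Longrightarrow> Cod S f = y \<Longrightarrow> LUnit S y \<cdot> (Ident S (Unit S) \<star> f) = f \<cdot> LUnit S (Dom S f)"
  using LUnit_natural[of f "Dom S f" "Cod S f"] by (auto simp: Hom_def)

lemma RUnit_nat: "f \<in> Arr S \<Longrightarrow> Cod S f = y \<Longrightarrow> RUnit S y \<cdot> (f \<star> Ident S (Unit S)) = f \<cdot> RUnit S (Dom S f)"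
  using RUnit_natural[of f "Dom S f" "Cod S f"] by (auto simp: Hom_def)

lemma Sym_nat':
  "\<lbrakk>f \<in> Arr S; g \<in> Arr S; Cod S f = x; Cod S g = y\<rbrakk> \<Longrightarrow>
    Sym S x y \<cdot> (f \<star> g) = (g \<star> f) \<cdot> Sym S (Dom S f) (Dom S g)"
  using Sym_natural[of f "Dom S f" "Cod S f" g "Dom S g" "Cod S g"] by (auto simp: Hom_def)

lemma iso_ten:
  assumes f: "iso_arrow S f" and g: "iso_arrow S g"
  shows "iso_arrow S (f \<star> g)"
  by (rule iso_arrowI[of _ "Inv S f \<star> Inv S g"])
    (use Inv_arr[OF f] Inv_arr[OF g] in \<open>simp_all add: arrs ten_cmp TArr_Ident\<close>)

text \<open>\<open>LUnit\<close> is a natural isomorphism from tensoring with the unit to the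
  identity functor, and functors isomorphic to the identity are faithful.\<close>

lemma unit_left_faithful:
  assumes "f \<in> Arr S" "g \<in> Arr S" "Dom S f = Dom S g" "Cod S f = Cod S g"
    and "Ident S (Unit S) \<star> f = Ident S (Unit S) \<star> g"
  shows "f = g"
proof (rule iso_cancel_right[OF LUnit_iso[of "Dom S f"]])
  show "f \<cdot> LUnit S (Dom S f) = g \<cdot> LUnit S (Dom S f)"
    using LUnit_nat[of f "Cod S f"] LUnit_nat[of g "Cod S f"] assms by simp
qed (use assms in \<open>simp_all add: arrs\<close>)

lemma unit_right_faithful:
  assumes "f \<in> Arr S" "g \<in> Arr S" "Dom S f = Dom S g" "Cod S f = Cod S g"
    and "f \<star> Ident S (Unit S) = g \<star> Ident S (Unit S)"
  shows "f = g"
proof (rule iso_cancel_right[OF RUnit_iso[of "Dom S f"]])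
  show "f \<cdot> RUnit S (Dom S f) = g \<cdot> RUnit S (Dom S f)"
    using RUnit_nat[of f "Cod S f"] RUnit_nat[of g "Cod S f"] assms by simp
qed (use assms in \<open>simp_all add: arrs\<close>)

text \<open>Kelly's argument, as only pentagon and triangle are axioms. After tensoring with the
  unit from the left, the claim is one face of the pentagon for two units, \<open>x\<close> and
  \<open>y\<close>; the other faces commute by the triangle and by naturality.\<close>

lemma LUnit_tensor:
  assumes o: "x \<in> Obj S" "y \<in> Obj S"
  shows "LUnit S (x \<odot> y) \<cdot> Assoc S (Unit S) x y = LUnit S x \<star> Ident S y"
proof (rule unit_left_faithful)
  let ?I = "Unit S" and ?i = "Ident S (Unit S)"
  note a = arrs o
  let ?E = "Assoc S ?I (?I \<odot> x) y \<cdot> (Assoc S ?I ?I x \<star> Ident S y)"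
  show "?i \<star> (LUnit S (x \<odot> y) \<cdot> Assoc S ?I x y) = ?i \<star> (LUnit S x \<star> Ident S y)"
  proof (rule iso_cancel_right[of ?E])
    show "iso_arrow S ?E" by (intro iso_cmp iso_ten Assoc_iso iso_Ident) (simp_all add: a)
    have "(?i \<star> (LUnit S (x \<odot> y) \<cdot> Assoc S ?I x y)) \<cdot> ?E
        = ((?i \<star> LUnit S (x \<odot> y)) \<cdot> (?i \<star> Assoc S ?I x y)) \<cdot> ?E"
      by (simp add: a ten_cmp)
    also have "\<dots> = (?i \<star> LUnit S (x \<odot> y)) \<cdot> ((?i \<star> Assoc S ?I x y) \<cdot> ?E)"
      by (simp add: a cmp_assoc)
    also have "(?i \<star> Assoc S ?I x y) \<cdot> ?E = Assoc S ?I ?I (x \<odot> y) \<cdot> Assoc S (?I \<odot> ?I) x y"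
      using pentagon[of ?I ?I x y] by (simp add: a)
    also have "(?i \<star> LUnit S (x \<odot> y)) \<cdot> (Assoc S ?I ?I (x \<odot> y) \<cdot> Assoc S (?I \<odot> ?I) x y)
        = ((?i \<star> LUnit S (x \<odot> y)) \<cdot> Assoc S ?I ?I (x \<odot> y)) \<cdot> Assoc S (?I \<odot> ?I) x y"
      by (simp add: a cmp_assoc)
    also have "\<dots> = (RUnit S ?I \<star> (Ident S x \<star> Ident S y)) \<cdot> Assoc S (?I \<odot> ?I) x y"
      using triangle[of ?I "x \<odot> y"] by (simp add: a TArr_Ident)
    also have "\<dots> = Assoc S ?I x y \<cdot> ((RUnit S ?I \<star> Ident S x) \<star> Ident S y)"
      using Assoc_nat[of "RUnit S ?I" "Ident S x" "Ident S y" ?I x y] by (simp add: a)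
    also have "(RUnit S ?I \<star> Ident S x) \<star> Ident S y = ((?i \<star> LUnit S x) \<star> Ident S y) \<cdot> (Assoc S ?I ?I x \<star> Ident S y)"
      using triangle[of ?I x] by (simp add: a ten_cmp)
    also have "Assoc S ?I x y \<cdot> (((?i \<star> LUnit S x) \<star> Ident S y) \<cdot> (Assoc S ?I ?I x \<star> Ident S y))
        = (Assoc S ?I x y \<cdot> ((?i \<star> LUnit S x) \<star> Ident S y)) \<cdot> (Assoc S ?I ?I x \<star> Ident S y)"
      by (simp add: a cmp_assoc)
    also have "Assoc S ?I x y \<cdot> ((?i \<star> LUnit S x) \<star> Ident S y) = (?i \<star> (LUnit S x \<star> Ident S y)) \<cdot> Assoc S ?I (?I \<odot> x) y"
      using Assoc_nat[of ?i "LUnit S x" "Ident S y" ?I x y] by (simp add: a)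
    also have "((?i \<star> (LUnit S x \<star> Ident S y)) \<cdot> Assoc S ?I (?I \<odot> x) y) \<cdot> (Assoc S ?I ?I x \<star> Ident S y)
        = (?i \<star> (LUnit S x \<star> Ident S y)) \<cdot> ?E"
      by (simp add: a cmp_assoc)
    finally show "(?i \<star> (LUnit S (x \<odot> y) \<cdot> Assoc S ?I x y)) \<cdot> ?E = (?i \<star> (LUnit S x \<star> Ident S y)) \<cdot> ?E" .
  qed (simp_all add: a)
qed (use o in \<open>simp_all add: arrs\<close>)

text \<open>The mirror image of the previous argument, with the pentagon for \<open>x\<close>,
  \<open>y\<close> and two units.\<close>

lemma RUnit_tensor:
  assumes o: "x \<in> Obj S" "y \<in> Obj S"
  shows "(Ident S x \<star> RUnit S y) \<cdot> Assoc S x y (Unit S) = RUnit S (x \<odot> y)"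
proof (rule unit_right_faithful)
  let ?I = "Unit S" and ?i = "Ident S (Unit S)"
  note a = arrs o
  let ?A = "Assoc S x y ?I"
  show "((Ident S x \<star> RUnit S y) \<cdot> ?A) \<star> ?i = RUnit S (x \<odot> y) \<star> ?i"
  proof (rule iso_cancel_left[of ?A])
    show "iso_arrow S ?A" by (intro Assoc_iso) (simp_all add: a)
    have "?A \<cdot> (((Ident S x \<star> RUnit S y) \<cdot> ?A) \<star> ?i) = (?A \<cdot> ((Ident S x \<star> RUnit S y) \<star> ?i)) \<cdot> (?A \<star> ?i)"
      by (simp add: a ten_cmp cmp_assoc)
    also have "?A \<cdot> ((Ident S x \<star> RUnit S y) \<star> ?i) = (Ident S x \<star> (RUnit S y \<star> ?i)) \<cdot> Assoc S x (y \<odot> ?I) ?I"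
      using Assoc_nat[of "Ident S x" "RUnit S y" ?i x y ?I] by (simp add: a)
    also have "RUnit S y \<star> ?i = (Ident S y \<star> LUnit S ?I) \<cdot> Assoc S y ?I ?I"
      using triangle[of y ?I] by (simp add: a)
    also have "Ident S x \<star> ((Ident S y \<star> LUnit S ?I) \<cdot> Assoc S y ?I ?I)
        = (Ident S x \<star> (Ident S y \<star> LUnit S ?I)) \<cdot> (Ident S x \<star> Assoc S y ?I ?I)"
      by (simp add: a ten_cmp)
    also have "(((Ident S x \<star> (Ident S y \<star> LUnit S ?I)) \<cdot> (Ident S x \<star> Assoc S y ?I ?I)) \<cdot> Assoc S x (y \<odot> ?I) ?I) \<cdot> (?A \<star> ?i)
        = (Ident S x \<star> (Ident S y \<star> LUnit S ?I)) \<cdot> ((Ident S x \<star> Assoc S y ?I ?I) \<cdot> (Assoc S x (y \<odot> ?I) ?I \<cdot> (?A \<star> ?i)))"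
      by (simp add: a cmp_assoc)
    also have "(Ident S x \<star> Assoc S y ?I ?I) \<cdot> (Assoc S x (y \<odot> ?I) ?I \<cdot> (?A \<star> ?i)) = Assoc S x y (?I \<odot> ?I) \<cdot> Assoc S (x \<odot> y) ?I ?I"
      using pentagon[of x y ?I ?I] by (simp add: a)
    also have "(Ident S x \<star> (Ident S y \<star> LUnit S ?I)) \<cdot> (Assoc S x y (?I \<odot> ?I) \<cdot> Assoc S (x \<odot> y) ?I ?I)
        = ((Ident S x \<star> (Ident S y \<star> LUnit S ?I)) \<cdot> Assoc S x y (?I \<odot> ?I)) \<cdot> Assoc S (x \<odot> y) ?I ?I"
      by (simp add: a cmp_assoc)
    also have "(Ident S x \<star> (Ident S y \<star> LUnit S ?I)) \<cdot> Assoc S x y (?I \<odot> ?I) = ?A \<cdot> ((Ident S x \<star> Ident S y) \<star> LUnit S ?I)"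
      using Assoc_nat[of "Ident S x" "Ident S y" "LUnit S ?I" x y ?I] by (simp add: a)
    also have "(?A \<cdot> ((Ident S x \<star> Ident S y) \<star> LUnit S ?I)) \<cdot> Assoc S (x \<odot> y) ?I ?I
        = ?A \<cdot> ((Ident S (x \<odot> y) \<star> LUnit S ?I) \<cdot> Assoc S (x \<odot> y) ?I ?I)"
      by (simp add: a cmp_assoc TArr_Ident)
    also have "(Ident S (x \<odot> y) \<star> LUnit S ?I) \<cdot> Assoc S (x \<odot> y) ?I ?I = RUnit S (x \<odot> y) \<star> ?i"
      using triangle[of "x \<odot> y" ?I] by (simp add: a)
    finally show "?A \<cdot> (((Ident S x \<star> RUnit S y) \<cdot> ?A) \<star> ?i) = ?A \<cdot> (RUnit S (x \<odot> y) \<star> ?i)" .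
  qed (simp_all add: a)
qed (use o in \<open>simp_all add: arrs\<close>)

text \<open>Naturality of \<open>LUnit\<close> at \<open>LUnit S (Unit S)\<close> identifies
  \<open>LUnit\<close> of the squared unit with a tensor product. After that,
  \<open>LUnit_tensor\<close> and the triangle have the same left hand side.\<close>

lemma LUnit_Unit: "LUnit S (Unit S) = RUnit S (Unit S)"
proof (rule unit_right_faithful)
  let ?I = "Unit S" and ?i = "Ident S (Unit S)"
  have "LUnit S (?I \<odot> ?I) = ?i \<star> LUnit S ?I"
  proof (rule iso_cancel_left[OF LUnit_iso[OF Unit_in]])
    show "LUnit S ?I \<cdot> LUnit S (?I \<odot> ?I) = LUnit S ?I \<cdot> (?i \<star> LUnit S ?I)"
      using LUnit_nat[of "LUnit S ?I" ?I] by (simp add: arrs)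
  qed (simp_all add: arrs)
  then show "LUnit S ?I \<star> ?i = RUnit S ?I \<star> ?i"
    using LUnit_tensor[of ?I ?I] triangle[of ?I ?I] by (simp add: arrs)
qed (simp_all add: arrs)

end

subsection \<open>Tensor powers\<close>

locale tensor_powers = symmetric_monoidal_category S
  for S :: "('o, 'a, 'z) sym_mon_cat_scheme" (structure) +
  fixes X :: 'o
  assumes X_in: "X \<in> Obj S"
begin

abbreviation P :: "nat \<Rightarrow> 'o" where "P \<equiv> tpow S X"
abbreviation c :: "nat \<Rightarrow> nat \<Rightarrow> 'a" where "c \<equiv> tcan S X"
abbreviation i :: "nat \<Rightarrow> 'a" where "i n \<equiv> Ident S (P n)"

lemma P_in [simp]: "P n \<in> Obj S"
proof (induction n)
  case (Suc n)
  then show ?case by (cases n) (auto intro: TObj_in simp: X_in)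
qed (simp add: Unit_in)

lemma P_Suc: "n > 0 \<Longrightarrow> P (Suc n) = P n \<odot> X"
  by (cases n) auto

lemma c_0_left: "c 0 n = LUnit S (P n)"
  by (cases n) (auto simp: LUnit_Unit)

lemma c_1: "m > 0 \<Longrightarrow> c m (Suc 0) = i (Suc m)"
  by (cases m) auto

lemma c_Suc: "m > 0 \<Longrightarrow> n > 0 \<Longrightarrow> c m (Suc n) = (c m n \<star> Ident S X) \<cdot> Inv S (Assoc S (P m) (P n) X)"
  by (cases m; cases n) auto

lemma c_iso_arr: "iso_arrow S (c m n) \<and> Dom S (c m n) = P m \<odot> P n \<and> Cod S (c m n) = P (m + n)"
proof (cases "m = 0")
  case True
  then show ?thesis using LUnit_iso[OF P_in] LUnit_arr[OF P_in] by (simp add: c_0_left)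
next
  case m: False
  show ?thesis
  proof (induction n)
    case 0
    then show ?case using RUnit_iso[OF P_in] RUnit_arr[OF P_in] by simp
  next
    case (Suc n)
    show ?case
    proof (cases "n = 0")
      case True
      then show ?thesis using m iso_Ident[OF P_in, of "Suc m"] Ident_arr'[OF P_in, of "Suc m"] P_Suc[of m] by (simp add: c_1)
    next
      case n: False
      note A = Inv_arr[OF Assoc_iso[OF P_in P_in X_in, of m n]]
      note t = Inv_arr[OF conjunct1[OF Suc.IH]]
      have "iso_arrow S (c m n \<star> Ident S X)" using Suc.IH by (intro iso_ten iso_Ident X_in) auto
      then have "iso_arrow S (c m (Suc n))"
        unfolding c_Suc[OF m[simplified] n[simplified]]
        using A Suc.IH t by (intro iso_cmp) (auto simp: arrs X_in)
      moreover have "Dom S (c m (Suc n)) = P m \<odot> P (Suc n)" "Cod S (c m (Suc n)) = P (m + Suc n)"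
        using A Suc.IH t m n by (simp_all add: c_Suc arrs X_in P_Suc)
      ultimately show ?thesis by simp
    qed
  qed
qed

lemma c_iso: "iso_arrow S (c m n)"
  and c_arr [simp]: "c m n \<in> Arr S" "Dom S (c m n) = P m \<odot> P n" "Cod S (c m n) = P (m + n)"
  using c_iso_arr[of m n] Inv_arr(1)[of "c m n"] by auto

lemma c_inv [simp]:
  "Inv S (c m n) \<in> Arr S" "Dom S (Inv S (c m n)) = P (m + n)" "Cod S (Inv S (c m n)) = P m \<odot> P n"
  "Inv S (c m n) \<cdot> c m n = Ident S (P m \<odot> P n)" "c m n \<cdot> Inv S (c m n) = i (m + n)"
  using Inv_arr[OF c_iso[of m n]] by simp_all

text \<open>The pentagon in the form needed for unfolding \<open>tcan\<close>, whose recursion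
  contains inverse associators.\<close>

lemma pentagon_inv:
  assumes o: "w \<in> Obj S" "x \<in> Obj S" "y \<in> Obj S" "z \<in> Obj S"
  shows "(Assoc S w x y \<star> Ident S z) \<cdot> Inv S (Assoc S (w \<odot> x) y z)
    = Inv S (Assoc S w (x \<odot> y) z) \<cdot> ((Ident S w \<star> Inv S (Assoc S x y z)) \<cdot> Assoc S w x (y \<odot> z))"
proof -
  let ?a = "Assoc S w x (y \<odot> z)" and ?b = "Assoc S (w \<odot> x) y z" and ?c = "Assoc S x y z"
    and ?d = "Assoc S w (x \<odot> y) z" and ?e = "Assoc S w x y \<star> Ident S z"
  have iso: "iso_arrow S ?b" "iso_arrow S ?c" "iso_arrow S ?d" by (intro Assoc_iso TObj_in o)+
  note a = arrs o Inv_arr[OF iso(1)] Inv_arr[OF iso(2)] Inv_arr[OF iso(3)]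
  have p: "?a \<cdot> ?b = (Ident S w \<star> ?c) \<cdot> ?d \<cdot> ?e" using pentagon[OF o] .
  have "Inv S ?d \<cdot> ((Ident S w \<star> Inv S ?c) \<cdot> ?a) = Inv S ?d \<cdot> ((Ident S w \<star> Inv S ?c) \<cdot> ((?a \<cdot> ?b) \<cdot> Inv S ?b))"
    using a by (simp add: cmp_assoc)
  also have "\<dots> = Inv S ?d \<cdot> (((Ident S w \<star> Inv S ?c) \<cdot> (Ident S w \<star> ?c)) \<cdot> (?d \<cdot> (?e \<cdot> Inv S ?b)))"
    unfolding p using a by (simp add: cmp_assoc)
  also have "\<dots> = Inv S ?d \<cdot> (?d \<cdot> (?e \<cdot> Inv S ?b))"
    using a by (simp add: ten_cmp TArr_Ident)
  also have "\<dots> = ?e \<cdot> Inv S ?b"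
    using a by (simp add: cmp_assoc[symmetric])
  finally show ?thesis ..
qed

lemma Assoc_inv_nat:
  assumes f: "f \<in> Arr S" "g \<in> Arr S" "h \<in> Arr S" and d: "Dom S f = x" "Dom S g = y" "Dom S h = z"
  shows "Inv S (Assoc S (Cod S f) (Cod S g) (Cod S h)) \<cdot> (f \<star> (g \<star> h)) = ((f \<star> g) \<star> h) \<cdot> Inv S (Assoc S x y z)"
proof -
  have iso: "iso_arrow S (Assoc S (Cod S f) (Cod S g) (Cod S h))" "iso_arrow S (Assoc S x y z)"
    using f d by (auto intro!: Assoc_iso Dom_in Cod_in)
  have o: "x \<in> Obj S" "y \<in> Obj S" "z \<in> Obj S" using f d Dom_in by auto
  note a = arrs f Inv_arr[OF iso(1)] Inv_arr[OF iso(2)] d o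
  let ?A = "Assoc S x y z" and ?B = "Assoc S (Cod S f) (Cod S g) (Cod S h)"
  have "Inv S ?B \<cdot> (f \<star> (g \<star> h)) = Inv S ?B \<cdot> (((f \<star> (g \<star> h)) \<cdot> ?A) \<cdot> Inv S ?A)"
    using a by (simp add: cmp_assoc)
  also have "(f \<star> (g \<star> h)) \<cdot> ?A = ?B \<cdot> ((f \<star> g) \<star> h)"
    using Assoc_nat[OF f refl refl refl] d by simp
  also have "Inv S ?B \<cdot> ((?B \<cdot> ((f \<star> g) \<star> h)) \<cdot> Inv S ?A) = Inv S ?B \<cdot> (?B \<cdot> (((f \<star> g) \<star> h) \<cdot> Inv S ?A))"
    using a by (simp add: cmp_assoc)
  also have "\<dots> = ((f \<star> g) \<star> h) \<cdot> Inv S ?A"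
    by (rule Inv_cmp(1)[OF iso(1)]) (use a in simp_all)
  finally show ?thesis .
qed

text \<open>Coherence for left bracketed powers. The recursion of \<open>tcan\<close> peels off
  factors on the right, hence the induction on \<open>n\<close>. Zero arities are separate, since
  there \<open>tcan\<close> is a unitor, and the induction starts at arity 1, since the power with
  exponent 1 is \<open>X\<close> itself without a unit factor.\<close>

lemma tcan_assoc:
  "c (l + m) n \<cdot> (c l m \<star> i n) = c l (m + n) \<cdot> ((i l \<star> c m n) \<cdot> Assoc S (P l) (P m) (P n))"
proof -
  note a = arrs
  consider "n = 0" | "n > 0" "m = 0" | "n > 0" "m > 0" "l = 0" | "n > 0" "m > 0" "l > 0" by auto
  then show ?thesis
  proof cases
    case 1
    then show ?thesis
      using RUnit_nat[of "c l m" "P (l + m)"] RUnit_tensor[of "P l" "P m"] by (simp add: a)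
  next
    case 2
    then show ?thesis using triangle[of "P l" "P n"] by (simp add: a c_0_left)
  next
    case 3
    have "LUnit S (P (m + n)) \<cdot> ((i 0 \<star> c m n) \<cdot> Assoc S (P 0) (P m) (P n))
      = (LUnit S (P (m + n)) \<cdot> (Ident S (Unit S) \<star> c m n)) \<cdot> Assoc S (Unit S) (P m) (P n)"
      by (simp add: a cmp_assoc)
    also have "\<dots> = c m n \<cdot> (LUnit S (P m \<odot> P n) \<cdot> Assoc S (Unit S) (P m) (P n))"
      using LUnit_nat[of "c m n" "P (m + n)"] by (simp add: a cmp_assoc)
    also have "\<dots> = c m n \<cdot> (LUnit S (P m) \<star> i n)"
      by (simp add: LUnit_tensor)
    finally show ?thesis using 3 by (simp add: c_0_left)
  next
    case 4
    then have lm: "l > 0" "m > 0" by auto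
    let ?x = "Ident S X"
    have "n > 0 \<Longrightarrow> c (l + m) n \<cdot> (c l m \<star> i n) = c l (m + n) \<cdot> ((i l \<star> c m n) \<cdot> Assoc S (P l) (P m) (P n))"
    proof (induction n)
      case (Suc n)
      note A = Inv_arr[OF Assoc_iso]
      show ?case
      proof (cases "n = 0")
        case True
        have "((c l m \<star> ?x) \<cdot> Inv S (Assoc S (P l) (P m) X)) \<cdot> ((i l \<star> Ident S (P m \<odot> X)) \<cdot> Assoc S (P l) (P m) X) = c l m \<star> ?x"
          using A[OF P_in P_in X_in, of l m] by (simp add: a X_in TArr_Ident cmp_assoc)
        moreover have "c (l + m) (Suc 0) \<cdot> (c l m \<star> ?x) = c l m \<star> ?x"
          using lm by (simp add: c_1 P_Suc a X_in)
        ultimately show ?thesis using lm True by (simp add: c_1 c_Suc P_Suc)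
      next
        case False
        then have n: "n > 0" by simp
        note IH = Suc.IH[OF n]
        let ?L = "Assoc S (P l) (P m) (P n)"
        let ?A1 = "Inv S (Assoc S (P (l + m)) (P n) X)" and ?A2 = "Inv S (Assoc S (P l \<odot> P m) (P n) X)"
        let ?A3 = "Inv S (Assoc S (P l) (P (m + n)) X)" and ?A4 = "Inv S (Assoc S (P m) (P n) X)"
        let ?A5 = "Inv S (Assoc S (P l) (P m \<odot> P n) X)"
        have iv: "?A1 \<in> Arr S" "Dom S ?A1 = P (l + m) \<odot> (P n \<odot> X)" "Cod S ?A1 = (P (l + m) \<odot> P n) \<odot> X"
          "?A2 \<in> Arr S" "Dom S ?A2 = (P l \<odot> P m) \<odot> (P n \<odot> X)" "Cod S ?A2 = ((P l \<odot> P m) \<odot> P n) \<odot> X"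
          "?A3 \<in> Arr S" "Dom S ?A3 = P l \<odot> (P (m + n) \<odot> X)" "Cod S ?A3 = (P l \<odot> P (m + n)) \<odot> X"
          "?A4 \<in> Arr S" "Dom S ?A4 = P m \<odot> (P n \<odot> X)" "Cod S ?A4 = (P m \<odot> P n) \<odot> X"
          "?A5 \<in> Arr S" "Dom S ?A5 = P l \<odot> ((P m \<odot> P n) \<odot> X)" "Cod S ?A5 = (P l \<odot> (P m \<odot> P n)) \<odot> X"
          using A[OF P_in P_in X_in, of "l + m" n] A[OF TObj_in[OF P_in P_in] P_in X_in, of l m n]
            A[OF P_in P_in X_in, of l "m + n"] A[OF P_in P_in X_in, of m n] A[OF P_in TObj_in[OF P_in P_in] X_in, of l m n]
          by (simp_all add: a X_in)
        note b = a X_in iv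
        have "c (l + m) (Suc n) \<cdot> (c l m \<star> i (Suc n)) = ((c (l + m) n \<star> ?x) \<cdot> ?A1) \<cdot> (c l m \<star> (i n \<star> ?x))"
          using lm n by (simp add: c_Suc P_Suc TArr_Ident X_in)
        also have "\<dots> = (c (l + m) n \<star> ?x) \<cdot> (?A1 \<cdot> (c l m \<star> (i n \<star> ?x)))"
          by (simp add: b cmp_assoc)
        also have "?A1 \<cdot> (c l m \<star> (i n \<star> ?x)) = ((c l m \<star> i n) \<star> ?x) \<cdot> ?A2"
          using Assoc_inv_nat[of "c l m" "i n" ?x "P l \<odot> P m" "P n" X] by (simp add: b)
        also have "(c (l + m) n \<star> ?x) \<cdot> (((c l m \<star> i n) \<star> ?x) \<cdot> ?A2) = ((c (l + m) n \<cdot> (c l m \<star> i n)) \<star> ?x) \<cdot> ?A2"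
          by (simp add: b cmp_assoc[symmetric] ten_cmp)
        also have "(c (l + m) n \<cdot> (c l m \<star> i n)) \<star> ?x = ((c l (m + n) \<star> ?x) \<cdot> ((i l \<star> c m n) \<star> ?x)) \<cdot> (?L \<star> ?x)"
          unfolding IH by (simp add: b ten_cmp cmp_assoc)
        also have "(((c l (m + n) \<star> ?x) \<cdot> ((i l \<star> c m n) \<star> ?x)) \<cdot> (?L \<star> ?x)) \<cdot> ?A2
          = (c l (m + n) \<star> ?x) \<cdot> (((i l \<star> c m n) \<star> ?x) \<cdot> ((?L \<star> ?x) \<cdot> ?A2))"
          by (simp add: b cmp_assoc)
        \<comment> \<open>For positive arities this is the one use of the pentagon.\<close>
        also have "(?L \<star> ?x) \<cdot> ?A2 = ?A5 \<cdot> ((i l \<star> ?A4) \<cdot> Assoc S (P l) (P m) (P n \<odot> X))"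
          using pentagon_inv[of "P l" "P m" "P n" X] by (simp add: X_in)
        also have "((i l \<star> c m n) \<star> ?x) \<cdot> (?A5 \<cdot> ((i l \<star> ?A4) \<cdot> Assoc S (P l) (P m) (P n \<odot> X)))
          = (((i l \<star> c m n) \<star> ?x) \<cdot> ?A5) \<cdot> ((i l \<star> ?A4) \<cdot> Assoc S (P l) (P m) (P n \<odot> X))"
          by (simp add: b cmp_assoc)
        also have "((i l \<star> c m n) \<star> ?x) \<cdot> ?A5 = ?A3 \<cdot> (i l \<star> (c m n \<star> ?x))"
          using Assoc_inv_nat[of "i l" "c m n" ?x "P l" "P m \<odot> P n" X] by (simp add: b)
        also have "(c l (m + n) \<star> ?x) \<cdot> ((?A3 \<cdot> (i l \<star> (c m n \<star> ?x))) \<cdot> ((i l \<star> ?A4) \<cdot> Assoc S (P l) (P m) (P n \<odot> X)))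
          = ((c l (m + n) \<star> ?x) \<cdot> ?A3) \<cdot> (((i l \<star> (c m n \<star> ?x)) \<cdot> (i l \<star> ?A4)) \<cdot> Assoc S (P l) (P m) (P n \<odot> X))"
          by (simp add: b cmp_assoc)
        also have "(i l \<star> (c m n \<star> ?x)) \<cdot> (i l \<star> ?A4) = i l \<star> c m (Suc n)"
          using lm n by (simp add: b ten_cmp c_Suc)
        also have "(c l (m + n) \<star> ?x) \<cdot> ?A3 = c l (m + Suc n)"
          using lm n by (simp add: c_Suc)
        finally show ?thesis using n by (simp add: P_Suc)
      qed
    qed simp
    then show ?thesis using 4 by simp
  qed
qed

end

section \<open>The endomorphism PROP of an object\<close>

context tensor_powers
begin

definition etens :: "nat \<Rightarrow> nat \<Rightarrow> nat \<Rightarrow> nat \<Rightarrow> 'a \<Rightarrow> 'a \<Rightarrow> 'a" where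
  "etens m m' n n' f g = c m' n' \<cdot> ((f \<star> g) \<cdot> Inv S (c m n))"

definition esym :: "nat \<Rightarrow> nat \<Rightarrow> 'a" where
  "esym m n = c n m \<cdot> (Sym S (P m) (P n) \<cdot> Inv S (c m n))"

text \<open>The endomorphism PROP of \<open>X\<close>.  Arrows carry their arities because \<open>tpow S X\<close> need not be
  injective, and conjugation by \<open>tcan\<close> makes the tensor product strict.\<close>

definition endo :: "(nat, nat \<times> nat \<times> 'a) sym_mon_cat" where
  "endo =
     \<lparr>Obj = UNIV,
      Arr = {(m, n, f). f \<in> Hom S (P m) (P n)},
      Dom = fst,
      Cod = fst \<circ> snd,
      Ident = (\<lambda>n. (n, n, i n)),
      Cmp = (\<lambda>g f. (fst f, fst (snd g), snd (snd g) \<cdot> snd (snd f))),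
      TObj = (+),
      TArr = (\<lambda>(m, m', f) (n, n', g). (m + n, m' + n', etens m m' n n' f g)),
      Unit = 0,
      Assoc = (\<lambda>l m n. (l + m + n, l + m + n, i (l + m + n))),
      LUnit = (\<lambda>n. (n, n, i n)),
      RUnit = (\<lambda>n. (n, n, i n)),
      Sym = (\<lambda>m n. (m + n, n + m, esym m n))\<rparr>"

lemma endo_sel [simp]:
  "Obj endo = UNIV" "Arr endo = {(m, n, f). f \<in> Hom S (P m) (P n)}" "Dom endo = fst" "Cod endo = fst \<circ> snd"
  "Ident endo n = (n, n, i n)" "TObj endo m n = m + n" "Unit endo = 0"
  "Cmp endo g f = (fst f, fst (snd g), snd (snd g) \<cdot> snd (snd f))"
  "TArr endo (m, m', h) (n, n', k) = (m + n, m' + n', etens m m' n n' h k)"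
  "Assoc endo l m n = (l + m + n, l + m + n, i (l + m + n))" "LUnit endo n = (n, n, i n)" "RUnit endo n = (n, n, i n)"
  "Sym endo m n = (m + n, n + m, esym m n)"
  by (simp_all add: endo_def)

lemma Hom_endo: "f \<in> Hom endo m n \<longleftrightarrow> (\<exists>h. f = (m, n, h) \<and> h \<in> Hom S (P m) (P n))"
  by (cases f) (auto simp: Hom_def)

lemma HomS: "f \<in> Hom S x y \<longleftrightarrow> f \<in> Arr S \<and> Dom S f = x \<and> Cod S f = y"
  by (simp add: Hom_def)

lemma etens_in: "f \<in> Hom S (P m) (P m') \<Longrightarrow> g \<in> Hom S (P n) (P n') \<Longrightarrow> etens m m' n n' f g \<in> Hom S (P (m + n)) (P (m' + n'))"
  by (simp add: etens_def HomS arrs)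

lemma etens_char:
  assumes "f \<in> Hom S (P m) (P m')" "g \<in> Hom S (P n) (P n')"
  shows "etens m m' n n' f g \<cdot> c m n = c m' n' \<cdot> (f \<star> g)"
  using assms by (simp add: etens_def HomS arrs cmp_assoc)

text \<open>The defining square of the conjugated tensor product determines it, because
  \<open>tcan\<close> is invertible. The PROP laws can thus be checked without inverses.\<close>

lemma etens_eqI:
  assumes "f \<in> Hom S (P m) (P m')" "g \<in> Hom S (P n) (P n')" "h \<in> Hom S (P (m + n)) (P (m' + n'))"
    and "h \<cdot> c m n = c m' n' \<cdot> (f \<star> g)"
  shows "etens m m' n n' f g = h"
  by (rule iso_cancel_right[OF c_iso[of m n]])
    (use assms etens_char[OF assms(1,2)] etens_in[OF assms(1,2)] in \<open>simp_all add: HomS\<close>)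

lemma esym_in: "esym m n \<in> Hom S (P (m + n)) (P (n + m))"
  by (simp add: esym_def HomS arrs)

lemma esym_char: "esym m n \<cdot> c m n = c n m \<cdot> Sym S (P m) (P n)"
  by (simp add: esym_def arrs cmp_assoc)

lemma i_in: "i n \<in> Hom S (P n) (P n)"
  by (simp add: HomS arrs)

text \<open>The canonical map out of \<open>(P l \<odot> P m) \<odot> P n\<close>; laws with three
  arities are checked after composing with it.\<close>

lemma triple_iso: "iso_arrow S (c (l + m) n \<cdot> (c l m \<star> i n))"
  by (intro iso_cmp iso_ten c_iso iso_Ident P_in) (simp_all add: arrs)

text \<open>Both sides are pushed through \<open>tcan\<close>. Then \<open>tcan_assoc\<close>
  changes the bracketing at the target and at the source, and naturality of the associator is what
  remains in between.\<close>

lemma etens_assoc: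
  assumes f: "f \<in> Hom S (P l) (P l')" and g: "g \<in> Hom S (P m) (P m')" and h: "h \<in> Hom S (P n) (P n')"
  shows "etens (l + m) (l' + m') n n' (etens l l' m m' f g) h = etens l l' (m + n) (m' + n') f (etens m m' n n' g h)"
    (is "?F = ?G")
proof (rule iso_cancel_right[OF triple_iso[of l m n]])
  let ?fg = "etens l l' m m' f g" and ?gh = "etens m m' n n' g h"
  let ?A = "Assoc S (P l) (P m) (P n)" and ?A' = "Assoc S (P l') (P m') (P n')"
  note fg = etens_in[OF f g] and gh = etens_in[OF g h]
  note F = etens_in[OF fg h] and G = etens_in[OF f gh]
  note b = arrs HomS f[unfolded HomS] g[unfolded HomS] h[unfolded HomS] fg[unfolded HomS] gh[unfolded HomS] F[unfolded HomS] G[unfolded HomS]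
  have "?F \<cdot> (c (l + m) n \<cdot> (c l m \<star> i n)) = (?F \<cdot> c (l + m) n) \<cdot> (c l m \<star> i n)"
    using b by (simp add: cmp_assoc)
  also have "?F \<cdot> c (l + m) n = c (l' + m') n' \<cdot> (?fg \<star> h)" by (rule etens_char[OF fg h])
  also have "(c (l' + m') n' \<cdot> (?fg \<star> h)) \<cdot> (c l m \<star> i n) = c (l' + m') n' \<cdot> ((?fg \<cdot> c l m) \<star> h)"
    using b by (simp add: cmp_assoc ten_cmp)
  also have "?fg \<cdot> c l m = c l' m' \<cdot> (f \<star> g)" by (rule etens_char[OF f g])
  also have "c (l' + m') n' \<cdot> ((c l' m' \<cdot> (f \<star> g)) \<star> h) = (c (l' + m') n' \<cdot> (c l' m' \<star> i n')) \<cdot> ((f \<star> g) \<star> h)"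
    using b by (simp add: cmp_assoc ten_cmp)
  also have "c (l' + m') n' \<cdot> (c l' m' \<star> i n') = c l' (m' + n') \<cdot> ((i l' \<star> c m' n') \<cdot> ?A')" by (rule tcan_assoc)
  also have "(c l' (m' + n') \<cdot> ((i l' \<star> c m' n') \<cdot> ?A')) \<cdot> ((f \<star> g) \<star> h) = c l' (m' + n') \<cdot> ((i l' \<star> c m' n') \<cdot> (?A' \<cdot> ((f \<star> g) \<star> h)))"
    using b by (simp add: cmp_assoc)
  also have "?A' \<cdot> ((f \<star> g) \<star> h) = (f \<star> (g \<star> h)) \<cdot> ?A"
    using Assoc_nat[of f g h "P l'" "P m'" "P n'"] b by simp
  also have "c l' (m' + n') \<cdot> ((i l' \<star> c m' n') \<cdot> ((f \<star> (g \<star> h)) \<cdot> ?A)) = c l' (m' + n') \<cdot> ((f \<star> (c m' n' \<cdot> (g \<star> h))) \<cdot> ?A)"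
    using b by (simp add: cmp_assoc[symmetric] ten_cmp)
  also have "c m' n' \<cdot> (g \<star> h) = ?gh \<cdot> c m n" by (rule etens_char[OF g h, symmetric])
  also have "c l' (m' + n') \<cdot> ((f \<star> (?gh \<cdot> c m n)) \<cdot> ?A) = (c l' (m' + n') \<cdot> (f \<star> ?gh)) \<cdot> ((i l \<star> c m n) \<cdot> ?A)"
    using b by (simp add: cmp_assoc[symmetric] ten_cmp) (simp add: cmp_assoc ten_cmp b)
  also have "c l' (m' + n') \<cdot> (f \<star> ?gh) = ?G \<cdot> c l (m + n)" by (rule etens_char[OF f gh, symmetric])
  also have "(?G \<cdot> c l (m + n)) \<cdot> ((i l \<star> c m n) \<cdot> ?A) = ?G \<cdot> (c l (m + n) \<cdot> ((i l \<star> c m n) \<cdot> ?A))"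
    using b by (simp add: cmp_assoc add.assoc)
  also have "c l (m + n) \<cdot> ((i l \<star> c m n) \<cdot> ?A) = c (l + m) n \<cdot> (c l m \<star> i n)" by (rule tcan_assoc[symmetric])
  finally show "?F \<cdot> (c (l + m) n \<cdot> (c l m \<star> i n)) = ?G \<cdot> (c (l + m) n \<cdot> (c l m \<star> i n))" .
qed (use etens_in[OF etens_in[OF f g] h] etens_in[OF f etens_in[OF g h]] in \<open>simp_all add: HomS arrs add.assoc\<close>)

lemma etens_cmp:
  assumes f: "f \<in> Hom S (P l) (P m)" and g: "g \<in> Hom S (P m) (P n)" and f': "f' \<in> Hom S (P l') (P m')" and g': "g' \<in> Hom S (P m') (P n')"
  shows "etens l n l' n' (g \<cdot> f) (g' \<cdot> f') = etens m n m' n' g g' \<cdot> etens l m l' m' f f'"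
proof (rule etens_eqI)
  let ?G = "etens m n m' n' g g'" and ?F = "etens l m l' m' f f'"
  note b = arrs f[unfolded HomS] g[unfolded HomS] f'[unfolded HomS] g'[unfolded HomS]
    etens_in[OF g g', unfolded HomS] etens_in[OF f f', unfolded HomS]
  show "g \<cdot> f \<in> Hom S (P l) (P n)" "g' \<cdot> f' \<in> Hom S (P l') (P n')" "?G \<cdot> ?F \<in> Hom S (P (l + l')) (P (n + n'))"
    using b by (simp_all add: HomS)
  have "(?G \<cdot> ?F) \<cdot> c l l' = ?G \<cdot> (?F \<cdot> c l l')" using b by (simp add: cmp_assoc)
  also have "\<dots> = (?G \<cdot> c m m') \<cdot> (f \<star> f')" unfolding etens_char[OF f f'] using b by (simp add: cmp_assoc)
  also have "\<dots> = c n n' \<cdot> ((g \<cdot> f) \<star> (g' \<cdot> f'))" unfolding etens_char[OF g g'] using b by (simp add: cmp_assoc ten_cmp)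
  finally show "(?G \<cdot> ?F) \<cdot> c l l' = c n n' \<cdot> ((g \<cdot> f) \<star> (g' \<cdot> f'))" .
qed

lemma etens_i: "etens m m n n (i m) (i n) = i (m + n)"
  by (rule etens_eqI) (simp_all add: HomS arrs TArr_Ident)

lemma etens_0:
  assumes f: "f \<in> Hom S (P m) (P n)"
  shows "etens 0 0 m n (i 0) f = f" "etens m n 0 0 f (i 0) = f"
proof -
  note b = arrs f[unfolded HomS]
  show "etens 0 0 m n (i 0) f = f"
    by (rule etens_eqI[OF i_in f]) (use f LUnit_nat[of f "P n"] b in \<open>simp_all add: c_0_left\<close>)
  show "etens m n 0 0 f (i 0) = f"
    by (rule etens_eqI[OF f i_in]) (use f RUnit_nat[of f "P n"] b in simp_all)
qed

lemma esym_nat: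
  assumes f: "f \<in> Hom S (P m) (P m')" and g: "g \<in> Hom S (P n) (P n')"
  shows "esym m' n' \<cdot> etens m m' n n' f g = etens n n' m m' g f \<cdot> esym m n"
proof (rule iso_cancel_right[OF c_iso[of m n]])
  let ?F = "etens m m' n n' f g" and ?G = "etens n n' m m' g f"
  note b = arrs f[unfolded HomS] g[unfolded HomS] etens_in[OF f g, unfolded HomS] etens_in[OF g f, unfolded HomS]
    esym_in[unfolded HomS]
  have "(esym m' n' \<cdot> ?F) \<cdot> c m n = esym m' n' \<cdot> (?F \<cdot> c m n)" using b by (simp add: cmp_assoc)
  also have "\<dots> = (esym m' n' \<cdot> c m' n') \<cdot> (f \<star> g)" unfolding etens_char[OF f g] using b by (simp add: cmp_assoc)
  also have "\<dots> = c n' m' \<cdot> (Sym S (P m') (P n') \<cdot> (f \<star> g))" unfolding esym_char using b by (simp add: cmp_assoc)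
  also have "Sym S (P m') (P n') \<cdot> (f \<star> g) = (g \<star> f) \<cdot> Sym S (P m) (P n)"
    using Sym_nat'[of f g "P m'" "P n'"] b by simp
  also have "c n' m' \<cdot> ((g \<star> f) \<cdot> Sym S (P m) (P n)) = (c n' m' \<cdot> (g \<star> f)) \<cdot> Sym S (P m) (P n)"
    using b by (simp add: cmp_assoc)
  also have "\<dots> = ?G \<cdot> (c n m \<cdot> Sym S (P m) (P n))"
    unfolding etens_char[OF g f, symmetric] using b by (simp add: cmp_assoc)
  also have "\<dots> = (?G \<cdot> esym m n) \<cdot> c m n"
    unfolding esym_char[symmetric] using b by (simp add: cmp_assoc)
  finally show "(esym m' n' \<cdot> ?F) \<cdot> c m n = (?G \<cdot> esym m n) \<cdot> c m n" .
qed (use esym_in[unfolded HomS] etens_in[OF f g, unfolded HomS] etens_in[OF g f, unfolded HomS] in \<open>simp_all\<close>)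

lemma esym_inv: "esym n m \<cdot> esym m n = i (m + n)"
proof (rule iso_cancel_right[OF c_iso[of m n]])
  note b = arrs esym_in[unfolded HomS]
  have "(esym n m \<cdot> esym m n) \<cdot> c m n = esym n m \<cdot> (esym m n \<cdot> c m n)"
    using b by (simp add: cmp_assoc)
  also have "\<dots> = (esym n m \<cdot> c n m) \<cdot> Sym S (P m) (P n)"
    unfolding esym_char[of m n] using b by (simp add: cmp_assoc)
  also have "esym n m \<cdot> c n m = c m n \<cdot> Sym S (P n) (P m)" by (rule esym_char)
  also have "(c m n \<cdot> Sym S (P n) (P m)) \<cdot> Sym S (P m) (P n) = c m n \<cdot> (Sym S (P n) (P m) \<cdot> Sym S (P m) (P n))"
    by (rule cmp_assoc) (simp_all add: arrs)
  finally show "(esym n m \<cdot> esym m n) \<cdot> c m n = i (m + n) \<cdot> c m n" using b by (simp add: Sym_Sym)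
qed (use esym_in[unfolded HomS] in \<open>simp_all add: arrs\<close>)

text \<open>The hexagon of \<open>S\<close>, with one use of \<open>tcan_assoc\<close> for each of
  its three associators.\<close>

lemma esym_hexagon:
  "esym l (m + n) = etens m m (l + n) (n + l) (i m) (esym l n) \<cdot> etens (l + m) (m + l) n n (esym l m) (i n)"
proof (rule iso_cancel_right[OF triple_iso[of l m n]])
  let ?F = "etens (l + m) (m + l) n n (esym l m) (i n)" and ?G = "etens m m (l + n) (n + l) (i m) (esym l n)"
  let ?sm = "Sym S (P l) (P m)" and ?sn = "Sym S (P l) (P n)"
  have F: "?F \<in> Hom S (P (l + m + n)) (P (m + l + n))" by (rule etens_in[OF esym_in i_in])
  have G: "?G \<in> Hom S (P (m + (l + n))) (P (m + (n + l)))" by (rule etens_in[OF i_in esym_in])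
  note b = arrs esym_in[unfolded HomS] F[unfolded HomS] G[unfolded HomS]
  let ?A = "Assoc S (P l) (P m) (P n)" and ?B = "Assoc S (P m) (P l) (P n)" and ?C = "Assoc S (P m) (P n) (P l)"
  have "(?G \<cdot> ?F) \<cdot> (c (l + m) n \<cdot> (c l m \<star> i n)) = ?G \<cdot> ((?F \<cdot> c (l + m) n) \<cdot> (c l m \<star> i n))"
    using b by (simp add: add.assoc cmp_assoc)
  also have "?F \<cdot> c (l + m) n = c (m + l) n \<cdot> (esym l m \<star> i n)" by (rule etens_char[OF esym_in i_in])
  also have "(c (m + l) n \<cdot> (esym l m \<star> i n)) \<cdot> (c l m \<star> i n) = c (m + l) n \<cdot> ((esym l m \<cdot> c l m) \<star> i n)"
    using b by (simp add: add.assoc cmp_assoc ten_cmp)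
  also have "c (m + l) n \<cdot> ((esym l m \<cdot> c l m) \<star> i n) = (c (m + l) n \<cdot> (c m l \<star> i n)) \<cdot> (?sm \<star> i n)"
    unfolding esym_char using b by (simp add: add.assoc cmp_assoc ten_cmp)
  also have "\<dots> = (c m (l + n) \<cdot> ((i m \<star> c l n) \<cdot> ?B)) \<cdot> (?sm \<star> i n)" unfolding tcan_assoc ..
  also have "?G \<cdot> \<dots> = (?G \<cdot> c m (l + n)) \<cdot> ((i m \<star> c l n) \<cdot> (?B \<cdot> (?sm \<star> i n)))"
    using b by (simp add: add.assoc cmp_assoc)
  also have "?G \<cdot> c m (l + n) = c m (n + l) \<cdot> (i m \<star> esym l n)" by (rule etens_char[OF i_in esym_in])
  also have "(c m (n + l) \<cdot> (i m \<star> esym l n)) \<cdot> ((i m \<star> c l n) \<cdot> (?B \<cdot> (?sm \<star> i n)))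
     = c m (n + l) \<cdot> (((i m \<star> esym l n) \<cdot> (i m \<star> c l n)) \<cdot> (?B \<cdot> (?sm \<star> i n)))"
    using b by (simp add: add.assoc cmp_assoc)
  also have "(i m \<star> esym l n) \<cdot> (i m \<star> c l n) = (i m \<star> c n l) \<cdot> (i m \<star> ?sn)"
    using b esym_char[of l n] by (simp add: ten_cmp)
  also have "c m (n + l) \<cdot> (((i m \<star> c n l) \<cdot> (i m \<star> ?sn)) \<cdot> (?B \<cdot> (?sm \<star> i n)))
     = c m (n + l) \<cdot> ((i m \<star> c n l) \<cdot> ((i m \<star> ?sn) \<cdot> ?B \<cdot> (?sm \<star> i n)))"
    using b by (simp add: add.assoc cmp_assoc)
  also have "(i m \<star> ?sn) \<cdot> ?B \<cdot> (?sm \<star> i n) = ?C \<cdot> Sym S (P l) (P m \<odot> P n) \<cdot> ?A"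
    using hexagon[of "P l" "P m" "P n"] by simp
  also have "c m (n + l) \<cdot> ((i m \<star> c n l) \<cdot> (?C \<cdot> Sym S (P l) (P m \<odot> P n) \<cdot> ?A))
     = (c m (n + l) \<cdot> ((i m \<star> c n l) \<cdot> ?C)) \<cdot> (Sym S (P l) (P m \<odot> P n) \<cdot> ?A)"
    using b by (simp add: add.assoc cmp_assoc)
  also have "c m (n + l) \<cdot> ((i m \<star> c n l) \<cdot> ?C) = c (m + n) l \<cdot> (c m n \<star> i l)" by (rule tcan_assoc[symmetric])
  also have "(c (m + n) l \<cdot> (c m n \<star> i l)) \<cdot> (Sym S (P l) (P m \<odot> P n) \<cdot> ?A)
     = c (m + n) l \<cdot> (((c m n \<star> i l) \<cdot> Sym S (P l) (P m \<odot> P n)) \<cdot> ?A)"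
    using b by (simp add: add.assoc cmp_assoc)
  also have "(c m n \<star> i l) \<cdot> Sym S (P l) (P m \<odot> P n) = Sym S (P l) (P (m + n)) \<cdot> (i l \<star> c m n)"
    using Sym_nat'[of "i l" "c m n" "P l" "P (m + n)"] b by simp
  also have "c (m + n) l \<cdot> ((Sym S (P l) (P (m + n)) \<cdot> (i l \<star> c m n)) \<cdot> ?A)
     = (c (m + n) l \<cdot> Sym S (P l) (P (m + n))) \<cdot> ((i l \<star> c m n) \<cdot> ?A)"
    using b by (simp add: add.assoc cmp_assoc)
  also have "\<dots> = esym l (m + n) \<cdot> (c l (m + n) \<cdot> ((i l \<star> c m n) \<cdot> ?A))"
    unfolding esym_char[symmetric] using b by (simp add: add.assoc cmp_assoc)
  also have "c l (m + n) \<cdot> ((i l \<star> c m n) \<cdot> ?A) = c (l + m) n \<cdot> (c l m \<star> i n)" by (rule tcan_assoc[symmetric])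
  finally show "esym l (m + n) \<cdot> (c (l + m) n \<cdot> (c l m \<star> i n)) = (?G \<cdot> ?F) \<cdot> (c (l + m) n \<cdot> (c l m \<star> i n))" ..
qed (use esym_in[unfolded HomS] etens_in[OF esym_in[of l m] i_in[of n], unfolded HomS] etens_in[OF i_in[of m] esym_in[of l n], unfolded HomS]
    in \<open>simp_all add: arrs add.assoc\<close>)

lemma category_endo: "category endo"
  by standard (auto simp: Hom_endo i_in HomS arrs cmp_assoc)

lemma prop_category_endo: "prop_category endo"
proof -
  interpret E: category endo by (rule category_endo)
  have iso: "iso_arrow endo (n, n, i n)" for n
    using E.iso_Ident[of n] by simp
  show ?thesis
  proof
    fix x y z w :: nat
    show "TArr endo f g \<in> Hom endo (TObj endo x x') (TObj endo y y')" if "f \<in> Hom endo x y" "g \<in> Hom endo x' y'" for f g x' y'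
      using that by (auto simp: Hom_endo etens_in)
    show "TArr endo (Ident endo x) (Ident endo y) = Ident endo (TObj endo x y)"
      by (simp add: etens_i)
    show "TArr endo (Cmp endo g f) (Cmp endo g' f') = Cmp endo (TArr endo g g') (TArr endo f f')"
      if "f \<in> Hom endo x y" "g \<in> Hom endo y z" "f' \<in> Hom endo x' y'" "g' \<in> Hom endo y' z'" for f g f' g' x' y' z'
      using that by (auto simp: Hom_endo etens_cmp)
    show "Cmp endo (Assoc endo x' y' z') (TArr endo (TArr endo f g) h) = Cmp endo (TArr endo f (TArr endo g h)) (Assoc endo x y z)"
      if fgh: "f \<in> Hom endo x x'" "g \<in> Hom endo y y'" "h \<in> Hom endo z z'" for f g h x' y' z'
    proof -
      obtain f' g' h' where "f = (x, x', f')" "g = (y, y', g')" "h = (z, z', h')"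
        and h: "f' \<in> Hom S (P x) (P x')" "g' \<in> Hom S (P y) (P y')" "h' \<in> Hom S (P z) (P z')"
        using fgh by (auto simp: Hom_endo)
      then show ?thesis using etens_assoc[OF h] etens_in[OF etens_in[OF h(1,2)] h(3)] etens_in[OF h(1) etens_in[OF h(2,3)]]
        by (simp add: HomS add.assoc)
    qed
    show "Cmp endo (LUnit endo y) (TArr endo (Ident endo (Unit endo)) f) = Cmp endo f (LUnit endo x)"
      "Cmp endo (RUnit endo y) (TArr endo f (Ident endo (Unit endo))) = Cmp endo f (RUnit endo x)" if "f \<in> Hom endo x y" for f
      using that etens_0[unfolded tpow.simps] by (auto simp: Hom_endo HomS)
    show "Cmp endo (Sym endo x' y') (TArr endo f g) = Cmp endo (TArr endo g f) (Sym endo x y)"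
      if "f \<in> Hom endo x x'" "g \<in> Hom endo y y'" for f g x' y'
      using that by (auto simp: Hom_endo esym_nat)
    show "Cmp endo (Assoc endo y z x) (Cmp endo (Sym endo x (TObj endo y z)) (Assoc endo x y z)) =
      Cmp endo (TArr endo (Ident endo y) (Sym endo x z)) (Cmp endo (Assoc endo y x z) (TArr endo (Sym endo x y) (Ident endo z)))"
    proof -
      have "etens (x + y) (y + x) z z (esym x y) (i z) \<in> Hom S (P (x + y + z)) (P (y + x + z))"
        by (rule etens_in[OF esym_in i_in])
      then show ?thesis
        using esym_hexagon[of x y z] esym_in[of x "y + z"] by (simp add: HomS add.assoc)
    qed
  qed (use iso in \<open>auto simp: Hom_endo i_in etens_i esym_in[unfolded HomS] esym_inv add.assoc HomS arrs\<close>)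
qed

end

section \<open>Bimonoids in the endomorphism PROP\<close>

context tensor_powers
begin

lemma Inv_Ident: "x \<in> Obj S \<Longrightarrow> Inv S (Ident S x) = Ident S x"
  using Inv_arr[OF iso_Ident] cmp_Ident(1)[of "Inv S (Ident S x)" x] by (metis Ident_arr'(1,2,3))

lemma Inv_Inv:
  assumes "iso_arrow S f"
  shows "Inv S (Inv S f) = f"
proof -
  note b = Inv_arr[OF assms]
  note d = Inv_arr[OF b(7)]
  have "inverse_arrows S (Inv S f) (Inv S (Inv S f))" "inverse_arrows S (Inv S f) f"
    using b d by (auto simp: inverse_arrows_def Hom_def)
  then show ?thesis by (rule inverse_arrows_unique)
qed

lemma Inv_move:
  assumes "iso_arrow S v" "f \<in> Arr S" "g \<in> Arr S" "Dom S f = Dom S v" "Dom S g = Cod S v"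
  shows "f \<cdot> Inv S v = g \<longleftrightarrow> f = g \<cdot> v"
proof
  note b = Inv_arr[OF assms(1)] assms
  show "f = g \<cdot> v" if "f \<cdot> Inv S v = g" unfolding that[symmetric] using b by (simp add: cmp_assoc)
  show "f \<cdot> Inv S v = g" if "f = g \<cdot> v" unfolding that using b by (simp add: cmp_assoc)
qed

lemma Inv_move_left:
  assumes "iso_arrow S v" "f \<in> Arr S" "g \<in> Arr S" "Cod S f = Cod S v" "Cod S g = Dom S v"
  shows "Inv S v \<cdot> f = g \<longleftrightarrow> f = v \<cdot> g"
  using Inv_cmp[OF assms(1)] assms by metis

abbreviation "x \<equiv> Ident S X"
abbreviation "\<alpha> \<equiv> Assoc S X X X"
abbreviation "\<tau> \<equiv> Sym S X X"

lemmas assoc_arrs = Inv_arr[OF Assoc_iso[OF X_in X_in X_in]]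

lemma c_vals:
  "c (Suc 0) (Suc 0) = Ident S (X \<odot> X)" "c (Suc (Suc 0)) (Suc 0) = Ident S ((X \<odot> X) \<odot> X)"
  "c (Suc 0) (Suc (Suc 0)) = Inv S \<alpha>"
  "c 0 (Suc 0) = LUnit S X" "c (Suc 0) 0 = RUnit S X" "c 0 0 = LUnit S (Unit S)"
  using assoc_arrs by (simp_all add: arrs X_in TArr_Ident LUnit_Unit)

text \<open>In these small arities \<open>tcan\<close> is an identity, an inverse associator or a
  unitor, so conjugation by it inserts the structure isomorphisms that the bimonoid axioms in
  \<open>S\<close> display.\<close>

lemma etens_vals:
  shows "\<mu> \<in> Hom S (X \<odot> X) X \<Longrightarrow> etens (Suc (Suc 0)) (Suc 0) (Suc 0) (Suc 0) \<mu> x = \<mu> \<star> x"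
    "\<mu> \<in> Hom S (X \<odot> X) X \<Longrightarrow> etens (Suc 0) (Suc 0) (Suc (Suc 0)) (Suc 0) x \<mu> = (x \<star> \<mu>) \<cdot> \<alpha>"
    "\<eta> \<in> Hom S (Unit S) X \<Longrightarrow> etens 0 (Suc 0) (Suc 0) (Suc 0) \<eta> x = (\<eta> \<star> x) \<cdot> Inv S (LUnit S X)"
    "\<eta> \<in> Hom S (Unit S) X \<Longrightarrow> etens (Suc 0) (Suc 0) 0 (Suc 0) x \<eta> = (x \<star> \<eta>) \<cdot> Inv S (RUnit S X)"
    "\<Delta> \<in> Hom S X (X \<odot> X) \<Longrightarrow> etens (Suc 0) (Suc (Suc 0)) (Suc 0) (Suc 0) \<Delta> x = \<Delta> \<star> x"
    "\<Delta> \<in> Hom S X (X \<odot> X) \<Longrightarrow> etens (Suc 0) (Suc 0) (Suc 0) (Suc (Suc 0)) x \<Delta> = Inv S \<alpha> \<cdot> (x \<star> \<Delta>)"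
    "\<epsilon> \<in> Hom S X (Unit S) \<Longrightarrow> etens (Suc 0) 0 (Suc 0) (Suc 0) \<epsilon> x = LUnit S X \<cdot> (\<epsilon> \<star> x)"
    "\<epsilon> \<in> Hom S X (Unit S) \<Longrightarrow> etens (Suc 0) (Suc 0) (Suc 0) 0 x \<epsilon> = RUnit S X \<cdot> (x \<star> \<epsilon>)"
    "\<epsilon> \<in> Hom S X (Unit S) \<Longrightarrow> etens (Suc 0) 0 (Suc 0) 0 \<epsilon> \<epsilon> = LUnit S (Unit S) \<cdot> (\<epsilon> \<star> \<epsilon>)"
    "\<eta> \<in> Hom S (Unit S) X \<Longrightarrow> etens 0 (Suc 0) 0 (Suc 0) \<eta> \<eta> = (\<eta> \<star> \<eta>) \<cdot> Inv S (LUnit S (Unit S))"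
    "h \<in> Hom S X X \<Longrightarrow> etens (Suc 0) (Suc 0) (Suc 0) (Suc 0) h h = h \<star> h"
    "etens (Suc (Suc 0)) (Suc (Suc 0)) (Suc 0) (Suc 0) \<tau> x = \<tau> \<star> x"
    "esym (Suc 0) (Suc 0) = \<tau>"
  using assoc_arrs Inv_Inv[OF Assoc_iso[OF X_in X_in X_in]] Inv_arr[OF LUnit_iso[OF X_in]] Inv_arr[OF RUnit_iso[OF X_in]]
    Inv_arr[OF LUnit_iso[OF Unit_in]]
  by (simp_all add: etens_def esym_def c_vals Inv_Ident HomS arrs X_in TArr_Ident del: tcan.simps)

lemma middle_swap_in: "middle_swap S X \<in> Hom S ((X \<odot> X) \<odot> (X \<odot> X)) ((X \<odot> X) \<odot> (X \<odot> X))"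
  using assoc_arrs Inv_arr[OF Assoc_iso[OF X_in X_in TObj_in[OF X_in X_in]]] by (simp add: middle_swap_def HomS arrs X_in)

text \<open>By \<open>tcan_assoc\<close>, \<open>tcan\<close> in arities 2 and 2 factors through
  \<open>X \<odot> ((X \<odot> X) \<odot> X)\<close>, where the two middle factors are adjacent. The
  factors of \<open>tcan\<close> before that point are the rebracketings in
  \<open>middle_swap\<close>.\<close>

lemma middle_swap_char:
  "etens (Suc 0) (Suc 0) (Suc (Suc (Suc 0))) (Suc (Suc (Suc 0))) x (\<tau> \<star> x) \<cdot> c (Suc (Suc 0)) (Suc (Suc 0))
    = c (Suc (Suc 0)) (Suc (Suc 0)) \<cdot> middle_swap S X" (is "?M \<cdot> ?c = _")
proof -
  let ?A = "Assoc S X X (X \<odot> X)" and ?d = "c (Suc 0) (Suc (Suc (Suc 0)))"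
  note A = Inv_arr[OF Assoc_iso[OF X_in X_in TObj_in[OF X_in X_in]]]
  have d: "?d \<in> Arr S" "Dom S ?d = X \<odot> ((X \<odot> X) \<odot> X)"
    using c_arr[of "Suc 0" "Suc (Suc (Suc 0))"] by (simp_all del: tcan.simps c_arr)
  have t: "x \<in> Hom S (P (Suc 0)) (P (Suc 0))" "\<tau> \<star> x \<in> Hom S (P (Suc (Suc (Suc 0)))) (P (Suc (Suc (Suc 0))))"
    by (simp_all add: HomS arrs X_in)
  have M: "?M \<in> Arr S" "Dom S ?M = Cod S ?d"
    using etens_in[OF t] by (simp_all add: HomS del: tcan.simps)
  note b = arrs X_in A(1-6) assoc_arrs(1-6) d M
  have c: "?c = ?d \<cdot> ((x \<star> Inv S \<alpha>) \<cdot> ?A)"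
    using tcan_assoc[of "Suc 0" "Suc 0" "Suc (Suc 0)"] c_arr[of "Suc (Suc 0)" "Suc (Suc 0)"]
    by (simp add: c_vals arrs X_in TArr_Ident del: tcan.simps c_arr)
  have "?M \<cdot> ?c = (?M \<cdot> ?d) \<cdot> ((x \<star> Inv S \<alpha>) \<cdot> ?A)"
    unfolding c using b by (simp add: cmp_assoc del: tcan.simps)
  also have "?M \<cdot> ?d = ?d \<cdot> (x \<star> (\<tau> \<star> x))" by (rule etens_char[OF t])
  also have "(?d \<cdot> (x \<star> (\<tau> \<star> x))) \<cdot> ((x \<star> Inv S \<alpha>) \<cdot> ?A) = ?d \<cdot> ((x \<star> ((\<tau> \<star> x) \<cdot> Inv S \<alpha>)) \<cdot> ?A)"
  proof -
    have e: "x \<star> ((\<tau> \<star> x) \<cdot> Inv S \<alpha>) = (x \<star> (\<tau> \<star> x)) \<cdot> (x \<star> Inv S \<alpha>)" using b by (simp add: ten_cmp)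
    show ?thesis unfolding e using b by (simp add: cmp_assoc del: tcan.simps)
  qed
  also have "x \<star> ((\<tau> \<star> x) \<cdot> Inv S \<alpha>) = (x \<star> Inv S \<alpha>) \<cdot> (x \<star> (\<alpha> \<cdot> (\<tau> \<star> x) \<cdot> Inv S \<alpha>))"
    using b Inv_cmp(1)[OF Assoc_iso[OF X_in X_in X_in]] by (simp add: ten_cmp)
  also have "?d \<cdot> (((x \<star> Inv S \<alpha>) \<cdot> (x \<star> (\<alpha> \<cdot> (\<tau> \<star> x) \<cdot> Inv S \<alpha>))) \<cdot> ?A)
      = ?d \<cdot> ((x \<star> Inv S \<alpha>) \<cdot> ((x \<star> (\<alpha> \<cdot> (\<tau> \<star> x) \<cdot> Inv S \<alpha>)) \<cdot> ?A))"
    using b by (simp add: cmp_assoc del: tcan.simps)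
  also have "(x \<star> (\<alpha> \<cdot> (\<tau> \<star> x) \<cdot> Inv S \<alpha>)) \<cdot> ?A = ?A \<cdot> middle_swap S X"
    unfolding middle_swap_def
    by (rule Inv_cmp(2)[OF Assoc_iso[OF X_in X_in TObj_in[OF X_in X_in]], symmetric]) (use b in simp_all)
  also have "?d \<cdot> ((x \<star> Inv S \<alpha>) \<cdot> (?A \<cdot> middle_swap S X)) = ?c \<cdot> middle_swap S X"
    unfolding c using b middle_swap_in by (simp add: HomS cmp_assoc del: tcan.simps)
  finally show ?thesis .
qed


text \<open>Law by law, conjugation by \<open>tcan\<close> accounts for the associators and unitors.
  One direction turns algebras into bimonoids, the other one makes evaluation available for a given
  bimonoid with action.\<close>

lemma gbimonoid_endo_iff:
  assumes G: "group G"
    and B_def: "B = \<lparr>Car = X, Mul = \<mu>, Uni = \<eta>, Com = \<Delta>, Cou = \<epsilon>\<rparr>"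
  shows "gbimonoid_in_prop endo G (Suc (Suc 0), Suc 0, \<mu>) (0, Suc 0, \<eta>) (Suc 0, Suc (Suc 0), \<Delta>) (Suc 0, 0, \<epsilon>)
      (\<lambda>g. (Suc 0, Suc 0, h g)) \<longleftrightarrow>
    bimonoid S B \<and> (\<forall>g \<in> carrier G. bimonoid_hom S B B (h g)) \<and> h \<one>\<^bsub>G\<^esub> = x \<and>
    (\<forall>g \<in> carrier G. \<forall>k \<in> carrier G. h (g \<otimes>\<^bsub>G\<^esub> k) = h g \<cdot> h k)"
proof (cases "\<mu> \<in> Hom S (X \<odot> X) X \<and> \<eta> \<in> Hom S (Unit S) X \<and> \<Delta> \<in> Hom S X (X \<odot> X) \<and> \<epsilon> \<in> Hom S X (Unit S) \<and>
    (\<forall>g \<in> carrier G. h g \<in> Hom S X X)")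
  \<comment> \<open>If a structure map has the wrong source or target, then both sides fail.\<close>
  case False
  then show ?thesis
    by (auto simp: gbimonoid_in_prop_def gbimonoid_in_prop_axioms_def bimonoid_def bimonoid_hom_def Let_def B_def Hom_endo)
next
  case True
  then have m: "\<mu> \<in> Hom S (X \<odot> X) X" and e: "\<eta> \<in> Hom S (Unit S) X" and d: "\<Delta> \<in> Hom S X (X \<odot> X)"
    and p: "\<epsilon> \<in> Hom S X (Unit S)" and h: "\<And>g. g \<in> carrier G \<Longrightarrow> h g \<in> Hom S X X" by auto
  note v = etens_vals(1,2)[OF m] etens_vals(3,4)[OF e] etens_vals(5,6)[OF d] etens_vals(7,8,9)[OF p] etens_vals(10)[OF e]
    etens_vals(11)[OF h] etens_vals(12,13)
  let ?c = "c (Suc (Suc 0)) (Suc (Suc 0))"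
  note isos = LUnit_iso[OF X_in] RUnit_iso[OF X_in] LUnit_iso[OF Unit_in] Assoc_iso[OF X_in X_in X_in]
  note b = arrs X_in assoc_arrs(1-6) Inv_arr(1-6)[OF isos(1)] Inv_arr(1-6)[OF isos(2)] Inv_arr(1-6)[OF isos(3)]
    m[unfolded HomS] e[unfolded HomS] d[unfolded HomS] p[unfolded HomS]
  have 2: "\<mu> \<cdot> ((\<eta> \<star> x) \<cdot> Inv S (LUnit S X)) = x \<longleftrightarrow> \<mu> \<cdot> (\<eta> \<star> x) = LUnit S X"
  proof -
    have "\<mu> \<cdot> ((\<eta> \<star> x) \<cdot> Inv S (LUnit S X)) = (\<mu> \<cdot> (\<eta> \<star> x)) \<cdot> Inv S (LUnit S X)" using b by (simp add: cmp_assoc)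
    moreover have "\<dots> = x \<longleftrightarrow> \<mu> \<cdot> (\<eta> \<star> x) = x \<cdot> LUnit S X" by (rule Inv_move[OF isos(1)]) (use b in simp_all)
    moreover have "x \<cdot> LUnit S X = LUnit S X" using b by simp
    ultimately show ?thesis by simp
  qed
  have 3: "\<mu> \<cdot> ((x \<star> \<eta>) \<cdot> Inv S (RUnit S X)) = x \<longleftrightarrow> \<mu> \<cdot> (x \<star> \<eta>) = RUnit S X"
  proof -
    have "\<mu> \<cdot> ((x \<star> \<eta>) \<cdot> Inv S (RUnit S X)) = (\<mu> \<cdot> (x \<star> \<eta>)) \<cdot> Inv S (RUnit S X)" using b by (simp add: cmp_assoc)
    moreover have "\<dots> = x \<longleftrightarrow> \<mu> \<cdot> (x \<star> \<eta>) = x \<cdot> RUnit S X" by (rule Inv_move[OF isos(2)]) (use b in simp_all)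
    moreover have "x \<cdot> RUnit S X = RUnit S X" using b by simp
    ultimately show ?thesis by simp
  qed
  have 4: "(\<Delta> \<star> x) \<cdot> \<Delta> = (Inv S \<alpha> \<cdot> (x \<star> \<Delta>)) \<cdot> \<Delta> \<longleftrightarrow> \<alpha> \<cdot> (\<Delta> \<star> x) \<cdot> \<Delta> = (x \<star> \<Delta>) \<cdot> \<Delta>"
  proof -
    have e: "(Inv S \<alpha> \<cdot> (x \<star> \<Delta>)) \<cdot> \<Delta> = Inv S \<alpha> \<cdot> ((x \<star> \<Delta>) \<cdot> \<Delta>)" using b by (simp add: cmp_assoc)
    have i: "Inv S \<alpha> \<cdot> ((x \<star> \<Delta>) \<cdot> \<Delta>) = (\<Delta> \<star> x) \<cdot> \<Delta> \<longleftrightarrow> (x \<star> \<Delta>) \<cdot> \<Delta> = \<alpha> \<cdot> ((\<Delta> \<star> x) \<cdot> \<Delta>)"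
      by (rule Inv_move_left[OF isos(4)]) (use b in simp_all)
    show ?thesis unfolding e by (rule iffI) (rule i[THEN iffD1, symmetric, OF sym], assumption, rule i[THEN iffD2, symmetric, OF sym], assumption)
  qed
  have 5: "(LUnit S X \<cdot> (\<epsilon> \<star> x)) \<cdot> \<Delta> = LUnit S X \<cdot> (\<epsilon> \<star> x) \<cdot> \<Delta>" "(RUnit S X \<cdot> (x \<star> \<epsilon>)) \<cdot> \<Delta> = RUnit S X \<cdot> (x \<star> \<epsilon>) \<cdot> \<Delta>"
    using b by (simp_all add: cmp_assoc)
  let ?M = "etens (Suc 0) (Suc 0) (Suc (Suc (Suc 0))) (Suc (Suc (Suc 0))) x (\<tau> \<star> x)"
  \<comment> \<open>The copies of \<open>tcan\<close> that come with the two comultiplications and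
    with the two multiplications are inverse to each other and cancel around the swap by
    \<open>middle_swap_char\<close>.\<close>
  have 6: "etens (Suc (Suc 0)) (Suc 0) (Suc (Suc 0)) (Suc 0) \<mu> \<mu> \<cdot> ?M \<cdot> etens (Suc 0) (Suc (Suc 0)) (Suc 0) (Suc (Suc 0)) \<Delta> \<Delta>
    = (\<mu> \<star> \<mu>) \<cdot> middle_swap S X \<cdot> (\<Delta> \<star> \<Delta>)"
  proof -
    note C = Inv_arr[OF c_iso[of "Suc (Suc 0)" "Suc (Suc 0)"]] c_arr[of "Suc (Suc 0)" "Suc (Suc 0)"]
    have M: "?M \<in> Arr S" "Dom S ?M = P (Suc (Suc (Suc (Suc 0))))" "Cod S ?M = P (Suc (Suc (Suc (Suc 0))))"
      using etens_in[of x "Suc 0" "Suc 0" "\<tau> \<star> x" "Suc (Suc (Suc 0))" "Suc (Suc (Suc 0))"]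
      by (simp_all add: HomS arrs X_in del: tcan.simps)
    note b' = b C M middle_swap_in[unfolded HomS]
    have mm: "etens (Suc (Suc 0)) (Suc 0) (Suc (Suc 0)) (Suc 0) \<mu> \<mu> = (\<mu> \<star> \<mu>) \<cdot> Inv S ?c"
      using b' by (simp add: etens_def c_vals del: tcan.simps)
    have dd: "etens (Suc 0) (Suc (Suc 0)) (Suc 0) (Suc (Suc 0)) \<Delta> \<Delta> = ?c \<cdot> (\<Delta> \<star> \<Delta>)"
      using b' by (simp add: etens_def c_vals Inv_Ident del: tcan.simps)
    have "((\<mu> \<star> \<mu>) \<cdot> Inv S ?c) \<cdot> (?M \<cdot> (?c \<cdot> (\<Delta> \<star> \<Delta>))) = (\<mu> \<star> \<mu>) \<cdot> (Inv S ?c \<cdot> ((?M \<cdot> ?c) \<cdot> (\<Delta> \<star> \<Delta>)))"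
      using b' by (simp add: cmp_assoc del: tcan.simps)
    also have "?M \<cdot> ?c = ?c \<cdot> middle_swap S X" by (rule middle_swap_char)
    also have "(?c \<cdot> middle_swap S X) \<cdot> (\<Delta> \<star> \<Delta>) = ?c \<cdot> (middle_swap S X \<cdot> (\<Delta> \<star> \<Delta>))"
      using b' by (simp add: cmp_assoc del: tcan.simps)
    also have "Inv S ?c \<cdot> \<dots> = middle_swap S X \<cdot> (\<Delta> \<star> \<Delta>)"
      by (rule Inv_cmp(1)[OF c_iso]) (use b' in \<open>simp_all del: tcan.simps\<close>)
    finally show ?thesis unfolding mm dd .
  qed
  have act: "\<And>g. g \<in> carrier G \<Longrightarrow> h g \<in> Arr S" "\<And>g. g \<in> carrier G \<Longrightarrow> Dom S (h g) = X"
    "\<And>g. g \<in> carrier G \<Longrightarrow> Cod S (h g) = X"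
    using h by (auto simp: HomS)
  have "gbimonoid_in_prop endo G (Suc (Suc 0), Suc 0, \<mu>) (0, Suc 0, \<eta>) (Suc 0, Suc (Suc 0), \<Delta>) (Suc 0, 0, \<epsilon>)
      (\<lambda>g. (Suc 0, Suc 0, h g)) \<longleftrightarrow>
     \<mu> \<cdot> (\<mu> \<star> x) = \<mu> \<cdot> (x \<star> \<mu>) \<cdot> \<alpha> \<and> \<mu> \<cdot> (\<eta> \<star> x) = LUnit S X \<and> \<mu> \<cdot> (x \<star> \<eta>) = RUnit S X \<and>
     \<alpha> \<cdot> (\<Delta> \<star> x) \<cdot> \<Delta> = (x \<star> \<Delta>) \<cdot> \<Delta> \<and> LUnit S X \<cdot> (\<epsilon> \<star> x) \<cdot> \<Delta> = x \<and> RUnit S X \<cdot> (x \<star> \<epsilon>) \<cdot> \<Delta> = x \<and>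
     \<Delta> \<cdot> \<mu> = (\<mu> \<star> \<mu>) \<cdot> middle_swap S X \<cdot> (\<Delta> \<star> \<Delta>) \<and> \<epsilon> \<cdot> \<mu> = LUnit S (Unit S) \<cdot> (\<epsilon> \<star> \<epsilon>) \<and>
     \<Delta> \<cdot> \<eta> = (\<eta> \<star> \<eta>) \<cdot> Inv S (LUnit S (Unit S)) \<and> \<epsilon> \<cdot> \<eta> = Ident S (Unit S) \<and>
     (\<forall>g \<in> carrier G. h g \<cdot> \<mu> = \<mu> \<cdot> (h g \<star> h g)) \<and> (\<forall>g \<in> carrier G. h g \<cdot> \<eta> = \<eta>) \<and>
     (\<forall>g \<in> carrier G. (h g \<star> h g) \<cdot> \<Delta> = \<Delta> \<cdot> h g) \<and> (\<forall>g \<in> carrier G. \<epsilon> \<cdot> h g = \<epsilon>) \<and> h \<one>\<^bsub>G\<^esub> = x \<and>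
     (\<forall>g \<in> carrier G. \<forall>k \<in> carrier G. h (g \<otimes>\<^bsub>G\<^esub> k) = h g \<cdot> h k)"
    unfolding gbimonoid_in_prop_def gbimonoid_in_prop_axioms_def
    using prop_category_endo G m e d p h
    by (simp add: Hom_endo v 2 3 4 5 6 Ball_def del: tcan.simps cong: imp_cong)
  then show ?thesis
    using m e d p h X_in by (auto simp: bimonoid_def bimonoid_hom_def Let_def B_def)
qed

end

section \<open>Categories of functors\<close>

lemma Hom_iff: "f \<in> Hom C x y \<longleftrightarrow> f \<in> Arr C \<and> Dom C f = x \<and> Cod C f = y"
  by (simp add: Hom_def)

lemma is_functorD:
  assumes "is_functor C D F"
  shows "category C" "category D" "x \<in> Obj C \<Longrightarrow> FObj F x \<in> Obj D"
    "FObj F \<in> extensional (Obj C)" "FArr F \<in> extensional (Arr C)"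
    "f \<in> Hom C x y \<Longrightarrow> FArr F f \<in> Hom D (FObj F x) (FObj F y)"
    "x \<in> Obj C \<Longrightarrow> FArr F (Ident C x) = Ident D (FObj F x)"
    "\<lbrakk>f \<in> Hom C x y; g \<in> Hom C y z\<rbrakk> \<Longrightarrow> FArr F (g \<cdot>\<^bsub>C\<^esub> f) = FArr F g \<cdot>\<^bsub>D\<^esub> FArr F f"
  using assms unfolding is_functor_def by (auto simp: PiE_def)

lemma nat_transD:
  assumes "nat_trans C D F K \<theta>"
  shows "is_functor C D F" "is_functor C D K" "\<theta> \<in> extensional (Obj C)"
    "x \<in> Obj C \<Longrightarrow> \<theta> x \<in> Hom D (FObj F x) (FObj K x)"
    "f \<in> Hom C x y \<Longrightarrow> \<theta> y \<cdot>\<^bsub>D\<^esub> FArr F f = FArr K f \<cdot>\<^bsub>D\<^esub> \<theta> x"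
  using assms unfolding nat_trans_def by blast+

lemma nat_trans_ident:
  assumes F: "is_functor C D F"
  shows "nat_trans C D F F (\<lambda>x \<in> Obj C. Ident D (FObj F x))"
proof -
  interpret C: category C + D: category D using F by (simp_all add: is_functorD)
  show ?thesis unfolding nat_trans_def
  proof (intro conjI allI ballI F)
    fix x y f assume f: "f \<in> Hom C x y"
    then have o: "x \<in> Obj C" "y \<in> Obj C" using C.Dom_in C.Cod_in by (auto simp: Hom_def)
    then show "(\<lambda>x \<in> Obj C. Ident D (FObj F x)) y \<cdot>\<^bsub>D\<^esub> FArr F f = FArr F f \<cdot>\<^bsub>D\<^esub> (\<lambda>x \<in> Obj C. Ident D (FObj F x)) x"
      using D.Ident_left[OF is_functorD(6)[OF F f]] D.Ident_right[OF is_functorD(6)[OF F f]] by simp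
  qed (use D.Ident_in is_functorD(3)[OF F] in auto)
qed

lemma nat_trans_cmp:
  assumes t: "nat_trans C D F K \<theta>" and t': "nat_trans C D K L \<theta>'"
  shows "nat_trans C D F L (\<lambda>x \<in> Obj C. \<theta>' x \<cdot>\<^bsub>D\<^esub> \<theta> x)"
proof -
  interpret C: category C + D: category D using nat_transD(1)[OF t] by (simp_all add: is_functorD)
  show ?thesis unfolding nat_trans_def
  proof (intro conjI allI ballI nat_transD(1)[OF t] nat_transD(2)[OF t'])
    fix x y f assume f: "f \<in> Hom C x y"
    then have o: "x \<in> Obj C" "y \<in> Obj C" using C.Dom_in C.Cod_in by (auto simp: Hom_def)
    note h = nat_transD(4)[OF t o(1)] nat_transD(4)[OF t o(2)] nat_transD(4)[OF t' o(1)] nat_transD(4)[OF t' o(2)]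
      is_functorD(6)[OF nat_transD(1)[OF t] f] is_functorD(6)[OF nat_transD(2)[OF t] f] is_functorD(6)[OF nat_transD(2)[OF t'] f]
    have "(\<theta>' y \<cdot>\<^bsub>D\<^esub> \<theta> y) \<cdot>\<^bsub>D\<^esub> FArr F f = \<theta>' y \<cdot>\<^bsub>D\<^esub> (\<theta> y \<cdot>\<^bsub>D\<^esub> FArr F f)" by (rule D.Cmp_assoc) (rule h)+
    also have "\<dots> = (\<theta>' y \<cdot>\<^bsub>D\<^esub> FArr K f) \<cdot>\<^bsub>D\<^esub> \<theta> x"
      unfolding nat_transD(5)[OF t f] by (rule D.Cmp_assoc[symmetric]) (rule h)+
    also have "\<dots> = FArr L f \<cdot>\<^bsub>D\<^esub> (\<theta>' x \<cdot>\<^bsub>D\<^esub> \<theta> x)"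
      unfolding nat_transD(5)[OF t' f] by (rule D.Cmp_assoc) (rule h)+
    finally show "(\<lambda>x \<in> Obj C. \<theta>' x \<cdot>\<^bsub>D\<^esub> \<theta> x) y \<cdot>\<^bsub>D\<^esub> FArr F f = FArr L f \<cdot>\<^bsub>D\<^esub> (\<lambda>x \<in> Obj C. \<theta>' x \<cdot>\<^bsub>D\<^esub> \<theta> x) x"
      using o by simp
  qed (auto intro: D.Cmp_in[OF nat_transD(4)[OF t] nat_transD(4)[OF t']])
qed

text \<open>Stated for every class of functors and transformations closed under the operations, to cover
  monoidal transformations as well.\<close>

lemma category_functors:
  assumes D: "category D"
    and Ob: "\<And>F. F \<in> Ob \<Longrightarrow> is_functor C D F"
    and Ar: "\<And>F K \<theta>. (F, K, \<theta>) \<in> Ar \<Longrightarrow> F \<in> Ob \<and> K \<in> Ob \<and> nat_trans C D F K \<theta>"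
    and Id: "\<And>F. F \<in> Ob \<Longrightarrow> (F, F, \<lambda>x \<in> Obj C. Ident D (FObj F x)) \<in> Ar"
    and Cm: "\<And>F K L \<theta> \<theta>'. \<lbrakk>(F, K, \<theta>) \<in> Ar; (K, L, \<theta>') \<in> Ar\<rbrakk> \<Longrightarrow> (F, L, \<lambda>x \<in> Obj C. \<theta>' x \<cdot>\<^bsub>D\<^esub> \<theta> x) \<in> Ar"
  shows "category ((functor_category C D)\<lparr>Obj := Ob, Arr := Ar\<rparr>)"
proof -
  interpret D: category D by fact
  define E where "E = (functor_category C D)\<lparr>Obj := Ob, Arr := Ar\<rparr>"
  have s: "Obj E = Ob" "Arr E = Ar" "\<And>F. Ident E F = (F, F, \<lambda>x \<in> Obj C. Ident D (FObj F x))"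
    "\<And>F K \<theta>. Dom E (F, K, \<theta>) = F" "\<And>F K \<theta>. Cod E (F, K, \<theta>) = K"
    "\<And>F K L M \<theta> \<theta>'. Cmp E (K, L, \<theta>') (F, M, \<theta>) = (F, L, \<lambda>x \<in> Obj C. \<theta>' x \<cdot>\<^bsub>D\<^esub> \<theta> x)"
    by (simp_all add: E_def functor_category_def)
  have H: "f \<in> Hom E F K \<longleftrightarrow> (\<exists>\<theta>. f = (F, K, \<theta>) \<and> (F, K, \<theta>) \<in> Ar)" for f F K
    by (cases f) (auto simp: Hom_iff s)
  show ?thesis unfolding E_def[symmetric]
  proof
    show "Dom E f \<in> Obj E" "Cod E f \<in> Obj E" if "f \<in> Arr E" for f
      using that Ar by (cases f; auto simp: s)+
    show "Ident E F \<in> Hom E F F" if "F \<in> Obj E" for F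
      using that Id by (auto simp: s H)
    show "Cmp E g f \<in> Hom E F L" if "f \<in> Hom E F K" "g \<in> Hom E K L" for f g F K L
      using that Cm by (auto simp: s H)
    show "Cmp E (Ident E K) f = f" "Cmp E f (Ident E F) = f" if f: "f \<in> Hom E F K" for f F K
    proof -
      obtain \<theta> where t: "f = (F, K, \<theta>)" "(F, K, \<theta>) \<in> Ar" using f H by auto
      note n = conjunct2[OF conjunct2[OF Ar[OF t(2)]]]
      have "(\<lambda>x \<in> Obj C. Ident D (FObj K x) \<cdot>\<^bsub>D\<^esub> \<theta> x) = \<theta>" "(\<lambda>x \<in> Obj C. \<theta> x \<cdot>\<^bsub>D\<^esub> Ident D (FObj F x)) = \<theta>"
        using nat_transD(3)[OF n] D.Ident_left[OF nat_transD(4)[OF n]] D.Ident_right[OF nat_transD(4)[OF n]]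
        by (auto simp: fun_eq_iff extensional_def)
      then show "Cmp E (Ident E K) f = f" "Cmp E f (Ident E F) = f"
        by (simp_all add: s t cong: restrict_cong)
    qed
    show "Cmp E (Cmp E h g) f = Cmp E h (Cmp E g f)" if f: "f \<in> Hom E F K" "g \<in> Hom E K L" "h \<in> Hom E L M" for f g h F K L M
    proof -
      obtain a b c where t: "f = (F, K, a)" "g = (K, L, b)" "h = (L, M, c)" and "(F, K, a) \<in> Ar" "(K, L, b) \<in> Ar" "(L, M, c) \<in> Ar"
        using f H by auto
      then have n: "nat_trans C D F K a" "nat_trans C D K L b" "nat_trans C D L M c" using Ar by blast+
      have "(c x \<cdot>\<^bsub>D\<^esub> b x) \<cdot>\<^bsub>D\<^esub> a x = c x \<cdot>\<^bsub>D\<^esub> (b x \<cdot>\<^bsub>D\<^esub> a x)" if "x \<in> Obj C" for x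
        by (rule D.Cmp_assoc) (rule nat_transD(4)[OF n(1) that] nat_transD(4)[OF n(2) that] nat_transD(4)[OF n(3) that])+
      then show ?thesis by (simp add: s t cong: restrict_cong)
    qed
  qed
qed

lemma category_functor_category:
  assumes D: "category D"
  shows "category (functor_category C D)"
proof -
  have "functor_category C D = (functor_category C D)\<lparr>Obj := {F. is_functor C D F}, Arr := {(F, K, \<theta>). nat_trans C D F K \<theta>}\<rparr>"
    by (simp add: functor_category_def)
  moreover have "category \<dots>"
    by (rule category_functors[OF D]) (auto intro: nat_trans_ident nat_trans_cmp dest: nat_transD(1,2))
  ultimately show ?thesis by simp
qed

lemma category_one_object:
  assumes "group G"
  shows "category (one_object_category G)"
proof -
  interpret group G by fact
  show ?thesis by standard (auto simp: one_object_category_def Hom_def m_assoc)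
qed

lemma nat_iso_id:
  assumes C: "category C" and F: "is_functor C C (id_functor C)"
  shows "nat_iso C C (id_functor C) (id_functor C) (\<lambda>x \<in> Obj C. Ident C (FObj (id_functor C) x))"
  unfolding nat_iso_def
  using nat_trans_ident[OF F] category.iso_Ident[OF C] by (simp add: id_functor_def)

lemma is_functor_id:
  assumes "category C"
  shows "is_functor C C (id_functor C)"
proof -
  interpret category C by fact
  have "Dom C f = x \<Longrightarrow> f \<in> Arr C \<Longrightarrow> x \<in> Obj C" "Cod C f = x \<Longrightarrow> f \<in> Arr C \<Longrightarrow> x \<in> Obj C" for f x
    using Dom_in Cod_in by auto
  then show ?thesis using assms unfolding is_functor_def id_functor_def
    by (auto simp: Hom_iff Ident_arr')
qed

text \<open>Functors are extensional, so the inverse maps on objects and arrows compose to the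
  identity functors on the nose, and identities serve as unit and counit.\<close>

lemma bijective_functor_equivalence:
  assumes F: "is_functor C D F" and bO: "bij_betw (FObj F) (Obj C) (Obj D)" and bA: "bij_betw (FArr F) (Arr C) (Arr D)"
  shows "equivalent_categories C D"
proof -
  interpret C: category C + D: category D using F by (simp_all add: is_functorD)
  let ?O = "inv_into (Obj C) (FObj F)" and ?A = "inv_into (Arr C) (FArr F)"
  let ?K = "\<lparr>FObj = (\<lambda>y \<in> Obj D. ?O y), FArr = (\<lambda>g \<in> Arr D. ?A g)\<rparr>"
  have O: "?O y \<in> Obj C" "FObj F (?O y) = y" if "y \<in> Obj D" for y
    using that bO by (auto simp: bij_betw_def f_inv_into_f inv_into_into)
  have O': "?O (FObj F x) = x" if "x \<in> Obj C" for x using that bO by (simp add: bij_betw_def)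
  have A: "?A g \<in> Arr C" "FArr F (?A g) = g" if "g \<in> Arr D" for g
    using that bA by (auto simp: bij_betw_def f_inv_into_f inv_into_into)
  have A': "?A (FArr F f) = f" if "f \<in> Arr C" for f using that bA by (simp add: bij_betw_def)
  have AH: "?A g \<in> Hom C (?O x) (?O y)" if g: "g \<in> Hom D x y" for g x y
  proof -
    have gA: "g \<in> Arr D" using g by (simp add: Hom_iff)
    have h: "?A g \<in> Hom C (Dom C (?A g)) (Cod C (?A g))" using A(1)[OF gA] by (simp add: Hom_iff)
    have "g \<in> Hom D (FObj F (Dom C (?A g))) (FObj F (Cod C (?A g)))"
      using is_functorD(6)[OF F h] A(2)[OF gA] by simp
    then have "x = FObj F (Dom C (?A g))" "y = FObj F (Cod C (?A g))" using g by (auto simp: Hom_iff)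
    then have "?O x = Dom C (?A g)" "?O y = Cod C (?A g)"
      using O' C.Dom_in[OF A(1)[OF gA]] C.Cod_in[OF A(1)[OF gA]] by auto
    then show ?thesis using h by simp
  qed
  have K: "is_functor D C ?K"
    unfolding is_functor_def
  proof (intro conjI allI ballI C.category_axioms D.category_axioms)
    fix x y f assume f: "f \<in> Hom D x y"
    then have "x \<in> Obj D" "y \<in> Obj D" "f \<in> Arr D" using D.Dom_in D.Cod_in by (auto simp: Hom_iff)
    then show "FArr ?K f \<in> Hom C (FObj ?K x) (FObj ?K y)" using AH[OF f] by simp
  next
    fix x assume x: "x \<in> Obj D"
    have "Ident D x = FArr F (Ident C (?O x))" using is_functorD(7)[OF F O(1)[OF x]] O(2)[OF x] by simp
    then have "?A (Ident D x) = Ident C (?O x)" using A'[OF C.Ident_arr'(1)[OF O(1)[OF x]]] by simp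
    then show "FArr ?K (Ident D x) = Ident C (FObj ?K x)" using x D.Ident_arr'(1)[OF x] by simp
  next
    fix x y z f g assume f: "f \<in> Hom D x y" and g: "g \<in> Hom D y z"
    have fg: "f \<in> Arr D" "g \<in> Arr D" "g \<cdot>\<^bsub>D\<^esub> f \<in> Arr D" using f g D.Cmp_in[OF f g] by (simp_all add: Hom_iff)
    have "FArr F (?A g \<cdot>\<^bsub>C\<^esub> ?A f) = g \<cdot>\<^bsub>D\<^esub> f"
      using is_functorD(8)[OF F AH[OF f] AH[OF g]] A(2)[OF fg(1)] A(2)[OF fg(2)] by simp
    then have "?A (g \<cdot>\<^bsub>D\<^esub> f) = ?A g \<cdot>\<^bsub>C\<^esub> ?A f"
      using A'[of "?A g \<cdot>\<^bsub>C\<^esub> ?A f"] C.Cmp_in[OF AH[OF f] AH[OF g]] by (simp add: Hom_iff)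
    then show "FArr ?K (g \<cdot>\<^bsub>D\<^esub> f) = FArr ?K g \<cdot>\<^bsub>C\<^esub> FArr ?K f" using fg by simp
  qed (use O(1) in auto)
  have Fo: "FObj F x \<in> Obj D" if "x \<in> Obj C" for x using is_functorD(3)[OF F that] .
  have Fa: "FArr F f \<in> Arr D" if "f \<in> Arr C" for f
    using is_functorD(6)[OF F, of f "Dom C f" "Cod C f"] that by (simp add: Hom_iff)
  have "comp_functor C ?K F = id_functor C" "comp_functor D F ?K = id_functor D"
    by (simp_all add: comp_functor_def id_functor_def O O' A A' Fo Fa cong: restrict_cong)
  then show ?thesis unfolding equivalent_categories_def
    using F K nat_iso_id[OF C.category_axioms is_functor_id] nat_iso_id[OF D.category_axioms is_functor_id]
      C.category_axioms D.category_axioms by metis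
qed

section \<open>The category of bimonoids\<close>

context symmetric_monoidal_category
begin

lemma bimonoid_Car: "bimonoid S B \<Longrightarrow> Car B \<in> Obj S"
  by (simp add: bimonoid_def Let_def)

lemma bimonoid_in:
  assumes "bimonoid S B"
  shows "Mul B \<in> Hom S (Car B \<odot> Car B) (Car B)" "Uni B \<in> Hom S (Unit S) (Car B)"
    "Com B \<in> Hom S (Car B) (Car B \<odot> Car B)" "Cou B \<in> Hom S (Car B) (Unit S)"
  using assms by (simp_all add: bimonoid_def Let_def)

lemma bimonoid_hom_Ident:
  assumes B: "bimonoid S B"
  shows "bimonoid_hom S B B (Ident S (Car B))"
  using bimonoid_Car[OF B] bimonoid_in[OF B] unfolding bimonoid_hom_def
  by (simp add: Hom_iff TArr_Ident Ident_arr')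

lemma bimonoid_hom_cmp:
  assumes A: "bimonoid S A" and B: "bimonoid S B" and C: "bimonoid S C" and f: "bimonoid_hom S A B f" and g: "bimonoid_hom S B C g"
  shows "bimonoid_hom S A C (g \<cdot> f)"
proof -
  note b = bimonoid_in[OF A, unfolded Hom_iff] bimonoid_in[OF B, unfolded Hom_iff] bimonoid_in[OF C, unfolded Hom_iff]
  note f' = f[unfolded bimonoid_hom_def Hom_iff] and g' = g[unfolded bimonoid_hom_def Hom_iff]
  have t: "(g \<cdot> f) \<star> (g \<cdot> f) = (g \<star> g) \<cdot> (f \<star> f)" using f' g' by (simp add: ten_cmp)
  have "(g \<cdot> f) \<cdot> Mul A = g \<cdot> (f \<cdot> Mul A)" using f' g' b by (simp add: cmp_assoc)
  also have "f \<cdot> Mul A = Mul B \<cdot> (f \<star> f)" using f' by simp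
  also have "g \<cdot> (Mul B \<cdot> (f \<star> f)) = (g \<cdot> Mul B) \<cdot> (f \<star> f)" by (rule cmp_assoc[symmetric]) (use f' g' b in \<open>simp_all add: ten_arr'\<close>)
  also have "g \<cdot> Mul B = Mul C \<cdot> (g \<star> g)" using g' by simp
  also have "(Mul C \<cdot> (g \<star> g)) \<cdot> (f \<star> f) = Mul C \<cdot> ((g \<cdot> f) \<star> (g \<cdot> f))" unfolding t by (rule cmp_assoc) (use f' g' b in \<open>simp_all add: ten_arr'\<close>)
  finally have 1: "(g \<cdot> f) \<cdot> Mul A = Mul C \<cdot> ((g \<cdot> f) \<star> (g \<cdot> f))" .
  have 2: "(g \<cdot> f) \<cdot> Uni A = Uni C" using f' g' b by (simp add: cmp_assoc)
  have "((g \<cdot> f) \<star> (g \<cdot> f)) \<cdot> Com A = (g \<star> g) \<cdot> ((f \<star> f) \<cdot> Com A)" unfolding t using f' g' b by (simp add: cmp_assoc ten_arr')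
  also have "(f \<star> f) \<cdot> Com A = Com B \<cdot> f" using f' by simp
  also have "(g \<star> g) \<cdot> (Com B \<cdot> f) = ((g \<star> g) \<cdot> Com B) \<cdot> f" by (rule cmp_assoc[symmetric]) (use f' g' b in \<open>simp_all add: ten_arr'\<close>)
  also have "(g \<star> g) \<cdot> Com B = Com C \<cdot> g" using g' by simp
  also have "(Com C \<cdot> g) \<cdot> f = Com C \<cdot> (g \<cdot> f)" by (rule cmp_assoc) (use f' g' b in simp_all)
  finally have 3: "((g \<cdot> f) \<star> (g \<cdot> f)) \<cdot> Com A = Com C \<cdot> (g \<cdot> f)" .
  have 4: "Cou C \<cdot> (g \<cdot> f) = (Cou C \<cdot> g) \<cdot> f" by (rule cmp_assoc[symmetric]) (use f' g' b in simp_all)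
  show ?thesis unfolding bimonoid_hom_def using 1 2 3 4 f' g' by (simp add: Hom_iff)
qed

lemma Bimon_sel [simp]:
  "Obj (Bimon S) = {B. bimonoid S B}" "Arr (Bimon S) = {(A, B, f). bimonoid S A \<and> bimonoid S B \<and> bimonoid_hom S A B f}"
  "Dom (Bimon S) (A, B, f) = A" "Cod (Bimon S) (A, B, f) = B" "Ident (Bimon S) B = (B, B, Ident S (Car B))"
  "Cmp (Bimon S) (B, C, g) (A, D, f) = (A, C, g \<cdot> f)"
  by (simp_all add: Bimon_def)

lemma Hom_Bimon: "h \<in> Hom (Bimon S) A B \<longleftrightarrow> (\<exists>f. h = (A, B, f) \<and> bimonoid S A \<and> bimonoid S B \<and> bimonoid_hom S A B f)"
  by (cases h) (auto simp: Hom_iff)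

lemma category_Bimon: "category (Bimon S)"
proof
  show "Cmp (Bimon S) (Cmp (Bimon S) h g) f = Cmp (Bimon S) h (Cmp (Bimon S) g f)"
    if "f \<in> Hom (Bimon S) w x" "g \<in> Hom (Bimon S) x y" "h \<in> Hom (Bimon S) y z" for f g h w x y z
    using that by (auto simp: Hom_Bimon bimonoid_hom_def Cmp_assoc)
qed (auto simp: Hom_Bimon bimonoid_hom_Ident bimonoid_hom_cmp, auto simp: bimonoid_hom_def Ident_left Ident_right)

end

section \<open>The universal property of the composite PROP\<close>

text \<open>Strict symmetric monoidal functors that are the identity on objects, given by their
  action on arrows.\<close>

definition prop_morphism ::
  "(nat, 'a, 'y) sym_mon_cat_scheme \<Rightarrow> (nat, 'b, 'z) sym_mon_cat_scheme \<Rightarrow> ('a \<Rightarrow> 'b) \<Rightarrow> bool" where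
  "prop_morphism T T' \<phi> \<longleftrightarrow>
     (\<forall>f \<in> Arr T. \<phi> f \<in> Hom T' (Dom T f) (Cod T f)) \<and>
     (\<forall>n. \<phi> (Ident T n) = Ident T' n) \<and>
     (\<forall>m n. \<phi> (Sym T m n) = Sym T' m n) \<and>
     (\<forall>f \<in> Arr T. \<forall>g \<in> Arr T. Cod T f = Dom T g \<longrightarrow> \<phi> (g \<cdot>\<^bsub>T\<^esub> f) = \<phi> g \<cdot>\<^bsub>T'\<^esub> \<phi> f) \<and>
     (\<forall>f \<in> Arr T. \<forall>g \<in> Arr T. \<phi> (f \<star>\<^bsub>T\<^esub> g) = \<phi> f \<star>\<^bsub>T'\<^esub> \<phi> g)"

lemma prop_morphismD:
  assumes "prop_morphism T T' \<phi>"
  shows "f \<in> Hom T m n \<Longrightarrow> \<phi> f \<in> Hom T' m n" "\<phi> (Ident T n) = Ident T' n" "\<phi> (Sym T m n) = Sym T' m n"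
    "f \<in> Arr T \<Longrightarrow> g \<in> Arr T \<Longrightarrow> Cod T f = Dom T g \<Longrightarrow> \<phi> (g \<cdot>\<^bsub>T\<^esub> f) = \<phi> g \<cdot>\<^bsub>T'\<^esub> \<phi> f"
    "f \<in> Arr T \<Longrightarrow> g \<in> Arr T \<Longrightarrow> \<phi> (f \<star>\<^bsub>T\<^esub> g) = \<phi> f \<star>\<^bsub>T'\<^esub> \<phi> g"
  using assms unfolding prop_morphism_def by (auto simp: Hom_iff)

text \<open>Apart from arities, the axioms are equations between composites and tensor products of
  the structure maps, symmetries and identities; a PROP morphism preserves these.\<close>

lemma gbimonoid_in_prop_image:
  assumes B: "gbimonoid_in_prop T G \<mu> \<eta> \<Delta> \<epsilon> act" and \<phi>: "prop_morphism T T' \<phi>" and T': "prop_category T'"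
  shows "gbimonoid_in_prop T' G (\<phi> \<mu>) (\<phi> \<eta>) (\<phi> \<Delta>) (\<phi> \<epsilon>) (\<lambda>g. \<phi> (act g))"
proof -
  interpret B: gbimonoid_in_prop T G \<mu> \<eta> \<Delta> \<epsilon> act by fact
  interpret T': prop_category T' by fact
  note p = prop_morphismD[OF \<phi>]
  note q = p(2,3)[symmetric] p(4,5)[symmetric]
  interpret group G by (rule B.grp)
  show ?thesis
  proof
    show "\<phi> (act (g \<otimes>\<^bsub>G\<^esub> h)) = Cmp T' (\<phi> (act g)) (\<phi> (act h))" if "g \<in> carrier G" "h \<in> carrier G" for g h
      using that by (simp add: q B.act_mult)
  qed (simp_all add: p(1) B.gen_in, simp_all add: q B.mu_assoc[unfolded One_nat_def] B.mu_left[unfolded One_nat_def] B.mu_right[unfolded One_nat_def] B.De_assoc[unfolded One_nat_def] B.De_left[unfolded One_nat_def] B.De_right[unfolded One_nat_def] B.De_mu B.ep_mu B.De_eta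
     B.ep_eta B.act_mu B.act_eta B.act_De B.act_ep B.act_one)
qed

context gbimonoid_in_prop
begin

text \<open>Spans with the same class differ by a renaming of strands, under which evaluation is
  invariant.\<close>

lemma ev_gcls_eq:
  assumes s: "gvalid G s" and t: "gvalid G t" and e: "gcls G s = gcls G t"
  shows "ev s = ev t"
proof -
  obtain \<rho> n where r: "lift G \<rho> (\<lambda>_. \<one>\<^bsub>G\<^esub>) n s \<in> gcls G s" by (rule gcls_ex[OF grp])
  obtain \<theta> where \<theta>: "inj_on \<theta> (strands s)" "t = grename \<theta> s"
    by (rule gcls_eqD[OF grp s t r]) (use r e in simp)
  show ?thesis unfolding \<theta>(2) by (rule ev_grename[symmetric, OF s]) (use \<theta>(1) in \<open>simp add: strands_def\<close>)
qed

text \<open>The choice is made among spans with numbers as strands, which fixes the type; by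
  \<open>evc_gcls\<close> spans with strands of any type lead to the same value.\<close>

definition evc :: "'g lspan set \<Rightarrow> 'a" where
  "evc A = ev (SOME s :: (nat, 'g) gspan. gvalid G s \<and> gcls G s = A)"

lemma evc_gcls:
  fixes s :: "('s, 'g) gspan"
  assumes s: "gvalid G s"
  shows "evc (gcls G s) = ev s"
proof -
  \<comment> \<open>A representative with numbers as strands exists in every class, so the choice in
    \<open>evc\<close> is a genuine one.\<close>
  obtain t :: "(nat, 'g) gspan" where "gvalid G t \<and> gcls G t = gcls G s"
    using group.Arr_gclsE[OF grp group.Arr_gcls[OF grp s]] by metis
  then have "gvalid G (SOME t :: (nat, 'g) gspan. gvalid G t \<and> gcls G t = gcls G s) \<and>
      gcls G (SOME t :: (nat, 'g) gspan. gvalid G t \<and> gcls G t = gcls G s) = gcls G s"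
    by (rule someI)
  then show ?thesis unfolding evc_def using ev_gcls_eq[OF _ s] by blast
qed

text \<open>The existence half of the universal property of the composite PROP; the other half is
  \<open>prop_morphism_unique\<close>.\<close>

lemma prop_morphism_evc: "prop_morphism (GFas_composite G) T evc"
proof -
  interpret group G by (rule grp)
  show ?thesis unfolding prop_morphism_def
  proof (intro conjI ballI allI impI)
    fix f assume f: "f \<in> Arr TG"
    obtain s :: "(nat, 'g) gspan" where s: "gvalid G s" "f = gcls G s" by (rule Arr_gclsE[OF f])
    show "evc f \<in> Hom T (Dom TG f) (Cod TG f)"
      unfolding s(2) by (simp add: evc_gcls[OF s(1)] Hom_iff Dom_gcls Cod_gcls s(1))
    fix g assume g: "g \<in> Arr TG"
    obtain t :: "(nat, 'g) gspan" where t: "gvalid G t" "g = gcls G t" by (rule Arr_gclsE[OF g])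
    show "evc (TArr TG f g) = evc f \<star> evc g"
      unfolding s(2) t(2) TArr_gcls[OF s(1) t(1)] evc_gcls[OF s(1)] evc_gcls[OF t(1)] evc_gcls[OF gvalid_gtensor[OF s(1) t(1)]]
      by (rule ev_gtensor[OF s(1) t(1)])
    assume "Cod TG f = Dom TG g"
    then have l: "length (snd s) = length (fst t)" by (simp add: s t Dom_gcls Cod_gcls)
    show "evc (Cmp TG g f) = evc g \<cdot> evc f"
      unfolding s(2) t(2) Cmp_gcls[OF s(1) t(1) l] evc_gcls[OF s(1)] evc_gcls[OF t(1)] evc_gcls[OF gvalid_gcomp[OF grp s(1) t(1) l]]
      by (rule ev_gcomp[OF s(1) t(1) l])
  qed (simp_all add: Ident_gcls Sym_gcls evc_gcls gvalid_gid' gvalid_gsym' ev_gid ev_gsym)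
qed

lemma evc_gens:
  "evc (gcls G (group.smu G)) = \<mu>" "evc (gcls G group.seta) = \<eta>" "evc (gcls G (group.sDe G)) = \<Delta>"
  "evc (gcls G group.sep) = \<epsilon>" "g \<in> carrier G \<Longrightarrow> evc (gcls G (group.sact g)) = act g"
proof -
  interpret group G by (rule grp)
  have m: "mul (Suc 0) = Ident T 1" using mu_right by simp
  have c: "com (Suc 0) = Ident T 1" using De_right by simp
  have m2: "mul (Suc (Suc 0)) = \<mu>" unfolding mul.simps(2)[of "Suc 0"] m by simp
  have c2: "com (Suc (Suc 0)) = \<Delta>" unfolding com.simps(2)[of "Suc 0"] c by simp
  have r: "rearr [0, 1] [0, 1 :: nat]" "rearr [0] [0 :: nat]" by (auto simp: rearr_def)
  note e = gvalid_s(1-4)[THEN evc_gcls]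
  note l = ev_def s_defs word_def act_one perm_refl
  show "evc (gcls G smu) = \<mu>" "evc (gcls G seta) = \<eta>" "evc (gcls G sDe) = \<Delta>" "evc (gcls G sep) = \<epsilon>"
    unfolding e using m2 c2 m c r by (simp_all add: l del: com.simps(2) mul.simps(2))
  show "evc (gcls G (sact g)) = act g" if g: "g \<in> carrier G"
    unfolding evc_gcls[OF gvalid_s(5)[OF g]] using g m c r by (simp add: l del: com.simps(2) mul.simps(2))
qed

end

context group
begin

text \<open>The arrows on which two PROP morphisms agree are closed under composition and tensor
  product, and by \<open>TG_induct\<close> the generators reach every arrow.\<close>

lemma prop_morphism_unique:
  assumes \<phi>: "prop_morphism TG T \<phi>" and \<psi>: "prop_morphism TG T \<psi>"
    and "\<phi> (gcls G smu) = \<psi> (gcls G smu)" "\<phi> (gcls G seta) = \<psi> (gcls G seta)"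
    "\<phi> (gcls G sDe) = \<psi> (gcls G sDe)" "\<phi> (gcls G sep) = \<psi> (gcls G sep)"
    "\<And>g. g \<in> carrier G \<Longrightarrow> \<phi> (gcls G (sact g)) = \<psi> (gcls G (sact g))"
    and f: "f \<in> Arr TG"
  shows "\<phi> f = \<psi> f"
  by (rule TG_induct[OF f]) (use assms prop_morphismD[OF \<phi>] prop_morphismD[OF \<psi>] in auto)

end

section \<open>Algebras and natural transformations\<close>

lemma symmetric_strict_monoidal_functorD:
  assumes "symmetric_strict_monoidal_functor T S F"
  shows "prop_category T" "symmetric_monoidal_category S" "is_functor T S F" "FObj F n = tpow S (FObj F 1) n"
    "\<lbrakk>f \<in> Hom T m m'; g \<in> Hom T n n'\<rbrakk> \<Longrightarrow>
      FArr F (f \<star>\<^bsub>T\<^esub> g) \<cdot>\<^bsub>S\<^esub> tcan S (FObj F 1) m n = tcan S (FObj F 1) m' n' \<cdot>\<^bsub>S\<^esub> (FArr F f \<star>\<^bsub>S\<^esub> FArr F g)"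
    "FArr F (Sym T m n) \<cdot>\<^bsub>S\<^esub> tcan S (FObj F 1) m n = tcan S (FObj F 1) n m \<cdot>\<^bsub>S\<^esub> Sym S (FObj F m) (FObj F n)"
  using assms unfolding symmetric_strict_monoidal_functor_def Let_def by blast+

lemma tensor_powers_functor:
  assumes "symmetric_strict_monoidal_functor T S F"
  shows "tensor_powers S (FObj F 1)"
proof -
  note D = symmetric_strict_monoidal_functorD[OF assms]
  have "Obj T = UNIV" using D(1) by (simp add: prop_category_def prop_category_axioms_def)
  then show ?thesis using is_functorD(3)[OF D(3), of 1] D(2)
    by (simp add: tensor_powers_def tensor_powers_axioms_def)
qed

context tensor_powers
begin

text \<open>The compatibility of an algebra with \<open>tcan\<close> is exactly the characterisation
  of \<open>etens\<close> and \<open>esym\<close>, so it becomes strict preservation of the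
  structure of \<open>endo\<close>.\<close>

lemma prop_morphism_of_functor:
  assumes F: "symmetric_strict_monoidal_functor T S F" and X: "FObj F 1 = X"
  shows "prop_morphism T endo (\<lambda>f. (Dom T f, Cod T f, FArr F f))"
proof -
  note D = symmetric_strict_monoidal_functorD[OF F]
  interpret T: prop_category T by (rule D(1))
  have O: "FObj F n = P n" for n using D(4)[of n] unfolding X .
  have A: "FArr F f \<in> Hom S (P (Dom T f)) (P (Cod T f))" if "f \<in> Arr T" for f
    using is_functorD(6)[OF D(3), of f "Dom T f" "Cod T f"] that by (simp add: O Hom_iff)
  show ?thesis unfolding prop_morphism_def
  proof (intro conjI ballI allI impI)
    fix n show "(Dom T (Ident T n), Cod T (Ident T n), FArr F (Ident T n)) = Ident endo n"
      using is_functorD(7)[OF D(3), of n] by (simp add: T.Obj_PROP O)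
    fix m show "(Dom T (Sym T m n), Cod T (Sym T m n), FArr F (Sym T m n)) = Sym endo m n"
    proof -
      have "FArr F (Sym T m n) = esym m n"
      proof (rule iso_cancel_right[OF c_iso[of m n]])
        show "FArr F (Sym T m n) \<cdot> c m n = esym m n \<cdot> c m n" using D(6)[of m n] X by (simp add: esym_char O)
      qed (use A[of "Sym T m n"] esym_in[unfolded HomS] in \<open>simp_all add: HomS arrs\<close>)
      then show ?thesis by simp
    qed
  next
    fix f assume f: "f \<in> Arr T"
    show "(Dom T f, Cod T f, FArr F f) \<in> Hom endo (Dom T f) (Cod T f)" using A[OF f] by (simp add: Hom_endo)
    fix g assume g: "g \<in> Arr T"
    show "(Dom T (f \<star>\<^bsub>T\<^esub> g), Cod T (f \<star>\<^bsub>T\<^esub> g), FArr F (f \<star>\<^bsub>T\<^esub> g)) =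
      TArr endo (Dom T f, Cod T f, FArr F f) (Dom T g, Cod T g, FArr F g)"
    proof -
      have "etens (Dom T f) (Cod T f) (Dom T g) (Cod T g) (FArr F f) (FArr F g) = FArr F (f \<star>\<^bsub>T\<^esub> g)"
        by (rule etens_eqI[OF A[OF f] A[OF g]])
          (use A[of "f \<star>\<^bsub>T\<^esub> g"] f g D(5)[of f "Dom T f" "Cod T f" g "Dom T g" "Cod T g"] X in \<open>simp_all add: Hom_iff\<close>)
      then show ?thesis using f g by simp
    qed
    assume "Cod T f = Dom T g"
    then show "(Dom T (g \<cdot>\<^bsub>T\<^esub> f), Cod T (g \<cdot>\<^bsub>T\<^esub> f), FArr F (g \<cdot>\<^bsub>T\<^esub> f)) =
      Cmp endo (Dom T g, Cod T g, FArr F g) (Dom T f, Cod T f, FArr F f)"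
      using is_functorD(8)[OF D(3), of f "Dom T f" "Cod T f" g "Cod T g"] f g by (simp add: Hom_iff)
  qed
qed

text \<open>The converse of \<open>prop_morphism_of_functor\<close>: the arities are forgotten, and
  \<open>etens_char\<close> and \<open>esym_char\<close> return the compatibility with
  \<open>tcan\<close>.\<close>

lemma functor_of_prop_morphism:
  assumes T: "prop_category T" and \<phi>: "prop_morphism T endo \<phi>"
  shows "symmetric_strict_monoidal_functor T S \<lparr>FObj = P, FArr = (\<lambda>f \<in> Arr T. snd (snd (\<phi> f)))\<rparr>" (is "symmetric_strict_monoidal_functor T S ?F")
proof -
  interpret T: prop_category T by (rule T)
  note p = prop_morphismD[OF \<phi>]
  have A: "\<phi> f = (Dom T f, Cod T f, FArr ?F f)" "FArr ?F f \<in> Hom S (P (Dom T f)) (P (Cod T f))" if "f \<in> Arr T" for f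
    using p(1)[of f "Dom T f" "Cod T f"] that by (auto simp: Hom_iff[of f] Hom_endo)
  have "is_functor T S ?F"
    unfolding is_functor_def
  proof (intro conjI allI ballI T.category_axioms category_axioms)
    show "FArr ?F f \<in> Hom S (FObj ?F m) (FObj ?F n)" if "f \<in> Hom T m n" for f m n
      using A(2)[of f] that by (simp add: Hom_iff)
    show "FArr ?F (Ident T n) = Ident S (FObj ?F n)" for n
      using p(2)[of n] by simp
    show "FArr ?F (g \<cdot>\<^bsub>T\<^esub> f) = FArr ?F g \<cdot> FArr ?F f" if "f \<in> Hom T l m" "g \<in> Hom T m n" for f g l m n
      using p(4)[of f g] that by (simp add: Hom_iff)
  qed (auto simp: T.Obj_PROP)
  moreover have "FArr ?F (f \<star>\<^bsub>T\<^esub> g) \<cdot> c m n = c m' n' \<cdot> (FArr ?F f \<star> FArr ?F g)"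
    if f: "f \<in> Hom T m m'" and g: "g \<in> Hom T n n'" for f g m n m' n'
  proof -
    have fg: "f \<in> Arr T" "g \<in> Arr T" "Dom T f = m" "Cod T f = m'" "Dom T g = n" "Cod T g = n'" using f g by (auto simp: Hom_iff)
    have "\<phi> (f \<star>\<^bsub>T\<^esub> g) = TArr endo (Dom T f, Cod T f, FArr ?F f) (Dom T g, Cod T g, FArr ?F g)"
      by (rule trans[OF p(5)[OF fg(1,2)] arg_cong2[where f = "TArr endo", OF A(1)[OF fg(1)] A(1)[OF fg(2)]]])
    then have "FArr ?F (f \<star>\<^bsub>T\<^esub> g) = etens m m' n n' (FArr ?F f) (FArr ?F g)" using fg by simp
    then show ?thesis using etens_char[of "FArr ?F f" m m' "FArr ?F g" n n'] A(2)[OF fg(1)] A(2)[OF fg(2)] fg by simp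
  qed
  moreover have "FArr ?F (Sym T m n) \<cdot> c m n = c n m \<cdot> Sym S (P m) (P n)" for m n
    using p(3)[of m n] esym_char by simp
  ultimately show ?thesis
    unfolding symmetric_strict_monoidal_functor_def Let_def using T symmetric_monoidal_category_axioms by simp
qed

end

section \<open>Monoidal transformations as tensor powers of an arrow\<close>

fun arrow_power :: "('o, 'a, 'z) sym_mon_cat_scheme \<Rightarrow> 'a \<Rightarrow> nat \<Rightarrow> 'a" where
  "arrow_power S h 0 = Ident S (Unit S)"
| "arrow_power S h (Suc 0) = h"
| "arrow_power S h (Suc (Suc n)) = arrow_power S h (Suc n) \<star>\<^bsub>S\<^esub> h"

locale tensor_powers_arrow = X: tensor_powers S X + Y: tensor_powers S Y
  for S :: "('o, 'a, 'z) sym_mon_cat_scheme" (structure) and X Y +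
  fixes h :: 'a
  assumes h_in: "h \<in> Hom S X Y"
begin

abbreviation "H \<equiv> arrow_power S h"

lemma H_Suc: "n > 0 \<Longrightarrow> H (Suc n) = H n \<star> h"
  by (cases n) auto

lemma h_arr [simp]: "h \<in> Arr S" "Dom S h = X" "Cod S h = Y"
  using h_in by (auto simp: Hom_iff)

lemma H_arr [simp]: "H n \<in> Arr S" "Dom S (H n) = X.P n" "Cod S (H n) = Y.P n"
proof -
  have "H n \<in> Arr S \<and> Dom S (H n) = X.P n \<and> Cod S (H n) = Y.P n"
  proof (induction n)
    case (Suc n)
    then show ?case by (cases n) (auto simp: X.arrs)
  qed (simp add: X.arrs)
  then show "H n \<in> Arr S" "Dom S (H n) = X.P n" "Cod S (H n) = Y.P n" by auto
qed

text \<open>Naturality of \<open>tcan\<close> in the object, along the recursion that defines it: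
  unitors and inverse associators are natural.\<close>

lemma H_add: "H (m + n) \<cdot> X.c m n = Y.c m n \<cdot> (H m \<star> H n)"
proof (cases "m = 0")
  case True
  then show ?thesis using X.LUnit_nat[of "H n" "Y.P n"] by (simp add: X.c_0_left Y.c_0_left)
next
  case m: False
  note a = X.arrs X.X_in Y.X_in
  show ?thesis
  proof (induction n)
    case 0
    show ?case using X.RUnit_nat[of "H m" "Y.P m"] by simp
  next
    case (Suc n)
    show ?case
    proof (cases "n = 0")
      case True
      then show ?thesis using m by (simp add: X.c_1 Y.c_1 H_Suc a X.P_Suc Y.P_Suc)
    next
      case n: False
      let ?A = "Inv S (Assoc S (X.P m) (X.P n) X)" and ?B = "Inv S (Assoc S (Y.P m) (Y.P n) Y)"
      note A = X.Inv_arr[OF X.Assoc_iso[OF X.P_in X.P_in X.X_in, of m n]]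
      note B = X.Inv_arr[OF X.Assoc_iso[OF Y.P_in Y.P_in Y.X_in, of m n]]
      note b = a A(1-6) B(1-6)
      have "H (m + Suc n) \<cdot> X.c m (Suc n) = (H (m + n) \<star> h) \<cdot> ((X.c m n \<star> Ident S X) \<cdot> ?A)"
        using m n by (simp add: H_Suc X.c_Suc)
      also have "\<dots> = ((H (m + n) \<cdot> X.c m n) \<star> h) \<cdot> ?A" using b by (simp add: X.cmp_assoc[symmetric] X.ten_cmp)
      also have "H (m + n) \<cdot> X.c m n = Y.c m n \<cdot> (H m \<star> H n)" by (rule Suc.IH)
      also have "((Y.c m n \<cdot> (H m \<star> H n)) \<star> h) \<cdot> ?A = (Y.c m n \<star> Ident S Y) \<cdot> (((H m \<star> H n) \<star> h) \<cdot> ?A)"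
        using b by (simp add: X.cmp_assoc[symmetric] X.ten_cmp)
      also have "((H m \<star> H n) \<star> h) \<cdot> ?A = ?B \<cdot> (H m \<star> (H n \<star> h))"
        using X.Assoc_inv_nat[of "H m" "H n" h] by simp
      also have "(Y.c m n \<star> Ident S Y) \<cdot> (?B \<cdot> (H m \<star> (H n \<star> h))) = Y.c m (Suc n) \<cdot> (H m \<star> H (Suc n))"
        using m n b by (simp add: H_Suc Y.c_Suc X.cmp_assoc)
      finally show ?thesis .
    qed
  qed
qed

end

text \<open>For \<open>n > 0\<close> the map \<open>tcan S X n 1\<close> is an identity, so
  monoidality reads \<open>\<theta> (n + 1) = \<theta> n \<star> \<theta> 1\<close>;
  \<open>arrow_power\<close> has the same bracketing as \<open>tpow\<close>.\<close>

lemma monoidal_nat_trans_unique: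
  assumes t: "monoidal_nat_trans T S F K \<theta>" and F: "symmetric_strict_monoidal_functor T S F" and K: "symmetric_strict_monoidal_functor T S K"
  shows "\<theta> n = arrow_power S (\<theta> 1) n"
proof -
  interpret X: tensor_powers S "FObj F 1" by (rule tensor_powers_functor[OF F])
  interpret Y: tensor_powers S "FObj K 1" by (rule tensor_powers_functor[OF K])
  note D = symmetric_strict_monoidal_functorD[OF F] and E = symmetric_strict_monoidal_functorD[OF K]
  have nt: "nat_trans T S F K \<theta>" and t0: "\<theta> 0 = Ident S (Unit S)"
    and ta: "\<And>m n. \<theta> (m + n) \<cdot>\<^bsub>S\<^esub> X.c m n = Y.c m n \<cdot>\<^bsub>S\<^esub> (\<theta> m \<star>\<^bsub>S\<^esub> \<theta> n)"
    using t by (auto simp: monoidal_nat_trans_def)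
  have "Obj T = UNIV" using D(1) by (simp add: prop_category_def prop_category_axioms_def)
  then have h: "\<theta> n \<in> Hom S (X.P n) (Y.P n)" for n
    using nat_transD(4)[OF nt, of n] D(4)[of n] E(4)[of n] by simp
  show ?thesis
  proof (induction n)
    case (Suc n)
    show ?case
    proof (cases n)
      case (Suc k)
      have "\<theta> (n + 1) \<cdot>\<^bsub>S\<^esub> X.c n 1 = Y.c n 1 \<cdot>\<^bsub>S\<^esub> (\<theta> n \<star>\<^bsub>S\<^esub> \<theta> 1)" by (rule ta)
      then have "\<theta> (Suc n) = \<theta> n \<star>\<^bsub>S\<^esub> \<theta> 1"
        using h[of n, unfolded Hom_iff] h[of 1, unfolded Hom_iff] h[of "Suc n", unfolded Hom_iff] Suc X.P_Suc[of n] Y.P_Suc[of n]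
        by (simp add: X.c_1[unfolded One_nat_def] Y.c_1[unfolded One_nat_def] X.arrs X.X_in Y.X_in del: tpow.simps(3))
      then show ?thesis using Suc.IH Suc by simp
    qed simp
  qed (use t0 in simp)
qed

context tensor_powers_arrow
begin

text \<open>The naturality square at a single arrow. The arrows with this property contain
  identities and symmetries and are closed under composition and tensor product, so that naturality
  can be checked at generators.\<close>

definition commutes ::
  "(nat, 'b, 'o, 'a) functor_data \<Rightarrow> (nat, 'b, 'o, 'a) functor_data \<Rightarrow> (nat, 'b, 'y) sym_mon_cat_scheme \<Rightarrow> 'b \<Rightarrow> bool"
where
  "commutes F K T f \<longleftrightarrow> H (Cod T f) \<cdot> FArr F f = FArr K f \<cdot> H (Dom T f)"

context
  fixes T :: "(nat, 'b, 'y) sym_mon_cat_scheme" and F K :: "(nat, 'b, 'o, 'a) functor_data"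
  assumes F: "symmetric_strict_monoidal_functor T S F" and K: "symmetric_strict_monoidal_functor T S K"
    and FX: "FObj F 1 = X" and KY: "FObj K 1 = Y"
begin

interpretation T: prop_category T by (rule symmetric_strict_monoidal_functorD(1)[OF F])

lemma FObj_powers: "FObj F n = X.P n" "FObj K n = Y.P n"
  using symmetric_strict_monoidal_functorD(4)[OF F, of n] symmetric_strict_monoidal_functorD(4)[OF K, of n]
  unfolding FX KY .

lemma FArr_arr [simp]:
  assumes "f \<in> Arr T"
  shows "FArr F f \<in> Arr S" "Dom S (FArr F f) = X.P (Dom T f)" "Cod S (FArr F f) = X.P (Cod T f)"
    "FArr K f \<in> Arr S" "Dom S (FArr K f) = Y.P (Dom T f)" "Cod S (FArr K f) = Y.P (Cod T f)"
  using is_functorD(6)[OF symmetric_strict_monoidal_functorD(3)[OF F], of f "Dom T f" "Cod T f"]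
    is_functorD(6)[OF symmetric_strict_monoidal_functorD(3)[OF K], of f "Dom T f" "Cod T f"] assms
  by (auto simp: Hom_iff FObj_powers)

lemma commutes_Ident: "commutes F K T (Ident T n)"
  using is_functorD(7)[OF symmetric_strict_monoidal_functorD(3)[OF F], of n]
    is_functorD(7)[OF symmetric_strict_monoidal_functorD(3)[OF K], of n]
  by (simp add: commutes_def FObj_powers T.Obj_PROP)

lemma commutes_cmp:
  assumes f: "f \<in> Arr T" "commutes F K T f" and g: "g \<in> Arr T" "commutes F K T g" and d: "Cod T f = Dom T g"
  shows "commutes F K T (g \<cdot>\<^bsub>T\<^esub> f)"
proof -
  have fg: "FArr F (g \<cdot>\<^bsub>T\<^esub> f) = FArr F g \<cdot> FArr F f" "FArr K (g \<cdot>\<^bsub>T\<^esub> f) = FArr K g \<cdot> FArr K f"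
    using is_functorD(8)[OF symmetric_strict_monoidal_functorD(3)[OF F], of f "Dom T f" "Cod T f" g "Cod T g"]
      is_functorD(8)[OF symmetric_strict_monoidal_functorD(3)[OF K], of f "Dom T f" "Cod T f" g "Cod T g"] f g d
    by (simp_all add: Hom_iff)
  have "H (Cod T g) \<cdot> (FArr F g \<cdot> FArr F f) = (H (Cod T g) \<cdot> FArr F g) \<cdot> FArr F f"
    by (rule X.cmp_assoc[symmetric]) (use f g d in simp_all)
  also have "H (Cod T g) \<cdot> FArr F g = FArr K g \<cdot> H (Dom T g)" using g(2) by (simp add: commutes_def)
  also have "(FArr K g \<cdot> H (Dom T g)) \<cdot> FArr F f = FArr K g \<cdot> (H (Cod T f) \<cdot> FArr F f)"
    unfolding d by (rule X.cmp_assoc) (use f g d in simp_all)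
  also have "H (Cod T f) \<cdot> FArr F f = FArr K f \<cdot> H (Dom T f)" using f(2) by (simp add: commutes_def)
  also have "FArr K g \<cdot> (FArr K f \<cdot> H (Dom T f)) = (FArr K g \<cdot> FArr K f) \<cdot> H (Dom T f)"
    by (rule X.cmp_assoc[symmetric]) (use f g d in simp_all)
  finally show ?thesis using f g d by (simp add: commutes_def fg)
qed

text \<open>Both functors are monoidal up to \<open>tcan\<close>, with which \<open>H\<close> is
  compatible by \<open>H_add\<close>; after composing with \<open>tcan\<close> the square is the
  tensor product of the two given ones.\<close>

lemma commutes_ten:
  assumes f: "f \<in> Arr T" "commutes F K T f" and g: "g \<in> Arr T" "commutes F K T g"
  shows "commutes F K T (f \<star>\<^bsub>T\<^esub> g)"
  unfolding commutes_def
proof (rule X.iso_cancel_right[OF X.c_iso[of "Dom T f" "Dom T g"]])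
  let ?m = "Dom T f" and ?n = "Dom T g" and ?m' = "Cod T f" and ?n' = "Cod T g"
  have D: "FArr F (f \<star>\<^bsub>T\<^esub> g) \<cdot> X.c ?m ?n = X.c ?m' ?n' \<cdot> (FArr F f \<star> FArr F g)"
    "FArr K (f \<star>\<^bsub>T\<^esub> g) \<cdot> Y.c ?m ?n = Y.c ?m' ?n' \<cdot> (FArr K f \<star> FArr K g)"
    using symmetric_strict_monoidal_functorD(5)[OF F, of f ?m ?m' g ?n ?n', unfolded FX]
      symmetric_strict_monoidal_functorD(5)[OF K, of f ?m ?m' g ?n ?n', unfolded KY] f g by (simp_all add: Hom_iff)
  have q: "H ?m' \<cdot> FArr F f = FArr K f \<cdot> H ?m" "H ?n' \<cdot> FArr F g = FArr K g \<cdot> H ?n"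
    using f g by (simp_all add: commutes_def)
  note b = X.ten_arr' f(1) g(1)
  have "(H (?m' + ?n') \<cdot> FArr F (f \<star>\<^bsub>T\<^esub> g)) \<cdot> X.c ?m ?n = H (?m' + ?n') \<cdot> (FArr F (f \<star>\<^bsub>T\<^esub> g) \<cdot> X.c ?m ?n)"
    by (rule X.cmp_assoc) (use b in simp_all)
  also have "\<dots> = (H (?m' + ?n') \<cdot> X.c ?m' ?n') \<cdot> (FArr F f \<star> FArr F g)"
    unfolding D by (rule X.cmp_assoc[symmetric]) (use b in simp_all)
  also have "\<dots> = Y.c ?m' ?n' \<cdot> ((H ?m' \<star> H ?n') \<cdot> (FArr F f \<star> FArr F g))"
    unfolding H_add by (rule X.cmp_assoc) (use b in simp_all)
  also have "(H ?m' \<star> H ?n') \<cdot> (FArr F f \<star> FArr F g) = (FArr K f \<star> FArr K g) \<cdot> (H ?m \<star> H ?n)"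
    using b q by (simp add: X.ten_cmp)
  also have "Y.c ?m' ?n' \<cdot> ((FArr K f \<star> FArr K g) \<cdot> (H ?m \<star> H ?n)) = (Y.c ?m' ?n' \<cdot> (FArr K f \<star> FArr K g)) \<cdot> (H ?m \<star> H ?n)"
    by (rule X.cmp_assoc[symmetric]) (use b in simp_all)
  also have "\<dots> = FArr K (f \<star>\<^bsub>T\<^esub> g) \<cdot> (Y.c ?m ?n \<cdot> (H ?m \<star> H ?n))"
    unfolding D(2)[symmetric] by (rule X.cmp_assoc) (use b in simp_all)
  also have "\<dots> = (FArr K (f \<star>\<^bsub>T\<^esub> g) \<cdot> H (?m + ?n)) \<cdot> X.c ?m ?n"
    unfolding H_add[symmetric] by (rule X.cmp_assoc[symmetric]) (use b in simp_all)
  finally show "(H (Cod T (f \<star>\<^bsub>T\<^esub> g)) \<cdot> FArr F (f \<star>\<^bsub>T\<^esub> g)) \<cdot> X.c ?m ?n =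
      (FArr K (f \<star>\<^bsub>T\<^esub> g) \<cdot> H (Dom T (f \<star>\<^bsub>T\<^esub> g))) \<cdot> X.c ?m ?n" using b by simp
qed (use f g in simp_all)

lemma commutes_Sym: "commutes F K T (Sym T m n)"
  unfolding commutes_def
proof (rule X.iso_cancel_right[OF X.c_iso[of m n]])
  let ?s = "FArr F (Sym T m n)" and ?t = "FArr K (Sym T m n)"
  have D: "?s \<cdot> X.c m n = X.c n m \<cdot> Sym S (X.P m) (X.P n)" "?t \<cdot> Y.c m n = Y.c n m \<cdot> Sym S (Y.P m) (Y.P n)"
    using symmetric_strict_monoidal_functorD(6)[OF F, of m n, unfolded FX]
      symmetric_strict_monoidal_functorD(6)[OF K, of m n, unfolded KY] by (simp_all add: FObj_powers)
  note b = X.arrs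
  have "(H (n + m) \<cdot> ?s) \<cdot> X.c m n = H (n + m) \<cdot> (?s \<cdot> X.c m n)"
    by (rule X.cmp_assoc) (use b in simp_all)
  also have "\<dots> = (H (n + m) \<cdot> X.c n m) \<cdot> Sym S (X.P m) (X.P n)"
    unfolding D by (rule X.cmp_assoc[symmetric]) (use b in simp_all)
  also have "\<dots> = Y.c n m \<cdot> ((H n \<star> H m) \<cdot> Sym S (X.P m) (X.P n))"
    unfolding H_add by (rule X.cmp_assoc) (use b in simp_all)
  also have "(H n \<star> H m) \<cdot> Sym S (X.P m) (X.P n) = Sym S (Y.P m) (Y.P n) \<cdot> (H m \<star> H n)"
    using X.Sym_nat'[of "H m" "H n" "Y.P m" "Y.P n"] by simp
  also have "Y.c n m \<cdot> (Sym S (Y.P m) (Y.P n) \<cdot> (H m \<star> H n)) = (Y.c n m \<cdot> Sym S (Y.P m) (Y.P n)) \<cdot> (H m \<star> H n)"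
    by (rule X.cmp_assoc[symmetric]) (use b in simp_all)
  also have "\<dots> = ?t \<cdot> (Y.c m n \<cdot> (H m \<star> H n))"
    unfolding D(2)[symmetric] by (rule X.cmp_assoc) (use b in simp_all)
  also have "\<dots> = (?t \<cdot> H (m + n)) \<cdot> X.c m n"
    unfolding H_add[symmetric] by (rule X.cmp_assoc[symmetric]) (use b in simp_all)
  finally show "(H (Cod T (Sym T m n)) \<cdot> ?s) \<cdot> X.c m n = (?t \<cdot> H (Dom T (Sym T m n))) \<cdot> X.c m n" by simp
qed simp_all

lemma monoidal_nat_trans_powers:
  assumes "\<And>f. f \<in> Arr T \<Longrightarrow> commutes F K T f"
  shows "monoidal_nat_trans T S F K H"
  unfolding monoidal_nat_trans_def nat_trans_def FX KY
  using symmetric_strict_monoidal_functorD(3)[OF F] symmetric_strict_monoidal_functorD(3)[OF K] H_add assms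
  by (auto simp: T.Obj_PROP Hom_iff FObj_powers commutes_def)

end
end

lemma tensor_powers_arrowI:
  assumes "symmetric_strict_monoidal_functor T S F" "symmetric_strict_monoidal_functor T S K" "h \<in> Hom S (FObj F 1) (FObj K 1)"
  shows "tensor_powers_arrow S (FObj F 1) (FObj K 1) h"
  using tensor_powers_functor[OF assms(1)] tensor_powers_functor[OF assms(2)] assms(3)
  by (simp add: tensor_powers_arrow_def tensor_powers_arrow_axioms_def)

lemma Alg_sel:
  "Obj (Alg T S) = {F. symmetric_strict_monoidal_functor T S F}"
  "Arr (Alg T S) = {(F, K, \<theta>). symmetric_strict_monoidal_functor T S F \<and>
     symmetric_strict_monoidal_functor T S K \<and> monoidal_nat_trans T S F K \<theta>}"
  "Dom (Alg T S) (F, K, \<theta>) = F" "Cod (Alg T S) (F, K, \<theta>) = K"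
  "Ident (Alg T S) F = (F, F, \<lambda>x \<in> Obj T. Ident S (FObj F x))"
  "Cmp (Alg T S) (K, L, \<theta>') (F, M, \<theta>) = (F, L, \<lambda>x \<in> Obj T. \<theta>' x \<cdot>\<^bsub>S\<^esub> \<theta> x)"
  by (simp_all add: Alg_def functor_category_def)

lemma category_Alg:
  assumes T: "prop_category T" and S: "symmetric_monoidal_category S"
  shows "category (Alg T S)"
  unfolding Alg_def
proof (rule category_functors)
  interpret T: prop_category T by fact
  interpret S: symmetric_monoidal_category S by fact
  show "category S" by (rule S.category_axioms)
  show "is_functor T S F" if "F \<in> {F. symmetric_strict_monoidal_functor T S F}" for F
    using that symmetric_strict_monoidal_functorD(3) by blast
  let ?A = "{(F, K, \<theta>). symmetric_strict_monoidal_functor T S F \<and> symmetric_strict_monoidal_functor T S K \<and> monoidal_nat_trans T S F K \<theta>}"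
  show "F \<in> {F. symmetric_strict_monoidal_functor T S F} \<and> K \<in> {F. symmetric_strict_monoidal_functor T S F} \<and> nat_trans T S F K \<theta>"
    if "(F, K, \<theta>) \<in> ?A" for F K \<theta>
    using that by (auto simp: monoidal_nat_trans_def)
  show "(F, F, \<lambda>x \<in> Obj T. Ident S (FObj F x)) \<in> ?A" if "F \<in> {F. symmetric_strict_monoidal_functor T S F}" for F
  proof -
    have F: "symmetric_strict_monoidal_functor T S F" using that by simp
    define Z where "Z = FObj F 1"
    interpret X: tensor_powers S Z unfolding Z_def by (rule tensor_powers_functor[OF F])
    have p: "FObj F n = X.P n" for n unfolding Z_def by (rule symmetric_strict_monoidal_functorD(4)[OF F])
    have e: "Ident S (FObj F n) = X.i n" for n by (rule arg_cong[OF p])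
    have "Ident S (FObj F (m + n)) \<cdot>\<^bsub>S\<^esub> X.c m n = X.c m n \<cdot>\<^bsub>S\<^esub> (Ident S (FObj F m) \<star>\<^bsub>S\<^esub> Ident S (FObj F n))" for m n
      unfolding e by (simp add: S.TArr_Ident)
    moreover have "Ident S (FObj F 0) = Ident S (Unit S)" using p[of 0] by simp
    ultimately show ?thesis
      using F nat_trans_ident[OF symmetric_strict_monoidal_functorD(3)[OF F]]
      by (simp add: monoidal_nat_trans_def T.Obj_PROP Z_def)
  qed
  fix F K L \<theta> \<theta>' assume a: "(F, K, \<theta>) \<in> ?A" "(K, L, \<theta>') \<in> ?A"
  then have F: "symmetric_strict_monoidal_functor T S F" and K: "symmetric_strict_monoidal_functor T S K"
    and L: "symmetric_strict_monoidal_functor T S L" and t: "monoidal_nat_trans T S F K \<theta>" and t': "monoidal_nat_trans T S K L \<theta>'" by auto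
  interpret X: tensor_powers S "FObj F 1" by (rule tensor_powers_functor[OF F])
  interpret Y: tensor_powers S "FObj K 1" by (rule tensor_powers_functor[OF K])
  interpret Z: tensor_powers S "FObj L 1" by (rule tensor_powers_functor[OF L])
  have n: "nat_trans T S F K \<theta>" "nat_trans T S K L \<theta>'" and z: "\<theta> 0 = Ident S (Unit S)" "\<theta>' 0 = Ident S (Unit S)"
    and ad: "\<theta> (m + n) \<cdot>\<^bsub>S\<^esub> X.c m n = Y.c m n \<cdot>\<^bsub>S\<^esub> (\<theta> m \<star>\<^bsub>S\<^esub> \<theta> n)" "\<theta>' (m + n) \<cdot>\<^bsub>S\<^esub> Y.c m n = Z.c m n \<cdot>\<^bsub>S\<^esub> (\<theta>' m \<star>\<^bsub>S\<^esub> \<theta>' n)" for m n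
    using t t' by (simp_all add: monoidal_nat_trans_def)
  have th: "\<theta> n \<in> Arr S" "Dom S (\<theta> n) = X.P n" "Cod S (\<theta> n) = Y.P n" "\<theta>' n \<in> Arr S" "Dom S (\<theta>' n) = Y.P n" "Cod S (\<theta>' n) = Z.P n" for n
    using nat_transD(4)[OF n(1), of n] nat_transD(4)[OF n(2), of n]
    unfolding T.Obj_PROP Hom_iff symmetric_strict_monoidal_functorD(4)[OF F, symmetric]
      symmetric_strict_monoidal_functorD(4)[OF K, symmetric] symmetric_strict_monoidal_functorD(4)[OF L, symmetric] by auto
  have "(\<theta>' (m + n) \<cdot>\<^bsub>S\<^esub> \<theta> (m + n)) \<cdot>\<^bsub>S\<^esub> X.c m n = Z.c m n \<cdot>\<^bsub>S\<^esub> ((\<theta>' m \<cdot>\<^bsub>S\<^esub> \<theta> m) \<star>\<^bsub>S\<^esub> (\<theta>' n \<cdot>\<^bsub>S\<^esub> \<theta> n))" for m n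
  proof -
    note cc = X.c_arr[unfolded One_nat_def] Y.c_arr[unfolded One_nat_def] Z.c_arr[unfolded One_nat_def]
    have "(\<theta>' (m + n) \<cdot>\<^bsub>S\<^esub> \<theta> (m + n)) \<cdot>\<^bsub>S\<^esub> X.c m n = \<theta>' (m + n) \<cdot>\<^bsub>S\<^esub> (\<theta> (m + n) \<cdot>\<^bsub>S\<^esub> X.c m n)"
      by (rule S.cmp_assoc) (simp_all add: th cc)
    also have "\<dots> = (\<theta>' (m + n) \<cdot>\<^bsub>S\<^esub> Y.c m n) \<cdot>\<^bsub>S\<^esub> (\<theta> m \<star>\<^bsub>S\<^esub> \<theta> n)"
      unfolding ad(1) by (rule S.cmp_assoc[symmetric]) (simp_all add: th cc S.ten_arr')
    also have "\<dots> = Z.c m n \<cdot>\<^bsub>S\<^esub> ((\<theta>' m \<star>\<^bsub>S\<^esub> \<theta>' n) \<cdot>\<^bsub>S\<^esub> (\<theta> m \<star>\<^bsub>S\<^esub> \<theta> n))"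
      unfolding ad(2) by (rule S.cmp_assoc) (simp_all add: th cc S.ten_arr')
    finally show ?thesis by (simp add: S.ten_cmp th)
  qed
  then show "(F, L, \<lambda>x \<in> Obj T. \<theta>' x \<cdot>\<^bsub>S\<^esub> \<theta> x) \<in> ?A"
    using F L nat_trans_cmp[OF n] z S.Unit_in by (simp add: monoidal_nat_trans_def T.Obj_PROP S.Ident_arr')
qed

section \<open>The equivalence\<close>

lemma Ident_one [simp]: "Obj (one_object_category G) = UNIV" "Arr (one_object_category G) = carrier G"
  "Dom (one_object_category G) g = ()" "Cod (one_object_category G) g = ()"
  "Ident (one_object_category G) u = \<one>\<^bsub>G\<^esub>" "Cmp (one_object_category G) g h = g \<otimes>\<^bsub>G\<^esub> h"
  by (simp_all add: one_object_category_def)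

lemma Hom_one [simp]: "g \<in> Hom (one_object_category G) u v \<longleftrightarrow> g \<in> carrier G"
  by (simp add: Hom_def)

locale composite_algebras = group G + S: symmetric_monoidal_category S
  for G :: "('g, 'w) monoid_scheme" (structure) and S :: "('o, 'a, 'z) sym_mon_cat_scheme"
begin

abbreviation algebra :: "(nat, 'g lspan set, 'o, 'a) functor_data \<Rightarrow> bool" where
  "algebra F \<equiv> symmetric_strict_monoidal_functor TG S F"

definition bimonoid_of :: "(nat, 'g lspan set, 'o, 'a) functor_data \<Rightarrow> ('o, 'a) bimonoid_data" where
  "bimonoid_of F = \<lparr>Car = FObj F 1, Mul = FArr F (gcls G smu), Uni = FArr F (gcls G seta),
     Com = FArr F (gcls G sDe), Cou = FArr F (gcls G sep)\<rparr>"

definition gbimonoid_of where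
  "gbimonoid_of F = \<lparr>FObj = (\<lambda>_ :: unit. bimonoid_of F),
     FArr = (\<lambda>g \<in> carrier G. (bimonoid_of F, bimonoid_of F, FArr F (gcls G (sact g))))\<rparr>"

definition gbimonoid_hom_of where
  "gbimonoid_hom_of = (\<lambda>(F, K, \<theta>). (gbimonoid_of F, gbimonoid_of K, \<lambda>_ :: unit. (bimonoid_of F, bimonoid_of K, \<theta> (1 :: nat))))"

lemma gens_arr:
  "gcls G smu \<in> Arr TG" "gcls G seta \<in> Arr TG" "gcls G sDe \<in> Arr TG" "gcls G sep \<in> Arr TG"
  "g \<in> carrier G \<Longrightarrow> gcls G (sact g) \<in> Arr TG"
  by (intro Arr_gcls gvalid_s; assumption?)+

lemma gens_dom:
  "Dom TG (gcls G smu) = Suc (Suc 0)" "Cod TG (gcls G smu) = Suc 0" "Dom TG (gcls G seta) = 0" "Cod TG (gcls G seta) = Suc 0"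
  "Dom TG (gcls G sDe) = Suc 0" "Cod TG (gcls G sDe) = Suc (Suc 0)" "Dom TG (gcls G sep) = Suc 0" "Cod TG (gcls G sep) = 0"
  "Dom TG (gcls G (sact g)) = Suc 0" "Cod TG (gcls G (sact g)) = Suc 0"
  by (simp_all add: Dom_gcls Cod_gcls)

text \<open>The generic bimonoid is carried along the PROP morphism that belongs to \<open>F\<close>
  into the endomorphism PROP of \<open>FObj F 1\<close>, where \<open>gbimonoid_endo_iff\<close>
  reads it as a bimonoid in \<open>S\<close>.\<close>

lemma algebra_bimonoid:
  assumes F: "algebra F"
  shows "bimonoid S (bimonoid_of F)"
    "g \<in> carrier G \<Longrightarrow> bimonoid_hom S (bimonoid_of F) (bimonoid_of F) (FArr F (gcls G (sact g)))"
    "FArr F (gcls G (sact \<one>)) = Ident S (FObj F 1)"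
    "\<lbrakk>g \<in> carrier G; h \<in> carrier G\<rbrakk> \<Longrightarrow>
      FArr F (gcls G (sact (g \<otimes> h))) = FArr F (gcls G (sact g)) \<cdot>\<^bsub>S\<^esub> FArr F (gcls G (sact h))"
proof -
  interpret X: tensor_powers S "FObj F 1" by (rule tensor_powers_functor[OF F])
  note B = gbimonoid_in_prop_image[OF gbimonoid_TG X.prop_morphism_of_functor[OF F refl] X.prop_category_endo,
    unfolded gens_dom X.gbimonoid_endo_iff[OF is_group bimonoid_of_def[symmetric, THEN sym]]]
  show "bimonoid S (bimonoid_of F)"
    "g \<in> carrier G \<Longrightarrow> bimonoid_hom S (bimonoid_of F) (bimonoid_of F) (FArr F (gcls G (sact g)))"
    "FArr F (gcls G (sact \<one>)) = Ident S (FObj F 1)"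
    "\<lbrakk>g \<in> carrier G; h \<in> carrier G\<rbrakk> \<Longrightarrow>
      FArr F (gcls G (sact (g \<otimes> h))) = FArr F (gcls G (sact g)) \<cdot>\<^bsub>S\<^esub> FArr F (gcls G (sact h))"
    using B by blast+
qed

lemma gbimonoid_of_functor:
  assumes F: "algebra F"
  shows "is_functor (one_object_category G) (Bimon S) (gbimonoid_of F)"
  using algebra_bimonoid[OF F] category_one_object[OF is_group] S.category_Bimon unfolding is_functor_def
  by (auto simp: gbimonoid_of_def S.Hom_Bimon bimonoid_of_def)

lemma gbimonoid_hom_of_nat_trans:
  assumes t: "monoidal_nat_trans TG S F K \<theta>" and F: "algebra F" and K: "algebra K"
  shows "nat_trans (one_object_category G) (Bimon S) (gbimonoid_of F) (gbimonoid_of K) (\<lambda>_. (bimonoid_of F, bimonoid_of K, \<theta> 1))"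
proof -
  have n: "nat_trans TG S F K \<theta>" using t by (simp add: monoidal_nat_trans_def)
  interpret X: tensor_powers S "FObj F 1" by (rule tensor_powers_functor[OF F])
  interpret Y: tensor_powers S "FObj K 1" by (rule tensor_powers_functor[OF K])
  have h: "\<theta> 1 \<in> Hom S (FObj F 1) (FObj K 1)" using nat_transD(4)[OF n, of 1] by simp
  have nt: "\<theta> (Cod TG f) \<cdot>\<^bsub>S\<^esub> FArr F f = FArr K f \<cdot>\<^bsub>S\<^esub> \<theta> (Dom TG f)" if "f \<in> Arr TG" for f
    using nat_transD(5)[OF n, of f] that by (simp add: Hom_iff)
  have t2: "\<theta> (Suc (Suc 0)) = \<theta> 1 \<star>\<^bsub>S\<^esub> \<theta> 1" and t0: "\<theta> 0 = Ident S (Unit S)"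
    using monoidal_nat_trans_unique[OF t F K, of "Suc (Suc 0)"] monoidal_nat_trans_unique[OF t F K, of 0] by simp_all
  note B = S.bimonoid_in[OF algebra_bimonoid(1)[OF F], unfolded Hom_iff] S.bimonoid_in[OF algebra_bimonoid(1)[OF K], unfolded Hom_iff]
  note nts = nt[OF gens_arr(1)] nt[OF gens_arr(2)] nt[OF gens_arr(3)] nt[OF gens_arr(4)]
  have "bimonoid_hom S (bimonoid_of F) (bimonoid_of K) (\<theta> 1)"
    using nts h B unfolding bimonoid_hom_def gens_dom t2 t0 by (auto simp: bimonoid_of_def)
  moreover have "\<theta> 1 \<cdot>\<^bsub>S\<^esub> FArr F (gcls G (sact g)) = FArr K (gcls G (sact g)) \<cdot>\<^bsub>S\<^esub> \<theta> 1" if "g \<in> carrier G" for g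
    using nt[OF gens_arr(5)[OF that]] by (simp add: gens_dom)
  ultimately show ?thesis
    unfolding nat_trans_def
    using gbimonoid_of_functor[OF F] gbimonoid_of_functor[OF K] algebra_bimonoid(1)[OF F] algebra_bimonoid(1)[OF K]
    by (auto simp: S.Hom_Bimon gbimonoid_of_def)
qed

text \<open>Uniqueness in the universal property: both algebras are PROP morphisms into the same
  endomorphism PROP and agree on the generators. Extensionality then makes the functors
  equal.\<close>

lemma gbimonoid_of_inj:
  assumes F: "algebra F" and K: "algebra K" and e: "gbimonoid_of F = gbimonoid_of K"
  shows "F = K"
proof -
  have b: "bimonoid_of F = bimonoid_of K"
    using e unfolding gbimonoid_of_def functor_data.ext_inject by (auto dest: fun_cong)
  have g: "FArr F (gcls G (sact g)) = FArr K (gcls G (sact g))" if "g \<in> carrier G" for g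
  proof -
    have "FArr (gbimonoid_of F) g = FArr (gbimonoid_of K) g" using e by simp
    then show ?thesis using that by (simp add: gbimonoid_of_def)
  qed
  define X where "X = FObj F 1"
  have FX: "FObj F 1 = X" and KX: "FObj K 1 = X" using b by (simp_all add: X_def bimonoid_of_def)
  interpret X: tensor_powers S X using tensor_powers_functor[OF F] unfolding FX .
  have "(Dom TG f, Cod TG f, FArr F f) = (Dom TG f, Cod TG f, FArr K f)" if "f \<in> Arr TG" for f
    using b g by (intro prop_morphism_unique[OF X.prop_morphism_of_functor[OF F FX] X.prop_morphism_of_functor[OF K KX] _ _ _ _ _ that])
      (simp_all add: bimonoid_of_def)
  then have "FArr F f = FArr K f" for f
    using is_functorD(5)[OF symmetric_strict_monoidal_functorD(3)[OF F]] is_functorD(5)[OF symmetric_strict_monoidal_functorD(3)[OF K]]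
    by (cases "f \<in> Arr TG") (auto simp: extensional_def)
  moreover have "FObj F n = FObj K n" for n
    using symmetric_strict_monoidal_functorD(4)[OF F, of n] symmetric_strict_monoidal_functorD(4)[OF K, of n] unfolding FX KX by simp
  ultimately show ?thesis by (intro functor_data.equality) auto
qed

text \<open>Existence in the universal property: the algebra is evaluation in the endomorphism PROP
  of the carrier.\<close>

lemma gbimonoid_of_surj:
  assumes L: "is_functor (one_object_category G) (Bimon S) L"
  obtains F where "algebra F" "gbimonoid_of F = L"
proof -
  define B where "B = FObj L ()"
  define h where "h g = snd (snd (FArr L g))" for g
  have B: "bimonoid S B" using is_functorD(3)[OF L, of "()"] by (simp add: B_def)
  have LA: "FArr L g = (B, B, h g) \<and> bimonoid_hom S B B (h g)" if "g \<in> carrier G" for g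
    using is_functorD(6)[OF L, of g "()" "()"] that by (auto simp: S.Hom_Bimon B_def h_def)
  have h1: "h \<one> = Ident S (Car B)"
    using is_functorD(7)[OF L, of "()"] by (simp add: h_def B_def)
  have h2: "h (g \<otimes> k) = h g \<cdot>\<^bsub>S\<^esub> h k" if gk: "g \<in> carrier G" "k \<in> carrier G" for g k
    using is_functorD(8)[OF L, of k "()" "()" g "()"] LA[OF gk(1)] LA[OF gk(2)] LA[OF m_closed[OF gk]] gk by simp
  interpret X: tensor_powers S "Car B" by unfold_locales (rule S.bimonoid_Car[OF B])
  have "gbimonoid_in_prop X.endo G (Suc (Suc 0), Suc 0, Mul B) (0, Suc 0, Uni B) (Suc 0, Suc (Suc 0), Com B) (Suc 0, 0, Cou B)
      (\<lambda>g. (Suc 0, Suc 0, h g))"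
    using X.gbimonoid_endo_iff[OF is_group, of B "Mul B" "Uni B" "Com B" "Cou B" h] B LA h1 h2 by simp
  then interpret E: gbimonoid_in_prop X.endo G "(Suc (Suc 0), Suc 0, Mul B)" "(0, Suc 0, Uni B)" "(Suc 0, Suc (Suc 0), Com B)"
    "(Suc 0, 0, Cou B)" "\<lambda>g. (Suc 0, Suc 0, h g)" .
  define F where "F = \<lparr>FObj = X.P, FArr = (\<lambda>f \<in> Arr TG. snd (snd (E.evc f)))\<rparr>"
  have F: "algebra F" unfolding F_def by (rule X.functor_of_prop_morphism[OF prop_category_TG E.prop_morphism_evc])
  have b: "bimonoid_of F = B"
    by (simp add: bimonoid_of_def F_def gens_arr E.evc_gens)
  have "gbimonoid_of F = L"
  proof (rule functor_data.equality)
    show "FObj (gbimonoid_of F) = FObj L" by (auto simp: gbimonoid_of_def b B_def)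
    have "FArr F (gcls G (sact g)) = h g" if "g \<in> carrier G" for g
      using that by (simp add: F_def gens_arr E.evc_gens)
    then show "FArr (gbimonoid_of F) = FArr L"
      using is_functorD(5)[OF L] LA by (auto simp: gbimonoid_of_def b fun_eq_iff extensional_def)
  qed simp
  with F show thesis by (rule that)
qed

text \<open>The powers of the underlying arrow \<open>h\<close> are natural at the generators
  because \<open>h\<close> is a bimonoid map that commutes with \<open>G\<close>, hence at every
  arrow by \<open>TG_induct\<close>.\<close>

lemma gbimonoid_hom_of_surj:
  assumes F: "algebra F" and K: "algebra K"
    and z: "nat_trans (one_object_category G) (Bimon S) (gbimonoid_of F) (gbimonoid_of K) \<zeta>"
  obtains \<theta> where "monoidal_nat_trans TG S F K \<theta>" "\<zeta> = (\<lambda>_. (bimonoid_of F, bimonoid_of K, \<theta> 1))"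
proof -
  obtain h where h: "\<zeta> () = (bimonoid_of F, bimonoid_of K, h)" "bimonoid_hom S (bimonoid_of F) (bimonoid_of K) h"
    using nat_transD(4)[OF z, of "()"] by (auto simp: S.Hom_Bimon gbimonoid_of_def)
  have a: "h \<cdot>\<^bsub>S\<^esub> FArr F (gcls G (sact g)) = FArr K (gcls G (sact g)) \<cdot>\<^bsub>S\<^esub> h" if "g \<in> carrier G" for g
    using nat_transD(5)[OF z, of g "()" "()"] that by (simp add: gbimonoid_of_def h)
  have hin: "h \<in> Hom S (FObj F 1) (FObj K 1)" using h(2) by (simp add: bimonoid_hom_def bimonoid_of_def)
  interpret H: tensor_powers_arrow S "FObj F 1" "FObj K 1" h by (rule tensor_powers_arrowI[OF F K hin])
  note B = S.bimonoid_in[OF algebra_bimonoid(1)[OF F], unfolded Hom_iff] S.bimonoid_in[OF algebra_bimonoid(1)[OF K], unfolded Hom_iff]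
  note q = H.commutes_Ident[OF F K refl refl] H.commutes_Sym[OF F K refl refl] H.commutes_cmp[OF F K refl refl] H.commutes_ten[OF F K refl refl]
  note hh = h(2)[unfolded bimonoid_hom_def]
  have "H.commutes F K TG f" if "f \<in> Arr TG" for f
  proof (rule TG_induct[OF that])
    show "H.commutes F K TG (gcls G smu)" "H.commutes F K TG (gcls G seta)" "H.commutes F K TG (gcls G sDe)"
      "H.commutes F K TG (gcls G sep)"
      using hh B by (simp_all add: H.commutes_def gens_dom bimonoid_of_def)
    show "H.commutes F K TG (gcls G (sact g))" if "g \<in> carrier G" for g
      using a[OF that] by (simp add: H.commutes_def gens_dom)
  qed (use q in auto)
  then have "monoidal_nat_trans TG S F K (arrow_power S h)"
    by (rule H.monoidal_nat_trans_powers[OF F K refl refl])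
  moreover have "\<zeta> = (\<lambda>_. (bimonoid_of F, bimonoid_of K, arrow_power S h 1))" using h(1) by (auto simp: fun_eq_iff)
  ultimately show thesis by (rule that)
qed

lemma GBimon_sel:
  "Obj (GBimon G S) = {F. is_functor (one_object_category G) (Bimon S) F}"
  "Arr (GBimon G S) = {(F, K, \<theta>). nat_trans (one_object_category G) (Bimon S) F K \<theta>}"
  "Dom (GBimon G S) (F, K, \<theta>) = F" "Cod (GBimon G S) (F, K, \<theta>) = K"
  "Ident (GBimon G S) F = (F, F, \<lambda>x. Ident (Bimon S) (FObj F x))"
  "Cmp (GBimon G S) (K, L, \<theta>') (F, M, \<theta>) = (F, L, \<lambda>x. \<theta>' x \<cdot>\<^bsub>Bimon S\<^esub> \<theta> x)"
  by (simp_all add: GBimon_def functor_category_def restrict_UNIV)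

theorem equivalence: "equivalent_categories (Alg TG S) (GBimon G S)"
proof (rule bijective_functor_equivalence)
  let ?E = "\<lparr>FObj = (\<lambda>F \<in> Obj (Alg TG S). gbimonoid_of F), FArr = (\<lambda>t \<in> Arr (Alg TG S). gbimonoid_hom_of t)\<rparr>"
  interpret A: category "Alg TG S" by (rule category_Alg[OF prop_category_TG S.symmetric_monoidal_category_axioms])
  interpret B: category "GBimon G S" unfolding GBimon_def by (rule category_functor_category[OF S.category_Bimon])
  have H: "t \<in> Hom (Alg TG S) F K \<longleftrightarrow> (\<exists>\<theta>. t = (F, K, \<theta>) \<and> algebra F \<and> algebra K \<and> monoidal_nat_trans TG S F K \<theta>)" for t F K
    by (cases t) (auto simp: Hom_iff Alg_sel)
  show "is_functor (Alg TG S) (GBimon G S) ?E"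
    unfolding is_functor_def
  proof (intro conjI allI ballI A.category_axioms B.category_axioms)
    show "FObj ?E \<in> Obj (Alg TG S) \<rightarrow>\<^sub>E Obj (GBimon G S)"
      using gbimonoid_of_functor by (auto simp: Alg_sel GBimon_sel)
    show "FArr ?E \<in> extensional (Arr (Alg TG S))" by simp
    show "FArr ?E (Ident (Alg TG S) F) = Ident (GBimon G S) (FObj ?E F)" if F: "F \<in> Obj (Alg TG S)" for F
    proof -
      have "FArr ?E (Ident (Alg TG S) F) = gbimonoid_hom_of (Ident (Alg TG S) F)"
        using A.Ident_in[OF F] by (simp add: Hom_iff)
      then show ?thesis using F S.category_Bimon
        by (simp add: Alg_sel GBimon_sel gbimonoid_hom_of_def gbimonoid_of_def) (simp add: bimonoid_of_def)
    qed
    fix F K t assume t: "t \<in> Hom (Alg TG S) F K"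
    then show "FArr ?E t \<in> Hom (GBimon G S) (FObj ?E F) (FObj ?E K)"
      using gbimonoid_hom_of_nat_trans unfolding H
      by (auto simp: Hom_iff Alg_sel GBimon_sel gbimonoid_hom_of_def)
    fix L s assume s: "s \<in> Hom (Alg TG S) K L"
    have "FArr ?E (s \<cdot>\<^bsub>Alg TG S\<^esub> t) = gbimonoid_hom_of (s \<cdot>\<^bsub>Alg TG S\<^esub> t)"
      using A.Cmp_in[OF t s] by (simp add: Hom_iff)
    moreover have "FArr ?E s = gbimonoid_hom_of s" "FArr ?E t = gbimonoid_hom_of t"
      using s t by (simp_all add: Hom_iff)
    ultimately show "FArr ?E (s \<cdot>\<^bsub>Alg TG S\<^esub> t) = FArr ?E s \<cdot>\<^bsub>GBimon G S\<^esub> FArr ?E t"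
      using s t unfolding H by (auto simp: Alg_sel GBimon_sel gbimonoid_hom_of_def)
  qed
  show "bij_betw (FObj ?E) (Obj (Alg TG S)) (Obj (GBimon G S))"
    unfolding bij_betw_def
  proof
    show "inj_on (FObj ?E) (Obj (Alg TG S))"
      by (rule inj_onI) (auto simp: Alg_sel intro: gbimonoid_of_inj)
    show "FObj ?E ` Obj (Alg TG S) = Obj (GBimon G S)"
      using gbimonoid_of_functor by (auto simp: Alg_sel GBimon_sel image_iff elim!: gbimonoid_of_surj)
  qed
  show "bij_betw (FArr ?E) (Arr (Alg TG S)) (Arr (GBimon G S))"
    unfolding bij_betw_def
  proof
    show "inj_on (FArr ?E) (Arr (Alg TG S))"
    proof (rule inj_onI)
      fix s t assume s: "s \<in> Arr (Alg TG S)" and t: "t \<in> Arr (Alg TG S)" and e: "FArr ?E s = FArr ?E t"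
      obtain F K \<theta> F' K' \<theta>' where st: "s = (F, K, \<theta>)" "t = (F', K', \<theta>')" by (cases s, cases t) auto
      have a: "algebra F" "algebra K" "algebra F'" "algebra K'" "monoidal_nat_trans TG S F K \<theta>" "monoidal_nat_trans TG S F' K' \<theta>'"
        using s t by (simp_all add: st Alg_sel)
      have "gbimonoid_hom_of s = gbimonoid_hom_of t" using e s t by simp
      then have "gbimonoid_of F = gbimonoid_of F'" "gbimonoid_of K = gbimonoid_of K'" and 1: "\<theta> 1 = \<theta>' 1"
        by (auto simp: st gbimonoid_hom_of_def fun_eq_iff)
      \<comment> \<open>Arrows carry their source and target, so these are recovered before the
        components are compared.\<close>
      then have FK: "F = F'" "K = K'" using gbimonoid_of_inj a by blast+
      have "\<theta> = \<theta>'"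
        using monoidal_nat_trans_unique[OF a(5) a(1,2)] monoidal_nat_trans_unique[OF a(6) a(3,4)] 1 by (intro ext) metis
      then show "s = t" by (simp add: st FK)
    qed
    show "FArr ?E ` Arr (Alg TG S) = Arr (GBimon G S)"
    proof (intro equalityI subsetI)
      fix u assume "u \<in> FArr ?E ` Arr (Alg TG S)"
      then show "u \<in> Arr (GBimon G S)"
        using gbimonoid_hom_of_nat_trans by (auto simp: Alg_sel GBimon_sel gbimonoid_hom_of_def)
    next
      fix u assume "u \<in> Arr (GBimon G S)"
      then obtain M L \<zeta> where u: "u = (M, L, \<zeta>)" and z: "nat_trans (one_object_category G) (Bimon S) M L \<zeta>"
        by (auto simp: GBimon_sel)
      obtain F where F: "algebra F" "gbimonoid_of F = M" by (rule gbimonoid_of_surj[OF nat_transD(1)[OF z]])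
      obtain K where K: "algebra K" "gbimonoid_of K = L" by (rule gbimonoid_of_surj[OF nat_transD(2)[OF z]])
      obtain \<theta> where t: "monoidal_nat_trans TG S F K \<theta>" "\<zeta> = (\<lambda>_. (bimonoid_of F, bimonoid_of K, \<theta> 1))"
        using gbimonoid_hom_of_surj[OF F(1) K(1)] z F(2) K(2) by metis
      have "(F, K, \<theta>) \<in> Arr (Alg TG S)" using F K t by (simp add: Alg_sel)
      moreover have "FArr ?E (F, K, \<theta>) = u" using calculation F(2) K(2) t(2) u by (simp add: gbimonoid_hom_of_def)
      ultimately show "u \<in> FArr ?E ` Arr (Alg TG S)" by (rule image_eqI[OF sym, rotated])
    qed
  qed
qed

end

theorem theorem6p16:
  fixes G :: "('g, 'w) monoid_scheme" and S :: "('o, 'a, 'z) sym_mon_cat_scheme"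
  assumes "symmetric_monoidal_category S"
    and "group G"
  shows "equivalent_categories (Alg (GFas_composite G) S) (GBimon G S)"
  by (rule composite_algebras.equivalence) (use assms in \<open>simp add: composite_algebras_def\<close>)

end
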